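(* Let $\mathbb{K}$ be a field, let $\Delta$ be a non-acyclic $\mathbb{K}$-spherical complex with vertex set $\{1,\dots,n\}$, and let $I_\Delta\subset R=\mathbb{K}[x_1,\dots,x_n]$ be the Stanley-Reisner ideal of $\Delta$. Then $$\operatorname{reg}(R/I_\Delta)=\operatorname{depth}(R/I_\Delta).$$
   Context: All simplicial complexes are finite; a vertex of $\Delta$ is an element $v$ with $\{v\}\in\Delta$. The complex $\{\emptyset\}$ has $\tilde H_{-1}\cong\mathbb{K}$; the void complex $\{\}$ has zero homology. For a vertex $v$ of $\Delta$, $\mathrm{del}_\Delta(v)=\{\sigma\in\Delta: v\notin\sigma\}$ and $\mathrm{link}_\Delta(v)=\{\sigma\in\mathrm{del}_\Delta(v):\sigma\cup\{v\}\in\Delta\}$. A simplicial complex $\Delta$ is $\mathbb{K}$-spherical if (recursively) (i) $\tilde H_i(\Delta;\mathbb{K})$ is one-dimensional for at most one $i$ and is zero for all other $i$; and (ii) for every vertex $v$ of $\Delta$ both $\mathrm{link}_\Delta(v)$ and $\mathrm{del}_\Delta(v)$ are $\mathbb{K}$-spherical. $\Delta$ is acyclic if $\tilde H_i(\Delta;\mathbb{K})=0$ for all $i$. The Stanley-Reisner ideal is $I_\Delta=(x_{i_1}\cdots x_{i_r}:\{i_1,\dots,i_r\}\notin\Delta)$. The Castelnuovo-Mumford regularity is $\operatorname{reg}(R/I_\Delta)=\max\{\deg \mathfrak{m}-i:\beta_{i,\mathfrak{m}}(R/I_\Delta)\ne0\}$, where $\beta_{i,\mathfrak m}$ are the multigraded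 Betti numbers ($\mathfrak m$ a monomial of $R$). The depth is the length of a maximal regular sequence for $R/I_\Delta$ contained in $(x_1,\dots,x_n)$. *)

theory Defs
  imports
    "HOL-Library.Poly_Mapping"
    "HOL-Algebra.QuotRing"
    "HOL-Algebra.Module"
    "Jordan_Normal_Form.Matrix"
begin

section \<open>Simplicial complexes\<close>

text \<open>The void complex \<open>{}\<close> and the complex \<open>{{}}\<close> are both allowed, and they are different.\<close>

definition simplicial_complex :: "nat set set \<Rightarrow> bool" where
  "simplicial_complex \<Delta> \<longleftrightarrow>
     finite \<Delta> \<and> (\<forall>\<sigma>\<in>\<Delta>. finite \<sigma> \<and> (\<forall>\<tau>. \<tau> \<subseteq> \<sigma> \<longrightarrow> \<tau> \<in> \<Delta>))"

definition vertices :: "nat set set \<Rightarrow> nat set" where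
  "vertices \<Delta> = {v. {v} \<in> \<Delta>}"

definition del :: "nat set set \<Rightarrow> nat \<Rightarrow> nat set set" where
  "del \<Delta> v = {\<sigma> \<in> \<Delta>. v \<notin> \<sigma>}"

definition link :: "nat set set \<Rightarrow> nat \<Rightarrow> nat set set" where
  "link \<Delta> v = {\<sigma> \<in> del \<Delta> v. \<sigma> \<union> {v} \<in> \<Delta>}"


section \<open>Reduced simplicial homology over a field\<close>

text \<open>Chains are formal linear combinations of faces, each face being oriented by the order of the
  natural numbers. Homological degrees are integers; a face \<open>\<sigma>\<close> has degree \<open>card \<sigma> - 1\<close>, so the empty
  face spans the chains of degree \<open>-1\<close>.\<close>

type_synonym 'k chain = "nat set \<Rightarrow>\<^sub>0 'k"

definition chain_scale :: "'k::field \<Rightarrow> 'k chain \<Rightarrow> 'k chain" where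
  "chain_scale a c = Poly_Mapping.map (\<lambda>x. a * x) c"

lemma lookup_chain_scale:
  "Poly_Mapping.lookup (chain_scale a c) \<sigma> = a * Poly_Mapping.lookup c \<sigma>"
  unfolding chain_scale_def by (simp add: map.rep_eq when_def)

interpretation chain_space: vector_space chain_scale
  by unfold_locales
    (auto intro!: poly_mapping_eqI simp: lookup_chain_scale lookup_add algebra_simps)

definition chains :: "nat set set \<Rightarrow> int \<Rightarrow> 'k::field chain set" where
  "chains \<Delta> i = {c. \<forall>\<sigma>\<in>Poly_Mapping.keys c. \<sigma> \<in> \<Delta> \<and> int (card \<sigma>) = i + 1}"

definition boundary :: "'k::field chain \<Rightarrow> 'k chain" where
  "boundary c =
     (\<Sum>\<sigma>\<in>Poly_Mapping.keys c. \<Sum>v\<in>\<sigma>.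
        Poly_Mapping.single (\<sigma> - {v}) ((- 1) ^ card {w \<in> \<sigma>. w < v} * Poly_Mapping.lookup c \<sigma>))"

definition cycles :: "nat set set \<Rightarrow> int \<Rightarrow> 'k::field chain set" where
  "cycles \<Delta> i = {c \<in> chains \<Delta> i. boundary c = 0}"

definition boundaries :: "nat set set \<Rightarrow> int \<Rightarrow> 'k::field chain set" where
  "boundaries \<Delta> i = boundary ` chains \<Delta> (i + 1)"

text \<open>The dimension of the reduced homology \<open>cycles / boundaries\<close> in degree \<open>i\<close>. The
  subtraction does not truncate, since boundaries are cycles and, for a finite complex, the chain
  spaces are finite-dimensional.\<close>

definition homology_dim :: "'k::field itself \<Rightarrow> nat set set \<Rightarrow> int \<Rightarrow> nat" where
  "homology_dim K \<Delta> i =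
     chain_space.dim (cycles \<Delta> i :: 'k chain set) -
     chain_space.dim (boundaries \<Delta> i :: 'k chain set)"

definition acyclic_complex :: "'k::field itself \<Rightarrow> nat set set \<Rightarrow> bool" where
  "acyclic_complex K \<Delta> \<longleftrightarrow> (\<forall>i. homology_dim K \<Delta> i = 0)"

text \<open>The recursion is well-founded on finite complexes, because links and deletions of a vertex
  have fewer vertices; on these the inductive definition is the recursive one.\<close>

inductive spherical :: "'k::field itself \<Rightarrow> nat set set \<Rightarrow> bool" for K :: "'k itself" where
  "\<lbrakk>\<forall>i. homology_dim K \<Delta> i = 0 \<or> homology_dim K \<Delta> i = 1;
    \<forall>i j. homology_dim K \<Delta> i = 1 \<and> homology_dim K \<Delta> j = 1 \<longrightarrow> i = j;
    \<forall>v\<in>vertices \<Delta>. spherical K (link \<Delta> v) \<and> spherical K (del \<Delta> v)\<rbrakk>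
   \<Longrightarrow> spherical K \<Delta>"


section \<open>The polynomial ring and the Stanley-Reisner ideal\<close>

text \<open>Monomials are identified with their exponent vectors, so that multiplication of monomials is
  addition. The ring in the variables \<open>x\<^sub>1, \<dots>, x\<^sub>n\<close> is a subring of the ring with variables indexed by
  all natural numbers.\<close>

type_synonym monomial = "nat \<Rightarrow>\<^sub>0 nat"
type_synonym 'k mpoly = "monomial \<Rightarrow>\<^sub>0 'k"

definition monomials :: "nat \<Rightarrow> monomial set" where
  "monomials n = {m. Poly_Mapping.keys m \<subseteq> {1..n}}"

definition mdeg :: "monomial \<Rightarrow> nat" where
  "mdeg m = (\<Sum>i\<in>Poly_Mapping.keys m. Poly_Mapping.lookup m i)"

definition poly_ring :: "nat \<Rightarrow> 'k::field mpoly ring" where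
  "poly_ring n =
     \<lparr>carrier = {p. Poly_Mapping.keys p \<subseteq> monomials n}, monoid.mult = (*), one = 1, zero = 0, add = (+)\<rparr>"

definition var :: "nat \<Rightarrow> 'k::field mpoly" where
  "var i = Poly_Mapping.single (Poly_Mapping.single i 1) 1"

definition irrelevant_ideal :: "nat \<Rightarrow> 'k::field mpoly set" where
  "irrelevant_ideal n = Idl\<^bsub>poly_ring n\<^esub> (var ` {1..n})"

definition stanley_reisner_ideal :: "nat \<Rightarrow> nat set set \<Rightarrow> 'k::field mpoly set" where
  "stanley_reisner_ideal n \<Delta> =
     Idl\<^bsub>poly_ring n\<^esub> {\<Prod>i\<in>\<sigma>. var i | \<sigma>. \<sigma> \<subseteq> {1..n} \<and> \<sigma> \<notin> \<Delta>}"

lemma monomials_add: "m \<in> monomials n \<Longrightarrow> m' \<in> monomials n \<Longrightarrow> m + m' \<in> monomials n"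
  using keys_add[of m m'] by (auto simp: monomials_def)

lemma poly_ring_cring: "cring (poly_ring n :: 'k::field mpoly ring)"
proof (intro cringI abelian_groupI comm_monoidI)
  fix x y :: "'k mpoly"
  assume x: "x \<in> carrier (poly_ring n)" and y: "y \<in> carrier (poly_ring n)"
  show "x \<oplus>\<^bsub>poly_ring n\<^esub> y \<in> carrier (poly_ring n)"
    using x y keys_add[of x y] by (auto simp: poly_ring_def)
  show "x \<otimes>\<^bsub>poly_ring n\<^esub> y \<in> carrier (poly_ring n)"
    using x y keys_mult[of x y] by (auto simp: poly_ring_def intro!: monomials_add)
next
  fix x :: "'k mpoly" assume "x \<in> carrier (poly_ring n)"
  then show "\<exists>y\<in>carrier (poly_ring n). y \<oplus>\<^bsub>poly_ring n\<^esub> x = \<zero>\<^bsub>poly_ring n\<^esub>"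
    by (intro bexI[of _ "- x"]) (auto simp: poly_ring_def in_keys_iff subset_iff)
qed (auto simp: poly_ring_def algebra_simps monomials_def)

lemma var_carrier: "i \<in> {1..n} \<Longrightarrow> (var i :: 'k::field mpoly) \<in> carrier (poly_ring n)"
  by (auto simp: var_def poly_ring_def monomials_def)

lemma prod_var_carrier:
  assumes "\<sigma> \<subseteq> {1..n}"
  shows "(\<Prod>i\<in>\<sigma>. var i :: 'k::field mpoly) \<in> carrier (poly_ring n)"
proof -
  interpret R: cring "poly_ring n :: 'k mpoly ring" by (rule poly_ring_cring)
  have "finite \<sigma>" using assms finite_subset by blast
  then show ?thesis using assms
  proof (induction \<sigma>)
    case empty
    then show ?case using R.one_closed by (simp add: poly_ring_def)
  next
    case (insert i \<sigma>)
    then have "(var i :: 'k mpoly) \<otimes>\<^bsub>poly_ring n\<^esub> (\<Prod>i\<in>\<sigma>. var i) \<in> carrier (poly_ring n)"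
      using var_carrier[of i n] by (intro R.m_closed) auto
    then show ?case using insert by (simp add: poly_ring_def)
  qed
qed

lemma irrelevant_ideal_ideal:
  "ideal (irrelevant_ideal n :: 'k::field mpoly set) (poly_ring n)"
  unfolding irrelevant_ideal_def
  using var_carrier by (intro ring.genideal_ideal cring.axioms(1) poly_ring_cring) blast

lemma stanley_reisner_ideal_ideal:
  "ideal (stanley_reisner_ideal n \<Delta> :: 'k::field mpoly set) (poly_ring n)"
  unfolding stanley_reisner_ideal_def
  using prod_var_carrier by (intro ring.genideal_ideal cring.axioms(1) poly_ring_cring) blast


section \<open>Depth\<close>

definition quotient_module :: "('a, 'b) ring_scheme \<Rightarrow> 'a set \<Rightarrow> ('a, 'a set) module" where
  "quotient_module R I =
     ring.extend (R Quot I) \<lparr>smult = (\<lambda>r X. (I +>\<^bsub>R\<^esub> r) \<otimes>\<^bsub>R Quot I\<^esub> X)\<rparr>"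

lemma quotient_module_simps:
  "carrier (quotient_module R I) = carrier (R Quot I)"
  "add (quotient_module R I) = add (R Quot I)"
  "zero (quotient_module R I) = zero (R Quot I)"
  "r \<odot>\<^bsub>quotient_module R I\<^esub> X = (I +>\<^bsub>R\<^esub> r) \<otimes>\<^bsub>R Quot I\<^esub> X"
  by (simp_all add: quotient_module_def ring.extend_def)

lemma quotient_module_module:
  assumes "cring R" and "ideal I R"
  shows "module R (quotient_module R I)"
proof -
  interpret R: cring R by fact
  interpret I: ideal I R by fact
  interpret Q: cring "R Quot I" by (rule I.quotient_is_cring) fact
  interpret h: ring_hom_ring R "R Quot I" "(+>\<^bsub>R\<^esub>) I" by (rule I.rcos_ring_hom_ring)
  have "abelian_group (quotient_module R I)"
    by (rule abelian_groupI)
      (auto simp: quotient_module_simps Q.a_ac intro: Q.add.l_inv_ex)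
  then show ?thesis
    by (intro moduleI)
      (auto simp: quotient_module_simps R.is_cring Q.l_distr Q.r_distr Q.m_assoc)
qed

text \<open>The submodule \<open>(r\<^sub>1, \<dots>, r\<^sub>k) M\<close>.\<close>

definition seq_submodule ::
    "('a, 'b) ring_scheme \<Rightarrow> ('a, 'm, 'c) module_scheme \<Rightarrow> 'a list \<Rightarrow> 'm set" where
  "seq_submodule R M rs =
     {\<Oplus>\<^bsub>M\<^esub>j\<in>{..<length rs}. rs ! j \<odot>\<^bsub>M\<^esub> y j | y. y \<in> {..<length rs} \<rightarrow> carrier M}"

text \<open>\<open>r\<^sub>k\<close> is a nonzerodivisor on \<open>M / (r\<^sub>1, \<dots>, r\<^sub>k\<^sub>-\<^sub>1) M\<close> for every \<open>k\<close>, and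
  \<open>M / (r\<^sub>1, \<dots>, r\<^sub>d) M\<close> is nonzero.\<close>

definition regular_sequence ::
    "('a, 'b) ring_scheme \<Rightarrow> ('a, 'm, 'c) module_scheme \<Rightarrow> 'a list \<Rightarrow> bool" where
  "regular_sequence R M rs \<longleftrightarrow>
     set rs \<subseteq> carrier R \<and>
     (\<forall>k<length rs. \<forall>x\<in>carrier M.
        rs ! k \<odot>\<^bsub>M\<^esub> x \<in> seq_submodule R M (take k rs) \<longrightarrow> x \<in> seq_submodule R M (take k rs)) \<and>
     seq_submodule R M rs \<noteq> carrier M"

definition maximal_regular_sequence_in ::
    "('a, 'b) ring_scheme \<Rightarrow> 'a set \<Rightarrow> ('a, 'm, 'c) module_scheme \<Rightarrow> 'a list \<Rightarrow> bool" where
  "maximal_regular_sequence_in R J M rs \<longleftrightarrow>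
     regular_sequence R M rs \<and> set rs \<subseteq> J \<and> (\<forall>r\<in>J. \<not> regular_sequence R M (rs @ [r]))"

text \<open>By Rees' theorem all maximal regular sequences have the same length, for a finitely generated
  module \<open>M \<noteq> J M\<close> over a Noetherian ring.\<close>

definition depth ::
    "('a, 'b) ring_scheme \<Rightarrow> 'a set \<Rightarrow> ('a, 'm, 'c) module_scheme \<Rightarrow> nat" where
  "depth R J M = (THE d. \<exists>rs. maximal_regular_sequence_in R J M rs \<and> length rs = d)"


section \<open>Multigraded Betti numbers and regularity\<close>

definition free_module :: "nat \<Rightarrow> nat \<Rightarrow> 'k::field mpoly vec set" where
  "free_module n r = {v \<in> carrier_vec r. \<forall>j<r. v $ j \<in> carrier (poly_ring n)}"

text \<open>A minimal multigraded free resolution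
  \<open>\<dots> \<rightarrow> F\<^sub>2 \<rightarrow> F\<^sub>1 \<rightarrow> F\<^sub>0 \<rightarrow> R/I \<rightarrow> 0\<close> for a monomial ideal \<open>I\<close>. Here \<open>F\<^sub>i\<close> is the direct sum
  of the \<open>R(-m)\<close> for \<open>m\<close> in the list \<open>a i\<close>, the map \<open>F\<^sub>i\<^sub>+\<^sub>1 \<rightarrow> F\<^sub>i\<close> is the matrix \<open>D i\<close>, and the basis
  elements of \<open>F\<^sub>0\<close> are sent to the cosets of the entries of \<open>e\<close>. Each entry of \<open>e\<close> and \<open>D i\<close> is a
  scalar multiple, possibly zero, of the monomial that makes the maps homogeneous of degree 0.\<close>

definition minimal_free_resolution ::
    "nat \<Rightarrow> 'k::field mpoly set \<Rightarrow>
     (nat \<Rightarrow> monomial list) \<Rightarrow> 'k mpoly vec \<Rightarrow> (nat \<Rightarrow> 'k mpoly mat) \<Rightarrow> bool" where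
  "minimal_free_resolution n I a e D \<longleftrightarrow>
     (let R = poly_ring n; F = (\<lambda>i. free_module n (length (a i))) in
      (\<forall>i. set (a i) \<subseteq> monomials n) \<and>
      e \<in> F 0 \<and>
      (\<forall>p<length (a 0). Poly_Mapping.keys (e $ p) \<subseteq> {a 0 ! p}) \<and>
      (\<forall>i. D i \<in> carrier_mat (length (a i)) (length (a (Suc i))) \<and>
           elements_mat (D i) \<subseteq> carrier R \<and>
           (\<forall>p<length (a i). \<forall>q<length (a (Suc i)).
              \<forall>m\<in>Poly_Mapping.keys (D i $$ (p, q)). m + a i ! p = a (Suc i) ! q)) \<and>
      (\<lambda>v. I +>\<^bsub>R\<^esub> (e \<bullet> v)) ` F 0 = carrier (R Quot I) \<and>
      {v \<in> F 0. I +>\<^bsub>R\<^esub> (e \<bullet> v) = \<zero>\<^bsub>R Quot I\<^esub>} = (\<lambda>v. D 0 *\<^sub>v v) ` F 1 \<and>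
      (\<forall>i. {v \<in> F (Suc i). D i *\<^sub>v v = 0\<^sub>v (length (a i))} =
           (\<lambda>v. D (Suc i) *\<^sub>v v) ` F (Suc (Suc i))) \<and>
      (\<forall>i. elements_mat (D i) \<subseteq> irrelevant_ideal n))"

text \<open>The number of summands \<open>R(-m)\<close> of \<open>F\<^sub>i\<close> in a minimal free resolution of \<open>R/I\<close>, for a monomial
  ideal \<open>I\<close>; it is independent of the resolution.\<close>

definition betti :: "nat \<Rightarrow> 'k::field mpoly set \<Rightarrow> nat \<Rightarrow> monomial \<Rightarrow> nat" where
  "betti n I i m =
     (THE b. \<exists>a e D. minimal_free_resolution n I a e D \<and> b = count_list (a i) m)"

text \<open>As for \<open>betti\<close>, the argument \<open>I\<close> stands for the module \<open>R/I\<close>. By Hilbert's syzygy theorem the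
  set is finite.\<close>

definition regularity :: "nat \<Rightarrow> 'k::field mpoly set \<Rightarrow> int" where
  "regularity n I = Max {int (mdeg m) - int i | i m. m \<in> monomials n \<and> betti n I i m \<noteq> 0}"

end

theory Submission
  imports Defs
begin

text \<open>
  Both sides equal \<open>d + 1\<close>, where \<open>d\<close> is the degree of the nonzero homology of \<open>\<Delta>\<close>. By Hochster's
  formula, the Koszul homology of the Stanley-Reisner ring in homological degree \<open>i\<close> is the sum over
  all \<open>W\<close> of the (co)homology of the induced subcomplex \<open>\<Delta>\<^sub>W\<close> in degree \<open>|W| - i - 1\<close>. It determines the
  regularity, since it computes the Betti numbers, and the depth, since dividing by a regular element
  shifts the top nonvanishing Koszul homology by one until a socle appears. So the claim is that
  nonzero homology of \<open>\<Delta>\<^sub>W\<close> lives in degrees between \<open>d - |V - W|\<close> and \<open>d\<close>. This follows by induction: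
  for a vertex \<open>v\<close> outside \<open>W\<close>, sphericity and the long exact sequence of link, deletion and complex
  show that either the deletion of \<open>v\<close> has its homology in degree \<open>d\<close>, or it is acyclic and the link
  has its homology in degree \<open>d - 1\<close>; in the second case one compares \<open>W\<close> with \<open>insert v W\<close>.
\<close>

text \<open>\<open>depth\<close> and \<open>betti\<close> are definite descriptions, so bounding
  their values is not enough: maximal regular sequences of one common length, and minimal
  resolutions with the same generator counts, must be shown to exist. This is the reason for the
  Noetherian property, prime avoidance and the explicit construction of a resolution. Homology is
  never formed as a quotient. Vanishing is a condition on chains (\<open>exact_at\<close>,
  \<open>kexact\<close>), and where a dimension matters it is the size of a basis of one space
  modulo another (\<open>qbasis\<close>). Betti numbers of different resolutions are compared by
  dimension shifting: the generators of F_(i+1) in degree u form a basis of H_0 of a syzygy module,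
  and i shifts identify it with H_i of the ideal, which depends on \<Delta> alone. The dichotomy for
  a vertex v rests on lines. If the deletion had its homology in degree e \<noteq> d, the link would
  have homology in degrees e and d - 1, hence e = d - 1; a map of lines from link to deletion that
  hits a nonzero class is injective, and this kills the homology of \<Delta> in degree d. Here
  dimension one is used, and not only concentration in one degree.\<close>

abbreviation "lk \<equiv> Poly_Mapping.lookup"
abbreviation "keys \<equiv> Poly_Mapping.keys"
abbreviation "single \<equiv> Poly_Mapping.single"

section \<open>The Koszul differential\<close>

text \<open>The sign that moves e_v to its sorted place in front of or inside e_T. Counting strictly
  smaller indices makes it the same for \<open>T\<close>, \<open>insert v T\<close> and
  \<open>T - {v}\<close>.\<close>

definition sg :: "nat \<Rightarrow> nat set \<Rightarrow> 'a::comm_ring_1" where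
  "sg v T = (- 1) ^ card {w \<in> T. w < v}"

lemma sg_square [simp]: "sg v T * sg v T = 1"
  unfolding sg_def by (simp flip: power_add add: mult_2[symmetric] power_mult)

lemma sg_square_mult [simp]: "sg v T * (sg v T * a) = a"
  by (simp flip: mult.assoc)

lemma sg_neq_0 [simp]: "sg v T \<noteq> (0::'a::comm_ring_1)"
  by (metis sg_square mult_zero_left zero_neq_one)

lemma sg_insert:
  assumes "finite T" "v \<notin> T"
  shows "sg w (insert v T) = (if v < w then - sg w T else sg w T)"
proof (cases "v < w")
  case True
  then have "{u \<in> insert v T. u < w} = insert v {u \<in> T. u < w}" by auto
  then show ?thesis using assms True by (simp add: sg_def)
next
  case False
  then have "{u \<in> insert v T. u < w} = {u \<in> T. u < w}" by auto
  then show ?thesis using False by (simp add: sg_def)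
qed

lemma sg_insert_self [simp]: "sg v (insert v T) = sg v T"
proof -
  have "{u \<in> insert v T. u < v} = {u \<in> T. u < v}" by auto
  then show ?thesis by (simp add: sg_def)
qed

lemma sg_remove_self [simp]: "sg v (T - {v}) = sg v T"
proof -
  have "{u \<in> T - {v}. u < v} = {u \<in> T. u < v}" by auto
  then show ?thesis by (simp add: sg_def)
qed

text \<open>A function \<open>f\<close> on finite sets of indices stands for \<open>\<Sum> f S e\<^sub>S\<close>. For weights \<open>x = 1\<close> this is the
  simplicial boundary, for \<open>x = var\<close> the differential of the Koszul complex of the variables.\<close>

definition koszul :: "nat \<Rightarrow> (nat \<Rightarrow> 'a) \<Rightarrow> (nat set \<Rightarrow> 'a) \<Rightarrow> nat set \<Rightarrow> 'a::comm_ring_1" where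
  "koszul n x f T = (\<Sum>v\<in>{1..n} - T. sg v T * x v * f (insert v T))"

lemma koszul_add: "koszul n x (\<lambda>S. f S + g S) T = koszul n x f T + koszul n x g T"
  by (simp add: koszul_def algebra_simps sum.distrib)

lemma koszul_diff: "koszul n x (\<lambda>S. f S - g S) T = koszul n x f T - koszul n x g T"
  by (simp add: koszul_def algebra_simps sum_subtractf)

lemma koszul_uminus: "koszul n x (\<lambda>S. - f S) T = - koszul n x f T"
  by (simp add: koszul_def sum_negf)

lemma koszul_scale: "koszul n x (\<lambda>S. c * f S) T = c * koszul n x f T"
  by (simp add: koszul_def sum_distrib_left mult_ac)

lemma koszul_zero [simp]: "koszul n x (\<lambda>S. 0) T = 0"
  by (simp add: koszul_def)

lemma koszul_sum: "koszul n x (\<lambda>S. \<Sum>i\<in>A. f i S) T = (\<Sum>i\<in>A. koszul n x (f i) T)"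
proof -
  have "koszul n x (\<lambda>S. \<Sum>i\<in>A. f i S) T = (\<Sum>v\<in>{1..n} - T. \<Sum>i\<in>A. sg v T * x v * f i (insert v T))"
    by (simp add: koszul_def sum_distrib_left)
  also have "\<dots> = (\<Sum>i\<in>A. koszul n x (f i) T)" unfolding koszul_def by (rule sum.swap)
  finally show ?thesis .
qed

text \<open>The terms cancel in pairs. Arguing that the sum equals its own negative would require 2
  to be invertible, so the induction adds one index at a time and cancels its row against its
  column.\<close>

lemma antisym_sum_zero:
  fixes q :: "'b \<Rightarrow> 'b \<Rightarrow> 'a::comm_ring_1"
  assumes "finite A" "\<And>v w. v \<in> A \<Longrightarrow> w \<in> A \<Longrightarrow> v \<noteq> w \<Longrightarrow> q v w = - q w v"
  shows "(\<Sum>v\<in>A. \<Sum>w\<in>A - {v}. q v w) = 0"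
  using assms
proof (induction A)
  case (insert a A)
  have IH: "(\<Sum>v\<in>A. \<Sum>w\<in>A - {v}. q v w) = 0"
    by (rule insert.IH) (use insert.prems in blast)
  have "(\<Sum>v\<in>A. \<Sum>w\<in>insert a A - {v}. q v w) = (\<Sum>v\<in>A. q v a + (\<Sum>w\<in>A - {v}. q v w))"
  proof (rule sum.cong)
    fix v assume v: "v \<in> A"
    then have "insert a A - {v} = insert a (A - {v})" using insert.hyps by auto
    then show "(\<Sum>w\<in>insert a A - {v}. q v w) = q v a + (\<Sum>w\<in>A - {v}. q v w)"
      using insert.hyps by simp
  qed simp
  also have "\<dots> = (\<Sum>v\<in>A. q v a)" using IH by (simp add: sum.distrib)
  also have "\<dots> = (\<Sum>v\<in>A. - q a v)"
  proof (rule sum.cong)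
    fix v assume "v \<in> A"
    then show "q v a = - q a v" using insert.hyps by (intro insert.prems) auto
  qed simp
  finally show ?case using insert.hyps by (simp add: insert_Diff_if sum_negf)
qed simp

lemma koszul_koszul:
  fixes f :: "nat set \<Rightarrow> 'a::comm_ring_1"
  assumes "finite T"
  shows "koszul n x (koszul n x f) T = 0"
proof -
  define A where "A = {1..n} - T"
  define q where "q v w = sg v T * x v * (sg w (insert v T) * x w * f (insert w (insert v T)))" for v w
  have "koszul n x (koszul n x f) T = (\<Sum>v\<in>A. \<Sum>w\<in>A - {v}. q v w)"
    unfolding koszul_def A_def q_def by (simp only: sum_distrib_left Diff_insert[of _ _ T])
  also have "\<dots> = 0"
  proof (rule antisym_sum_zero)
    fix v w assume vw: "v \<in> A" "w \<in> A" "v \<noteq> w"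
    then have "sg v T * sg w (insert v T) = - (sg w T * sg v (insert w T) :: 'a)"
      by (cases "v < w") (auto simp: A_def sg_insert assms mult.commute)
    then have "sg v T * sg w (insert v T) * (x v * x w * f (insert w (insert v T)))
      = - (sg w T * sg v (insert w T)) * (x v * x w * f (insert w (insert v T)))" by simp
    then show "q v w = - q w v" unfolding q_def insert_commute[of v w] by (simp add: mult_ac)
  qed (simp add: A_def)
  finally show ?thesis .
qed

text \<open>Exterior multiplication by e_a from the left, written on coefficients.\<close>

definition wedge :: "nat \<Rightarrow> (nat set \<Rightarrow> 'a) \<Rightarrow> nat set \<Rightarrow> 'a::comm_ring_1" where
  "wedge a f S = (if a \<in> S then sg a S * f (S - {a}) else 0)"

text \<open>The homotopy formula d(e_a f) + e_a df = x_a f. With weights 1 it contracts cones; with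
  weights \<open>var\<close> it makes multiplication by x_a null-homotopic.\<close>

lemma koszul_wedge:
  assumes "finite T" "a \<in> {1..n}"
  shows "koszul n x (wedge a f) T + wedge a (koszul n x f) T = x a * f T"
proof (cases "a \<in> T")
  case False
  then have "koszul n x (wedge a f) T = (\<Sum>v\<in>{1..n} - T. if v = a then x a * f T else 0)"
    unfolding koszul_def wedge_def by (intro sum.cong) (auto simp: mult_ac)
  also have "\<dots> = x a * f T" using False assms by (simp add: sum.delta)
  finally show ?thesis using False by (simp add: wedge_def)
next
  case True
  define U where "U = T - {a}"
  have U: "T = insert a U" "a \<notin> U" "finite U" using True assms by (auto simp: U_def)
  have "wedge a (koszul n x f) T = sg a U * koszul n x f U"
    using U by (simp add: wedge_def)
  also have "\<dots> = (\<Sum>v\<in>insert a ({1..n} - T). sg a U * (sg v U * x v * f (insert v U)))"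
    unfolding koszul_def sum_distrib_left using U assms by (intro sum.cong) auto
  also have "\<dots> = x a * f T + (\<Sum>v\<in>{1..n} - T. sg a U * (sg v U * x v * f (insert v U)))"
    using U by (simp add: mult_ac)
  finally have 1: "wedge a (koszul n x f) T = x a * f T + (\<Sum>v\<in>{1..n} - T. sg a U * (sg v U * x v * f (insert v U)))" .
  have "koszul n x (wedge a f) T = (\<Sum>v\<in>{1..n} - T. - (sg a U * (sg v U * x v * f (insert v U))))"
    unfolding koszul_def
  proof (intro sum.cong refl)
    fix v assume v: "v \<in> {1..n} - T"
    then have "insert v T - {a} = insert v U" using U by auto
    moreover have "sg a (insert v T) = sg a (insert v U)" using U by (metis insert_commute sg_insert_self)
    ultimately show "sg v T * x v * wedge a f (insert v T) = - (sg a U * (sg v U * x v * f (insert v U)))"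
      using U v by (auto simp: wedge_def sg_insert mult_ac)
  qed
  then show ?thesis using 1 by (simp add: sum_negf)
qed

section \<open>Chains supported on a family of faces, and exactness\<close>

definition supp_on :: "nat set set \<Rightarrow> nat \<Rightarrow> (nat set \<Rightarrow> 'a::zero) \<Rightarrow> bool" where
  "supp_on X k f \<longleftrightarrow> (\<forall>S. f S \<noteq> 0 \<longrightarrow> S \<in> X \<and> card S = k)"

abbreviation bd :: "nat \<Rightarrow> (nat set \<Rightarrow> 'a) \<Rightarrow> nat set \<Rightarrow> 'a::comm_ring_1" where
  "bd n \<equiv> koszul n (\<lambda>_. 1)"

text \<open>The index \<open>k\<close> is the cardinality of the faces, one more than the homological degree. The set \<open>X\<close>
  need not be closed under subsets, so that relative complexes are covered as well.\<close>

definition exact_at :: "nat \<Rightarrow> 'k::field itself \<Rightarrow> nat set set \<Rightarrow> nat \<Rightarrow> bool" where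
  "exact_at n K X k \<longleftrightarrow>
     (\<forall>f :: nat set \<Rightarrow> 'k. supp_on X k f \<longrightarrow> (\<forall>T\<in>X. bd n f T = 0) \<longrightarrow>
        (\<exists>g. supp_on X (Suc k) g \<and> (\<forall>S\<in>X. card S = k \<longrightarrow> bd n g S = f S)))"

definition cplx :: "nat \<Rightarrow> nat set set \<Rightarrow> bool" where
  "cplx n \<Delta> \<longleftrightarrow> \<Delta> \<subseteq> Pow {1..n} \<and> (\<forall>\<sigma>\<in>\<Delta>. \<forall>\<tau>\<subseteq>\<sigma>. \<tau> \<in> \<Delta>)"

lemma cplxD: "cplx n \<Delta> \<Longrightarrow> \<sigma> \<in> \<Delta> \<Longrightarrow> \<tau> \<subseteq> \<sigma> \<Longrightarrow> \<tau> \<in> \<Delta>"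
  and cplx_subsp: "cplx n \<Delta> \<Longrightarrow> \<sigma> \<in> \<Delta> \<Longrightarrow> \<sigma> \<subseteq> {1..n}"
  by (auto simp: cplx_def)

lemma cplx_finite: "cplx n \<Delta> \<Longrightarrow> \<sigma> \<in> \<Delta> \<Longrightarrow> finite \<sigma>"
  by (meson cplx_subsp finite_subset finite_atLeastAtMost)

lemma supp_on_alt: "supp_on X k f \<longleftrightarrow> (\<forall>S. \<not> (S \<in> X \<and> card S = k) \<longrightarrow> f S = 0)"
  unfolding supp_on_def by blast

lemma supp_on_add: "supp_on X k f \<Longrightarrow> supp_on X k g \<Longrightarrow> supp_on X k (\<lambda>S. f S + g S :: 'a::comm_ring_1)"
  and supp_on_diff: "supp_on X k f \<Longrightarrow> supp_on X k g \<Longrightarrow> supp_on X k (\<lambda>S. f S - g S :: 'a::comm_ring_1)"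
  and supp_on_uminus: "supp_on X k f \<Longrightarrow> supp_on X k (\<lambda>S. - f S :: 'a::comm_ring_1)"
  and supp_on_scale: "supp_on X k f \<Longrightarrow> supp_on X k (\<lambda>S. c * f S :: 'a::comm_ring_1)"
  by (auto simp: supp_on_alt)

lemma supp_on_mono: "supp_on X k f \<Longrightarrow> X \<subseteq> Y \<Longrightarrow> supp_on Y k f"
  by (auto simp: supp_on_def)

lemma supp_on_bd:
  fixes f :: "nat set \<Rightarrow> 'a::comm_ring_1"
  assumes "cplx n \<Delta>" "supp_on \<Delta> k f" "bd n f T \<noteq> 0"
  shows "T \<in> \<Delta> \<and> Suc (card T) = k"
proof -
  obtain v where v: "v \<in> {1..n} - T" "f (insert v T) \<noteq> 0"
    using assms(3) unfolding koszul_def by (metis (no_types, lifting) mult_zero_right sum.neutral)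
  then have "insert v T \<in> \<Delta>" "card (insert v T) = k" using assms by (auto simp: supp_on_def)
  moreover have "T \<in> \<Delta>" using cplxD[OF assms(1) calculation(1)] by blast
  moreover have "finite T" using cplx_finite[OF assms(1) calculation(1)] by simp
  ultimately show ?thesis using v by auto
qed

text \<open>In a family closed under subsets the boundary of a supported chain vanishes outside the
  family, so the equations may be demanded of all sets.\<close>

lemma exact_at_cplx:
  assumes "cplx n \<Delta>"
  shows "exact_at n TYPE('k::field) \<Delta> k \<longleftrightarrow>
     (\<forall>f :: nat set \<Rightarrow> 'k. supp_on \<Delta> k f \<longrightarrow> (\<forall>T. bd n f T = 0) \<longrightarrow>
        (\<exists>g. supp_on \<Delta> (Suc k) g \<and> (\<forall>S. bd n g S = f S)))" (is "?l \<longleftrightarrow> ?r")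
proof
  assume l: ?l
  show ?r
  proof (intro allI impI)
    fix f :: "nat set \<Rightarrow> 'k" assume f: "supp_on \<Delta> k f" "\<forall>T. bd n f T = 0"
    then obtain g where g: "supp_on \<Delta> (Suc k) g" "\<forall>S\<in>\<Delta>. card S = k \<longrightarrow> bd n g S = f S"
      using l by (fastforce simp: exact_at_def)
    have "bd n g S = f S" for S
    proof (cases "S \<in> \<Delta> \<and> card S = k")
      case False
      then have "f S = 0" "bd n g S = 0" using f(1) supp_on_bd[OF assms g(1), of S]
        by (auto simp: supp_on_def)
      then show ?thesis by simp
    qed (use g in auto)
    then show "\<exists>g. supp_on \<Delta> (Suc k) g \<and> (\<forall>S. bd n g S = f S)" using g by blast
  qed
next
  assume r: ?r
  show ?l unfolding exact_at_def
  proof (intro allI impI)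
    fix f :: "nat set \<Rightarrow> 'k" assume f: "supp_on \<Delta> k f" "\<forall>T\<in>\<Delta>. bd n f T = 0"
    have "\<forall>T. bd n f T = 0" using f supp_on_bd[OF assms f(1)] by blast
    then show "\<exists>g. supp_on \<Delta> (Suc k) g \<and> (\<forall>S\<in>\<Delta>. card S = k \<longrightarrow> bd n g S = f S)"
      using r f by blast
  qed
qed

section \<open>The long exact sequence of link, deletion and complex\<close>

definition del_part :: "nat \<Rightarrow> (nat set \<Rightarrow> 'a) \<Rightarrow> nat set \<Rightarrow> 'a::comm_ring_1" where
  "del_part v f S = (if v \<in> S then 0 else f S)"
text \<open>Every chain is f = f_D + e_v f_L with f_D = \<open>del_part v f\<close> and f_L =
  \<open>link_part v f\<close>; the sign makes \<open>wedge v\<close> recover the part through v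
  exactly.\<close>

definition link_part :: "nat \<Rightarrow> (nat set \<Rightarrow> 'a) \<Rightarrow> nat set \<Rightarrow> 'a::comm_ring_1" where
  "link_part v f S = (if v \<in> S then 0 else sg v S * f (insert v S))"

text \<open>Together with \<open>bd_on\<close>: d(f_D + e_v f_L) = (d f_D + f_L) - e_v d f_L. So
  \<Delta> is the mapping cone of the inclusion of the link into the deletion, which is the source
  of all exact sequence arguments below.\<close>

lemma bd_off:
  assumes "v \<in> {1..n}" "v \<notin> T"
  shows "bd n f T = bd n (del_part v f) T + link_part v f T"
proof -
  have *: "{1..n} - T = insert v ({1..n} - T - {v})" using assms by auto
  have "bd n f T = sg v T * f (insert v T) + (\<Sum>w\<in>{1..n} - T - {v}. sg w T * f (insert w T))"
    unfolding koszul_def by (subst *) (subst sum.insert, auto)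
  moreover have "bd n (del_part v f) T = (\<Sum>w\<in>{1..n} - T - {v}. sg w T * f (insert w T))"
    unfolding koszul_def
    by (rule sum.mono_neutral_cong_right) (use assms in \<open>auto simp: del_part_def\<close>)
  ultimately show ?thesis using assms by (simp add: link_part_def)
qed

lemma bd_on:
  assumes "v \<in> {1..n}" "v \<notin> T" "finite T"
  shows "bd n f (insert v T) = - (sg v T * bd n (link_part v f) T)"
proof -
  have "bd n f (insert v T) = (\<Sum>w\<in>{1..n} - insert v T. - (sg v T * (sg w T * link_part v f (insert w T))))"
    unfolding koszul_def
  proof (intro sum.cong refl)
    fix w assume w: "w \<in> {1..n} - insert v T"
    then show "sg w (insert v T) * 1 * f (insert w (insert v T)) = - (sg v T * (sg w T * link_part v f (insert w T)))"
      using assms by (auto simp: link_part_def sg_insert insert_commute mult.left_commute[of "sg w T"])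
  qed
  also have "\<dots> = (\<Sum>w\<in>{1..n} - T. - (sg v T * (sg w T * link_part v f (insert w T))))"
    by (rule sum.mono_neutral_left) (auto simp: link_part_def)
  finally show ?thesis by (simp add: koszul_def sum_negf sum_distrib_left)
qed

lemma del_cplx: "cplx n \<Delta> \<Longrightarrow> cplx n (del \<Delta> v)"
  unfolding cplx_def del_def by blast

lemma link_cplx:
  assumes "cplx n \<Delta>" shows "cplx n (link \<Delta> v)"
proof -
  have "\<tau> \<union> {v} \<in> \<Delta>" if "\<tau> \<subseteq> \<sigma>" "\<sigma> \<union> {v} \<in> \<Delta>" for \<sigma> \<tau>
    using that cplxD[OF assms that(2), of "\<tau> \<union> {v}"] by blast
  then show ?thesis using assms unfolding cplx_def link_def del_def by blast
qed

lemma link_subsp_del: "link \<Delta> v \<subseteq> del \<Delta> v" by (auto simp: link_def)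
lemma del_subsp: "del \<Delta> v \<subseteq> \<Delta>" by (auto simp: del_def)

lemma supp_del_part: "supp_on \<Delta> k f \<Longrightarrow> supp_on (del \<Delta> v) k (del_part v f)"
  by (auto simp: supp_on_def del_part_def del_def)

lemma supp_link_part:
  assumes "cplx n \<Delta>" "supp_on \<Delta> (Suc k) f" shows "supp_on (link \<Delta> v) k (link_part v f)"
  unfolding supp_on_def
proof (intro allI impI)
  fix S assume "link_part v f S \<noteq> 0"
  then have S: "v \<notin> S" "f (insert v S) \<noteq> 0" by (auto simp: link_part_def split: if_splits)
  then have "insert v S \<in> \<Delta>" "card (insert v S) = Suc k" using assms(2) by (auto simp: supp_on_def)
  moreover have "S \<in> \<Delta>" using cplxD[OF assms(1)] calculation by blast
  moreover have "finite S" using cplx_finite[OF assms(1)] calculation by blast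
  ultimately show "S \<in> link \<Delta> v \<and> card S = k" using S by (auto simp: link_def del_def)
qed

text \<open>The segment H_k(link) -> H_k(deletion) -> H_k(\<Delta>), where k counts vertices of
  faces: if the outer terms vanish, so does the middle one.\<close>

lemma exact_del:
  assumes c: "cplx n \<Delta>" and v: "v \<in> {1..n}"
    and L: "exact_at n TYPE('k::field) (link \<Delta> v) k" and D: "exact_at n TYPE('k) \<Delta> k"
  shows "exact_at n TYPE('k) (del \<Delta> v) k"
  unfolding exact_at_cplx[OF del_cplx[OF c]]
proof (intro allI impI)
  fix f :: "nat set \<Rightarrow> 'k" assume f: "supp_on (del \<Delta> v) k f" "\<forall>T. bd n f T = 0"
  then obtain g where g: "supp_on \<Delta> (Suc k) g" "\<forall>S. bd n g S = f S"
    using D[unfolded exact_at_cplx[OF c]] supp_on_mono[OF f(1) del_subsp] by blast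
  let ?gL = "link_part v g"
  have sL: "supp_on (link \<Delta> v) k ?gL" using supp_link_part[OF c g(1)] .
  have "bd n ?gL T = 0" for T
  proof (cases "v \<in> T \<or> infinite T")
    case False
    then have "f (insert v T) = - (sg v T * bd n ?gL T)" using bd_on[of v n T g] v g by simp
    moreover have "f (insert v T) = 0" using f(1) by (auto simp: supp_on_def del_def)
    ultimately show ?thesis by simp
  next
    case True
    then have "T \<notin> link \<Delta> v" using cplx_finite[OF c] by (auto simp: link_def del_def)
    then show ?thesis using supp_on_bd[OF link_cplx[OF c] sL] by blast
  qed
  then obtain h where h: "supp_on (link \<Delta> v) (Suc k) h" "\<forall>S. bd n h S = ?gL S"
    using L[unfolded exact_at_cplx[OF link_cplx[OF c]]] sL by blast
  have hD: "supp_on (del \<Delta> v) (Suc k) h" by (rule supp_on_mono[OF h(1) link_subsp_del])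
  \<comment> \<open>By \<open>bd_off\<close> the boundary of the deletion part of g misses f by the
    link part of g, and h has this link part as boundary.\<close>
  let ?g = "\<lambda>S. del_part v g S + h S"
  have s: "supp_on (del \<Delta> v) (Suc k) ?g" by (intro supp_on_add supp_del_part g(1) hD)
  moreover have "bd n ?g S = f S" for S
  proof (cases "v \<in> S")
    case True
    then have "f S = 0" "bd n ?g S = 0" using f(1) supp_on_bd[OF del_cplx[OF c] s]
      by (auto simp: supp_on_def del_def)
    then show ?thesis by simp
  next
    case False
    then show ?thesis using bd_off[of v n S g] v g h by (simp add: koszul_add)
  qed
  ultimately show "\<exists>g. supp_on (del \<Delta> v) (Suc k) g \<and> (\<forall>S. bd n g S = f S)" by blast
qed

text \<open>If the link part of a cycle bounds in the link, the cycle is homologous to one in the deletion.\<close>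

lemma cycle_bounds:
  fixes f h :: "nat set \<Rightarrow> 'k::field"
  assumes c: "cplx n \<Delta>" and v: "v \<in> {1..n}"
    and D: "exact_at n TYPE('k) (del \<Delta> v) k"
    and f: "supp_on \<Delta> k f" "\<forall>T. bd n f T = 0"
    and h: "supp_on (link \<Delta> v) k h" "\<forall>S. bd n h S = link_part v f S"
  shows "\<exists>g. supp_on \<Delta> (Suc k) g \<and> (\<forall>S. bd n g S = f S)"
proof -
  define m where "m = wedge v h"
  have mD: "del_part v m S = 0" for S by (auto simp: m_def wedge_def del_part_def)
  have h0: "h S = 0" if "v \<in> S \<or> infinite S" for S
    using h(1) that cplx_finite[OF c, of S] by (auto simp: supp_on_def link_def del_def)
  have mL: "link_part v m = h"
  proof
    fix S show "link_part v m S = h S" using h0[of S]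
      by (auto simp: link_part_def m_def wedge_def)
  qed
  have ms: "supp_on \<Delta> (Suc k) m" unfolding supp_on_def
  proof (intro allI impI)
    fix S assume "m S \<noteq> 0"
    then have *: "v \<in> S" "h (S - {v}) \<noteq> 0" by (auto simp: m_def wedge_def split: if_splits)
    then have "S - {v} \<in> link \<Delta> v" "card (S - {v}) = k" using h by (auto simp: supp_on_def)
    moreover have "finite (S - {v})" using * h0 by blast
    moreover have "(S - {v}) \<union> {v} = S" using * by auto
    ultimately show "S \<in> \<Delta> \<and> card S = Suc k" using * card.remove[of S v]
      by (simp add: link_def del_def)
  qed
  \<comment> \<open>The boundary of e_v h is h - e_v dh, so adding it cancels the part of f through
    v and leaves a cycle of the deletion.\<close>
  define f1 where "f1 S = f S + bd n m S" for S
  have bm: "supp_on \<Delta> k (bd n m)" using supp_on_bd[OF c ms] by (auto simp: supp_on_def)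
  have f1s: "supp_on \<Delta> k f1" unfolding f1_def by (intro supp_on_add f bm)
  have "f1 S = 0" if "v \<in> S" for S
  proof (cases "finite S")
    case False then show ?thesis using f1s cplx_finite[OF c] by (auto simp: supp_on_def)
  next
    case True
    define T where "T = S - {v}"
    have T: "S = insert v T" "v \<notin> T" "finite T" using that True by (auto simp: T_def)
    have "bd n m S = - (sg v T * bd n h T)" using bd_on[of v n T m] v T mL by simp
    also have "\<dots> = - f S" using h T by (simp add: link_part_def)
    finally show ?thesis by (simp add: f1_def)
  qed
  then have f1D: "supp_on (del \<Delta> v) k f1" using f1s by (auto simp: supp_on_def del_def)
  have "bd n f1 T = 0" for T
  proof (cases "finite T")
    case True then show ?thesis unfolding f1_def using f by (simp add: koszul_add koszul_koszul)
  next
    case False then show ?thesis using supp_on_bd[OF c f1s] cplx_finite[OF c] by blast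
  qed
  then obtain g where g: "supp_on (del \<Delta> v) (Suc k) g" "\<forall>S. bd n g S = f1 S"
    using D[unfolded exact_at_cplx[OF del_cplx[OF c]]] f1D by blast
  show ?thesis
  proof (intro exI conjI allI)
    show "supp_on \<Delta> (Suc k) (\<lambda>S. g S - m S)"
      by (intro supp_on_diff ms supp_on_mono[OF g(1) del_subsp])
    show "bd n (\<lambda>S. g S - m S) S = f S" for S using g by (simp add: koszul_diff f1_def)
  qed
qed

text \<open>Only the boundary at sets containing v enters, so this covers cycles of \<Delta> as well
  as chains whose boundary lies in the deletion.\<close>

lemma link_part_cycle:
  fixes f :: "nat set \<Rightarrow> 'k::field"
  assumes c: "cplx n \<Delta>" and v: "v \<in> {1..n}"
    and f: "supp_on \<Delta> (Suc k) f" "\<forall>T. v \<in> T \<longrightarrow> bd n f T = 0"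
  shows "bd n (link_part v f) T = 0"
proof (cases "v \<in> T \<or> infinite T")
  case False
  then show ?thesis using bd_on[of v n T f] v f(2) by simp
next
  case True
  then have "T \<notin> link \<Delta> v" using cplx_finite[OF c] by (auto simp: link_def del_def)
  then show ?thesis using supp_on_bd[OF link_cplx[OF c] supp_link_part[OF c f(1)]] by blast
qed

text \<open>The segment H_k(deletion) -> H_k(\<Delta>) -> H_(k-1)(link). The condition on the link
  is quantified over j with k = \<open>Suc j\<close>, since for k = 0 the last term is
  absent.\<close>

lemma exact_whole:
  assumes c: "cplx n \<Delta>" and v: "v \<in> {1..n}"
    and D: "exact_at n TYPE('k::field) (del \<Delta> v) k"
    and L: "\<And>j. k = Suc j \<Longrightarrow> exact_at n TYPE('k) (link \<Delta> v) j"
  shows "exact_at n TYPE('k) \<Delta> k"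
  unfolding exact_at_cplx[OF c]
proof (intro allI impI)
  fix f :: "nat set \<Rightarrow> 'k" assume f: "supp_on \<Delta> k f" "\<forall>T. bd n f T = 0"
  have "\<exists>h. supp_on (link \<Delta> v) k h \<and> (\<forall>S. bd n h S = link_part v f S)"
  proof (cases k)
    case 0
    have "link_part v f S = 0" for S
    proof (rule ccontr)
      assume "link_part v f S \<noteq> 0"
      then have "f (insert v S) \<noteq> 0" by (auto simp: link_part_def split: if_splits)
      then have "insert v S \<in> \<Delta>" "card (insert v S) = 0" using f 0 by (auto simp: supp_on_def)
      then show False using cplx_finite[OF c] by fastforce
    qed
    then show ?thesis by (intro exI[of _ "\<lambda>_. 0"]) (auto simp: supp_on_def)
  next
    case (Suc j)
    show ?thesis using L[OF Suc, unfolded exact_at_cplx[OF link_cplx[OF c]]]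
        supp_link_part[OF c f(1)[unfolded Suc]] link_part_cycle[OF c v, of j f] f Suc by blast
  qed
  then show "\<exists>g. supp_on \<Delta> (Suc k) g \<and> (\<forall>S. bd n g S = f S)"
    using cycle_bounds[OF c v D f] by blast
qed

text \<open>Homology of dimension at most one: all cycles are multiples of a single z up to
  boundaries.\<close>

definition line_at :: "nat \<Rightarrow> 'k::field itself \<Rightarrow> nat set set \<Rightarrow> nat \<Rightarrow> bool" where
  "line_at n K \<Delta> k \<longleftrightarrow> (\<exists>z. \<forall>f :: nat set \<Rightarrow> 'k. supp_on \<Delta> k f \<longrightarrow> (\<forall>T. bd n f T = 0) \<longrightarrow>
     (\<exists>c g. supp_on \<Delta> (Suc k) g \<and> (\<forall>S. f S = c * z S + bd n g S)))"

text \<open>If \<open>H\<^sub>k\<close> of the link is a line mapping onto a nonzero \<open>H\<^sub>k\<close> of the deletion, it maps injectively,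
  so the connecting map out of \<open>H\<^sub>k\<^sub>+\<^sub>1(\<Delta>)\<close> vanishes.\<close>

lemma exact_Suc_if_line:
  assumes c: "cplx n \<Delta>" and v: "v \<in> {1..n}"
    and E: "exact_at n TYPE('k::field) \<Delta> k" and ND: "\<not> exact_at n TYPE('k) (del \<Delta> v) k"
    and D: "exact_at n TYPE('k) (del \<Delta> v) (Suc k)" and L: "line_at n TYPE('k) (link \<Delta> v) k"
  shows "exact_at n TYPE('k) \<Delta> (Suc k)"
proof -
  \<comment> \<open>Equality is tested off v only, where \<open>bd_off\<close> applies; chains of
    the deletion have zero boundary on sets containing v.\<close>
  let ?bdD = "\<lambda>w :: nat set \<Rightarrow> 'k. \<exists>g. supp_on (del \<Delta> v) (Suc k) g \<and> (\<forall>S. v \<notin> S \<longrightarrow> bd n g S = w S)"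
  obtain w0 :: "nat set \<Rightarrow> 'k" where w0: "supp_on (del \<Delta> v) k w0" "\<forall>T. bd n w0 T = 0"
    "\<not> (\<exists>g. supp_on (del \<Delta> v) (Suc k) g \<and> (\<forall>S. bd n g S = w0 S))"
    using ND unfolding exact_at_cplx[OF del_cplx[OF c]] by blast
  have nb: "\<not> ?bdD w0"
  proof
    assume "?bdD w0"
    then obtain g where g: "supp_on (del \<Delta> v) (Suc k) g" "\<forall>S. v \<notin> S \<longrightarrow> bd n g S = w0 S" by blast
    have "bd n g S = w0 S" for S
    proof (cases "v \<in> S")
      case True
      then have "w0 S = 0" "bd n g S = 0" using supp_on_bd[OF del_cplx[OF c] g(1), of S] w0(1)
        by (auto simp: supp_on_def del_def)
      then show ?thesis by simp
    qed (use g in auto)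
    then show False using g w0 by blast
  qed
  obtain g where g: "supp_on \<Delta> (Suc k) g" "\<forall>S. bd n g S = w0 S"
    using E[unfolded exact_at_cplx[OF c]] supp_on_mono[OF w0(1) del_subsp] w0(2) by blast
  define l0 where "l0 = link_part v g"
  have vw0: "\<forall>T. v \<in> T \<longrightarrow> bd n g T = 0" using w0(1) g(2) by (auto simp: supp_on_def del_def)
  have l0: "supp_on (link \<Delta> v) k l0" "\<forall>T. bd n l0 T = 0"
    unfolding l0_def using supp_link_part[OF c g(1)] link_part_cycle[OF c v g(1) vw0] by auto
  have w0l0: "v \<notin> S \<Longrightarrow> w0 S = bd n (del_part v g) S + l0 S" for S
    using bd_off[of v n S g] v g by (simp add: l0_def)
  \<comment> \<open>Off v, w0 and l0 differ by the boundary of the deletion part of g. So they have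
    the same class in the deletion, and l0 is a link cycle whose image there is nonzero.\<close>
  have nb0: "\<not> ?bdD l0"
  proof
    assume "?bdD l0"
    then obtain h where h: "supp_on (del \<Delta> v) (Suc k) h" "\<forall>S. v \<notin> S \<longrightarrow> bd n h S = l0 S" by blast
    have "supp_on (del \<Delta> v) (Suc k) (\<lambda>S. del_part v g S + h S)"
      by (intro supp_on_add supp_del_part[OF g(1)] h)
    moreover have "\<forall>S. v \<notin> S \<longrightarrow> bd n (\<lambda>S. del_part v g S + h S) S = w0 S"
      using h w0l0 by (simp add: koszul_add)
    ultimately show False using nb by blast
  qed
  obtain z where z: "\<And>f :: nat set \<Rightarrow> 'k. supp_on (link \<Delta> v) k f \<Longrightarrow> (\<forall>T. bd n f T = 0) \<Longrightarrow>
     (\<exists>c g. supp_on (link \<Delta> v) (Suc k) g \<and> (\<forall>S. f S = c * z S + bd n g S))"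
    using L unfolding line_at_def by blast
  obtain c0 h0 where h0: "supp_on (link \<Delta> v) (Suc k) h0" "\<forall>S. l0 S = c0 * z S + bd n h0 S"
    using z[OF l0] by blast
  have c0: "c0 \<noteq> 0"
  proof
    assume "c0 = 0"
    then have "\<forall>S. bd n h0 S = l0 S" using h0 by simp
    then show False using nb0 supp_on_mono[OF h0(1) link_subsp_del] by blast
  qed
  show ?thesis unfolding exact_at_cplx[OF c]
  proof (intro allI impI)
    fix f :: "nat set \<Rightarrow> 'k" assume f: "supp_on \<Delta> (Suc k) f" "\<forall>T. bd n f T = 0"
    have fL: "supp_on (link \<Delta> v) k (link_part v f)" "\<forall>T. bd n (link_part v f) T = 0"
      using supp_link_part[OF c f(1)] link_part_cycle[OF c v f(1)] f(2) by auto
    obtain c1 h1 where h1: "supp_on (link \<Delta> v) (Suc k) h1" "\<forall>S. link_part v f S = c1 * z S + bd n h1 S"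
      using z[OF fL] by blast
    \<comment> \<open>Both link cycles are multiples of z up to boundaries and l0 has the nonzero
      multiple c0, so the link part of f is e times l0 up to a boundary.\<close>
    define e where "e = c1 / c0"
    define h where "h S = h1 S - e * h0 S" for S
    have hs: "supp_on (link \<Delta> v) (Suc k) h" unfolding h_def
      by (intro supp_on_diff supp_on_scale h1 h0)
    have wedge: "link_part v f S = e * l0 S + bd n h S" for S
    proof -
      have "e * l0 S = c1 * z S + e * bd n h0 S" using h0(2) c0 by (simp add: e_def algebra_simps)
      then show ?thesis using h1(2) by (simp add: h_def[abs_def] koszul_diff koszul_scale)
    qed
    have "e = 0"
    proof (rule ccontr)
      assume e: "e \<noteq> 0"
      \<comment> \<open>As f is a cycle, the negative of its deletion part has the link part of f as
        boundary. Subtracting h and dividing by e would then bound l0 in the deletion.\<close>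
      define p where "p S = (1 / e) * (- del_part v f S - h S)" for S
      have "supp_on (del \<Delta> v) (Suc k) p" unfolding p_def
        by (intro supp_on_scale supp_on_diff supp_on_uminus supp_del_part f(1) supp_on_mono[OF hs link_subsp_del])
      moreover have "bd n p S = l0 S" if "v \<notin> S" for S
      proof -
        have "0 = bd n (del_part v f) S + link_part v f S" using bd_off[of v n S f] v that f by simp
        then have "- bd n (del_part v f) S = e * l0 S + bd n h S" using wedge[of S]
          by (metis add_eq_0_iff add.commute)
        moreover have "bd n p S = (1 / e) * (- bd n (del_part v f) S - bd n h S)"
          unfolding p_def by (simp only: koszul_scale koszul_diff koszul_uminus)
        ultimately show ?thesis using e by simp
      qed
      ultimately show False using nb0 by blast
    qed
    then have "\<forall>S. bd n h S = link_part v f S" using wedge by simp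
    then show "\<exists>g. supp_on \<Delta> (Suc (Suc k)) g \<and> (\<forall>S. bd n g S = f S)"
      using cycle_bounds[OF c v D f hs] by blast
  qed
qed

section \<open>Simplicial homology\<close>

text \<open>A face contributes to the coefficient at \<open>T\<close> exactly when it is
  \<open>insert v T\<close> with v outside \<open>T\<close>; the bound on the keys ensures that such
  v lie in \<open>{1..n}\<close>.\<close>

lemma lookup_boundary:
  fixes c :: "'k::field chain"
  assumes "keys c \<subseteq> Pow {1..n}"
  shows "lk (boundary c) T = bd n (lk c) T"
proof -
  let ?t = "\<lambda>\<sigma> v. if \<sigma> - {v} = T then sg v \<sigma> * lk c \<sigma> else 0"
  have fin: "finite \<sigma>" if "\<sigma> \<in> keys c" for \<sigma>
    using assms that finite_subset[of \<sigma> "{1..n}"] by auto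
  have "lk (boundary c) T = (\<Sum>\<sigma>\<in>keys c. \<Sum>v\<in>\<sigma>. ?t \<sigma> v)"
    unfolding boundary_def lookup_sum lookup_single sg_def by (simp add: when_def)
  also have "\<dots> = (\<Sum>\<sigma>\<in>keys c. \<Sum>v\<in>{1..n}. if v \<in> \<sigma> then ?t \<sigma> v else 0)"
  proof (rule sum.cong)
    fix \<sigma> assume "\<sigma> \<in> keys c"
    then have "{1..n} \<inter> \<sigma> = \<sigma>" using assms by auto
    then show "(\<Sum>v\<in>\<sigma>. ?t \<sigma> v) = (\<Sum>v\<in>{1..n}. if v \<in> \<sigma> then ?t \<sigma> v else 0)"
      using sum.inter_restrict[of "{1..n}" "?t \<sigma>" \<sigma>] by simp
  qed simp
  also have "\<dots> = (\<Sum>v\<in>{1..n}. \<Sum>\<sigma>\<in>keys c. if v \<in> \<sigma> then ?t \<sigma> v else 0)"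
    by (rule sum.swap)
  also have "\<dots> = (\<Sum>v\<in>{1..n}. if v \<in> T then 0 else sg v T * lk c (insert v T))"
  proof (rule sum.cong)
    fix v assume "v \<in> {1..n}"
    show "(\<Sum>\<sigma>\<in>keys c. if v \<in> \<sigma> then ?t \<sigma> v else 0) = (if v \<in> T then 0 else sg v T * lk c (insert v T))"
    proof (cases "v \<in> T")
      case True
      then show ?thesis by (auto intro!: sum.neutral)
    next
      case False
      have "(\<Sum>\<sigma>\<in>keys c. if v \<in> \<sigma> then ?t \<sigma> v else 0) = (\<Sum>\<sigma>\<in>keys c. if insert v T = \<sigma> then sg v T * lk c (insert v T) else 0)"
        using False by (intro sum.cong refl) (auto simp: insert_absorb)
      also have "\<dots> = sg v T * lk c (insert v T)"
        by (simp add: sum.delta in_keys_iff)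
      finally show ?thesis using False by simp
    qed
  qed simp
  also have "\<dots> = (\<Sum>v\<in>{1..n} - T. sg v T * lk c (insert v T))"
    by (rule sum.mono_neutral_cong_right) auto
  finally show ?thesis by (simp add: koszul_def)
qed

section \<open>From dimensions of homology to exactness\<close>

context vector_space
begin

text \<open>Extend a basis of B to a basis of Z: the difference of the dimensions is the number of
  added vectors, and a single added vector is the z of the second claim.\<close>

lemma subspace_dim_gap:
  assumes "subspace B" "subspace Z" "B \<subseteq> Z" "finite W" "Z \<subseteq> span W"
  shows "dim Z - dim B = 0 \<longleftrightarrow> Z \<subseteq> B"
    and "dim Z - dim B = 1 \<Longrightarrow> \<exists>z. \<forall>x\<in>Z. \<exists>c. x - scale c z \<in> B"
proof -
  obtain B' where B': "B' \<subseteq> B" "independent B'" "B \<subseteq> span B'" "card B' = dim B"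
    by (rule basis_exists)
  have "B' \<subseteq> Z" using B'(1) assms(3) by (rule subset_trans)
  then obtain C where C: "B' \<subseteq> C" "C \<subseteq> Z" "independent C" "Z \<subseteq> span C"
    by (rule maximal_independent_subset_extend[OF _ B'(2)])
  have "C \<subseteq> span W" using C(2) assms(5) by (rule subset_trans)
  then have fC: "finite C" using independent_span_bound[OF assms(4) C(3)] by blast
  then have fB: "finite B'" by (rule finite_subset[OF C(1)])
  have dZ: "dim Z = card C" using basis_card_eq_dim[OF C(2,4,3)] by simp
  have sB: "span B' = B" using span_minimal[OF B'(1) assms(1)] B'(3) by (rule subset_antisym)
  show "dim Z - dim B = 0 \<longleftrightarrow> Z \<subseteq> B"
  proof
    assume "dim Z - dim B = 0"
    then have "card C \<le> card B'" using dZ B' by simp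
    then have "C = B'" using card_seteq[OF fC C(1)] by simp
    then show "Z \<subseteq> B" using C(4) sB by simp
  qed (use assms in auto)
  assume "dim Z - dim B = 1"
  then have "card (C - B') = 1" using dZ B' C fB by (simp add: card_Diff_subset)
  then obtain z where z: "C - B' = {z}" using card_1_singletonE by blast
  then have "C = insert z B'" using C(1) by blast
  then have "\<forall>x\<in>Z. \<exists>c. x - scale c z \<in> B"
    using C(4) span_breakdown_eq[of _ z B'] by (auto simp: sB)
  then show "\<exists>z. \<forall>x\<in>Z. \<exists>c. x - scale c z \<in> B" ..
qed

end

lemma boundary_eq_iff:
  assumes "keys c \<subseteq> Pow {1..n}"
  shows "boundary c = (d :: 'k::field chain) \<longleftrightarrow> (\<forall>T. bd n (lk c) T = lk d T)"
  by (subst poly_mapping_eq_iff) (simp add: fun_eq_iff lookup_boundary[OF assms])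

lemma keys_chains: "cplx n \<Delta> \<Longrightarrow> c \<in> chains \<Delta> i \<Longrightarrow> keys c \<subseteq> Pow {1..n}"
proof
  fix \<sigma> assume "cplx n \<Delta>" "c \<in> chains \<Delta> i" "\<sigma> \<in> keys c"
  then have "\<sigma> \<in> \<Delta>" by (simp add: chains_def)
  then show "\<sigma> \<in> Pow {1..n}" using cplx_subsp[OF \<open>cplx n \<Delta>\<close>] by simp
qed

lemma chains_supp:
  assumes "i = int k - 1"
  shows "(c :: 'k::field chain) \<in> chains \<Delta> i \<longleftrightarrow> supp_on \<Delta> k (lk c)"
  using assms by (auto simp: chains_def supp_on_def in_keys_iff)

lemma subspace_chains: "chain_space.subspace (chains \<Delta> i :: 'k::field chain set)"
proof (rule chain_space.subspaceI)
  fix x y :: "'k chain" assume "x \<in> chains \<Delta> i" "y \<in> chains \<Delta> i"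
  then show "x + y \<in> chains \<Delta> i" using keys_add[of x y] by (auto simp: chains_def)
next
  fix c and x :: "'k chain" assume "x \<in> chains \<Delta> i"
  then show "chain_scale c x \<in> chains \<Delta> i"
    by (auto simp: chains_def in_keys_iff lookup_chain_scale)
qed (auto simp: chains_def)

lemma boundary_chain_facts:
  fixes x y :: "'k::field chain"
  assumes "keys x \<subseteq> Pow {1..n}" "keys y \<subseteq> Pow {1..n}"
  shows "boundary (x + y) = boundary x + boundary y"
    and "boundary (chain_scale a x) = chain_scale a (boundary x)"
proof -
  have k: "keys (x + y) \<subseteq> Pow {1..n}" using keys_add[of x y] assms by blast
  show "boundary (x + y) = boundary x + boundary y"
    by (rule poly_mapping_eqI)
      (simp add: lookup_boundary[OF k] lookup_boundary[OF assms(1)] lookup_boundary[OF assms(2)] lookup_add koszul_add lookup_add[abs_def])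
  have k: "keys (chain_scale a x) \<subseteq> Pow {1..n}"
    using assms by (auto simp: in_keys_iff lookup_chain_scale)
  show "boundary (chain_scale a x) = chain_scale a (boundary x)"
    by (rule poly_mapping_eqI)
      (simp add: lookup_boundary[OF k] lookup_boundary[OF assms(1)] lookup_chain_scale koszul_scale lookup_chain_scale[abs_def])
qed

lemma finite_cplx: "cplx n \<Delta> \<Longrightarrow> finite \<Delta>"
  unfolding cplx_def by (meson finite_Pow_iff finite_atLeastAtMost finite_subset)

lemma poly_mapping_of_fun:
  assumes "finite {x. f x \<noteq> 0}"
  obtains c where "\<And>x. lk c x = f x"
  using lookup_Abs_poly_mapping[OF assms] by metis

text \<open>The bridge between \<open>homology_dim\<close> and conditions on chains. The shift
  arises because a face of degree i has k = i + 1 vertices; finiteness of \<Delta> gives the finite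
  spanning set that the dimension count requires.\<close>

lemma homology_facts:
  fixes K :: "'k::field itself"
  assumes c: "cplx n \<Delta>" and i: "i = int k - 1"
  shows "homology_dim TYPE('k) \<Delta> i = 0 \<longleftrightarrow> exact_at n TYPE('k) \<Delta> k"
    and "homology_dim TYPE('k) \<Delta> i = 1 \<Longrightarrow> line_at n TYPE('k) \<Delta> k"
proof -
  let ?Z = "cycles \<Delta> i :: 'k chain set" and ?B = "boundaries \<Delta> i :: 'k chain set"
  let ?C = "chains \<Delta> i :: 'k chain set" and ?C' = "chains \<Delta> (i + 1) :: 'k chain set"
  have i': "i + 1 = int (Suc k) - 1" using i by simp
  note kc = keys_chains[OF c]
  have b0: "boundary (0 :: 'k chain) = 0" by (simp add: boundary_def)
  have badd: "boundary (x + y) = boundary x + boundary y" if "x \<in> ?C" "y \<in> ?C" for x y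
    using boundary_chain_facts(1)[OF kc[OF that(1)] kc[OF that(2)]] .
  have bscale: "boundary (chain_scale a x) = chain_scale a (boundary x)" if "x \<in> ?C" for a x
    using boundary_chain_facts(2)[OF kc[OF that] kc[OF that]] .
  have subZ: "chain_space.subspace ?Z"
    by (rule chain_space.subspaceI)
      (use subspace_chains[of \<Delta> i, where ?'k = 'k] in
        \<open>auto simp: cycles_def b0 badd bscale chain_space.subspace_0 chain_space.subspace_add chain_space.subspace_scale\<close>)
  have subB: "chain_space.subspace ?B"
  proof (rule chain_space.subspaceI)
    show "0 \<in> ?B" unfolding boundaries_def
      using b0 chain_space.subspace_0[OF subspace_chains] by (intro image_eqI[of _ _ 0]) auto
    fix x y assume "x \<in> ?B" "y \<in> ?B"
    then obtain x' y' where "x = boundary x'" "x' \<in> ?C'" "y = boundary y'" "y' \<in> ?C'" by (auto simp: boundaries_def)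
    then show "x + y \<in> ?B" unfolding boundaries_def
      using chain_space.subspace_add[OF subspace_chains, of x' \<Delta> "i + 1" y']
      by (intro image_eqI[of _ _ "x' + y'"]) (simp_all add: boundary_chain_facts(1)[OF kc kc])
  next
    fix a and x assume "x \<in> ?B"
    then obtain x' where "x = boundary x'" "x' \<in> ?C'" by (auto simp: boundaries_def)
    then show "chain_scale a x \<in> ?B" unfolding boundaries_def
      using chain_space.subspace_scale[OF subspace_chains, of x' \<Delta> "i + 1" a]
      by (intro image_eqI[of _ _ "chain_scale a x'"]) (simp_all add: boundary_chain_facts(2)[OF kc kc])
  qed
  have BZ: "?B \<subseteq> ?Z"
  proof
    fix x assume "x \<in> ?B"
    then obtain y where y: "x = boundary y" "y \<in> ?C'" by (auto simp: boundaries_def)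
    have lx: "lk x = bd n (lk y)" using lookup_boundary[OF kc[OF y(2)]] y by auto
    have s: "supp_on \<Delta> (Suc k) (lk y)" using y chains_supp[OF i'] by blast
    have "supp_on \<Delta> k (lk x)" using supp_on_bd[OF c s] lx by (auto simp: supp_on_def)
    then have xC: "x \<in> ?C" using chains_supp[OF i] by blast
    moreover have "bd n (lk x) T = 0" for T
    proof (cases "finite T")
      case True then show ?thesis unfolding lx by (rule koszul_koszul)
    next
      case False
      then show ?thesis using supp_on_bd[OF c \<open>supp_on \<Delta> k (lk x)\<close>] cplx_finite[OF c] by blast
    qed
    ultimately show "x \<in> ?Z" using boundary_eq_iff[OF kc[OF xC], of 0] by (simp add: cycles_def)
  qed
  let ?W = "(\<lambda>\<sigma>. single \<sigma> (1::'k)) ` \<Delta>"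
  have fW: "finite ?W" using finite_cplx[OF c] by simp
  have ZW: "?Z \<subseteq> chain_space.span ?W"
  proof
    fix x :: "'k chain" assume "x \<in> ?Z"
    then have x: "keys x \<subseteq> \<Delta>" by (auto simp: cycles_def chains_def)
    have "x = (\<Sum>\<sigma>\<in>keys x. chain_scale (lk x \<sigma>) (single \<sigma> 1))"
      by (rule poly_mapping_eqI) (simp add: lookup_sum lookup_chain_scale lookup_single when_def sum.delta in_keys_iff if_distrib[of "(*) _"] cong: if_cong)
    also have "\<dots> \<in> chain_space.span ?W"
      using x by (intro chain_space.span_sum chain_space.span_scale chain_space.span_base) auto
    finally show "x \<in> chain_space.span ?W" .
  qed
  have Z: "x \<in> ?Z \<longleftrightarrow> supp_on \<Delta> k (lk x) \<and> (\<forall>T. bd n (lk x) T = 0)" for x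
  proof -
    have "x \<in> ?Z \<longleftrightarrow> x \<in> ?C \<and> boundary x = 0" by (simp add: cycles_def)
    also have "\<dots> \<longleftrightarrow> x \<in> ?C \<and> (\<forall>T. bd n (lk x) T = 0)"
      using boundary_eq_iff[OF kc, of x i 0] by auto
    finally show ?thesis using chains_supp[OF i, of x \<Delta>] by simp
  qed
  have B: "x \<in> ?B \<longleftrightarrow> (\<exists>g. supp_on \<Delta> (Suc k) g \<and> (\<forall>S. bd n g S = lk x S))" for x
  proof
    assume "x \<in> ?B"
    then obtain y where y: "x = boundary y" "y \<in> ?C'" by (auto simp: boundaries_def)
    then show "\<exists>g. supp_on \<Delta> (Suc k) g \<and> (\<forall>S. bd n g S = lk x S)"
      using lookup_boundary[OF kc[OF y(2)]] chains_supp[OF i'] by (intro exI[of _ "lk y"]) auto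
  next
    assume "\<exists>g. supp_on \<Delta> (Suc k) g \<and> (\<forall>S. bd n g S = lk x S)"
    then obtain g where g: "supp_on \<Delta> (Suc k) g" "\<forall>S. bd n g S = lk x S" by blast
    have "finite {S. g S \<noteq> 0}" by (rule finite_subset[OF _ finite_cplx[OF c]]) (use g in \<open>auto simp: supp_on_def\<close>)
    then obtain y where y: "\<And>S. lk y S = g S" by (rule poly_mapping_of_fun) blast
    then have "lk y = g" by auto
    then have "y \<in> ?C'" using chains_supp[OF i'] g by blast
    moreover from this have "boundary y = x" using boundary_eq_iff[OF kc, of y] g(2) \<open>lk y = g\<close> by simp
    ultimately show "x \<in> ?B" by (auto simp: boundaries_def)
  qed
  have lift: "\<exists>x. lk x = f" if "supp_on \<Delta> k f" for f :: "nat set \<Rightarrow> 'k"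
  proof -
    have "finite {S. f S \<noteq> 0}" by (rule finite_subset[OF _ finite_cplx[OF c]]) (use that in \<open>auto simp: supp_on_def\<close>)
    then obtain x where "\<And>S. lk x S = f S" by (rule poly_mapping_of_fun) blast
    then show ?thesis by (intro exI[of _ x]) auto
  qed
  have "homology_dim TYPE('k) \<Delta> i = 0 \<longleftrightarrow> ?Z \<subseteq> ?B"
    unfolding homology_dim_def by (rule chain_space.subspace_dim_gap(1)[OF subB subZ BZ fW ZW])
  also have "\<dots> \<longleftrightarrow> exact_at n TYPE('k) \<Delta> k"
  proof
    assume ZB: "?Z \<subseteq> ?B"
    show "exact_at n TYPE('k) \<Delta> k" unfolding exact_at_cplx[OF c]
    proof (intro allI impI)
      fix f :: "nat set \<Rightarrow> 'k" assume f: "supp_on \<Delta> k f" "\<forall>T. bd n f T = 0"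
      then obtain x where x: "lk x = f" using lift by blast
      then have "x \<in> ?B" using ZB Z[of x] f by auto
      then show "\<exists>g. supp_on \<Delta> (Suc k) g \<and> (\<forall>S. bd n g S = f S)" using B[of x] x by simp
    qed
  next
    assume "exact_at n TYPE('k) \<Delta> k"
    then have e: "\<And>f :: nat set \<Rightarrow> 'k. supp_on \<Delta> k f \<Longrightarrow> (\<forall>T. bd n f T = 0) \<Longrightarrow>
        (\<exists>g. supp_on \<Delta> (Suc k) g \<and> (\<forall>S. bd n g S = f S))"
      unfolding exact_at_cplx[OF c] by simp
    show "?Z \<subseteq> ?B"
    proof
      fix x assume "x \<in> ?Z"
      then have "supp_on \<Delta> k (lk x)" "\<forall>T. bd n (lk x) T = 0" using Z[of x] by simp_all
      then show "x \<in> ?B" unfolding B by (rule e)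
    qed
  qed
  finally show "homology_dim TYPE('k) \<Delta> i = 0 \<longleftrightarrow> exact_at n TYPE('k) \<Delta> k" .
  assume "homology_dim TYPE('k) \<Delta> i = 1"
  then obtain z where z: "\<forall>x\<in>?Z. \<exists>a. x - chain_scale a z \<in> ?B"
    unfolding homology_dim_def using chain_space.subspace_dim_gap(2)[OF subB subZ BZ fW ZW] by auto
  show "line_at n TYPE('k) \<Delta> k" unfolding line_at_def
  proof (intro exI[of _ "lk z"] allI impI)
    fix f :: "nat set \<Rightarrow> 'k" assume f: "supp_on \<Delta> k f" "\<forall>T. bd n f T = 0"
    then obtain x where x: "lk x = f" using lift by blast
    then have "x \<in> ?Z" using Z[of x] f by simp
    then obtain a where "x - chain_scale a z \<in> ?B" using z by auto
    then obtain g where g: "supp_on \<Delta> (Suc k) g" "\<forall>S. bd n g S = lk (x - chain_scale a z) S"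
      using B by blast
    then have "\<forall>S. f S = a * lk z S + bd n g S" using x by (simp add: lookup_minus lookup_chain_scale)
    then show "\<exists>a g. supp_on \<Delta> (Suc k) g \<and> (\<forall>S. f S = a * lk z S + bd n g S)" using g by blast
  qed
qed

text \<open>Cardinalities are nonnegative, so below degree -1 the only chain is 0.\<close>

lemma homology_low:
  assumes "i < -1" shows "homology_dim TYPE('k::field) \<Delta> i = 0"
proof -
  have "(c :: 'k chain) = 0" if "c \<in> chains \<Delta> i" for c
  proof (rule poly_mapping_eqI)
    fix \<sigma>
    have "\<sigma> \<notin> keys c"
    proof
      assume "\<sigma> \<in> keys c"
      then have "int (card \<sigma>) = i + 1" using that by (simp add: chains_def)
      then show False using assms by simp
    qed
    then show "lk c \<sigma> = lk 0 \<sigma>" by (simp add: in_keys_iff)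
  qed
  then have "cycles \<Delta> i \<subseteq> chain_space.span ({} :: 'k chain set)" by (auto simp: cycles_def)
  then have "chain_space.dim (cycles \<Delta> i :: 'k chain set) \<le> card ({} :: 'k chain set)"
    by (rule chain_space.dim_le_card) simp
  then show ?thesis by (simp add: homology_dim_def)
qed

section \<open>Induced subcomplexes of spherical complexes\<close>

definition restr :: "nat set set \<Rightarrow> nat set \<Rightarrow> nat set set" where
  "restr \<Delta> W = {\<sigma> \<in> \<Delta>. \<sigma> \<subseteq> W}"

lemma restr_cplx: "cplx n \<Delta> \<Longrightarrow> cplx n (restr \<Delta> W)"
  unfolding cplx_def restr_def by blast

text \<open>In the restriction to \<open>insert v W\<close>, deletion and link of v are restrictions
  to \<open>W\<close>. Thus the exact sequence compares \<open>W\<close> with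
  \<open>insert v W\<close>.\<close>

lemma restr_del: "v \<notin> W \<Longrightarrow> restr (del \<Delta> v) W = restr \<Delta> W"
  and del_restr: "v \<notin> W \<Longrightarrow> del (restr \<Delta> (insert v W)) v = restr \<Delta> W"
  and link_restr: "v \<notin> W \<Longrightarrow> link (restr \<Delta> (insert v W)) v = restr (link \<Delta> v) W"
  unfolding restr_def del_def link_def by auto

lemma vertices_del: "vertices (del \<Delta> v) = vertices \<Delta> - {v}"
  by (auto simp: vertices_def del_def)

lemma vertices_link: "vertices (link \<Delta> v) \<subseteq> vertices \<Delta> - {v}"
  by (auto simp: vertices_def link_def del_def)

lemma vertices_subsp: "cplx n \<Delta> \<Longrightarrow> vertices \<Delta> \<subseteq> {1..n}"
  using cplx_subsp by (fastforce simp: vertices_def)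

lemma restr_all:
  assumes "cplx n \<Delta>" "vertices \<Delta> \<subseteq> W" shows "restr \<Delta> W = \<Delta>"
proof -
  have "v \<in> W" if "\<sigma> \<in> \<Delta>" "v \<in> \<sigma>" for \<sigma> v
    using cplxD[OF assms(1) that(1), of "{v}"] that assms(2) by (auto simp: vertices_def)
  then show ?thesis by (auto simp: restr_def)
qed

lemma sphD:
  assumes "spherical TYPE('k::field) X"
  shows "homology_dim TYPE('k) X i = 0 \<or> homology_dim TYPE('k) X i = 1"
    and "homology_dim TYPE('k) X i = 1 \<Longrightarrow> homology_dim TYPE('k) X j = 1 \<Longrightarrow> i = j"
  using assms by (rule spherical.cases, blast)+

text \<open>The upper bound for \<open>j\<close> gives the regularity, the lower bound the depth.\<close>

lemma spherical_induced_degrees: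
  assumes "spherical TYPE('k::field) \<Delta>" "cplx n \<Delta>"
    and "\<not> exact_at n TYPE('k) \<Delta> d" "\<not> exact_at n TYPE('k) (restr \<Delta> W) j"
  shows "j \<le> d \<and> d \<le> j + card (vertices \<Delta> - W)"
  using assms
proof (induction arbitrary: W d j rule: spherical.induct)
  case (1 \<Delta>)
  note c = "1.prems"(1)
  have fv: "finite (vertices \<Delta>)" using vertices_subsp[OF c] finite_subset by blast
  have hd: "homology_dim TYPE('k) \<Delta> (int k - 1) = 1" if "\<not> exact_at n TYPE('k) \<Delta> k" for k
  proof -
    have "homology_dim TYPE('k) \<Delta> (int k - 1) = 0 \<or> homology_dim TYPE('k) \<Delta> (int k - 1) = 1"
      using "1.hyps"(1) by blast
    then show ?thesis using homology_facts(1)[OF c refl, of k, where ?'k = 'k] that by blast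
  qed
  have uniq: "k = l" if "\<not> exact_at n TYPE('k) \<Delta> k" "\<not> exact_at n TYPE('k) \<Delta> l" for k l
    using "1.hyps"(2)[rule_format, OF conjI[OF hd[OF that(1)] hd[OF that(2)]]] by simp
  \<comment> \<open>Inner induction on the number of vertices outside \<open>W\<close> with \<Delta>
    fixed; the outer induction hypotheses cover link and deletion.\<close>
  show ?case using "1.prems"(3)
  proof (induction "card (vertices \<Delta> - W)" arbitrary: W j)
    case 0
    then have "vertices \<Delta> \<subseteq> W" using fv by auto
    then show ?case using restr_all[OF c] 0 uniq[OF "1.prems"(2)] by auto
  next
    case (Suc m)
    then obtain v where v: "v \<in> vertices \<Delta>" "v \<notin> W" by (metis Diff_iff card.empty equals0I nat.distinct(1))
    have vn: "v \<in> {1..n}" using v vertices_subsp[OF c] by blast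
    have cd: "cplx n (del \<Delta> v)" and cl: "cplx n (link \<Delta> v)" using c del_cplx link_cplx by auto
    have sph: "spherical TYPE('k) (link \<Delta> v)" "spherical TYPE('k) (del \<Delta> v)" using "1.IH" v by auto
    have IHl: "\<And>d j. \<not> exact_at n TYPE('k) (link \<Delta> v) d \<Longrightarrow> \<not> exact_at n TYPE('k) (restr (link \<Delta> v) W) j
        \<Longrightarrow> j \<le> d \<and> d \<le> j + card (vertices (link \<Delta> v) - W)"
      and IHd: "\<And>d j. \<not> exact_at n TYPE('k) (del \<Delta> v) d \<Longrightarrow> \<not> exact_at n TYPE('k) (restr (del \<Delta> v) W) j
        \<Longrightarrow> j \<le> d \<and> d \<le> j + card (vertices (del \<Delta> v) - W)"
      using "1.IH" v(1) cl cd by blast+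
    have card: "card (vertices \<Delta> - insert v W) = m"
    proof -
      have "vertices \<Delta> - insert v W = vertices \<Delta> - W - {v}" by auto
      then show ?thesis using Suc.hyps(2) v card_Diff_singleton[of v "vertices \<Delta> - W"] by simp
    qed
    have cardl: "card (vertices (link \<Delta> v) - W) \<le> m"
      unfolding card[symmetric] by (rule card_mono) (use fv vertices_link in auto)
    have cardd: "card (vertices (del \<Delta> v) - W) = m"
      unfolding card[symmetric] vertices_del by (rule arg_cong[where f = card]) auto
    have uq: "k = l" if "spherical TYPE('k) X" "cplx n X" "\<not> exact_at n TYPE('k) X k" "\<not> exact_at n TYPE('k) X l" for X k l
    proof -
      have "homology_dim TYPE('k) X (int k - 1) = 1" "homology_dim TYPE('k) X (int l - 1) = 1"
        using sphD(1)[OF that(1)] homology_facts(1)[OF that(2) refl, where ?'k = 'k] that by blast+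
      then show ?thesis using sphD(2)[OF that(1), of "int k - 1" "int l - 1"] by simp
    qed
    show ?case
    proof (cases "\<exists>e. \<not> exact_at n TYPE('k) (del \<Delta> v) e")
      case True
      then obtain e where e: "\<not> exact_at n TYPE('k) (del \<Delta> v) e" by blast
      \<comment> \<open>Otherwise exactness puts homology of the link in both e and d - 1, so these
        agree; then the line of the link injects into the deletion and \<Delta> has no homology at
        d.\<close>
      have "e = d"
      proof (rule ccontr)
        assume ed: "e \<noteq> d"
        have Dd: "exact_at n TYPE('k) (del \<Delta> v) d" using uq[OF sph(2) cd e] ed by blast
        have De: "exact_at n TYPE('k) \<Delta> e" using uniq[OF "1.prems"(2)] ed by blast
        have Le: "\<not> exact_at n TYPE('k) (link \<Delta> v) e" using exact_del[OF c vn _ De] e by blast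
        obtain l where l: "d = Suc l" "\<not> exact_at n TYPE('k) (link \<Delta> v) l"
          using exact_whole[OF c vn Dd] "1.prems"(2) by blast
        have "l = e" using uq[OF sph(1) cl l(2) Le] .
        have "homology_dim TYPE('k) (link \<Delta> v) (int e - 1) = 1"
          using sphD(1)[OF sph(1)] homology_facts(1)[OF cl refl, where ?'k = 'k] Le by blast
        then have "line_at n TYPE('k) (link \<Delta> v) e" by (rule homology_facts(2)[OF cl refl])
        then have "exact_at n TYPE('k) \<Delta> d"
          using exact_Suc_if_line[OF c vn De e] Dd l \<open>l = e\<close> by simp
        then show False using "1.prems"(2) by simp
      qed
      then have "j \<le> d \<and> d \<le> j + m" using IHd[OF e, of j] Suc.prems restr_del[OF v(2)] cardd by simp
      then show ?thesis using Suc.hyps(2) by linarith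
    next
      case False
      \<comment> \<open>The deletion is acyclic, so the homology of \<Delta> at d comes from the
        link, one degree lower.\<close>
      then obtain l where l: "d = Suc l" "\<not> exact_at n TYPE('k) (link \<Delta> v) l"
        using exact_whole[OF c vn] "1.prems"(2) by blast
      show ?thesis
      proof (cases "exact_at n TYPE('k) (restr \<Delta> (insert v W)) j")
        case True
        \<comment> \<open>If adding v destroys the homology at j, the class must come from the link
          of v in the same degree j. So the hypothesis for the link applies with l = d - 1, and the
          lost 1 is repaid by v in the vertex count.\<close>
        have "\<not> exact_at n TYPE('k) (restr (link \<Delta> v) W) j"
          using exact_del[OF restr_cplx[OF c] vn, of "insert v W" j, where ?'k = 'k] True Suc.prems
          unfolding del_restr[OF v(2)] link_restr[OF v(2)] by blast
        then have "j \<le> l \<and> l \<le> j + card (vertices (link \<Delta> v) - W)" using IHl l by blast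
        then show ?thesis using cardl Suc.hyps(2) l by linarith
      next
        case False
        then have "j \<le> d \<and> d \<le> j + m" using Suc.hyps(1)[of "insert v W" j] card by simp
        then show ?thesis using Suc.hyps(2) by linarith
      qed
    qed
  qed
qed

section \<open>Duality\<close>

text \<open>A functional that vanishes on the common kernel of finitely many functionals is a
  combination of them. The predicate \<open>V\<close> is a subspace, kept general so that the
  induction can pass to the kernel of one of the functionals.\<close>

lemma functional_in_row_span:
  fixes c :: "'a \<Rightarrow> 'b \<Rightarrow> 'k::field"
  assumes "finite A" and V0: "\<And>f g r. V f \<Longrightarrow> V g \<Longrightarrow> V (\<lambda>b. f b - r * g b)"
    and "\<And>f. V f \<Longrightarrow> (\<And>a. a \<in> A \<Longrightarrow> (\<Sum>b\<in>B. c a b * f b) = 0) \<Longrightarrow> (\<Sum>b\<in>B. \<phi> b * f b) = 0"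
  shows "\<exists>\<psi>. \<forall>f. V f \<longrightarrow> (\<Sum>b\<in>B. \<phi> b * f b) = (\<Sum>a\<in>A. \<psi> a * (\<Sum>b\<in>B. c a b * f b))"
  using assms
proof (induction A arbitrary: V)
  case empty
  then show ?case by simp
next
  case (insert x A)
  define l where "l f = (\<Sum>b\<in>B. c x b * f b)" for f
  have ll: "(\<Sum>b\<in>B. p b * (f b - r * g b)) = (\<Sum>b\<in>B. p b * f b) - r * (\<Sum>b\<in>B. p b * g b)" for p f g :: "'b \<Rightarrow> 'k" and r
    by (simp add: right_diff_distrib sum_subtractf sum_distrib_left mult.left_commute)
  have lll: "l (\<lambda>b. f b - r * g b) = l f - r * l g" for f g r unfolding l_def by (rule ll)
  have "\<exists>\<psi>. \<forall>f. (V f \<and> l f = 0) \<longrightarrow> (\<Sum>b\<in>B. \<phi> b * f b) = (\<Sum>a\<in>A. \<psi> a * (\<Sum>b\<in>B. c a b * f b))"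
  proof (rule insert.IH)
    fix f g r assume "V f \<and> l f = 0" "V g \<and> l g = 0"
    then show "V (\<lambda>b. f b - r * g b) \<and> l (\<lambda>b. f b - r * g b) = 0"
      using insert.prems(1)[of f g r] by (simp add: lll)
  next
    fix f assume f: "V f \<and> l f = 0" "\<And>a. a \<in> A \<Longrightarrow> (\<Sum>b\<in>B. c a b * f b) = 0"
    show "(\<Sum>b\<in>B. \<phi> b * f b) = 0"
      by (rule insert.prems(2)) (use f in \<open>auto simp: l_def\<close>)
  qed
  then obtain \<psi> where psi: "\<And>f. V f \<Longrightarrow> l f = 0 \<Longrightarrow> (\<Sum>b\<in>B. \<phi> b * f b) = (\<Sum>a\<in>A. \<psi> a * (\<Sum>b\<in>B. c a b * f b))"
    by auto
  \<comment> \<open>The error of the combination obtained so far. It vanishes where l does, so it is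
    a multiple t of l, and t is the coefficient of the new functional.\<close>
  define d where "d f = (\<Sum>b\<in>B. \<phi> b * f b) - (\<Sum>a\<in>A. \<psi> a * (\<Sum>b\<in>B. c a b * f b))" for f
  have dl: "d (\<lambda>b. f b - r * g b) = d f - r * d g" for f g r
    unfolding d_def ll by (simp add: right_diff_distrib sum_subtractf sum_distrib_left mult.left_commute)
  have "\<exists>t. \<forall>f. V f \<longrightarrow> d f = t * l f"
  proof (cases "\<exists>f0. V f0 \<and> l f0 \<noteq> 0")
    case True
    then obtain f0 where f0: "V f0" "l f0 \<noteq> 0" by blast
    show ?thesis
    proof (intro exI allI impI)
      fix f assume f: "V f"
      obtain r where r: "r = l f / l f0" by blast
      then have "l (\<lambda>b. f b - r * f0 b) = 0" using f0 lll[of f r f0] by simp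
      then have "d (\<lambda>b. f b - r * f0 b) = 0"
        unfolding d_def using psi[OF insert.prems(1)[OF f f0(1)]] by simp
      then show "d f = d f0 / l f0 * l f" unfolding dl using r by simp
    qed
  next
    case False
    then have "d f = 0 * l f" if "V f" for f using psi that by (simp add: d_def)
    then show ?thesis by blast
  qed
  then obtain t where t: "\<And>f. V f \<Longrightarrow> d f = t * l f" by blast
  show ?case
  proof (intro exI[of _ "\<psi>(x := t)"] allI impI)
    fix f assume "V f"
    then have "(\<Sum>b\<in>B. \<phi> b * f b) = t * l f + (\<Sum>a\<in>A. \<psi> a * (\<Sum>b\<in>B. c a b * f b))"
      using t[of f] unfolding d_def by (simp add: algebra_simps)
    moreover have "(\<Sum>a\<in>A. (\<psi>(x := t)) a * (\<Sum>b\<in>B. c a b * f b)) = (\<Sum>a\<in>A. \<psi> a * (\<Sum>b\<in>B. c a b * f b))"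
      using insert.hyps by (intro sum.cong) auto
    ultimately show "(\<Sum>b\<in>B. \<phi> b * f b) = (\<Sum>a\<in>insert x A. (\<psi>(x := t)) a * (\<Sum>b\<in>B. c a b * f b))"
      using insert.hyps by (simp add: l_def)
  qed
qed

text \<open>If \<phi> vanishes on the image of d, it vanishes on the kernel of c by exactness, hence
  lies in the row span of c.\<close>

lemma exact_transpose:
  fixes c :: "'a \<Rightarrow> 'b \<Rightarrow> 'k::field" and d :: "'b \<Rightarrow> 'c \<Rightarrow> 'k"
  assumes fin: "finite A" "finite B" "finite C"
    and ex: "\<And>f. (\<And>a. a \<in> A \<Longrightarrow> (\<Sum>b\<in>B. c a b * f b) = 0) \<Longrightarrow> \<exists>g. \<forall>b\<in>B. f b = (\<Sum>x\<in>C. d b x * g x)"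
    and phi: "\<And>x. x \<in> C \<Longrightarrow> (\<Sum>b\<in>B. \<phi> b * d b x) = 0"
  shows "\<exists>\<psi>. \<forall>b\<in>B. \<phi> b = (\<Sum>a\<in>A. \<psi> a * c a b)"
proof -
  have "\<exists>\<psi>. \<forall>f. True \<longrightarrow> (\<Sum>b\<in>B. \<phi> b * f b) = (\<Sum>a\<in>A. \<psi> a * (\<Sum>b\<in>B. c a b * f b))"
  proof (rule functional_in_row_span[OF fin(1)])
    fix f assume "\<And>a. a \<in> A \<Longrightarrow> (\<Sum>b\<in>B. c a b * f b) = 0"
    then obtain g where g: "\<forall>b\<in>B. f b = (\<Sum>x\<in>C. d b x * g x)" using ex by blast
    have "(\<Sum>b\<in>B. \<phi> b * f b) = (\<Sum>b\<in>B. \<Sum>x\<in>C. \<phi> b * d b x * g x)"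
      using g by (intro sum.cong) (auto simp: sum_distrib_left mult.assoc)
    also have "\<dots> = (\<Sum>x\<in>C. (\<Sum>b\<in>B. \<phi> b * d b x) * g x)"
      by (subst sum.swap) (simp add: sum_distrib_right)
    also have "\<dots> = 0" using phi by simp
    finally show "(\<Sum>b\<in>B. \<phi> b * f b) = 0" .
  qed auto
  then obtain \<psi> where psi: "\<And>f. (\<Sum>b\<in>B. \<phi> b * f b) = (\<Sum>a\<in>A. \<psi> a * (\<Sum>b\<in>B. c a b * f b))" by auto
  have "\<phi> b = (\<Sum>a\<in>A. \<psi> a * c a b)" if "b \<in> B" for b
  proof -
    have *: "(\<Sum>b'\<in>B. p b' * (if b' = b then 1 else 0)) = p b" for p :: "'b \<Rightarrow> 'k"
      using fin(2) that by (simp add: if_distrib sum.delta cong: if_cong)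
    show ?thesis using psi[of "\<lambda>b'. if b' = b then 1 else 0"] unfolding * .
  qed
  then show ?thesis by blast
qed

text \<open>Matrix entry of the simplicial boundary in row \<open>T\<close> and column
  \<open>S\<close>; \<open>the_elem (S - T)\<close> is the vertex that is dropped. Matrices make
  transposition available.\<close>

definition incid :: "nat set \<Rightarrow> nat set \<Rightarrow> 'a::comm_ring_1" where
  "incid T S = (if T \<subseteq> S \<and> card (S - T) = 1 then sg (the_elem (S - T)) T else 0)"

lemma incid_insert: "v \<notin> T \<Longrightarrow> incid T (insert v T) = sg v T"
proof -
  assume "v \<notin> T"
  then have "insert v T - T = {v}" by auto
  then show ?thesis by (simp add: incid_def subset_insertI)
qed

lemma incE:
  assumes "incid T S \<noteq> 0" obtains v where "v \<notin> T" "S = insert v T"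
proof -
  have *: "T \<subseteq> S" "card (S - T) = 1" using assms by (auto simp: incid_def split: if_splits)
  then obtain v where "S - T = {v}" by (meson card_1_singletonE)
  then show ?thesis using that[of v] * by auto
qed

lemma bd_incid:
  assumes "finite B" "B \<subseteq> Pow {1..n}" "\<And>S. f S \<noteq> 0 \<Longrightarrow> S \<in> B"
  shows "bd n f T = (\<Sum>S\<in>B. incid T S * f S)"
proof -
  have inj: "inj_on (\<lambda>v. insert v T) ({1..n} - T)" by (auto simp: inj_on_def)
  have "bd n f T = (\<Sum>v\<in>{1..n} - T. incid T (insert v T) * f (insert v T))"
    unfolding koszul_def by (intro sum.cong) (auto simp: incid_insert)
  also have "\<dots> = (\<Sum>S\<in>(\<lambda>v. insert v T) ` ({1..n} - T). incid T S * f S)"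
    using sum.reindex[OF inj, of "\<lambda>S. incid T S * f S"] by simp
  also have "\<dots> = (\<Sum>S\<in>(\<lambda>v. insert v T) ` ({1..n} - T) \<union> B. incid T S * f S)"
  proof (rule sum.mono_neutral_left)
    show "\<forall>S\<in>(\<lambda>v. insert v T) ` ({1..n} - T) \<union> B - (\<lambda>v. insert v T) ` ({1..n} - T). incid T S * f S = 0"
    proof
      fix S assume S: "S \<in> (\<lambda>v. insert v T) ` ({1..n} - T) \<union> B - (\<lambda>v. insert v T) ` ({1..n} - T)"
      show "incid T S * f S = 0"
      proof (rule ccontr)
        assume "incid T S * f S \<noteq> 0"
        then have "incid T S \<noteq> (0::'a)" by auto
        then obtain v where "v \<notin> T" "S = insert v T" by (rule incE)
        then show False using S assms(2) by auto
      qed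
    qed
  qed (use assms in auto)
  also have "\<dots> = (\<Sum>S\<in>B. incid T S * f S)"
  proof (rule sum.mono_neutral_right)
    show "\<forall>S\<in>(\<lambda>v. insert v T) ` ({1..n} - T) \<union> B - B. incid T S * f S = 0"
      using assms(3) by (metis DiffD2 mult_zero_right)
  qed (use assms in auto)
  finally show ?thesis .
qed

text \<open>Kernel contained in image at B for K^C -> K^B -> K^A, both maps being blocks of the one
  matrix c.\<close>

definition mexact :: "('b \<Rightarrow> 'b \<Rightarrow> 'k::field) \<Rightarrow> 'b set \<Rightarrow> 'b set \<Rightarrow> 'b set \<Rightarrow> bool" where
  "mexact c A B C \<longleftrightarrow> (\<forall>f. (\<forall>a\<in>A. (\<Sum>b\<in>B. c a b * f b) = 0) \<longrightarrow> (\<exists>g. \<forall>b\<in>B. f b = (\<Sum>x\<in>C. c b x * g x)))"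

lemma mexact_dual:
  assumes "finite A" "finite B" "finite C" "mexact c A B C"
  shows "mexact (\<lambda>x y. c y x) C B A"
  unfolding mexact_def
proof (intro allI impI)
  fix f assume f: "\<forall>x\<in>C. (\<Sum>b\<in>B. c b x * f b) = 0"
  have "\<exists>\<psi>. \<forall>b\<in>B. f b = (\<Sum>a\<in>A. \<psi> a * c a b)"
    by (rule exact_transpose[OF assms(1-3), of c c]) (use assms(4) f in \<open>auto simp: mexact_def mult.commute\<close>)
  then show "\<exists>g. \<forall>b\<in>B. f b = (\<Sum>x\<in>A. c x b * g x)" by (simp add: mult.commute)
qed

text \<open>Relabelling the basis by \<phi> and rescaling it by signs e is conjugation by an
  invertible matrix.\<close>

lemma mexact_transport:
  fixes c c' :: "'b \<Rightarrow> 'b \<Rightarrow> 'k::field"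
  assumes m: "mexact c (\<phi> ` A) (\<phi> ` B) (\<phi> ` C)"
    and inj: "inj_on \<phi> A" "inj_on \<phi> B" "inj_on \<phi> C"
    and e: "\<And>x. e x * e x = 1"
    and AB: "\<And>x y. x \<in> A \<Longrightarrow> y \<in> B \<Longrightarrow> c' x y = e x * e y * c (\<phi> x) (\<phi> y)"
    and BC: "\<And>x y. x \<in> B \<Longrightarrow> y \<in> C \<Longrightarrow> c' x y = e x * e y * c (\<phi> x) (\<phi> y)"
  shows "mexact c' A B C"
  unfolding mexact_def
proof (intro allI impI)
  have ee: "e x * (e x * a) = a" for x a using e[of x] by (simp flip: mult.assoc)
  fix f' assume f': "\<forall>a\<in>A. (\<Sum>b\<in>B. c' a b * f' b) = 0"
  define f where "f b = e (inv_into B \<phi> b) * f' (inv_into B \<phi> b)" for b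
  have fphi: "f (\<phi> b) = e b * f' b" if "b \<in> B" for b
    using inv_into_f_f[OF inj(2) that] by (simp add: f_def)
  have "(\<Sum>b\<in>\<phi> ` B. c a b * f b) = 0" if "a \<in> \<phi> ` A" for a
  proof -
    from that obtain a' where a': "a = \<phi> a'" "a' \<in> A" by auto
    have "(\<Sum>b\<in>\<phi> ` B. c a b * f b) = (\<Sum>b\<in>B. c a (\<phi> b) * f (\<phi> b))"
      by (simp add: sum.reindex[OF inj(2)])
    also have "\<dots> = (\<Sum>b\<in>B. e a' * (c' a' b * f' b))"
    proof (rule sum.cong)
      fix b assume b: "b \<in> B"
      have "e a' * (c' a' b * f' b) = e a' * (e a' * (e b * c a (\<phi> b) * f' b))"
        unfolding AB[OF a'(2) b] a' by (simp only: mult_ac)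
      also have "\<dots> = c a (\<phi> b) * f (\<phi> b)" unfolding ee fphi[OF b] by (simp only: mult_ac)
      finally show "c a (\<phi> b) * f (\<phi> b) = e a' * (c' a' b * f' b)" by simp
    qed simp
    also have "\<dots> = 0" using f' a' by (simp flip: sum_distrib_left)
    finally show ?thesis .
  qed
  then obtain g where g: "\<forall>b\<in>\<phi> ` B. f b = (\<Sum>x\<in>\<phi> ` C. c b x * g x)" using m unfolding mexact_def by blast
  have "f' b = (\<Sum>x\<in>C. c' b x * (e x * g (\<phi> x)))" if b: "b \<in> B" for b
  proof -
    have "f' b = e b * f (\<phi> b)" using fphi[OF b] by (simp add: ee)
    also have "f (\<phi> b) = (\<Sum>x\<in>C. c (\<phi> b) (\<phi> x) * g (\<phi> x))"
      using g b by (simp add: sum.reindex[OF inj(3)])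
    also have "e b * \<dots> = (\<Sum>x\<in>C. c' b x * (e x * g (\<phi> x)))"
      unfolding sum_distrib_left
    proof (rule sum.cong)
      fix x assume x: "x \<in> C"
      have "c' b x * (e x * g (\<phi> x)) = e x * (e x * (e b * (c (\<phi> b) (\<phi> x) * g (\<phi> x))))"
        using BC[OF b x] by (simp add: mult_ac)
      then show "e b * (c (\<phi> b) (\<phi> x) * g (\<phi> x)) = c' b x * (e x * g (\<phi> x))" by (simp only: ee)
    qed simp
    finally show ?thesis .
  qed
  then show "\<exists>g. \<forall>b\<in>B. f' b = (\<Sum>x\<in>C. c' b x * g x)"
    by (intro exI[of _ "\<lambda>x. e x * g (\<phi> x)"] ballI)
qed

definition layer :: "nat set set \<Rightarrow> nat \<Rightarrow> nat set set" where
  "layer X k = {S \<in> X. card S = k}"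

text \<open>The row set is described by \<open>Suc (card T) = k\<close>, so that it is empty for k =
  0; truncated subtraction would yield the sets of size 0 instead.\<close>

lemma exact_at_mexact:
  assumes X: "X \<subseteq> Pow {1..n}"
  shows "exact_at n TYPE('k::field) X k \<longleftrightarrow>
    mexact (incid :: _ \<Rightarrow> _ \<Rightarrow> 'k) {T \<in> X. Suc (card T) = k} (layer X k) (layer X (Suc k))"
proof -
  have fX: "finite X" using X by (rule finite_subset) simp
  have fin: "finite (layer X j)" "layer X j \<subseteq> Pow {1..n}" for j
    using fX X by (auto simp: layer_def)
  have bd: "bd n f T = (\<Sum>S\<in>layer X j. incid T S * f S)" if "supp_on X j f" for j T and f :: "nat set \<Rightarrow> 'k"
    by (rule bd_incid[OF fin]) (use that in \<open>auto simp: supp_on_def layer_def\<close>)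
  have sup: "supp_on X j (\<lambda>S. if S \<in> layer X j then f S else 0)" for j and f :: "nat set \<Rightarrow> 'k"
    by (auto simp: supp_on_def layer_def)
  have triv: "bd n f T = 0" if "supp_on X k f" "Suc (card T) \<noteq> k" "T \<in> X" for f :: "nat set \<Rightarrow> 'k" and T
  proof -
    have "incid T S = (0::'k)" if "S \<in> layer X k" for S
    proof (rule ccontr)
      assume "incid T S \<noteq> (0::'k)"
      then obtain v where "v \<notin> T" "S = insert v T" by (rule incE)
      moreover have "finite T" using X \<open>T \<in> X\<close> finite_subset[of T "{1..n}"] by auto
      ultimately show False using that \<open>Suc (card T) \<noteq> k\<close> by (auto simp: layer_def)
    qed
    then show ?thesis unfolding bd[OF that(1)] by simp
  qed
  show ?thesis
  proof
    assume E: "exact_at n TYPE('k) X k"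
    show "mexact (incid :: _ \<Rightarrow> _ \<Rightarrow> 'k) {T \<in> X. Suc (card T) = k} (layer X k) (layer X (Suc k))"
      unfolding mexact_def
    proof (intro allI impI)
      fix f :: "nat set \<Rightarrow> 'k" assume f: "\<forall>a\<in>{T \<in> X. Suc (card T) = k}. (\<Sum>b\<in>layer X k. incid a b * f b) = 0"
      define f' where "f' S = (if S \<in> layer X k then f S else 0)" for S
      have s: "supp_on X k f'" unfolding f'_def by (rule sup)
      have "bd n f' T = 0" if "T \<in> X" for T
      proof (cases "Suc (card T) = k")
        case True
        then show ?thesis unfolding bd[OF s] using f that by (simp add: f'_def cong: sum.cong)
      qed (use triv[OF s] that in auto)
      then obtain g where g: "supp_on X (Suc k) g" "\<forall>S\<in>X. card S = k \<longrightarrow> bd n g S = f' S"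
        using E s unfolding exact_at_def by blast
      have "f b = (\<Sum>x\<in>layer X (Suc k). incid b x * g x)" if "b \<in> layer X k" for b
        using g that bd[OF g(1), of b] by (auto simp: f'_def layer_def)
      then show "\<exists>g. \<forall>b\<in>layer X k. f b = (\<Sum>x\<in>layer X (Suc k). incid b x * g x)"
        by (intro exI[of _ g] ballI)
    qed
  next
    assume M: "mexact (incid :: _ \<Rightarrow> _ \<Rightarrow> 'k) {T \<in> X. Suc (card T) = k} (layer X k) (layer X (Suc k))"
    show "exact_at n TYPE('k) X k"
      unfolding exact_at_def
    proof (intro allI impI)
      fix f :: "nat set \<Rightarrow> 'k" assume f: "supp_on X k f" "\<forall>T\<in>X. bd n f T = 0"
      then have "\<forall>a\<in>{T \<in> X. Suc (card T) = k}. (\<Sum>b\<in>layer X k. incid a b * f b) = 0"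
        using bd[OF f(1)] by auto
      then obtain g where g: "\<forall>b\<in>layer X k. f b = (\<Sum>x\<in>layer X (Suc k). incid b x * g x)"
        using M unfolding mexact_def by blast
      define g' where "g' S = (if S \<in> layer X (Suc k) then g S else 0)" for S
      have s: "supp_on X (Suc k) g'" unfolding g'_def by (rule sup)
      have "bd n g' S = f S" if "S \<in> X" "card S = k" for S
      proof -
        have "bd n g' S = (\<Sum>x\<in>layer X (Suc k). incid S x * g x)"
          unfolding bd[OF s] by (intro sum.cong) (auto simp: g'_def)
        then show ?thesis using g that by (simp add: layer_def)
      qed
      then show "\<exists>g. supp_on X (Suc k) g \<and> (\<forall>S\<in>X. card S = k \<longrightarrow> bd n g S = f S)" using s by blast
    qed
  qed
qed

lemma sg_disjoint:
  assumes "finite W" "T \<subseteq> W"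
  shows "sg v (W - T) * sg v T = sg v W"
proof -
  have "{w \<in> W. w < v} = {w \<in> W - T. w < v} \<union> {w \<in> T. w < v}" using assms by auto
  then have "card {w \<in> W. w < v} = card {w \<in> W - T. w < v} + card {w \<in> T. w < v}"
    using assms finite_subset[OF assms(2)] by (simp add: card_Un_disjoint disjoint_iff)
  then show ?thesis by (simp add: sg_def power_add)
qed

lemma prod_sg_square: "(\<Prod>w\<in>T. sg w W) * (\<Prod>w\<in>T. sg w W) = 1"
  by (simp flip: prod.distrib)

text \<open>If \<open>T\<close> is \<open>S\<close> with v added, then \<open>W - S\<close> is
  \<open>W - T\<close> with v added, and the two signs multiply to \<open>sg v W\<close>. This
  factor depends on v and \<open>W\<close> alone, so it is a quotient of products over
  \<open>T\<close> and \<open>S\<close>, that is, a rescaling of the basis.\<close>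

lemma incid_compl:
  assumes W: "finite W" "S \<subseteq> W" "T \<subseteq> W"
  shows "incid (W - T) (W - S) = (\<Prod>w\<in>S. sg w W) * (\<Prod>w\<in>T. sg w W) * incid S T"
proof (cases "S \<subseteq> T \<and> card (T - S) = 1")
  case True
  then obtain v where v: "T - S = {v}" by (meson card_1_singletonE)
  then have T: "T = insert v S" "v \<notin> S" using True by auto
  have fS: "finite S" using W finite_subset by auto
  have "W - S = insert v (W - T)" "v \<notin> W - T" using T W by auto
  then have "incid (W - T) (W - S) = (sg v (W - T) :: 'a)" by (metis incid_insert)
  also have "\<dots> = sg v W * sg v T" using sg_disjoint[OF W(1,3), of v, symmetric, where 'a = 'a] by (simp add: mult.assoc)
  also have "\<dots> = sg v W * sg v S" using T by simp
  finally have l: "incid (W - T) (W - S) = sg v W * (sg v S :: 'a)" .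
  have r: "(\<Prod>w\<in>T. sg w W) = sg v W * (\<Prod>w\<in>S. sg w W :: 'a)" using T fS by simp
  have "(\<Prod>w\<in>S. sg w W) * (\<Prod>w\<in>T. sg w W) * incid S T = sg v W * ((\<Prod>w\<in>S. sg w W) * (\<Prod>w\<in>S. sg w W)) * (sg v S :: 'a)"
    unfolding r using T incid_insert[of v S, where ?'a = 'a] by (simp add: mult_ac)
  then show ?thesis unfolding l prod_sg_square by simp
next
  case False
  have "W - S - (W - T) = T - S" using W by auto
  moreover have "W - T \<subseteq> W - S \<longleftrightarrow> S \<subseteq> T" using W by auto
  ultimately show ?thesis using False by (auto simp: incid_def)
qed

lemma incid_compl':
  assumes "finite W" "S \<subseteq> W" "T \<subseteq> W"
  shows "incid S T = (\<Prod>w\<in>S. sg w W) * (\<Prod>w\<in>T. sg w W) * incid (W - T) (W - S)"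
proof -
  have "a * b * (a * b * c) = a * a * (b * b * c)" for a b c :: 'a by (simp only: mult_ac)
  from this[of "\<Prod>w\<in>S. sg w W" "\<Prod>w\<in>T. sg w W"] show ?thesis
    unfolding incid_compl[OF assms] by (simp only: prod_sg_square mult_1)
qed

lemma compl_image:
  assumes "P \<subseteq> Pow W" "Q \<subseteq> Pow W" "\<And>S. S \<subseteq> W \<Longrightarrow> S \<in> P \<longleftrightarrow> W - S \<in> Q"
  shows "(-) W ` P = Q" "(-) W ` Q = P"
proof -
  have ww: "W - (W - S) = S" if "S \<subseteq> W" for S using that by auto
  have "S \<in> (-) W ` P" if "S \<in> Q" for S
    using that assms(2) assms(3)[of "W - S"] ww[of S] by (intro image_eqI[of _ _ "W - S"]) auto
  then show "(-) W ` P = Q" using assms(1,3) by auto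
  have "S \<in> (-) W ` Q" if "S \<in> P" for S
    using that assms(1) assms(3)[of S] ww[of S] by (intro image_eqI[of _ _ "W - S"]) auto
  moreover have "W - S \<in> P" if "S \<in> Q" for S
    using that assms(2) assms(3)[of "W - S"] ww[of S] by auto
  ultimately show "(-) W ` Q = P" by auto
qed

lemma card_compl: "finite W \<Longrightarrow> S \<subseteq> W \<Longrightarrow> card (W - S) + card S = card W"
  by (metis card_Diff_subset card_mono finite_subset le_add_diff_inverse2)

text \<open>Complementation in \<open>W\<close> identifies the relative complex with the cochain complex of \<open>\<Delta>\<^sub>W\<close>.\<close>

lemma exact_complement:
  assumes W: "W \<subseteq> {1..n}" and ik: "i + k = card W"
  shows "exact_at n TYPE('k::field) {S. S \<subseteq> W \<and> W - S \<in> \<Delta>} i \<longleftrightarrow> exact_at n TYPE('k) (restr \<Delta> W) k"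
proof -
  let ?Y = "{S. S \<subseteq> W \<and> W - S \<in> \<Delta>}" and ?X = "restr \<Delta> W"
  let ?incid = "incid :: _ \<Rightarrow> _ \<Rightarrow> 'k"
  let ?A = "{T \<in> ?X. Suc (card T) = k}" and ?A' = "{T \<in> ?Y. Suc (card T) = i}"
  have fW: "finite W" using W finite_subset by auto
  have XW: "?X \<subseteq> Pow W" and YW: "?Y \<subseteq> Pow W" by (auto simp: restr_def)
  have Xn: "?X \<subseteq> Pow {1..n}" using XW Pow_mono[OF W] by (rule subset_trans)
  have Yn: "?Y \<subseteq> Pow {1..n}" using YW Pow_mono[OF W] by (rule subset_trans)
  have fX: "finite ?X" and fY: "finite ?Y" using XW YW fW by (auto intro: finite_subset)
  have ww: "W - (W - S) = S" if "S \<subseteq> W" for S using that by auto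
  have cc: "card (W - S) + card S = card W" if "S \<subseteq> W" for S using card_compl[OF fW that] .
  have subsp: "layer ?X j \<subseteq> Pow W" "layer ?Y j \<subseteq> Pow W" "?A \<subseteq> Pow W" "?A' \<subseteq> Pow W" for j
    by (auto simp: layer_def restr_def)
  have im: "(-) W ` ?A = layer ?Y (Suc i)" "(-) W ` layer ?Y (Suc i) = ?A"
    "(-) W ` layer ?X k = layer ?Y i" "(-) W ` layer ?Y i = layer ?X k"
    "(-) W ` layer ?X (Suc k) = ?A'" "(-) W ` ?A' = layer ?X (Suc k)"
  proof -
    have A: "S \<in> ?A \<longleftrightarrow> W - S \<in> layer ?Y (Suc i)" if "S \<subseteq> W" for S
      using cc[OF that] ik that by (auto simp: restr_def layer_def ww)
    have B: "S \<in> layer ?X k \<longleftrightarrow> W - S \<in> layer ?Y i" if "S \<subseteq> W" for S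
      using cc[OF that] ik that by (auto simp: restr_def layer_def ww)
    have C: "S \<in> layer ?X (Suc k) \<longleftrightarrow> W - S \<in> ?A'" if "S \<subseteq> W" for S
      using cc[OF that] ik that by (auto simp: restr_def layer_def ww)
    show "(-) W ` ?A = layer ?Y (Suc i)" "(-) W ` layer ?Y (Suc i) = ?A"
      by (rule compl_image[OF subsp(3,2) A], assumption)+
    show "(-) W ` layer ?X k = layer ?Y i" "(-) W ` layer ?Y i = layer ?X k"
      by (rule compl_image[OF subsp(1,2) B], assumption)+
    show "(-) W ` layer ?X (Suc k) = ?A'" "(-) W ` ?A' = layer ?X (Suc k)"
      by (rule compl_image[OF subsp(1,4) C], assumption)+
  qed
  have inj: "inj_on ((-) W) Z" if "Z \<subseteq> Pow W" for Z
  proof (rule inj_onI)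
    fix x y assume "x \<in> Z" "y \<in> Z" and e: "W - x = W - y"
    then have "x = W - (W - x)" "y = W - (W - y)" using that ww by auto
    then show "x = y" using e by simp
  qed
  let ?e = "\<lambda>S. \<Prod>w\<in>S. sg w W :: 'k"
  have fin: "finite (layer ?X j)" "finite (layer ?Y j)" "finite ?A" "finite ?A'" for j
    by (rule finite_subset[OF _ fX] finite_subset[OF _ fY], force simp: layer_def)+
  show ?thesis unfolding exact_at_mexact[OF Xn] exact_at_mexact[OF Yn]
  proof
    assume "mexact ?incid ?A' (layer ?Y i) (layer ?Y (Suc i))"
    \<comment> \<open>Transposing reverses the order of the three layers, and complementation
      reverses it again.\<close>
    then have "mexact (\<lambda>x y. ?incid y x) (layer ?Y (Suc i)) (layer ?Y i) ?A'"
      by (rule mexact_dual[OF fin(4,2,2)])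
    then have "mexact (\<lambda>x y. ?incid y x) ((-) W ` ?A) ((-) W ` layer ?X k) ((-) W ` layer ?X (Suc k))"
      unfolding im .
    then show "mexact ?incid ?A (layer ?X k) (layer ?X (Suc k))"
    proof (rule mexact_transport[where e = ?e])
      fix x y assume "x \<in> ?A" "y \<in> layer ?X k"
      then have "x \<subseteq> W" "y \<subseteq> W" by (auto simp: layer_def restr_def)
      then show "incid x y = ?e x * ?e y * incid (W - y) (W - x)"
        by (rule incid_compl'[OF fW])
    next
      fix x y assume "x \<in> layer ?X k" "y \<in> layer ?X (Suc k)"
      then have "x \<subseteq> W" "y \<subseteq> W" by (auto simp: layer_def restr_def)
      then show "incid x y = ?e x * ?e y * incid (W - y) (W - x)"
        by (rule incid_compl'[OF fW])
    qed (use inj subsp prod_sg_square in auto)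
  next
    assume "mexact ?incid ?A (layer ?X k) (layer ?X (Suc k))"
    then have "mexact (\<lambda>x y. ?incid y x) (layer ?X (Suc k)) (layer ?X k) ?A"
      by (rule mexact_dual[OF fin(3,1,1)])
    then have "mexact (\<lambda>x y. ?incid y x) ((-) W ` ?A') ((-) W ` layer ?Y i) ((-) W ` layer ?Y (Suc i))"
      unfolding im .
    then show "mexact ?incid ?A' (layer ?Y i) (layer ?Y (Suc i))"
    proof (rule mexact_transport[where e = ?e])
      fix x y assume "x \<in> ?A'" "y \<in> layer ?Y i"
      then have "x \<subseteq> W" "y \<subseteq> W" by (auto simp: layer_def)
      then show "incid x y = ?e x * ?e y * incid (W - y) (W - x)"
        by (rule incid_compl'[OF fW])
    next
      fix x y assume "x \<in> layer ?Y i" "y \<in> layer ?Y (Suc i)"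
      then have "x \<subseteq> W" "y \<subseteq> W" by (auto simp: layer_def)
      then show "incid x y = ?e x * ?e y * incid (W - y) (W - x)"
        by (rule incid_compl'[OF fW])
    qed (use inj subsp prod_sg_square in auto)
  qed
qed

section \<open>The Koszul complex of a Stanley-Reisner ring\<close>

definition sqfree :: "nat set \<Rightarrow> monomial" where
  "sqfree S = (\<Sum>v\<in>S. single v 1)"

lemma lookup_sqfree: "finite S \<Longrightarrow> lk (sqfree S) v = (if v \<in> S then 1 else 0)"
  by (simp add: sqfree_def lookup_sum lookup_single when_def sum.delta')

lemma keys_sqfree: "finite S \<Longrightarrow> keys (sqfree S) = S"
  by (auto simp: in_keys_iff lookup_sqfree split: if_splits)

lemma sqfree_insert: "finite S \<Longrightarrow> v \<notin> S \<Longrightarrow> sqfree (insert v S) = single v 1 + sqfree S"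
  by (simp add: sqfree_def)

lemma minus_sqfree_plus:
  assumes "S \<subseteq> keys u" shows "u - sqfree S + sqfree S = u"
proof (rule poly_mapping_eqI)
  fix v
  have "finite S" using assms by (rule finite_subset) simp
  moreover have "1 \<le> lk u v" if "v \<in> S"
  proof -
    have "v \<in> keys u" using assms that by blast
    then show ?thesis by (simp add: in_keys_iff)
  qed
  ultimately show "lk (u - sqfree S + sqfree S) v = lk u v" by (simp add: lookup_add lookup_minus lookup_sqfree)
qed

lemma minus_sqfree_insert:
  assumes "finite S" "v \<notin> S" shows "u - sqfree (insert v S) = u - sqfree S - single v 1"
  using assms by (simp add: sqfree_insert add.commute diff_diff_add)

lemma keys_minus_subsp: "keys (u - w) \<subseteq> keys (u :: monomial)"
  by (auto simp: in_keys_iff lookup_minus)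

text \<open>The degree \<open>u\<close> part of the Koszul complex of the Stanley-Reisner ring has the basis
  \<open>x\<^sup>u\<^sup>-\<^sup>S e\<^sub>S\<close>, where \<open>S\<close> ranges over this set.\<close>

definition kfaces :: "nat set set \<Rightarrow> monomial \<Rightarrow> nat set set" where
  "kfaces \<Delta> u = {S. S \<subseteq> keys u \<and> keys (u - sqfree S) \<in> \<Delta>}"

lemma keys_minus_sqfree:
  assumes "finite S" shows "keys (u - sqfree S) = {v \<in> keys u. v \<in> S \<longrightarrow> lk u v \<noteq> 1}"
  using assms by (auto simp: in_keys_iff lookup_minus lookup_sqfree split: if_splits)

text \<open>A larger \<open>S\<close> leaves a smaller support behind. Closure upwards means that a
  boundary coefficient at a member involves members only, so cutting a chain off outside
  \<open>kfaces\<close> does not change its boundary inside.\<close>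

lemma kfaces_up:
  assumes "cplx n \<Delta>" "S \<in> kfaces \<Delta> u" "S \<subseteq> S'" "S' \<subseteq> keys u"
  shows "S' \<in> kfaces \<Delta> u"
proof -
  have f: "finite S'" by (rule finite_subset[OF assms(4)]) simp
  then have f': "finite S" using assms(3) finite_subset by auto
  have "keys (u - sqfree S') \<subseteq> keys (u - sqfree S)" using f f' assms(3) by (auto simp: keys_minus_sqfree)
  then show ?thesis using assms cplxD[OF assms(1)] by (auto simp: kfaces_def)
qed

text \<open>When adding and removing a both stay in X, multiplication by e_a is a contracting
  homotopy.\<close>

lemma exact_cone:
  assumes a: "a \<in> {1..n}" and X: "\<And>S. S \<in> X \<Longrightarrow> finite S"
    and cone: "\<And>S. S \<in> X \<Longrightarrow> insert a S \<in> X" "\<And>S. S \<in> X \<Longrightarrow> S - {a} \<in> X"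
  shows "exact_at n TYPE('k::field) X k"
  unfolding exact_at_def
proof (intro allI impI)
  fix f :: "nat set \<Rightarrow> 'k" assume f: "supp_on X k f" "\<forall>T\<in>X. bd n f T = 0"
  have "supp_on X (Suc k) (wedge a f)" unfolding supp_on_def
  proof (intro allI impI)
    fix S assume "wedge a f S \<noteq> 0"
    then have *: "a \<in> S" "f (S - {a}) \<noteq> 0" by (auto simp: wedge_def split: if_splits)
    then have "S - {a} \<in> X" "card (S - {a}) = k" using f(1) by (auto simp: supp_on_def)
    moreover have "insert a (S - {a}) = S" using * by auto
    ultimately show "S \<in> X \<and> card S = Suc k" using cone(1)[of "S - {a}"] X[of "S - {a}"] * card.remove[of S a] by auto
  qed
  moreover have "bd n (wedge a f) S = f S" if "S \<in> X" for S
  proof -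
    have "wedge a (bd n f) S = 0" using f(2) cone(2)[OF that] by (simp add: wedge_def)
    then show ?thesis using koszul_wedge[OF X[OF that] a, of "\<lambda>_. 1" f] by simp
  qed
  ultimately show "\<exists>g. supp_on X (Suc k) g \<and> (\<forall>S\<in>X. card S = k \<longrightarrow> bd n g S = f S)" by blast
qed

text \<open>Together with \<open>exact_kfaces_sqfree\<close> this is Hochster's formula.\<close>

lemma exact_kfaces_nonsquarefree:
  assumes u: "u \<in> monomials n" and a: "a \<in> keys u" "lk u a \<noteq> 1"
  shows "exact_at n TYPE('k::field) (kfaces \<Delta> u) k"
proof (rule exact_cone)
  show "a \<in> {1..n}" using assms by (auto simp: monomials_def)
  show fin: "finite S" if "S \<in> kfaces \<Delta> u" for S using that finite_subset[of S "keys u"] by (auto simp: kfaces_def)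
  fix S assume S: "S \<in> kfaces \<Delta> u"
  have "keys (u - sqfree (insert a S)) = keys (u - sqfree S)"
    using fin[OF S] a by (auto simp: keys_minus_sqfree)
  then show "insert a S \<in> kfaces \<Delta> u" using S a by (auto simp: kfaces_def)
  have "keys (u - sqfree (S - {a})) = keys (u - sqfree S)"
    using fin[OF S] a by (auto simp: keys_minus_sqfree)
  then show "S - {a} \<in> kfaces \<Delta> u" using S a by (auto simp: kfaces_def)
qed

lemma exact_kfaces_sqfree:
  assumes W: "W \<subseteq> {1..n}" and ik: "i + k = card W"
  shows "exact_at n TYPE('k::field) (kfaces \<Delta> (sqfree W)) i \<longleftrightarrow> exact_at n TYPE('k) (restr \<Delta> W) k"
proof -
  have f: "finite W" using W finite_subset by auto
  have "kfaces \<Delta> (sqfree W) = {S. S \<subseteq> W \<and> W - S \<in> \<Delta>}"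
  proof -
    have "keys (sqfree W - sqfree S) = W - S" if "S \<subseteq> W" for S
      using that f finite_subset[OF that f] by (auto simp: keys_minus_sqfree keys_sqfree lookup_sqfree)
    then show ?thesis by (auto simp: kfaces_def keys_sqfree[OF f])
  qed
  then show ?thesis using exact_complement[OF assms] by simp
qed

text \<open>An exponent above 1 would make the complex a cone, so u is squarefree with support W.
  The bound on i keeps \<open>card W - i\<close> from being truncated; it holds as W has no larger
  subsets.\<close>

lemma not_exact_kfaces:
  assumes u: "u \<in> monomials n" and ne: "\<not> exact_at n TYPE('k::field) (kfaces \<Delta> u) i"
  obtains W where "W \<subseteq> {1..n}" "u = sqfree W" "i \<le> card W" "\<not> exact_at n TYPE('k) (restr \<Delta> W) (card W - i)"
proof -
  let ?W = "keys u"
  have W: "?W \<subseteq> {1..n}" using u by (simp add: monomials_def)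
  have 1: "lk u a = 1" if "a \<in> ?W" for a using exact_kfaces_nonsquarefree[OF u that] ne by blast
  have eq: "u = sqfree ?W"
  proof (rule poly_mapping_eqI)
    fix v show "lk u v = lk (sqfree ?W) v" using 1[of v] by (auto simp: lookup_sqfree in_keys_iff)
  qed
  have le: "i \<le> card ?W"
  proof (rule ccontr)
    assume gt: "\<not> i \<le> card ?W"
    have "exact_at n TYPE('k) (kfaces \<Delta> u) i"
      unfolding exact_at_def
    proof (intro allI impI)
      fix f :: "nat set \<Rightarrow> 'k" assume f: "supp_on (kfaces \<Delta> u) i f"
      have "f S = 0" for S
      proof (rule ccontr)
        assume "f S \<noteq> 0"
        then have "S \<subseteq> ?W" "card S = i" using f by (auto simp: supp_on_def kfaces_def)
        then show False using card_mono[of ?W S] gt by simp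
      qed
      then show "\<exists>g. supp_on (kfaces \<Delta> u) (Suc i) g \<and> (\<forall>S\<in>kfaces \<Delta> u. card S = i \<longrightarrow> bd n g S = f S)"
        by (intro exI[of _ "\<lambda>_. 0"]) (simp add: supp_on_def)
    qed
    then show False using ne by simp
  qed
  have "\<not> exact_at n TYPE('k) (restr \<Delta> ?W) (card ?W - i)"
    using exact_kfaces_sqfree[OF W, of i "card ?W - i" \<Delta>, where ?'k = 'k] le ne eq by simp
  then show ?thesis using that W eq le by blast
qed

section \<open>The Koszul complex over the polynomial ring, degree by degree\<close>

definition polys :: "nat \<Rightarrow> 'k::field mpoly set" where
  "polys n = {p. keys p \<subseteq> monomials n}"

lemma polys_zero [simp]: "0 \<in> polys n" and polys_one [simp]: "1 \<in> polys n"
  by (auto simp: polys_def monomials_def)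

lemma polys_add: "p \<in> polys n \<Longrightarrow> q \<in> polys n \<Longrightarrow> p + q \<in> polys n"
  using keys_add[of p q] by (auto simp: polys_def)

lemma polys_uminus: "p \<in> polys n \<Longrightarrow> - p \<in> polys n"
  by (auto simp: polys_def in_keys_iff subset_iff)

lemma polys_diff: "p \<in> polys n \<Longrightarrow> q \<in> polys n \<Longrightarrow> p - q \<in> polys n"
  using polys_add[of p n "- q"] polys_uminus[of q] by simp

lemma polys_mult: "p \<in> polys n \<Longrightarrow> q \<in> polys n \<Longrightarrow> p * q \<in> polys n"
  using keys_mult[of p q] monomials_add by (fastforce simp: polys_def)

lemma polys_sum: "(\<And>i. i \<in> A \<Longrightarrow> f i \<in> polys n) \<Longrightarrow> sum f A \<in> polys n"
  by (induction A rule: infinite_finite_induct) (auto intro: polys_add)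

lemma polys_var: "v \<in> {1..n} \<Longrightarrow> var v \<in> polys n"
  by (auto simp: polys_def var_def monomials_def)

lemma polys_single: "m \<in> monomials n \<Longrightarrow> single m c \<in> polys n"
  by (auto simp: polys_def)

lemma polys_sg: "sg v T \<in> polys n"
proof -
  have "(-1) ^ k \<in> polys n" for k by (induction k) (auto intro: polys_uminus)
  then show ?thesis by (simp add: sg_def)
qed

lemma polys_koszul: "(\<And>S. f S \<in> polys n) \<Longrightarrow> koszul n var f T \<in> polys n"
  unfolding koszul_def by (intro polys_sum polys_mult polys_sg polys_var) auto

lemma lookup_single_times_plus:
  fixes p :: "'k::field mpoly"
  shows "lk (single w c * p) (w + m) = c * lk p m"
  by (simp add: lookup_mult lookup_single when_mult)

lemma lookup_single_times_none:
  fixes p :: "'k::field mpoly"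
  assumes "\<And>m'. m \<noteq> w + m'"
  shows "lk (single w c * p) m = 0"
  using assms by (simp add: lookup_mult lookup_single when_mult)

lemma lookup_var_times:
  fixes p :: "'k::field mpoly"
  shows "lk (var v * p) m = (if v \<in> keys m then lk p (m - single v 1) else 0)"
proof (cases "v \<in> keys m")
  case True
  then have "m = single v 1 + (m - single v 1)"
    by (intro poly_mapping_eqI) (auto simp: lookup_add lookup_minus lookup_single when_def in_keys_iff)
  then show ?thesis using True lookup_single_times_plus[of "single v 1" 1 p "m - single v 1"] by (simp add: var_def)
next
  case False
  have "m \<noteq> single v 1 + m'" for m' using False by (auto simp: in_keys_iff lookup_add)
  then show ?thesis using False unfolding var_def by (simp add: lookup_single_times_none)
qed

lemma lookup_sg_times: "lk (sg v T * p) m = sg v T * lk (p :: 'k::field mpoly) m"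
proof -
  have "lk ((-1) ^ k * p) m = (-1) ^ k * lk p m" for k by (induction k) auto
  then show ?thesis by (simp add: sg_def)
qed

text \<open>The component of multidegree u, where e_S is given the degree x_S. The guard excludes
  sets for which the subtraction of exponents would truncate.\<close>

definition degpart :: "monomial \<Rightarrow> (nat set \<Rightarrow> 'k::field mpoly) \<Rightarrow> nat set \<Rightarrow> 'k" where
  "degpart u f S = (if S \<subseteq> keys u then lk (f S) (u - sqfree S) else 0)"

text \<open>Multiplication by x_v sends the basis element of degree u at \<open>insert v T\<close>
  to the one at \<open>T\<close>, so in a fixed degree the Koszul differential has the entries of
  the simplicial boundary.\<close>

lemma bd_degpart:
  assumes "T \<subseteq> keys u"
  shows "bd n (degpart u f) T = lk (koszul n var f T) (u - sqfree T)"
proof -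
  have fT: "finite T" using assms by (rule finite_subset) simp
  have "lk (koszul n var f T) (u - sqfree T) = (\<Sum>v\<in>{1..n} - T. sg v T * lk (var v * f (insert v T)) (u - sqfree T))"
    by (simp add: koszul_def lookup_sum lookup_sg_times mult.assoc)
  also have "\<dots> = (\<Sum>v\<in>{1..n} - T. sg v T * 1 * degpart u f (insert v T))"
  proof (intro sum.cong refl)
    fix v assume v: "v \<in> {1..n} - T"
    then have "v \<in> keys (u - sqfree T) \<longleftrightarrow> insert v T \<subseteq> keys u" using fT assms by (auto simp: keys_minus_sqfree)
    then show "sg v T * lk (var v * f (insert v T)) (u - sqfree T) = sg v T * 1 * degpart u f (insert v T)"
      using v fT by (simp add: lookup_var_times degpart_def minus_sqfree_insert)
  qed
  finally show ?thesis by (simp add: koszul_def)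
qed

text \<open>Vanishing of the \<open>i\<close>-th Koszul homology of \<open>R/J\<close>, with chains lifted to \<open>R\<close>.\<close>

definition kexact :: "nat \<Rightarrow> 'k::field mpoly set \<Rightarrow> nat \<Rightarrow> bool" where
  "kexact n J i \<longleftrightarrow> (\<forall>f. (\<forall>S. f S \<in> polys n) \<longrightarrow> supp_on (Pow {1..n}) i f \<longrightarrow> (\<forall>T. koszul n var f T \<in> J) \<longrightarrow>
     (\<exists>g. (\<forall>S. g S \<in> polys n) \<and> supp_on (Pow {1..n}) (Suc i) g \<and> (\<forall>S. f S - koszul n var g S \<in> J)))"

text \<open>The Stanley-Reisner ideal in closed form; \<open>stanley_reisner_eq\<close> identifies
  it with the generated ideal.\<close>

definition nonfaces :: "nat \<Rightarrow> nat set set \<Rightarrow> 'k::field mpoly set" where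
  "nonfaces n \<Delta> = {p \<in> polys n. \<forall>m\<in>keys p. keys m \<notin> \<Delta>}"

lemma nonfaces_iff: "p \<in> nonfaces n \<Delta> \<longleftrightarrow> p \<in> polys n \<and> (\<forall>m. keys m \<in> \<Delta> \<longrightarrow> lk p m = 0)"
  by (auto simp: nonfaces_def in_keys_iff)

lemma monomials_minus: "u \<in> monomials n \<Longrightarrow> u - w \<in> monomials n"
  using keys_minus_subsp[of u w] by (auto simp: monomials_def)

lemma sqfree_monomials: "S \<subseteq> {1..n} \<Longrightarrow> sqfree S \<in> monomials n"
  using keys_sqfree[of S] finite_subset[of S "{1..n}"] by (auto simp: monomials_def)

lemma var_times_single:
  assumes "insert v T \<subseteq> keys u" "v \<notin> T"
  shows "var v * single (u - sqfree (insert v T)) c = single (u - sqfree T) (c :: 'k::field)"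
proof -
  have fT: "finite T" using assms finite_subset[of "insert v T" "keys u"] by auto
  have vk: "v \<in> keys (u - sqfree T)" using assms fT by (auto simp: keys_minus_sqfree)
  have "single v 1 + (u - sqfree T - single v 1) = u - sqfree T"
    using vk by (intro poly_mapping_eqI) (auto simp: lookup_add lookup_minus lookup_single when_def in_keys_iff)
  then show ?thesis using fT assms by (simp add: var_def mult_single minus_sqfree_insert)
qed

lemma sg_times_single: "sg v T * single m c = single m (sg v T * (c :: 'k::field))"
proof -
  have "(-1) ^ k * single m c = single m ((-1) ^ k * c)" for k
    by (induction k) (auto simp: single_uminus)
  then show ?thesis by (simp add: sg_def)
qed

lemma koszul_single:
  assumes "\<And>S. f S \<noteq> 0 \<Longrightarrow> S \<subseteq> keys u"
  shows "koszul n var (\<lambda>S. single (u - sqfree S) (f S)) T = single (u - sqfree T) (bd n f T :: 'k::field)"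
proof -
  have "koszul n var (\<lambda>S. single (u - sqfree S) (f S)) T = (\<Sum>v\<in>{1..n} - T. single (u - sqfree T) (sg v T * f (insert v T)))"
    unfolding koszul_def
  proof (intro sum.cong refl)
    fix v assume v: "v \<in> {1..n} - T"
    show "sg v T * var v * single (u - sqfree (insert v T)) (f (insert v T)) = single (u - sqfree T) (sg v T * f (insert v T))"
    proof (cases "f (insert v T) = 0")
      case False
      then show ?thesis using assms[of "insert v T"] v var_times_single[of v T u, where ?'k = 'k]
        by (simp add: mult.assoc sg_times_single)
    qed simp
  qed
  also have "\<dots> = single (u - sqfree T) (bd n f T)"
    unfolding koszul_def by (rule poly_mapping_eqI) (auto simp: lookup_sum lookup_single when_def intro!: sum.neutral)
  finally show ?thesis .
qed

text \<open>A scalar cycle becomes a homogeneous Koszul cycle with entries f_S times x^(u-S). Fill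
  it over the polynomial ring and keep the degree u part of the filling.\<close>

lemma exact_kfaces_of_kexact:
  assumes c: "cplx n \<Delta>" and E: "kexact n (nonfaces n \<Delta> :: 'k::field mpoly set) i" and u: "u \<in> monomials n"
  shows "exact_at n TYPE('k) (kfaces \<Delta> u) i"
  unfolding exact_at_def
proof (intro allI impI)
  fix f :: "nat set \<Rightarrow> 'k" assume f: "supp_on (kfaces \<Delta> u) i f" "\<forall>T\<in>kfaces \<Delta> u. bd n f T = 0"
  have uk: "keys u \<subseteq> {1..n}" using u by (simp add: monomials_def)
  define F where "F S = single (u - sqfree S) (f S)" for S
  have fk: "f S \<noteq> 0 \<Longrightarrow> S \<subseteq> keys u" for S using f(1) by (auto simp: supp_on_def kfaces_def)
  have FR: "F S \<in> polys n" for S unfolding F_def by (intro polys_single monomials_minus u)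
  have Fs: "supp_on (Pow {1..n}) i F" unfolding supp_on_def
  proof (intro allI impI)
    fix S assume "F S \<noteq> 0"
    then have "f S \<noteq> 0" by (auto simp: F_def)
    then show "S \<in> Pow {1..n} \<and> card S = i" using fk[of S] uk f(1) by (auto simp: supp_on_def)
  qed
  have kF: "koszul n var F T = single (u - sqfree T) (bd n f T)" for T
    unfolding F_def by (rule koszul_single[OF fk])
  have "koszul n var F T \<in> nonfaces n \<Delta>" for T
  proof (cases "bd n f T = 0")
    case True
    then show ?thesis unfolding kF by (simp add: nonfaces_def)
  next
    case False
    have "T \<subseteq> keys u"
    proof (rule ccontr)
      assume "\<not> T \<subseteq> keys u"
      then have "f (insert v T) = 0" for v using fk[of "insert v T"] by auto
      then show False using False by (simp add: koszul_def)
    qed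
    then have "keys (u - sqfree T) \<notin> \<Delta>" using f(2) False by (auto simp: kfaces_def)
    then show ?thesis unfolding kF using False polys_single[OF monomials_minus[OF u]] by (simp add: nonfaces_def)
  qed
  then obtain G where G: "supp_on (Pow {1..n}) (Suc i) G" "\<And>S. F S - koszul n var G S \<in> nonfaces n \<Delta>"
    using E FR Fs unfolding kexact_def by metis
  define g where "g S = (if S \<in> kfaces \<Delta> u then degpart u G S else 0)" for S
  have gs: "supp_on (kfaces \<Delta> u) (Suc i) g" unfolding supp_on_def
  proof (intro allI impI)
    fix S assume *: "g S \<noteq> 0"
    then have "S \<in> kfaces \<Delta> u" "G S \<noteq> 0" by (auto simp: g_def degpart_def split: if_splits)
    then show "S \<in> kfaces \<Delta> u \<and> card S = Suc i" using G(1) by (auto simp: supp_on_def)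
  qed
  have "bd n g S = f S" if S: "S \<in> kfaces \<Delta> u" for S
  proof -
    have Sk: "S \<subseteq> keys u" "keys (u - sqfree S) \<in> \<Delta>" using S by (auto simp: kfaces_def)
    have "bd n g S = bd n (degpart u G) S"
      unfolding koszul_def
    proof (intro sum.cong refl)
      fix v
      have "g (insert v S) = degpart u G (insert v S)"
        using kfaces_up[OF c S, of "insert v S"] by (auto simp: g_def degpart_def)
      then show "sg v S * 1 * g (insert v S) = sg v S * 1 * degpart u G (insert v S)" by simp
    qed
    also have "\<dots> = lk (koszul n var G S) (u - sqfree S)" by (rule bd_degpart[OF Sk(1)])
    also have "\<dots> = lk (F S) (u - sqfree S)" using G(2)[of S] Sk(2) by (simp add: nonfaces_iff lookup_minus)
    finally show ?thesis by (simp add: F_def)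
  qed
  then show "\<exists>g. supp_on (kfaces \<Delta> u) (Suc i) g \<and> (\<forall>S\<in>kfaces \<Delta> u. card S = i \<longrightarrow> bd n g S = f S)"
    using gs by blast
qed

text \<open>Fill the cycle separately in every degree and add up the fillings. The sum is finite
  because only finitely many degrees occur in f.\<close>

lemma kexact_of_exact_kfaces:
  assumes c: "cplx n \<Delta>" and E: "\<And>u. u \<in> monomials n \<Longrightarrow> exact_at n TYPE('k::field) (kfaces \<Delta> u) i"
  shows "kexact n (nonfaces n \<Delta> :: 'k mpoly set) i"
  unfolding kexact_def
proof (intro allI impI)
  fix f :: "nat set \<Rightarrow> 'k mpoly"
  assume f: "\<forall>S. f S \<in> polys n" "supp_on (Pow {1..n}) i f" "\<forall>T. koszul n var f T \<in> nonfaces n \<Delta>"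
  have "\<exists>g. supp_on (kfaces \<Delta> u) (Suc i) g \<and> (\<forall>S\<in>kfaces \<Delta> u. card S = i \<longrightarrow> bd n g S = degpart u f S)"
    if u: "u \<in> monomials n" for u
  proof -
    define h where "h S = (if S \<in> kfaces \<Delta> u then degpart u f S else 0)" for S
    have "supp_on (kfaces \<Delta> u) i h" unfolding supp_on_def
    proof (intro allI impI)
      fix S assume *: "h S \<noteq> 0"
      then have "S \<in> kfaces \<Delta> u" "f S \<noteq> 0" by (auto simp: h_def degpart_def split: if_splits)
      then show "S \<in> kfaces \<Delta> u \<and> card S = i" using f(2) by (auto simp: supp_on_def)
    qed
    moreover have "bd n h S = 0" if S: "S \<in> kfaces \<Delta> u" for S
    proof -
      have Sk: "S \<subseteq> keys u" "keys (u - sqfree S) \<in> \<Delta>" using S by (auto simp: kfaces_def)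
      have "bd n h S = bd n (degpart u f) S"
        unfolding koszul_def
      proof (intro sum.cong refl)
        fix v
        have "h (insert v S) = degpart u f (insert v S)"
          using kfaces_up[OF c S, of "insert v S"] by (auto simp: h_def degpart_def)
        then show "sg v S * 1 * h (insert v S) = sg v S * 1 * degpart u f (insert v S)" by simp
      qed
      also have "\<dots> = lk (koszul n var f S) (u - sqfree S)" by (rule bd_degpart[OF Sk(1)])
      also have "\<dots> = 0" using f(3) Sk(2) by (simp add: nonfaces_iff)
      finally show ?thesis .
    qed
    ultimately obtain g where "supp_on (kfaces \<Delta> u) (Suc i) g" "\<forall>S\<in>kfaces \<Delta> u. card S = i \<longrightarrow> bd n g S = h S"
      using E[OF u] unfolding exact_at_def by blast
    then show ?thesis by (intro exI[of _ g]) (simp add: h_def)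
  qed
  then obtain g where gs: "\<And>u. u \<in> monomials n \<Longrightarrow> supp_on (kfaces \<Delta> u) (Suc i) (g u)"
    and gb: "\<And>u S. u \<in> monomials n \<Longrightarrow> S \<in> kfaces \<Delta> u \<Longrightarrow> card S = i \<Longrightarrow> bd n (g u) S = degpart u f S"
    by metis
  \<comment> \<open>All degrees occurring in f: a monomial m in the coefficient of e_S has total
    degree m times x_S.\<close>
  define U where "U = (\<Union>S\<in>Pow {1..n}. (\<lambda>m. m + sqfree S) ` keys (f S))"
  have fU: "finite U" by (auto simp: U_def)
  have Um: "u \<in> monomials n" if "u \<in> U" for u
  proof -
    obtain S m where S: "S \<subseteq> {1..n}" "m \<in> keys (f S)" "u = m + sqfree S" using \<open>u \<in> U\<close> by (auto simp: U_def)
    have "m \<in> monomials n" using S(2) f(1) by (auto simp: polys_def)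
    then show ?thesis using S(3) sqfree_monomials[OF S(1)] by (simp add: monomials_add)
  qed
  define G where "G S = (\<Sum>u\<in>U. single (u - sqfree S) (g u S))" for S
  have GR: "\<forall>S. G S \<in> polys n" unfolding G_def by (intro allI polys_sum polys_single monomials_minus Um)
  have Gs: "supp_on (Pow {1..n}) (Suc i) G" unfolding supp_on_def
  proof (intro allI impI)
    fix S assume "G S \<noteq> 0"
    then obtain u where u: "u \<in> U" "g u S \<noteq> 0" unfolding G_def by (metis (mono_tags, lifting) single_zero sum.neutral)
    then have "S \<in> kfaces \<Delta> u" "card S = Suc i" using gs[OF Um[OF u(1)]] by (auto simp: supp_on_def)
    then show "S \<in> Pow {1..n} \<and> card S = Suc i" using Um[OF u(1)] by (auto simp: kfaces_def monomials_def)
  qed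
  have cG: "degpart u G S = (if u \<in> U then g u S else 0)" if u: "u \<in> monomials n" for u S
  proof (cases "S \<subseteq> keys u")
    case False
    then have "g u S = 0" using gs[OF u] by (auto simp: supp_on_def kfaces_def)
    then show ?thesis using False by (simp add: degpart_def)
  next
    case True
    have "lk (G S) (u - sqfree S) = (\<Sum>u'\<in>U. if u = u' then g u' S else 0)"
      unfolding G_def lookup_sum
    proof (intro sum.cong refl)
      fix u' assume u': "u' \<in> U"
      show "lk (single (u' - sqfree S) (g u' S)) (u - sqfree S) = (if u = u' then g u' S else 0)"
      proof (cases "g u' S = 0")
        case False
        then have "S \<subseteq> keys u'" using gs[OF Um[OF u']] by (auto simp: supp_on_def kfaces_def)
        then have "u' - sqfree S = u - sqfree S \<longleftrightarrow> u = u'" using minus_sqfree_plus[OF True] minus_sqfree_plus[of S u'] by metis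
        then show ?thesis by (auto simp: lookup_single when_def)
      qed simp
    qed
    also have "\<dots> = (if u \<in> U then g u S else 0)" using fU by (simp add: sum.delta')
    finally show ?thesis using True by (simp add: degpart_def)
  qed
  have "f S - koszul n var G S \<in> nonfaces n \<Delta>" for S
    unfolding nonfaces_iff
  proof (intro conjI allI impI)
    show "f S - koszul n var G S \<in> polys n" using f(1) GR by (intro polys_diff polys_koszul) auto
    fix m :: monomial assume m: "keys m \<in> \<Delta>"
    show "lk (f S - koszul n var G S) m = 0"
    proof (cases "S \<subseteq> {1..n} \<and> card S = i")
      case False
      have "G (insert v S) = 0" if "v \<in> {1..n} - S" for v
      proof (rule ccontr)
        assume "G (insert v S) \<noteq> 0"
        then have "insert v S \<subseteq> {1..n}" "card (insert v S) = Suc i" using Gs by (auto simp: supp_on_def)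
        moreover from this have "finite S" using finite_subset[of "insert v S" "{1..n}"] by auto
        ultimately show False using False that by auto
      qed
      then have "koszul n var G S = 0" by (simp add: koszul_def)
      moreover have "f S = 0" using f(2) False by (auto simp: supp_on_def)
      ultimately show ?thesis by simp
    next
      case True
      have fS: "finite S" using True finite_subset by auto
      define u where "u = m + sqfree S"
      have Sk: "S \<subseteq> keys u" using fS by (auto simp: u_def in_keys_iff lookup_add lookup_sqfree)
      have um: "u - sqfree S = m" by (simp add: u_def)
      have u: "u \<in> monomials n" unfolding u_def
        using cplx_subsp[OF c m] sqfree_monomials[of S n] True by (intro monomials_add) (auto simp: monomials_def)
      have SC: "S \<in> kfaces \<Delta> u" using Sk um m by (simp add: kfaces_def)
      have "lk (koszul n var G S) m = bd n (degpart u G) S" using bd_degpart[OF Sk] um by metis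
      also have "\<dots> = (if u \<in> U then bd n (g u) S else 0)"
        using cG[OF u] by (simp add: koszul_def)
      also have "\<dots> = lk (f S) m"
      proof (cases "u \<in> U")
        case True
        then show ?thesis using gb[OF u SC] \<open>S \<subseteq> {1..n} \<and> card S = i\<close> Sk um by (simp add: degpart_def)
      next
        case False
        then have "m \<notin> keys (f S)" using \<open>S \<subseteq> {1..n} \<and> card S = i\<close> by (auto simp: U_def u_def)
        then show ?thesis using False by (simp add: in_keys_iff)
      qed
      finally show ?thesis by (simp add: lookup_minus)
    qed
  qed
  then show "\<exists>g. (\<forall>S. g S \<in> polys n) \<and> supp_on (Pow {1..n}) (Suc i) g \<and> (\<forall>S. f S - koszul n var g S \<in> nonfaces n \<Delta>)"
    using GR Gs by (intro exI[of _ G]) simp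
qed

section \<open>Regular sequences and Koszul homology\<close>

definition pideal :: "nat \<Rightarrow> 'k::field mpoly set \<Rightarrow> bool" where
  "pideal n J \<longleftrightarrow> J \<subseteq> polys n \<and> 0 \<in> J \<and> (\<forall>a\<in>J. \<forall>b\<in>J. a + b \<in> J) \<and> (\<forall>r\<in>polys n. \<forall>a\<in>J. r * a \<in> J)"

lemma pideal_subsp: "pideal n J \<Longrightarrow> a \<in> J \<Longrightarrow> a \<in> polys n"
  and pideal_zero: "pideal n J \<Longrightarrow> 0 \<in> J"
  and pideal_add: "pideal n J \<Longrightarrow> a \<in> J \<Longrightarrow> b \<in> J \<Longrightarrow> a + b \<in> J"
  and pideal_mult: "pideal n J \<Longrightarrow> r \<in> polys n \<Longrightarrow> a \<in> J \<Longrightarrow> r * a \<in> J"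
  by (auto simp: pideal_def)

lemma pideal_uminus: "pideal n J \<Longrightarrow> a \<in> J \<Longrightarrow> - a \<in> J"
  using pideal_mult[of n J "- 1" a] polys_uminus[OF polys_one, of n] by auto

lemma pideal_diff: "pideal n J \<Longrightarrow> a \<in> J \<Longrightarrow> b \<in> J \<Longrightarrow> a - b \<in> J"
  using pideal_add[of n J a "- b"] pideal_uminus[of n J b] by simp

lemma pideal_sum: "pideal n J \<Longrightarrow> (\<And>i. i \<in> A \<Longrightarrow> f i \<in> J) \<Longrightarrow> sum f A \<in> J"
  by (induction A rule: infinite_finite_induct) (auto simp: pideal_zero pideal_add)

definition adjoin :: "nat \<Rightarrow> 'k::field mpoly set \<Rightarrow> 'k mpoly \<Rightarrow> 'k mpoly set" where
  "adjoin n J r = {a + r * b | a b. a \<in> J \<and> b \<in> polys n}"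

lemma adjI: "a \<in> J \<Longrightarrow> b \<in> polys n \<Longrightarrow> a + r * b \<in> adjoin n J r"
  by (auto simp: adjoin_def)

lemma adjoin_pideal:
  assumes J: "pideal n J" and r: "r \<in> polys n" shows "pideal n (adjoin n J r)"
  unfolding pideal_def
proof (intro conjI ballI subsetI)
  fix x assume "x \<in> adjoin n J r"
  then show "x \<in> polys n" using pideal_subsp[OF J] r by (auto simp: adjoin_def intro!: polys_add polys_mult)
next
  show "0 \<in> adjoin n J r" using adjI[OF pideal_zero[OF J] polys_zero, of r] by simp
next
  fix x y assume "x \<in> adjoin n J r" "y \<in> adjoin n J r"
  then obtain a b a' b' where "x = a + r * b" "y = a' + r * b'" "a \<in> J" "a' \<in> J" "b \<in> polys n" "b' \<in> polys n"
    by (auto simp: adjoin_def)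
  then show "x + y \<in> adjoin n J r" using adjI[OF pideal_add[OF J, of a a'] polys_add[of b n b'], of r]
    by (simp add: algebra_simps)
next
  fix s x :: "'a mpoly" assume s: "s \<in> polys n" "x \<in> adjoin n J r"
  then obtain a b where "x = a + r * b" "a \<in> J" "b \<in> polys n" by (auto simp: adjoin_def)
  then show "s * x \<in> adjoin n J r" using adjI[OF pideal_mult[OF J s(1), of a] polys_mult[OF s(1), of b], of r]
    by (simp add: algebra_simps)
qed

lemma adjoin_sup: "J \<subseteq> adjoin n J r"
  using adjI[of _ J 0 n r] by auto

lemma adjoin_elem: "pideal n J \<Longrightarrow> r \<in> adjoin n J r"
  using adjI[OF pideal_zero polys_one, of n J r] by simp

text \<open>The ideal of the variables with its coefficients exposed; \<open>kexact_adjoinD\<close>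
  builds its homotopy from them.\<close>

definition maxid :: "nat \<Rightarrow> 'k::field mpoly set" where
  "maxid n = {p. \<exists>a. (\<forall>v. a v \<in> polys n) \<and> p = (\<Sum>v\<in>{1..n}. a v * var v)}"

lemma maxid_pideal: "pideal n (maxid n :: 'k::field mpoly set)"
  unfolding pideal_def
proof (intro conjI ballI subsetI)
  fix x :: "'k mpoly" assume "x \<in> maxid n"
  then show "x \<in> polys n" by (auto simp: maxid_def intro!: polys_sum polys_mult polys_var)
next
  show "(0 :: 'k mpoly) \<in> maxid n" unfolding maxid_def by (auto intro!: exI[of _ "\<lambda>_. 0"])
next
  fix x y :: "'k mpoly" assume "x \<in> maxid n" "y \<in> maxid n"
  then obtain a b where "\<forall>v. a v \<in> polys n" "x = (\<Sum>v\<in>{1..n}. a v * var v)" "\<forall>v. b v \<in> polys n" "y = (\<Sum>v\<in>{1..n}. b v * var v)"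
    by (auto simp: maxid_def)
  then show "x + y \<in> maxid n" unfolding maxid_def
    by (auto intro!: exI[of _ "\<lambda>v. a v + b v"] polys_add simp: sum.distrib algebra_simps)
next
  fix r x :: "'k mpoly" assume "r \<in> polys n" "x \<in> maxid n"
  then obtain a where "\<forall>v. a v \<in> polys n" "x = (\<Sum>v\<in>{1..n}. a v * var v)" by (auto simp: maxid_def)
  then show "r * x \<in> maxid n" unfolding maxid_def using \<open>r \<in> polys n\<close>
    by (auto intro!: exI[of _ "\<lambda>v. r * a v"] polys_mult simp: sum_distrib_left mult.assoc)
qed

lemma var_maxid: "v \<in> {1..n} \<Longrightarrow> var v \<in> maxid n"
  unfolding maxid_def
  by (auto intro!: exI[of _ "\<lambda>w. if w = v then 1 else 0"] simp: if_distrib[of "\<lambda>x. x * _"] sum.delta cong: if_cong)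

lemma lookup_maxid_zero:
  assumes "p \<in> maxid n" shows "lk p 0 = 0"
proof -
  obtain a where "p = (\<Sum>v\<in>{1..n}. a v * var v)" using assms by (auto simp: maxid_def)
  then have "p = (\<Sum>v\<in>{1..n}. var v * a v)" by (simp add: mult.commute)
  then show ?thesis by (simp add: lookup_sum lookup_var_times)
qed

lemma one_notin_maxid: "1 \<notin> maxid n"
  using lookup_maxid_zero[of 1 n] by (auto simp: lookup_one)

lemma single_maxid:
  assumes "m \<in> monomials n" "m \<noteq> 0" shows "single m c \<in> maxid n"
proof -
  obtain v where v: "v \<in> keys m" using assms(2) by (metis all_not_in_conv keys_eq_empty)
  then have vn: "v \<in> {1..n}" using assms by (auto simp: monomials_def)
  have "single v 1 + (m - single v 1) = m"
    using v by (intro poly_mapping_eqI) (auto simp: lookup_add lookup_minus lookup_single when_def in_keys_iff)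
  then have "single m c = single (m - single v 1) c * var v"
    by (simp add: var_def mult_single add.commute)
  then show ?thesis using pideal_mult[OF maxid_pideal polys_single[OF monomials_minus[OF assms(1)]] var_maxid[OF vn]] by simp
qed

lemma supp_koszul:
  assumes "supp_on (Pow {1..n}) (Suc i) f"
  shows "supp_on (Pow {1..n}) i (koszul n x f)"
  unfolding supp_on_def
proof (intro allI impI)
  fix T assume "koszul n x f T \<noteq> 0"
  then obtain v where v: "v \<in> {1..n} - T" "f (insert v T) \<noteq> 0"
    unfolding koszul_def by (metis (no_types, lifting) mult_zero_right sum.neutral)
  then have "insert v T \<subseteq> {1..n}" "card (insert v T) = Suc i" using assms by (auto simp: supp_on_def)
  moreover from this have "finite T" using finite_subset[of "insert v T" "{1..n}"] by auto
  ultimately show "T \<in> Pow {1..n} \<and> card T = i" using v by auto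
qed

lemma supp_finite: "supp_on (Pow {1..n}) i f \<Longrightarrow> infinite S \<Longrightarrow> f S = 0"
  using finite_subset[of S "{1..n}"] by (auto simp: supp_on_def)

lemma koszul_infinite: "supp_on (Pow {1..n}) i f \<Longrightarrow> infinite S \<Longrightarrow> koszul n x f S = 0"
  unfolding koszul_def using supp_finite[of n i f "insert _ S"] by simp

lemma koszul_pideal:
  assumes "pideal n J" "\<And>S. f S \<in> J" shows "koszul n var f T \<in> J"
  unfolding koszul_def by (intro pideal_sum[OF assms(1)] pideal_mult[OF assms(1)] polys_mult polys_sg polys_var assms(2)) auto

definition nonzerodiv :: "nat \<Rightarrow> 'k::field mpoly set \<Rightarrow> 'k mpoly \<Rightarrow> bool" where
  "nonzerodiv n J r \<longleftrightarrow> (\<forall>x\<in>polys n. r * x \<in> J \<longrightarrow> x \<in> J)"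

text \<open>The decomposition is chosen with h zero wherever F is zero, so that h inherits the
  support of F and is again a Koszul chain.\<close>

lemma adjoin_split:
  assumes J: "pideal n J" and F: "\<And>S. F S \<in> adjoin n J r" and s: "supp_on (Pow {1..n}) i F"
  obtains j h where "\<And>S. j S \<in> J" "\<And>S. h S \<in> polys n" "supp_on (Pow {1..n}) i h" "\<And>S. F S = j S + r * h S"
proof -
  have "\<exists>j h. j \<in> J \<and> h \<in> polys n \<and> F S = j + r * h \<and> (F S = 0 \<longrightarrow> h = 0)" for S
  proof (cases "F S = 0")
    case True
    then show ?thesis using pideal_zero[OF J] by (intro exI[of _ 0]) auto
  next
    case False
    then show ?thesis using F[of S] by (auto simp: adjoin_def)
  qed
  then obtain j h where jh: "\<And>S. j S \<in> J \<and> h S \<in> polys n \<and> F S = j S + r * h S \<and> (F S = 0 \<longrightarrow> h S = 0)"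
    by metis
  show ?thesis
  proof (rule that)
    show "supp_on (Pow {1..n}) i h" using s jh unfolding supp_on_def by blast
  qed (use jh in blast)+
qed

text \<open>Multiplication by \<open>r\<close> is null-homotopic on the Koszul complex, so \<open>r z\<close> bounds for every cycle \<open>z\<close>;
  a chain with boundary \<open>r z\<close> is a cycle modulo \<open>r\<close>.\<close>

lemma kexact_adjoinD:
  assumes J: "pideal n J" and r: "r \<in> maxid n" and reg: "nonzerodiv n J r" and E: "kexact n (adjoin n J r) (Suc i)"
  shows "kexact n J i"
  unfolding kexact_def
proof (intro allI impI)
  fix z :: "nat set \<Rightarrow> 'a mpoly"
  assume z: "\<forall>S. z S \<in> polys n" "supp_on (Pow {1..n}) i z" "\<forall>T. koszul n var z T \<in> J"
  obtain a where a: "\<forall>v. a v \<in> polys n" "r = (\<Sum>v\<in>{1..n}. a v * var v)" using r by (auto simp: maxid_def)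
  have rR: "r \<in> polys n" using pideal_subsp[OF maxid_pideal r] .
  define f where "f S = (\<Sum>v\<in>{1..n}. a v * wedge v z S)" for S
  have fR: "\<forall>S. f S \<in> polys n" unfolding f_def
    using a z by (intro allI polys_sum polys_mult) (auto simp: wedge_def intro!: polys_mult polys_sg)
  have fs: "supp_on (Pow {1..n}) (Suc i) f" unfolding supp_on_def
  proof (intro allI impI)
    fix S assume "f S \<noteq> 0"
    then obtain v where v: "v \<in> {1..n}" "wedge v z S \<noteq> 0" unfolding f_def by (metis (no_types, lifting) mult_zero_right sum.neutral)
    then have *: "v \<in> S" "z (S - {v}) \<noteq> 0" by (auto simp: wedge_def split: if_splits)
    then have **: "S - {v} \<subseteq> {1..n}" "card (S - {v}) = i" using z(2) by (auto simp: supp_on_def)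
    then have S: "S \<subseteq> {1..n}" using v * by auto
    then have "finite S" by (rule finite_subset) simp
    from card.remove[OF this *(1)] **(2) have "card S = Suc i" by (simp only:)
    then show "S \<in> Pow {1..n} \<and> card S = Suc i" using S by simp
  qed
  have kf: "r * z T - koszul n var f T \<in> J" if "finite T" for T
  proof -
    have "koszul n var f T = (\<Sum>v\<in>{1..n}. a v * koszul n var (wedge v z) T)"
      unfolding f_def koszul_sum koszul_scale ..
    also have "\<dots> = (\<Sum>v\<in>{1..n}. a v * (var v * z T - wedge v (koszul n var z) T))"
    proof (intro sum.cong refl)
      fix v assume "v \<in> {1..n}"
      then have "koszul n var (wedge v z) T = var v * z T - wedge v (koszul n var z) T"
        using koszul_wedge[OF that, of v n var z] by (simp add: eq_diff_eq)
      then show "a v * koszul n var (wedge v z) T = a v * (var v * z T - wedge v (koszul n var z) T)" by simp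
    qed
    finally have "r * z T - koszul n var f T = (\<Sum>v\<in>{1..n}. a v * wedge v (koszul n var z) T)"
      unfolding a(2) by (simp add: right_diff_distrib sum_subtractf sum_distrib_right mult.assoc)
    also have "\<dots> \<in> J"
      using a z J by (intro pideal_sum pideal_mult) (auto simp: wedge_def pideal_zero intro!: pideal_mult polys_sg)
    finally show ?thesis .
  qed
  have "koszul n var f T \<in> adjoin n J r" for T
  proof (cases "finite T")
    case True
    have "koszul n var f T = - (r * z T - koszul n var f T) + r * z T" by simp
    then show ?thesis using adjI[OF pideal_uminus[OF J kf[OF True]], of "z T" n r] z(1) by simp
  next
    case False
    then show ?thesis using koszul_infinite[OF fs] pideal_zero[OF adjoin_pideal[OF J rR]] by simp
  qed
  then obtain g where g: "\<forall>S. g S \<in> polys n" "supp_on (Pow {1..n}) (Suc (Suc i)) g" "\<forall>S. f S - koszul n var g S \<in> adjoin n J r"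
    using E fR fs unfolding kexact_def by meson
  have "supp_on (Pow {1..n}) (Suc i) (\<lambda>S. f S - koszul n var g S)"
    by (intro supp_on_diff fs supp_koszul g)
  then obtain j h where jh: "\<And>S. j S \<in> J" "\<And>S. h S \<in> polys n" "supp_on (Pow {1..n}) (Suc i) h"
    "\<And>S. f S - koszul n var g S = j S + r * h S"
    using adjoin_split[OF J, of "\<lambda>S. f S - koszul n var g S" r "Suc i"] g(3) by blast
  \<comment> \<open>Write f - dg = j + r h and take boundaries: up to J, r z equals r dh. Cancelling
    r shows that h fills z.\<close>
  have "z T - koszul n var h T \<in> J" for T
  proof (cases "finite T")
    case True
    have "koszul n var (\<lambda>S. f S - koszul n var g S) T = koszul n var f T" by (simp add: koszul_diff koszul_koszul[OF True])
    moreover have "koszul n var (\<lambda>S. f S - koszul n var g S) T = koszul n var j T + r * koszul n var h T"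
      by (simp add: jh(4) koszul_add koszul_scale)
    ultimately have "r * (z T - koszul n var h T) = (r * z T - koszul n var f T) + koszul n var j T"
      by (simp add: algebra_simps)
    also have "\<dots> \<in> J" by (intro pideal_add[OF J] kf[OF True] koszul_pideal[OF J] jh)
    finally show ?thesis using reg z(1) jh(2) unfolding nonzerodiv_def by (meson polys_diff polys_koszul)
  next
    case False
    then show ?thesis using supp_finite[OF z(2)] koszul_infinite[OF jh(3)] pideal_zero[OF J] by simp
  qed
  then show "\<exists>g. (\<forall>S. g S \<in> polys n) \<and> supp_on (Pow {1..n}) (Suc i) g \<and> (\<forall>S. z S - koszul n var g S \<in> J)"
    using jh by (intro exI[of _ h]) simp
qed

text \<open>The segment H_(i+1)(R/J) -> H_(i+1)(R/(J,r)) -> H_i(R/J) of the sequence induced by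
  multiplication by r on R/J.\<close>

lemma kexact_adjoinI:
  assumes J: "pideal n J" and r: "r \<in> maxid n" and reg: "nonzerodiv n J r"
    and E: "kexact n J i" "kexact n J (Suc i)"
  shows "kexact n (adjoin n J r) (Suc i)"
  unfolding kexact_def
proof (intro allI impI)
  fix f :: "nat set \<Rightarrow> 'a mpoly"
  assume f: "\<forall>S. f S \<in> polys n" "supp_on (Pow {1..n}) (Suc i) f" "\<forall>T. koszul n var f T \<in> adjoin n J r"
  have rR: "r \<in> polys n" using pideal_subsp[OF maxid_pideal r] .
  obtain j h where jh: "\<And>S. j S \<in> J" "\<And>S. h S \<in> polys n" "supp_on (Pow {1..n}) i h"
    "\<And>S. koszul n var f S = j S + r * h S"
    using adjoin_split[OF J, of "koszul n var f" r i] f(3) supp_koszul[OF f(2)] by blast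
  have "koszul n var h T \<in> J" for T
  proof (cases "finite T")
    case True
    have "0 = koszul n var j T + r * koszul n var h T"
      using koszul_koszul[OF True, of n var f] unfolding jh(4) koszul_add koszul_scale by simp
    then have "r * koszul n var h T = - koszul n var j T" by (simp add: eq_neg_iff_add_eq_0 add.commute)
    also have "\<dots> \<in> J" by (intro pideal_uminus[OF J] koszul_pideal[OF J] jh)
    finally show ?thesis using reg polys_koszul[of h] jh(2) unfolding nonzerodiv_def by blast
  next
    case False
    then show ?thesis using koszul_infinite[OF jh(3)] pideal_zero[OF J] by simp
  qed
  then obtain g where g: "\<forall>S. g S \<in> polys n" "supp_on (Pow {1..n}) (Suc i) g" "\<forall>S. h S - koszul n var g S \<in> J"
    using E(1) jh(2,3) unfolding kexact_def by meson
  \<comment> \<open>The boundary of f is r h modulo J, and h is dg modulo J. So f - r g is a cycle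
    modulo J that agrees with f modulo r.\<close>
  define F where "F S = f S - r * g S" for S
  have "\<forall>S. F S \<in> polys n" using f g rR by (auto simp: F_def intro!: polys_diff polys_mult)
  moreover have "supp_on (Pow {1..n}) (Suc i) F" unfolding F_def by (intro supp_on_diff supp_on_scale f g)
  moreover have "koszul n var F T \<in> J" for T
  proof -
    have "koszul n var F T = j T + r * (h T - koszul n var g T)"
      unfolding F_def koszul_diff koszul_scale jh(4) by (simp add: right_diff_distrib)
    also have "\<dots> \<in> J" using jh g rR J by (intro pideal_add pideal_mult) auto
    finally show ?thesis .
  qed
  ultimately obtain g' where g': "\<forall>S. g' S \<in> polys n" "supp_on (Pow {1..n}) (Suc (Suc i)) g'" "\<forall>S. F S - koszul n var g' S \<in> J"
    using E(2) unfolding kexact_def by meson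
  have "f S - koszul n var g' S \<in> adjoin n J r" for S
  proof -
    have "f S - koszul n var g' S = (F S - koszul n var g' S) + r * g S" by (simp add: F_def)
    then show ?thesis using adjI[of "F S - koszul n var g' S" J "g S" n r] g' g by metis
  qed
  then show "\<exists>g. (\<forall>S. g S \<in> polys n) \<and> supp_on (Pow {1..n}) (Suc (Suc i)) g \<and> (\<forall>S. f S - koszul n var g S \<in> adjoin n J r)"
    using g' by (intro exI[of _ g']) simp
qed

text \<open>A top chain is s times e_(1..n), its boundary has the entries x_v s up to sign, and
  nothing lies above it. So top Koszul homology is the socle of R/J.\<close>

lemma kexact_socle:
  assumes J: "pideal n J"
  shows "kexact n J n \<longleftrightarrow> (\<forall>s\<in>polys n. (\<forall>v\<in>{1..n}. var v * s \<in> J) \<longrightarrow> s \<in> J)"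
proof
  assume E: "kexact n J n"
  show "\<forall>s\<in>polys n. (\<forall>v\<in>{1..n}. var v * s \<in> J) \<longrightarrow> s \<in> J"
  proof (intro ballI impI)
    fix s assume s: "s \<in> polys n" "\<forall>v\<in>{1..n}. var v * s \<in> J"
    define f where "f S = (if S = {1..n} then s else 0)" for S
    have "\<forall>S. f S \<in> polys n" using s by (simp add: f_def)
    moreover have "supp_on (Pow {1..n}) n f" by (auto simp: supp_on_def f_def)
    moreover have "koszul n var f T \<in> J" for T unfolding koszul_def mult.assoc
      by (rule pideal_sum[OF J], rule pideal_mult[OF J polys_sg]) (use s pideal_zero[OF J] in \<open>auto simp: f_def\<close>)
    ultimately obtain g where g: "supp_on (Pow {1..n}) (Suc n) g" "\<forall>S. f S - koszul n var g S \<in> J"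
      using E unfolding kexact_def by meson
    have "g S = 0" for S
    proof (rule ccontr)
      assume "g S \<noteq> 0"
      then have "S \<subseteq> {1..n}" "card S = Suc n" using g(1) by (auto simp: supp_on_def)
      then show False using card_mono[of "{1..n}" S] by simp
    qed
    then have "koszul n var g {1..n} = 0" by (simp add: koszul_def)
    then show "s \<in> J" using g(2)[rule_format, of "{1..n}"] by (simp add: f_def)
  qed
next
  assume S: "\<forall>s\<in>polys n. (\<forall>v\<in>{1..n}. var v * s \<in> J) \<longrightarrow> s \<in> J"
  show "kexact n J n" unfolding kexact_def
  proof (intro allI impI)
    fix f :: "nat set \<Rightarrow> 'a mpoly"
    assume f: "\<forall>S. f S \<in> polys n" "supp_on (Pow {1..n}) n f" "\<forall>T. koszul n var f T \<in> J"
    let ?s = "f {1..n}"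
    have "var v * ?s \<in> J" if v: "v \<in> {1..n}" for v
    proof -
      have *: "{1..n} - ({1..n} - {v}) = {v}" "insert v ({1..n} - {v}) = {1..n}" using v by auto
      have "insert v {1..n} = {1..n}" using v by auto
      then have "sg v {1..n} * koszul n var f ({1..n} - {v}) = var v * ?s"
        unfolding koszul_def * by (simp add: mult.assoc)
      then show ?thesis using pideal_mult[OF J polys_sg f(3)[rule_format]] by metis
    qed
    then have sJ: "?s \<in> J" using S f(1) by blast
    have "f S \<in> J" for S
    proof (cases "S = {1..n}")
      case False
      have "f S = 0"
      proof (rule ccontr)
        assume "f S \<noteq> 0"
        then have "S \<subseteq> {1..n}" "card S = n" using f(2) by (auto simp: supp_on_def)
        then show False using False card_subset_eq[of "{1..n}" S] by simp
      qed
      then show ?thesis using pideal_zero[OF J] by simp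
    qed (use sJ in simp)
    then show "\<exists>g. (\<forall>S. g S \<in> polys n) \<and> supp_on (Pow {1..n}) (Suc n) g \<and> (\<forall>S. f S - koszul n var g S \<in> J)"
      by (intro exI[of _ "\<lambda>_. 0"]) (simp add: supp_on_def)
  qed
qed

lemma kexact_large:
  assumes J: "pideal n J" "n < i" shows "kexact n J i"
  unfolding kexact_def
proof (intro allI impI)
  fix f :: "nat set \<Rightarrow> 'a mpoly" assume f: "supp_on (Pow {1..n}) i f"
  have "f S = 0" for S
  proof (rule ccontr)
    assume "f S \<noteq> 0"
    then have "S \<subseteq> {1..n}" "card S = i" using f by (auto simp: supp_on_def)
    then show False using card_mono[of "{1..n}" S] assms by simp
  qed
  then show "\<exists>g. (\<forall>S. g S \<in> polys n) \<and> supp_on (Pow {1..n}) (Suc i) g \<and> (\<forall>S. f S - koszul n var g S \<in> J)"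
    using pideal_zero[OF J(1)] by (intro exI[of _ "\<lambda>_. 0"]) (simp add: supp_on_def)
qed

section \<open>Existence of nonzerodivisors\<close>

lemma nat_seq_mono_subseq:
  fixes s :: "nat \<Rightarrow> nat"
  obtains f :: "nat \<Rightarrow> nat" where "strict_mono f" "\<And>i j. i \<le> j \<Longrightarrow> s (f i) \<le> s (f j)"
proof -
  obtain f :: "nat \<Rightarrow> nat" where f: "strict_mono f" "monoseq (\<lambda>n. s (f n))" using seq_monosub[of s] by blast
  show ?thesis
  proof (cases "\<forall>i j. i \<le> j \<longrightarrow> s (f i) \<le> s (f j)")
    case True then show ?thesis using that f by blast
  next
    case False
    then have dec: "\<And>i j. i \<le> j \<Longrightarrow> s (f j) \<le> s (f i)" using f(2) unfolding monoseq_def by blast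
    \<comment> \<open>A decreasing sequence of natural numbers is constant once it reaches its
      minimum, so its tail is also nondecreasing.\<close>
    define m where "m = (LEAST k. \<exists>i. s (f i) = k)"
    have "\<exists>i. s (f i) = m" unfolding m_def by (rule LeastI[of _ "s (f 0)"]) blast
    then obtain N where N: "s (f N) = m" ..
    have le: "m \<le> s (f i)" for i unfolding m_def by (rule Least_le) blast
    have eq: "s (f (N + i)) = m" for i using dec[of N "N + i"] le[of "N + i"] N by simp
    show ?thesis
    proof (rule that[of "\<lambda>i. f (N + i)"])
      show "strict_mono (\<lambda>i. f (N + i))" using f(1) by (simp add: strict_mono_def)
    qed (simp add: eq)
  qed
qed

text \<open>Coordinates are treated one at a time; passing to a further subsequence keeps the
  monotonicity already achieved.\<close>

lemma dickson_subseq: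
  fixes m :: "nat \<Rightarrow> monomial"
  assumes "finite V"
  shows "\<exists>f :: nat \<Rightarrow> nat. strict_mono f \<and> (\<forall>v\<in>V. \<forall>i j. i \<le> j \<longrightarrow> lk (m (f i)) v \<le> lk (m (f j)) v)"
  using assms
proof (induction V)
  case empty
  show ?case by (intro exI[of _ id]) (simp add: strict_mono_def)
next
  case (insert x V)
  from insert.IH obtain f :: "nat \<Rightarrow> nat"
    where f0: "strict_mono f \<and> (\<forall>v\<in>V. \<forall>i j. i \<le> j \<longrightarrow> lk (m (f i)) v \<le> lk (m (f j)) v)" ..
  note f = conjunct1[OF f0] conjunct2[OF f0]
  obtain g :: "nat \<Rightarrow> nat" where g: "strict_mono g" "\<And>i j. i \<le> j \<Longrightarrow> lk (m (f (g i))) x \<le> lk (m (f (g j))) x"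
    by (rule nat_seq_mono_subseq[of "\<lambda>i. lk (m (f i)) x"]) blast
  have gm: "g i \<le> g j" if "i \<le> j" for i j using that g(1) by (simp add: strict_mono_less_eq)
  show ?case
  proof (intro exI conjI ballI allI impI)
    show "strict_mono (\<lambda>i. f (g i))" using f(1) g(1) by (simp add: strict_mono_def)
    fix v i j assume "v \<in> insert x V" "i \<le> (j::nat)"
    then show "lk (m (f (g i))) v \<le> lk (m (f (g j))) v" using f(2) g(2) gm by auto
  qed
qed

lemma dickson:
  fixes m :: "nat \<Rightarrow> monomial"
  assumes "\<And>i. m i \<in> monomials n"
  obtains i j w where "i < j" "m j = m i + w"
proof -
  obtain f :: "nat \<Rightarrow> nat" where f: "strict_mono f" "\<forall>v\<in>{1..n}. \<forall>i j. i \<le> j \<longrightarrow> lk (m (f i)) v \<le> lk (m (f j)) v"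
    using dickson_subseq[of "{1..n}" m] by auto
  have "lk (m (f 0)) v \<le> lk (m (f 1)) v" for v
  proof (cases "v \<in> {1..n}")
    case True
    then show ?thesis using f(2)[rule_format, of v 0 1] by simp
  next
    case False
    then have "v \<notin> keys (m (f 0))" using assms[of "f 0"] by (auto simp: monomials_def)
    then show ?thesis by (simp add: in_keys_iff)
  qed
  then have "m (f 1) = m (f 0) + (m (f 1) - m (f 0))"
    by (intro poly_mapping_eqI) (simp add: lookup_add lookup_minus)
  moreover have "f 0 < f 1" using f(1) by (simp add: strict_mono_def)
  ultimately show ?thesis using that by blast
qed

text \<open>The order on exponent vectors is lexicographic. With 0 as least element and
  compatibility with addition it is a monomial order.\<close>

lemma monomial_ge_zero: "(0 :: monomial) \<le> w"
proof -
  have "\<not> w < 0" by (simp add: less_poly_mapping.rep_eq less_fun_def)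
  then show ?thesis by simp
qed

text \<open>The bound n matters: with infinitely many variables x_1 > x_2 > ... descends forever.
  Here Dickson's lemma finds a later term divisible by an earlier one, hence not smaller.\<close>

lemma monomials_wf:
  assumes "M \<noteq> {}" "M \<subseteq> monomials n"
  shows "\<exists>m\<in>M. \<forall>m'\<in>M. m \<le> m'"
proof (rule ccontr)
  assume "\<not> ?thesis"
  then have "\<forall>m\<in>M. \<exists>m'\<in>M. m' < m" by (meson not_le)
  then obtain g where g: "\<And>m. m \<in> M \<Longrightarrow> g m \<in> M \<and> g m < m" by metis
  obtain m0 where m0: "m0 \<in> M" using assms(1) by blast
  define s where "s i = (g ^^ i) m0" for i
  have sM: "s i \<in> M" for i by (induction i) (use m0 g in \<open>auto simp: s_def\<close>)
  have "s (Suc i) < s i" for i using g[OF sM[of i]] by (simp add: s_def)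
  then have dec: "i < j \<Longrightarrow> s j < s i" for i j
    by (induction j) (auto simp: less_Suc_eq intro: less_trans)
  obtain i j w where "i < j" "s j = s i + w" using dickson[of s n] sM assms(2) by blast
  then show False using dec[of i j] add_left_mono[OF monomial_ge_zero, of "s i" w] by simp
qed

definition lead :: "'k::field mpoly \<Rightarrow> monomial" where
  "lead p = Max (keys p)"

lemma lead_in: "p \<noteq> 0 \<Longrightarrow> lead p \<in> keys p"
  unfolding lead_def by (rule Max_in) (auto simp: keys_eq_empty)

lemma lead_ge: "m \<in> keys p \<Longrightarrow> m \<le> lead p"
  unfolding lead_def by (rule Max_ge) auto

text \<open>In each gap \<open>J (Suc k) - J k\<close> pick an element with least leading monomial.
  Some leading monomial divides a later one, and subtracting the matching multiple leaves an element
  of the same gap with smaller leading monomial.\<close>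

lemma noetherian:
  fixes J :: "nat \<Rightarrow> 'k::field mpoly set"
  assumes J: "\<And>k. pideal n (J k)" and incid: "\<And>k. J k \<subseteq> J (Suc k)"
  shows "\<exists>k. J (Suc k) = J k"
proof (rule ccontr)
  assume ne: "\<not> ?thesis"
  have "\<exists>p. p \<in> J (Suc k) - J k \<and> (\<forall>q\<in>J (Suc k) - J k. lead p \<le> lead q)" for k
  proof -
    let ?D = "J (Suc k) - J k"
    have "?D \<noteq> {}" using ne incid[of k] by blast
    moreover have "lead ` ?D \<subseteq> monomials n"
    proof
      fix m assume "m \<in> lead ` ?D"
      then obtain q where q: "q \<in> ?D" "m = lead q" by blast
      then have "q \<noteq> 0" using pideal_zero[OF J] by auto
      then have "m \<in> keys q" using lead_in q by blast
      moreover have "q \<in> polys n" using q pideal_subsp[OF J] by blast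
      ultimately show "m \<in> monomials n" by (auto simp: polys_def)
    qed
    ultimately show ?thesis using monomials_wf[of "lead ` ?D" n] by auto
  qed
  then obtain p where p: "\<And>k. p k \<in> J (Suc k) - J k" "\<And>k q. q \<in> J (Suc k) - J k \<Longrightarrow> lead (p k) \<le> lead q"
    by metis
  have p0: "p k \<noteq> 0" for k using p(1)[of k] pideal_zero[OF J, of k] by auto
  have pm: "lead (p k) \<in> monomials n" for k
  proof -
    have "p k \<in> polys n" using p(1)[of k] pideal_subsp[OF J] by blast
    then show ?thesis using lead_in[OF p0, of k] by (auto simp: polys_def)
  qed
  obtain i j w where ij: "i < j" "lead (p j) = lead (p i) + w" by (rule dickson[of "\<lambda>k. lead (p k)", OF pm])
  have up: "a \<le> b \<Longrightarrow> J a \<subseteq> J b" for a b by (rule lift_Suc_mono_le) (rule incid)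
  have wm: "w \<in> monomials n"
  proof -
    have "keys w \<subseteq> keys (lead (p j))" unfolding ij(2) by (auto simp: in_keys_iff lookup_add)
    then show ?thesis using pm[of j] by (auto simp: monomials_def)
  qed
  define c where "c = lk (p j) (lead (p j)) / lk (p i) (lead (p i))"
  define q where "q = p j - single w c * p i"
  have "p i \<in> J j" using p(1)[of i] up[of "Suc i" j] ij(1) by auto
  then have t: "single w c * p i \<in> J j" by (rule pideal_mult[OF J polys_single[OF wm]])
  have q1: "q \<in> J (Suc j)" unfolding q_def using p(1)[of j] t incid[of j] by (intro pideal_diff[OF J]) auto
  have "q \<notin> J j"
  proof
    assume "q \<in> J j"
    then have "q + single w c * p i \<in> J j" using t by (rule pideal_add[OF J])
    then show False using p(1)[of j] by (simp add: q_def)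
  qed
  then have q2: "lead (p j) \<le> lead q" using p(2)[of q j] q1 by blast
  have "q \<noteq> 0" using \<open>q \<notin> J j\<close> pideal_zero[OF J] by auto
  then have k: "lead q \<in> keys q" by (rule lead_in)
  have "lead q \<le> lead (p j)"
  proof (rule ccontr)
    assume gt: "\<not> lead q \<le> lead (p j)"
    then have "lk (p j) (lead q) = 0" using lead_ge[of "lead q" "p j"] by (auto simp: in_keys_iff)
    then have "lk (single w c * p i) (lead q) \<noteq> 0" using k by (auto simp: q_def in_keys_iff lookup_minus)
    then obtain m' where m': "lead q = w + m'" using lookup_single_times_none by blast
    then have "lk (p i) m' \<noteq> 0" using \<open>lk (single w c * p i) (lead q) \<noteq> 0\<close> by (simp add: lookup_single_times_plus)
    then have "m' \<le> lead (p i)" using lead_ge by (auto simp: in_keys_iff)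
    then have "lead q \<le> lead (p j)" unfolding m' ij(2) by (metis add.commute add_left_mono)
    then show False using gt by simp
  qed
  then have "lead q = lead (p j)" using q2 by simp
  moreover have "lk q (lead (p j)) = 0"
  proof -
    have "lk (single w c * p i) (lead (p j)) = c * lk (p i) (lead (p i))"
      unfolding ij(2) add.commute[of _ w] by (rule lookup_single_times_plus)
    moreover have "lk (p i) (lead (p i)) \<noteq> 0" using lead_in[OF p0, of i] by (simp add: in_keys_iff)
    ultimately show ?thesis by (simp add: q_def lookup_minus c_def)
  qed
  ultimately show False using k by (simp add: in_keys_iff)
qed

lemma noetherian_maximal:
  assumes "\<A> \<noteq> {}" "\<And>I. I \<in> \<A> \<Longrightarrow> pideal n I"
  shows "\<exists>M\<in>\<A>. \<forall>I\<in>\<A>. M \<subseteq> I \<longrightarrow> I = M"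
proof (rule ccontr)
  assume "\<not> ?thesis"
  then have "\<forall>M\<in>\<A>. \<exists>I\<in>\<A>. M \<subseteq> I \<and> I \<noteq> M" by blast
  then obtain g where g: "\<And>M. M \<in> \<A> \<Longrightarrow> g M \<in> \<A> \<and> M \<subseteq> g M \<and> g M \<noteq> M" by metis
  obtain M0 where M0: "M0 \<in> \<A>" using assms(1) by blast
  define s where "s i = (g ^^ i) M0" for i
  have sA: "s i \<in> \<A>" for i by (induction i) (use M0 g in \<open>auto simp: s_def\<close>)
  have ss: "s (Suc i) = g (s i)" for i by (simp add: s_def)
  have "\<exists>k. s (Suc k) = s k"
    by (rule noetherian[of n]) (use assms(2) sA g ss in auto)
  then show False using g[OF sA] ss by metis
qed

section \<open>Maximal annihilators and prime avoidance\<close>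

definition ann :: "nat \<Rightarrow> 'k::field mpoly set \<Rightarrow> 'k mpoly \<Rightarrow> 'k mpoly set" where
  "ann n J x = {r \<in> polys n. r * x \<in> J}"

lemma ann_pideal:
  assumes J: "pideal n J" and x: "x \<in> polys n" shows "pideal n (ann n J x)"
  unfolding pideal_def ann_def using J
  by (auto simp: pideal_zero pideal_add distrib_right mult.assoc intro: polys_add polys_mult pideal_mult)

text \<open>The zero divisors modulo \<open>J\<close> form the union of the maximal annihilators, which are finitely many
  primes; prime avoidance applies to them.\<close>

lemma exists_nonzerodiv:
  fixes J :: "'k::field mpoly set"
  assumes J: "pideal n J" and soc: "\<And>s. s \<in> polys n \<Longrightarrow> (\<And>v. v \<in> {1..n} \<Longrightarrow> var v * s \<in> J) \<Longrightarrow> s \<in> J"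
  shows "\<exists>r\<in>maxid n. nonzerodiv n J r"
proof -
  define \<A> where "\<A> = ann n J ` (polys n - J)"
  define \<P> where "\<P> = {P \<in> \<A>. \<forall>I\<in>\<A>. P \<subseteq> I \<longrightarrow> I = P}"
  have Aidl: "pideal n I" if "I \<in> \<A>" for I using that ann_pideal[OF J] by (auto simp: \<A>_def)
  have above: "\<exists>P\<in>\<P>. I \<subseteq> P" if "I \<in> \<A>" for I
  proof -
    have "\<exists>M\<in>{K\<in>\<A>. I \<subseteq> K}. \<forall>K\<in>{K\<in>\<A>. I \<subseteq> K}. M \<subseteq> K \<longrightarrow> K = M"
      by (rule noetherian_maximal[of _ n]) (use that Aidl in auto)
    then obtain M where M: "M \<in> \<A>" "I \<subseteq> M" "\<And>K. K \<in> \<A> \<Longrightarrow> I \<subseteq> K \<Longrightarrow> M \<subseteq> K \<Longrightarrow> K = M" by auto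
    have "K = M" if "K \<in> \<A>" "M \<subseteq> K" for K using M(3)[OF that(1) subset_trans[OF M(2) that(2)] that(2)] .
    then have "M \<in> \<P>" unfolding \<P>_def using M(1) by blast
    then show ?thesis using M(2) by (rule rev_bexI)
  qed
  \<comment> \<open>If b is not in P = ann(x), then b x is nonzero modulo J and ann(b x) contains P,
    so maximality makes them equal; it contains a.\<close>
  have prime: "a \<in> P \<or> b \<in> P" if P: "P \<in> \<P>" and ab: "a \<in> polys n" "b \<in> polys n" "a * b \<in> P" for P a b
  proof (rule disjCI)
    assume b: "b \<notin> P"
    obtain x where x: "x \<in> polys n - J" "P = ann n J x" using P by (auto simp: \<P>_def \<A>_def)
    have "b * x \<in> polys n - J" using b x ab polys_mult[of b n x] by (auto simp: ann_def)
    then have "ann n J (b * x) \<in> \<A>" by (auto simp: \<A>_def)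
    moreover have "P \<subseteq> ann n J (b * x)"
    proof
      fix r assume "r \<in> P"
      then have "r \<in> polys n" "b * (r * x) \<in> J" using x pideal_mult[OF J ab(2)] by (auto simp: ann_def)
      then show "r \<in> ann n J (b * x)" by (simp add: ann_def mult.left_commute)
    qed
    ultimately have "ann n J (b * x) = P" using P by (auto simp: \<P>_def)
    moreover have "a \<in> ann n J (b * x)" using ab x by (auto simp: ann_def mult.assoc)
    ultimately show "a \<in> P" by simp
  qed
  have one: "1 \<notin> P" if "P \<in> \<P>" for P using that by (auto simp: \<P>_def \<A>_def ann_def)
  have Pidl: "pideal n P" if "P \<in> \<P>" for P using that Aidl by (auto simp: \<P>_def)
  have prodR: "(\<Prod>i\<in>A. f i) \<in> polys n" if "\<And>i. i \<in> A \<Longrightarrow> f i \<in> polys n" for A and f :: "'b \<Rightarrow> 'k mpoly"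
    using that by (induction A rule: infinite_finite_induct) (auto intro: polys_mult)
  have primeprod: "(\<Prod>i\<in>A. f i) \<notin> P"
    if "P \<in> \<P>" "finite A" "\<And>i. i \<in> A \<Longrightarrow> f i \<in> polys n \<and> f i \<notin> P" for P A and f :: "'b \<Rightarrow> 'k mpoly"
    using that(2,3)
  proof (induction A)
    case (insert a A)
    have "(\<Prod>i\<in>A. f i) \<in> polys n" using insert by (intro prodR) auto
    then show ?case using prime[OF that(1), of "f a" "\<Prod>i\<in>A. f i"] insert by auto
  qed (use one that(1) in simp)
  have prodin: "(\<Prod>i\<in>A. f i) \<in> P" if "pideal n P" "finite A" "a \<in> A" "f a \<in> P" "\<And>i. i \<in> A \<Longrightarrow> f i \<in> polys n"
    for P A a and f :: "'b \<Rightarrow> 'k mpoly"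
  proof -
    have "(\<Prod>i\<in>A. f i) = (\<Prod>i\<in>A - {a}. f i) * f a" using that by (subst prod.remove[of A a]) (auto simp: mult.commute)
    then show ?thesis using pideal_mult[OF that(1) prodR that(4), of "A - {a}" f] that(5) by auto
  qed
  have maxeq: "P = Q" if "P \<in> \<P>" "Q \<in> \<P>" "P \<subseteq> Q" for P Q
  proof -
    have Q: "Q \<in> \<A>" using that(2) by (simp add: \<P>_def)
    have "\<forall>I\<in>\<A>. P \<subseteq> I \<longrightarrow> I = P" using that(1) unfolding \<P>_def by blast
    from bspec[OF this Q] that(3) show ?thesis by simp
  qed
  have fin: "finite \<P>"
  proof (rule ccontr)
    assume "infinite \<P>"
    from infinite_countable_subset[OF this]
    obtain P :: "nat \<Rightarrow> 'k mpoly set" where P: "inj P" "range P \<subseteq> \<P>" by blast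
    have Pk: "P k \<in> \<P>" for k using P(2) by blast
    have "\<exists>x. x \<in> polys n - J \<and> P k = ann n J x" for k using Pk[of k] by (auto simp: \<P>_def \<A>_def)
    then obtain x where x: "\<And>k. x k \<in> polys n - J" "\<And>k. P k = ann n J (x k)" by metis
    \<comment> \<open>The ideal generated by J and x_0, ..., x_(k-1). Once the chain stops, x_k is a
      combination of its predecessors modulo J.\<close>
    define N where "N k = rec_nat J (\<lambda>i I. adjoin n I (x i)) k" for k
    have N: "N 0 = J" "N (Suc k) = adjoin n (N k) (x k)" for k by (simp_all add: N_def)
    have Nidl: "pideal n (N k)" for k by (induction k) (use J x(1) in \<open>auto simp: N intro: adjoin_pideal\<close>)
    have "\<exists>k. N (Suc k) = N k" by (rule noetherian[of n N]) (simp_all add: Nidl N(2) adjoin_sup)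
    then obtain k where k: "N (Suc k) = N k" ..
    then have xk: "x k \<in> N k" using adjoin_elem[OF Nidl, of "x k" k] N(2)[of k] by simp
    have kill: "s * y \<in> J" if "s \<in> polys n" "\<And>i. i < l \<Longrightarrow> s \<in> P i" "y \<in> N l" for s y l
      using that(2,3)
    proof (induction l arbitrary: y)
      case 0
      then show ?case using pideal_mult[OF J that(1)] N by auto
    next
      case (Suc l)
      then obtain a b where y: "y = a + x l * b" "a \<in> N l" "b \<in> polys n" by (auto simp: N adjoin_def)
      have "s * a \<in> J" using Suc y by auto
      moreover have "b * (s * x l) \<in> J" using Suc.prems(1)[of l] x(2)[of l] y(3) pideal_mult[OF J] by (auto simp: ann_def)
      ultimately have "s * a + b * (s * x l) \<in> J" by (rule pideal_add[OF J])
      then show ?case unfolding y by (simp add: algebra_simps)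
    qed
    \<comment> \<open>Whatever lies in all P_i with i < k kills these x_i, hence x_k, modulo J. A
      product of elements of the P_i therefore lies in the prime P_k, which must contain one of the
      factors.\<close>
    have "\<exists>i<k. P i \<subseteq> P k"
    proof (rule ccontr)
      assume "\<not> ?thesis"
      then have "\<forall>i. i < k \<longrightarrow> (\<exists>a. a \<in> P i \<and> a \<notin> P k)" by blast
      then obtain a where a: "\<And>i. i < k \<Longrightarrow> a i \<in> P i \<and> a i \<notin> P k" by metis
      have aR: "a i \<in> polys n" if "i < k" for i using a[OF that] x(2)[of i] by (auto simp: ann_def)
      let ?s = "\<Prod>i\<in>{..<k}. a i"
      have "?s \<in> P i" if "i < k" for i
        using that a aR by (intro prodin[of _ _ i] Pidl Pk) auto
      moreover have sR: "?s \<in> polys n" using aR by (intro prodR) auto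
      ultimately have "?s * x k \<in> J" using kill[of ?s k "x k"] xk by blast
      then have "?s \<in> P k" unfolding x(2)[of k] ann_def using sR by blast
      moreover have "?s \<notin> P k" using a aR by (intro primeprod Pk) auto
      ultimately show False by blast
    qed
    then obtain i where "i < k" "P i \<subseteq> P k" by blast
    then have "P i = P k" using maxeq[OF Pk Pk] by simp
    then show False using P(1) \<open>i < k\<close> by (auto dest: injD)
  qed
  \<comment> \<open>Choose y outside P but inside every other member; the sum of these y avoids all
    members at once. Absence of a socle provides a variable outside P, and this factor puts y in the
    maximal ideal.\<close>
  have "\<exists>y. y \<in> maxid n \<and> y \<notin> P \<and> (\<forall>Q\<in>\<P> - {P}. y \<in> Q)" if P: "P \<in> \<P>" for P
  proof -
    obtain x where x: "x \<in> polys n - J" "P = ann n J x" using P by (auto simp: \<P>_def \<A>_def)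
    have "\<not> (\<forall>v\<in>{1..n}. var v \<in> P)"
    proof
      assume "\<forall>v\<in>{1..n}. var v \<in> P"
      then have "var v * x \<in> J" if "v \<in> {1..n}" for v
        using that x(2) by (simp add: ann_def)
      then have "x \<in> J" using soc[of x] x(1) by blast
      then show False using x by blast
    qed
    then obtain v where v: "v \<in> {1..n}" "var v \<notin> P" by blast
    have "\<forall>Q\<in>\<P> - {P}. \<exists>a. a \<in> Q \<and> a \<notin> P" using maxeq[OF _ P] by blast
    then obtain a where a: "\<And>Q. Q \<in> \<P> - {P} \<Longrightarrow> a Q \<in> Q \<and> a Q \<notin> P" by metis
    have aR: "a Q \<in> polys n" if "Q \<in> \<P> - {P}" for Q using a[OF that] pideal_subsp[OF Pidl] that by blast
    let ?p = "\<Prod>Q\<in>\<P> - {P}. a Q"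
    have pR: "?p \<in> polys n" using aR by (intro prodR) auto
    have "?p \<notin> P" using a aR P fin by (intro primeprod) auto
    then have "?p * var v \<notin> P" using prime[OF P pR polys_var[OF v(1)]] v(2) by blast
    moreover have "?p * var v \<in> maxid n" by (rule pideal_mult[OF maxid_pideal pR var_maxid[OF v(1)]])
    moreover have "?p * var v \<in> Q" if Q: "Q \<in> \<P> - {P}" for Q
    proof -
      have "?p \<in> Q" using a aR Pidl fin Q by (intro prodin[of _ _ Q]) auto
      then have "var v * ?p \<in> Q" using pideal_mult[OF Pidl polys_var[OF v(1)]] Q by blast
      then show ?thesis by (simp add: mult.commute)
    qed
    ultimately show ?thesis by blast
  qed
  then obtain y where y: "\<And>P. P \<in> \<P> \<Longrightarrow> y P \<in> maxid n \<and> y P \<notin> P \<and> (\<forall>Q\<in>\<P> - {P}. y P \<in> Q)" by metis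
  define r where "r = (\<Sum>P\<in>\<P>. y P)"
  have rM: "r \<in> maxid n" unfolding r_def using y by (intro pideal_sum[OF maxid_pideal]) auto
  have rP: "r \<notin> P" if P: "P \<in> \<P>" for P
  proof
    assume "r \<in> P"
    moreover have "r = y P + (\<Sum>Q\<in>\<P> - {P}. y Q)" unfolding r_def by (rule sum.remove[OF fin P])
    moreover have "(\<Sum>Q\<in>\<P> - {P}. y Q) \<in> P" using y P by (intro pideal_sum[OF Pidl[OF P]]) auto
    ultimately have "y P \<in> P" using pideal_diff[OF Pidl[OF P], of r "\<Sum>Q\<in>\<P> - {P}. y Q"] by simp
    then show False using y[OF P] by blast
  qed
  have "nonzerodiv n J r" unfolding nonzerodiv_def
  proof (intro ballI impI)
    fix x assume x: "x \<in> polys n" "r * x \<in> J"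
    show "x \<in> J"
    proof (rule ccontr)
      assume "x \<notin> J"
      then have "ann n J x \<in> \<A>" using x by (auto simp: \<A>_def)
      then obtain P where P: "P \<in> \<P>" "ann n J x \<subseteq> P" using above by blast
      have "r \<in> ann n J x" using x pideal_subsp[OF maxid_pideal rM] by (simp add: ann_def)
      then show False using P rP by blast
    qed
  qed
  then show ?thesis using rM by blast
qed

section \<open>Lengths of maximal regular sequences\<close>

definition adjoins :: "nat \<Rightarrow> 'k::field mpoly set \<Rightarrow> 'k mpoly list \<Rightarrow> 'k mpoly set" where
  "adjoins n I rs = foldl (adjoin n) I rs"

lemma adjoins_Nil [simp]: "adjoins n I [] = I" and adjoins_snoc [simp]: "adjoins n I (rs @ [r]) = adjoin n (adjoins n I rs) r"
  by (simp_all add: adjoins_def)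

definition regseq :: "nat \<Rightarrow> 'k::field mpoly set \<Rightarrow> 'k mpoly list \<Rightarrow> bool" where
  "regseq n I rs \<longleftrightarrow> set rs \<subseteq> maxid n \<and> (\<forall>k<length rs. nonzerodiv n (adjoins n I (take k rs)) (rs ! k))"

lemma regseq_Nil [simp]: "regseq n I []" by (simp add: regseq_def)

lemma regseq_snoc: "regseq n I (rs @ [r]) \<longleftrightarrow> regseq n I rs \<and> r \<in> maxid n \<and> nonzerodiv n (adjoins n I rs) r"
  by (auto simp: regseq_def less_Suc_eq nth_append)

lemma adjoin_maxid:
  assumes "J \<subseteq> maxid n" "r \<in> maxid n" shows "adjoin n J r \<subseteq> maxid n"
proof
  fix x assume "x \<in> adjoin n J r"
  then obtain a b where "x = a + b * r" "a \<in> J" "b \<in> polys n" by (auto simp: adjoin_def mult.commute)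
  then show "x \<in> maxid n" using assms pideal_add[OF maxid_pideal] pideal_mult[OF maxid_pideal] by blast
qed

text \<open>The number q is the top degree of nonzero Koszul homology. For each new element
  \<open>kexact_adjoinD\<close> carries the nonvanishing up by one and \<open>kexact_adjoinI\<close>
  carries the vanishing above it.\<close>

lemma regseq_profile:
  assumes I: "pideal n I" "I \<subseteq> maxid n" and q: "\<not> kexact n I q" "\<And>i. q < i \<Longrightarrow> kexact n I i"
    and rs: "regseq n I rs"
  shows "pideal n (adjoins n I rs) \<and> adjoins n I rs \<subseteq> maxid n \<and> \<not> kexact n (adjoins n I rs) (q + length rs)
    \<and> (\<forall>i>q + length rs. kexact n (adjoins n I rs) i)"
  using rs
proof (induction rs rule: rev_induct)
  case Nil
  then show ?case using I q by simp
next
  case (snoc r rs)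
  let ?J = "adjoins n I rs"
  have r: "regseq n I rs" "r \<in> maxid n" "nonzerodiv n ?J r" using snoc.prems by (auto simp: regseq_snoc)
  have IH: "pideal n ?J" "?J \<subseteq> maxid n" "\<not> kexact n ?J (q + length rs)" "\<And>i. q + length rs < i \<Longrightarrow> kexact n ?J i"
    using snoc.IH[OF r(1)] by auto
  have "kexact n (adjoin n ?J r) i" if "q + length (rs @ [r]) < i" for i
  proof -
    from that obtain k where k: "i = Suc k" by (cases i) auto
    then show ?thesis using kexact_adjoinI[OF IH(1) r(2,3), of k] IH(4) that by simp
  qed
  moreover have "\<not> kexact n (adjoin n ?J r) (q + length (rs @ [r]))"
    using kexact_adjoinD[OF IH(1) r(2,3), of "q + length rs"] IH(3) by auto
  ultimately show ?case using adjoin_pideal[OF IH(1) pideal_subsp[OF maxid_pideal r(2)]] adjoin_maxid[OF IH(2) r(2)] by auto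
qed

text \<open>The top degree cannot exceed n. Below n there is no socle, so another nonzerodivisor
  exists; at n a further element would push it beyond n. Hence all maximal sequences have length n -
  q.\<close>

lemma maximal_regseq_length:
  assumes I: "pideal n I" "I \<subseteq> maxid n" and q: "\<not> kexact n I q" "\<And>i. q < i \<Longrightarrow> kexact n I i"
    and rs: "regseq n I rs"
  shows "q + length rs \<le> n"
    and "(\<forall>r\<in>maxid n. \<not> regseq n I (rs @ [r])) \<longleftrightarrow> q + length rs = n"
proof -
  have len: "q + length xs \<le> n" if "regseq n I xs" for xs
    using regseq_profile[OF I q that] kexact_large[of n "adjoins n I xs" "q + length xs"] by (meson not_le)
  then show "q + length rs \<le> n" using rs .
  note pr = regseq_profile[OF I q rs]
  show "(\<forall>r\<in>maxid n. \<not> regseq n I (rs @ [r])) \<longleftrightarrow> q + length rs = n"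
  proof
    assume m: "\<forall>r\<in>maxid n. \<not> regseq n I (rs @ [r])"
    show "q + length rs = n"
    proof (rule ccontr)
      assume "q + length rs \<noteq> n"
      then have "kexact n (adjoins n I rs) n" using pr len[OF rs] by simp
      then have "\<exists>r\<in>maxid n. nonzerodiv n (adjoins n I rs) r"
        using pr kexact_socle[of n "adjoins n I rs"] by (intro exists_nonzerodiv) auto
      then show False using m rs by (auto simp: regseq_snoc)
    qed
  next
    assume "q + length rs = n"
    then show "\<forall>r\<in>maxid n. \<not> regseq n I (rs @ [r])" using len[of "rs @ [_]"] by fastforce
  qed
qed

text \<open>The common length alone does not give a value to the definite description
  \<open>depth\<close>; a maximal sequence is obtained by extending until length n - q.\<close>

lemma maximal_regseq_exists:
  assumes I: "pideal n I" "I \<subseteq> maxid n" and q: "\<not> kexact n I q" "\<And>i. q < i \<Longrightarrow> kexact n I i"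
  shows "\<exists>rs. regseq n I rs \<and> (\<forall>r\<in>maxid n. \<not> regseq n I (rs @ [r]))"
proof -
  have "\<exists>rs. regseq n I rs \<and> length rs = k" if "k \<le> n - q" for k
    using that
  proof (induction k)
    case 0
    then show ?case by (intro exI[of _ "[]"]) simp
  next
    case (Suc k)
    then obtain rs where rs: "regseq n I rs" "length rs = k" by auto
    then have "q + length rs \<noteq> n" using Suc.prems by simp
    then obtain r where "r \<in> maxid n" "regseq n I (rs @ [r])" using maximal_regseq_length(2)[OF I q rs(1)] by blast
    then show ?case using rs by (intro exI[of _ "rs @ [r]"]) simp
  qed
  then obtain rs where rs: "regseq n I rs" "length rs = n - q" by blast
  have "q \<le> n" using maximal_regseq_length(1)[OF I q regseq_Nil] by simp
  then show ?thesis using maximal_regseq_length(2)[OF I q rs(1)] rs by (intro exI[of _ rs]) simp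
qed

section \<open>Depth\<close>

lemma poly_ring_simps [simp]:
  "carrier (poly_ring n) = polys n" "add (poly_ring n) = (+)" "zero (poly_ring n) = 0"
  "monoid.mult (poly_ring n) = (*)" "one (poly_ring n) = 1"
  by (simp_all add: poly_ring_def polys_def)

lemma ideal_poly_ring: "ideal J (poly_ring n :: 'k::field mpoly ring) \<longleftrightarrow> pideal n J"
proof
  assume "ideal J (poly_ring n :: 'k mpoly ring)"
  then interpret ideal J "poly_ring n :: 'k mpoly ring" .
  show "pideal n J" unfolding pideal_def
    using a_subset additive_subgroup.zero_closed[OF additive_subgroup_axioms]
      additive_subgroup.a_closed[OF additive_subgroup_axioms] I_l_closed by auto
next
  assume J: "pideal n J"
  interpret R: cring "poly_ring n :: 'k mpoly ring" by (rule poly_ring_cring)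
  have inv: "\<ominus>\<^bsub>poly_ring n\<^esub> x = - x" if "x \<in> polys n" for x :: "'k mpoly"
    by (rule R.minus_equality) (use that in \<open>auto intro: polys_uminus\<close>)
  show "ideal J (poly_ring n :: 'k mpoly ring)"
  proof (rule idealI)
    show "ring (poly_ring n :: 'k mpoly ring)" by (rule R.ring_axioms)
    show "subgroup J (add_monoid (poly_ring n :: 'k mpoly ring))"
    proof (rule subgroup.intro)
      show "inv\<^bsub>add_monoid (poly_ring n)\<^esub> x \<in> J" if "x \<in> J" for x
        using inv[OF pideal_subsp[OF J that]] pideal_uminus[OF J that] by (simp add: a_inv_def)
    qed (use J in \<open>auto simp: pideal_subsp pideal_add pideal_zero\<close>)
    fix a x :: "'k mpoly" assume "a \<in> J" "x \<in> carrier (poly_ring n)"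
    then show "x \<otimes>\<^bsub>poly_ring n\<^esub> a \<in> J" "a \<otimes>\<^bsub>poly_ring n\<^esub> x \<in> J"
      using pideal_mult[OF J, of x a] by (auto simp: mult.commute)
  qed
qed

lemma Idl_least: "pideal n J \<Longrightarrow> S \<subseteq> J \<Longrightarrow> Idl\<^bsub>poly_ring n\<^esub> S \<subseteq> J"
  using ideal_poly_ring[of J n] by (auto simp: genideal_def)

lemma Idl_pideal: "S \<subseteq> polys n \<Longrightarrow> pideal n (Idl\<^bsub>poly_ring n\<^esub> S)" and Idl_self: "S \<subseteq> polys n \<Longrightarrow> S \<subseteq> Idl\<^bsub>poly_ring n\<^esub> S"
  using ring.genideal_ideal[OF cring.axioms(1)[OF poly_ring_cring], of S n]
    ring.genideal_self[OF cring.axioms(1)[OF poly_ring_cring], of S n]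
  by (simp_all add: ideal_poly_ring)

lemma irrelevant_ideal_eq: "irrelevant_ideal n = (maxid n :: 'k::field mpoly set)"
proof
  show "irrelevant_ideal n \<subseteq> (maxid n :: 'k mpoly set)" unfolding irrelevant_ideal_def
    by (rule Idl_least[OF maxid_pideal]) (use var_maxid in blast)
  have vR: "var ` {1..n} \<subseteq> (polys n :: 'k mpoly set)" using polys_var by blast
  show "(maxid n :: 'k mpoly set) \<subseteq> irrelevant_ideal n"
  proof
    fix x :: "'k mpoly" assume "x \<in> maxid n"
    then obtain a where a: "\<forall>v. a v \<in> polys n" "x = (\<Sum>v\<in>{1..n}. a v * var v)" by (auto simp: maxid_def)
    have "var v \<in> Idl\<^bsub>poly_ring n\<^esub> (var ` {1..n} :: 'k mpoly set)" if "v \<in> {1..n}" for v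
      using Idl_self[OF vR] that by blast
    then show "x \<in> irrelevant_ideal n" unfolding a(2) irrelevant_ideal_def
      using a(1) by (intro pideal_sum[OF Idl_pideal[OF vR]] pideal_mult[OF Idl_pideal[OF vR]]) auto
  qed
qed

lemma poly_as_sum: "p = (\<Sum>m\<in>keys p. single m (lk p m))"
  by (rule poly_mapping_eqI) (auto simp: lookup_sum lookup_single when_def sum.delta in_keys_iff)

lemma prod_var: "finite \<sigma> \<Longrightarrow> (\<Prod>i\<in>\<sigma>. var i) = (single (sqfree \<sigma>) 1 :: 'k::field mpoly)"
  by (induction \<sigma> rule: finite_induct) (simp_all add: sqfree_insert var_def mult_single, simp add: sqfree_def)

lemma nonfaces_pideal:
  assumes c: "cplx n \<Delta>" shows "pideal n (nonfaces n \<Delta> :: 'k::field mpoly set)"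
  unfolding pideal_def
proof (intro conjI ballI)
  fix x y :: "'k mpoly" assume "x \<in> nonfaces n \<Delta>" "y \<in> nonfaces n \<Delta>"
  then show "x + y \<in> nonfaces n \<Delta>" by (auto simp: nonfaces_iff lookup_add intro: polys_add)
next
  fix r x :: "'k mpoly" assume r: "r \<in> polys n" "x \<in> nonfaces n \<Delta>"
  have "keys m \<notin> \<Delta>" if m: "m \<in> keys (r * x)" for m
  proof
    assume k: "keys m \<in> \<Delta>"
    obtain a b where ab: "m = a + b" "b \<in> keys x" using keys_mult[of r x] m by blast
    have "keys b \<subseteq> keys m" unfolding ab by (auto simp: in_keys_iff lookup_add)
    then have "keys b \<in> \<Delta>" by (rule cplxD[OF c k])
    then show False using ab r by (auto simp: nonfaces_def)
  qed
  then show "r * x \<in> nonfaces n \<Delta>" using r by (auto simp: nonfaces_def intro: polys_mult)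
qed (auto simp: nonfaces_def)

text \<open>A monomial whose support is a nonface is a multiple of the squarefree monomial on that
  support, which is a generator. Conversely, multiplication enlarges supports, and supersets of
  nonfaces are nonfaces.\<close>

lemma stanley_reisner_eq:
  assumes c: "cplx n \<Delta>"
  shows "stanley_reisner_ideal n \<Delta> = (nonfaces n \<Delta> :: 'k::field mpoly set)"
proof
  let ?G = "{\<Prod>i\<in>\<sigma>. var i | \<sigma>. \<sigma> \<subseteq> {1..n} \<and> \<sigma> \<notin> \<Delta>} :: 'k mpoly set"
  have G: "single (sqfree \<sigma>) 1 \<in> ?G" if "\<sigma> \<subseteq> {1..n}" "\<sigma> \<notin> \<Delta>" for \<sigma>
    using prod_var[of \<sigma>, where ?'k = 'k] finite_subset[OF that(1)] that by (intro CollectI exI[of _ \<sigma>]) simp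
  show "stanley_reisner_ideal n \<Delta> \<subseteq> (nonfaces n \<Delta> :: 'k mpoly set)" unfolding stanley_reisner_ideal_def
  proof (rule Idl_least[OF nonfaces_pideal[OF c]])
    show "?G \<subseteq> nonfaces n \<Delta>"
    proof
      fix x :: "'k mpoly" assume "x \<in> ?G"
      then obtain \<sigma> where s: "x = (\<Prod>i\<in>\<sigma>. var i)" "\<sigma> \<subseteq> {1..n}" "\<sigma> \<notin> \<Delta>" by blast
      then have "finite \<sigma>" using finite_subset by auto
      then have "x = single (sqfree \<sigma>) 1" "keys (sqfree \<sigma>) = \<sigma>" using s prod_var keys_sqfree by auto
      then show "x \<in> nonfaces n \<Delta>" using s polys_single[OF sqfree_monomials] by (simp add: nonfaces_def)
    qed
  qed
  have GR: "?G \<subseteq> polys n" using prod_var_carrier by auto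
  show "(nonfaces n \<Delta> :: 'k mpoly set) \<subseteq> stanley_reisner_ideal n \<Delta>"
  proof
    fix p :: "'k mpoly" assume p: "p \<in> nonfaces n \<Delta>"
    have "single m (lk p m) \<in> Idl\<^bsub>poly_ring n\<^esub> ?G" if m: "m \<in> keys p" for m
    proof -
      have mm: "m \<in> monomials n" using p m by (auto simp: nonfaces_def polys_def)
      then have k: "keys m \<subseteq> {1..n}" "keys m \<notin> \<Delta>" using p m by (auto simp: nonfaces_def monomials_def)
      have "single (sqfree (keys m)) 1 \<in> Idl\<^bsub>poly_ring n\<^esub> ?G" using G[OF k] Idl_self[OF GR] by blast
      then have "single (m - sqfree (keys m)) (lk p m) * single (sqfree (keys m)) 1 \<in> Idl\<^bsub>poly_ring n\<^esub> ?G"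
        by (rule pideal_mult[OF Idl_pideal[OF GR] polys_single[OF monomials_minus[OF mm]]])
      then show ?thesis by (simp add: mult_single minus_sqfree_plus)
    qed
    then have "(\<Sum>m\<in>keys p. single m (lk p m)) \<in> Idl\<^bsub>poly_ring n\<^esub> ?G"
      by (rule pideal_sum[OF Idl_pideal[OF GR]])
    then show "p \<in> stanley_reisner_ideal n \<Delta>" unfolding stanley_reisner_ideal_def using poly_as_sum[of p] by simp
  qed
qed

section \<open>Regular sequences on the quotient module\<close>

locale quot =
  fixes n :: nat and I :: "'k::field mpoly set"
  assumes I: "pideal n I"
begin

abbreviation "R \<equiv> poly_ring n :: 'k mpoly ring"
definition "M = quotient_module R I"
definition rclass :: "'k mpoly \<Rightarrow> 'k mpoly set" where "rclass a = I +>\<^bsub>R\<^esub> a"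

sublocale id: ideal I R using I ideal_poly_ring by blast
sublocale h: ring_hom_ring R "R Quot I" "(+>\<^bsub>R\<^esub>) I"
  by (rule id.rcos_ring_hom_ring)
sublocale M: module R M
  unfolding M_def by (rule quotient_module_module[OF poly_ring_cring id.ideal_axioms])

lemma carrier_Quot: "carrier (R Quot I) = rclass ` polys n"
  by (auto simp: FactRing_def A_RCOSETS_def' rclass_def)

lemma carrier_M: "carrier M = rclass ` polys n"
  by (simp add: M_def quotient_module_simps carrier_Quot)

lemma rclass_eq: assumes "a \<in> polys n" "b \<in> polys n" shows "rclass a = rclass b \<longleftrightarrow> a - b \<in> I"
proof -
  have e: "rclass a = {i + a | i. i \<in> I}" for a by (auto simp: rclass_def a_r_coset_def')
  show ?thesis
  proof
    assume "rclass a = rclass b"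
    moreover have "a \<in> rclass a" unfolding e using pideal_zero[OF I] by force
    ultimately obtain i where "i \<in> I" "a = i + b" unfolding e by blast
    then show "a - b \<in> I" by simp
  next
    assume ab: "a - b \<in> I"
    show "rclass a = rclass b" unfolding e
    proof (intro Set.set_eqI iffI)
      fix x assume "x \<in> {i + a | i. i \<in> I}"
      then obtain i where "i \<in> I" "x = i + a" by blast
      then have "x = (i + (a - b)) + b" "i + (a - b) \<in> I" using pideal_add[OF I _ ab] by auto
      then show "x \<in> {i + b | i. i \<in> I}" by blast
    next
      fix x assume "x \<in> {i + b | i. i \<in> I}"
      then obtain i where "i \<in> I" "x = i + b" by blast
      then have "x = (i - (a - b)) + a" "i - (a - b) \<in> I" using pideal_diff[OF I _ ab] by auto
      then show "x \<in> {i + a | i. i \<in> I}" by blast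
    qed
  qed
qed

lemma rclass_add: "a \<in> polys n \<Longrightarrow> b \<in> polys n \<Longrightarrow> rclass a \<oplus>\<^bsub>M\<^esub> rclass b = rclass (a + b)"
  using h.hom_add[of a b] by (simp add: M_def quotient_module_simps rclass_def)

lemma rclass_smult: "a \<in> polys n \<Longrightarrow> b \<in> polys n \<Longrightarrow> a \<odot>\<^bsub>M\<^esub> rclass b = rclass (a * b)"
  using h.hom_mult[of a b] by (simp add: M_def quotient_module_simps rclass_def)

lemma rclass_zero_M: "\<zero>\<^bsub>M\<^esub> = rclass 0"
  using h.hom_zero by (simp add: M_def quotient_module_simps rclass_def)

lemma rclass_zero: "\<zero>\<^bsub>R Quot I\<^esub> = rclass 0"
  using h.hom_zero by (simp add: rclass_def)

lemma seq_submodule_Nil: "seq_submodule R M [] = {\<zero>\<^bsub>M\<^esub>}"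
  by (auto simp: seq_submodule_def intro!: exI[of _ "\<lambda>_. undefined"])

lemma seq_submodule_snoc:
  assumes rs: "set (rs @ [r]) \<subseteq> polys n"
  shows "seq_submodule R M (rs @ [r]) = {s \<oplus>\<^bsub>M\<^esub> (r \<odot>\<^bsub>M\<^esub> y) | s y. s \<in> seq_submodule R M rs \<and> y \<in> carrier M}"
proof -
  let ?k = "length rs"
  have rR: "r \<in> carrier R" using rs by auto
  have sm: "rs ! j \<odot>\<^bsub>M\<^esub> y j \<in> carrier M" if "y \<in> {..<?k} \<rightarrow> carrier M" "j < ?k" for y j
    using that rs by (intro M.smult_closed) (auto simp: subset_iff)
  have fs: "(\<Oplus>\<^bsub>M\<^esub>j\<in>{..<length (rs @ [r])}. (rs @ [r]) ! j \<odot>\<^bsub>M\<^esub> y j) =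
      (\<Oplus>\<^bsub>M\<^esub>j\<in>{..<?k}. rs ! j \<odot>\<^bsub>M\<^esub> y j) \<oplus>\<^bsub>M\<^esub> (r \<odot>\<^bsub>M\<^esub> y ?k)"
    if y: "y \<in> {..<?k} \<rightarrow> carrier M" "y ?k \<in> carrier M" for y
  proof -
    have "(\<Oplus>\<^bsub>M\<^esub>j\<in>{..<?k}. (rs @ [r]) ! j \<odot>\<^bsub>M\<^esub> y j) = (\<Oplus>\<^bsub>M\<^esub>j\<in>{..<?k}. rs ! j \<odot>\<^bsub>M\<^esub> y j)"
      by (rule M.finsum_cong') (use sm[OF y(1)] in \<open>auto simp: nth_append\<close>)
    moreover have "(\<Oplus>\<^bsub>M\<^esub>j\<in>insert ?k {..<?k}. (rs @ [r]) ! j \<odot>\<^bsub>M\<^esub> y j) =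
      ((rs @ [r]) ! ?k \<odot>\<^bsub>M\<^esub> y ?k) \<oplus>\<^bsub>M\<^esub> (\<Oplus>\<^bsub>M\<^esub>j\<in>{..<?k}. (rs @ [r]) ! j \<odot>\<^bsub>M\<^esub> y j)"
      by (rule M.finsum_insert) (use sm[OF y(1)] M.smult_closed[OF rR y(2)] in \<open>auto simp: nth_append\<close>)
    moreover have "(\<Oplus>\<^bsub>M\<^esub>j\<in>{..<?k}. rs ! j \<odot>\<^bsub>M\<^esub> y j) \<in> carrier M"
      by (rule M.finsum_closed) (use sm[OF y(1)] in auto)
    moreover have "{..<length (rs @ [r])} = insert ?k {..<?k}" by auto
    ultimately show ?thesis using M.smult_closed[OF rR y(2)] by (simp add: M.M.add.m_comm)
  qed
  show ?thesis
  proof (intro Set.set_eqI iffI)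
    fix x assume "x \<in> seq_submodule R M (rs @ [r])"
    then obtain y where y: "x = (\<Oplus>\<^bsub>M\<^esub>j\<in>{..<length (rs @ [r])}. (rs @ [r]) ! j \<odot>\<^bsub>M\<^esub> y j)"
      "y \<in> {..<length (rs @ [r])} \<rightarrow> carrier M" unfolding seq_submodule_def by blast
    then have y': "y \<in> {..<?k} \<rightarrow> carrier M" "y ?k \<in> carrier M" by (auto simp: Pi_iff)
    then show "x \<in> {s \<oplus>\<^bsub>M\<^esub> (r \<odot>\<^bsub>M\<^esub> y) | s y. s \<in> seq_submodule R M rs \<and> y \<in> carrier M}"
      unfolding y(1) fs[OF y'] unfolding seq_submodule_def by blast
  next
    fix x assume "x \<in> {s \<oplus>\<^bsub>M\<^esub> (r \<odot>\<^bsub>M\<^esub> y) | s y. s \<in> seq_submodule R M rs \<and> y \<in> carrier M}"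
    then obtain z y where zy: "x = (\<Oplus>\<^bsub>M\<^esub>j\<in>{..<?k}. rs ! j \<odot>\<^bsub>M\<^esub> z j) \<oplus>\<^bsub>M\<^esub> (r \<odot>\<^bsub>M\<^esub> y)"
      "z \<in> {..<?k} \<rightarrow> carrier M" "y \<in> carrier M" unfolding seq_submodule_def by blast
    define w where "w = z(?k := y)"
    have w: "w \<in> {..<?k} \<rightarrow> carrier M" "w ?k \<in> carrier M" using zy by (auto simp: w_def)
    have "(\<Oplus>\<^bsub>M\<^esub>j\<in>{..<?k}. rs ! j \<odot>\<^bsub>M\<^esub> w j) = (\<Oplus>\<^bsub>M\<^esub>j\<in>{..<?k}. rs ! j \<odot>\<^bsub>M\<^esub> z j)"
      by (rule M.finsum_cong') (use sm[OF zy(2)] in \<open>auto simp: w_def\<close>)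
    then have "x = (\<Oplus>\<^bsub>M\<^esub>j\<in>{..<length (rs @ [r])}. (rs @ [r]) ! j \<odot>\<^bsub>M\<^esub> w j)"
      unfolding fs[OF w] zy(1) by (simp add: w_def)
    moreover have "w \<in> {..<length (rs @ [r])} \<rightarrow> carrier M" using w by (auto simp: Pi_iff less_Suc_eq)
    ultimately show "x \<in> seq_submodule R M (rs @ [r])" unfolding seq_submodule_def by blast
  qed
qed

lemma adjoins_facts: "set rs \<subseteq> polys n \<Longrightarrow> pideal n (adjoins n I rs) \<and> I \<subseteq> adjoins n I rs"
proof (induction rs rule: rev_induct)
  case (snoc r rs)
  then show ?case using adjoin_pideal[of n "adjoins n I rs" r] adjoin_sup[of "adjoins n I rs" n r] by auto
qed (use I in simp)

text \<open>Replaces submodules of R/I by ideals of R containing I, on which the Koszul arguments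
  work.\<close>

lemma seq_submodule_adjoins: "set rs \<subseteq> polys n \<Longrightarrow> seq_submodule R M rs = rclass ` adjoins n I rs"
proof (induction rs rule: rev_induct)
  case Nil
  have "rclass a = rclass 0" if "a \<in> I" for a using that rclass_eq[of a 0] pideal_subsp[OF I that] by simp
  then have "rclass ` I = (\<lambda>_. rclass 0) ` I" by (rule image_cong[OF refl])
  also have "\<dots> = {rclass 0}" using pideal_zero[OF I] by blast
  finally show ?case by (simp add: seq_submodule_Nil rclass_zero_M)
next
  case (snoc r rs)
  let ?J = "adjoins n I rs"
  have J: "pideal n ?J" using adjoins_facts snoc by auto
  have r: "r \<in> polys n" using snoc by auto
  have IH: "seq_submodule R M rs = rclass ` ?J" using snoc by auto
  have *: "rclass a \<oplus>\<^bsub>M\<^esub> (r \<odot>\<^bsub>M\<^esub> rclass b) = rclass (a + r * b)" if "a \<in> ?J" "b \<in> polys n" for a b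
    using that pideal_subsp[OF J] r by (simp add: rclass_smult rclass_add polys_mult)
  show ?case
    unfolding seq_submodule_snoc[OF snoc.prems] IH carrier_M adjoins_snoc
  proof (intro Set.set_eqI iffI)
    fix x assume "x \<in> {s \<oplus>\<^bsub>M\<^esub> (r \<odot>\<^bsub>M\<^esub> y) |s y. s \<in> rclass ` ?J \<and> y \<in> rclass ` polys n}"
    then obtain a b where ab: "x = rclass a \<oplus>\<^bsub>M\<^esub> (r \<odot>\<^bsub>M\<^esub> rclass b)" "a \<in> ?J" "b \<in> polys n" by blast
    then have "x = rclass (a + r * b)" using * by simp
    then show "x \<in> rclass ` adjoin n ?J r" using adjI[OF ab(2,3)] by blast
  next
    fix x assume "x \<in> rclass ` adjoin n ?J r"
    then obtain a b where ab: "x = rclass (a + r * b)" "a \<in> ?J" "b \<in> polys n" by (auto simp: adjoin_def)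
    then have "x = rclass a \<oplus>\<^bsub>M\<^esub> (r \<odot>\<^bsub>M\<^esub> rclass b)" using * by simp
    then show "x \<in> {s \<oplus>\<^bsub>M\<^esub> (r \<odot>\<^bsub>M\<^esub> y) |s y. s \<in> rclass ` ?J \<and> y \<in> rclass ` polys n}" using ab by blast
  qed
qed

lemma rclass_in_adjoins:
  assumes "set rs \<subseteq> polys n" "x \<in> polys n"
  shows "rclass x \<in> seq_submodule R M rs \<longleftrightarrow> x \<in> adjoins n I rs"
proof -
  note J = adjoins_facts[OF assms(1), THEN conjunct1] adjoins_facts[OF assms(1), THEN conjunct2]
  show ?thesis
  proof
    assume "rclass x \<in> seq_submodule R M rs"
    then obtain y where y: "y \<in> adjoins n I rs" "rclass x = rclass y" using seq_submodule_adjoins[OF assms(1)] by auto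
    then have "x - y \<in> adjoins n I rs" using rclass_eq[OF assms(2) pideal_subsp[OF J(1) y(1)]] J(2) by blast
    then have "(x - y) + y \<in> adjoins n I rs" using y(1) by (rule pideal_add[OF J(1)])
    then show "x \<in> adjoins n I rs" by simp
  qed (use seq_submodule_adjoins[OF assms(1)] in simp)
qed

text \<open>The ideals built from I and elements of the maximal ideal stay inside it and miss 1, so
  the quotient demanded to be nonzero by \<open>regular_sequence\<close> is nonzero.\<close>

lemma regular_sequence_iff:
  assumes IM: "I \<subseteq> maxid n" and rs: "set rs \<subseteq> maxid n"
  shows "regular_sequence R M rs \<longleftrightarrow> regseq n I rs"
proof -
  have rR: "set rs \<subseteq> polys n" using rs pideal_subsp[OF maxid_pideal] by blast
  have "adjoins n I rs \<subseteq> maxid n" using rs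
  proof (induction rs rule: rev_induct)
    case (snoc r rs)
    then show ?case using adjoin_maxid[of "adjoins n I rs" n r] by simp
  qed (use IM in simp)
  then have "1 \<notin> adjoins n I rs" using one_notin_maxid by blast
  then have ne: "seq_submodule R M rs \<noteq> carrier M"
    using rclass_in_adjoins[OF rR polys_one] carrier_M by auto
  have "(\<forall>x\<in>carrier M. rs ! k \<odot>\<^bsub>M\<^esub> x \<in> seq_submodule R M (take k rs) \<longrightarrow> x \<in> seq_submodule R M (take k rs))
    \<longleftrightarrow> nonzerodiv n (adjoins n I (take k rs)) (rs ! k)" if k: "k < length rs" for k
  proof -
    have tk: "set (take k rs) \<subseteq> polys n" using rR set_take_subset[of k rs] by blast
    have rk: "rs ! k \<in> polys n" using k rR by (auto simp: subset_iff)
    show ?thesis unfolding carrier_M nonzerodiv_def using rclass_in_adjoins[OF tk] rclass_smult[OF rk] polys_mult[OF rk] by auto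
  qed
  then show ?thesis using rs rR ne by (auto simp: regular_sequence_def regseq_def)
qed

lemma depth_eq:
  assumes IM: "I \<subseteq> maxid n" and q: "\<not> kexact n I q" "\<And>i. q < i \<Longrightarrow> kexact n I i"
  shows "depth R (irrelevant_ideal n) M = n - q"
proof -
  have mx: "maximal_regular_sequence_in R (irrelevant_ideal n) M rs \<longleftrightarrow>
      regseq n I rs \<and> (\<forall>r\<in>maxid n. \<not> regseq n I (rs @ [r]))" for rs
  proof (cases "set rs \<subseteq> maxid n")
    case True
    then have "regular_sequence R M (rs @ [r]) \<longleftrightarrow> regseq n I (rs @ [r])" if "r \<in> maxid n" for r
      using regular_sequence_iff[OF IM, of "rs @ [r]"] that by simp
    then show ?thesis unfolding maximal_regular_sequence_in_def irrelevant_ideal_eq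
      using True regular_sequence_iff[OF IM True] by blast
  next
    case False
    then show ?thesis by (simp add: maximal_regular_sequence_in_def irrelevant_ideal_eq regseq_def)
  qed
  have "length rs = n - q" if "regseq n I rs" "\<forall>r\<in>maxid n. \<not> regseq n I (rs @ [r])" for rs
    using maximal_regseq_length[OF I IM q that(1)] that(2) by linarith
  moreover obtain rs where "regseq n I rs" "\<forall>r\<in>maxid n. \<not> regseq n I (rs @ [r])"
    using maximal_regseq_exists[OF I IM q] by blast
  ultimately show ?thesis unfolding depth_def mx by (intro the_equality) blast+
qed

end

section \<open>Bases of quotients\<close>

definition subsp :: "('z \<Rightarrow> 'k::field) set \<Rightarrow> bool" where
  "subsp L \<longleftrightarrow> (\<lambda>_. 0) \<in> L \<and> (\<forall>x\<in>L. \<forall>y\<in>L. \<forall>c. (\<lambda>z. x z + c * y z) \<in> L)"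

definition linmap :: "(('z \<Rightarrow> 'k::field) \<Rightarrow> ('y \<Rightarrow> 'k)) \<Rightarrow> bool" where
  "linmap P \<longleftrightarrow> (\<forall>x y c. P (\<lambda>z. x z + c * y z) = (\<lambda>z. P x z + c * P y z))"

lemma subsp_zero: "subsp L \<Longrightarrow> (\<lambda>_. 0) \<in> L"
  and subsp_comb: "subsp L \<Longrightarrow> x \<in> L \<Longrightarrow> y \<in> L \<Longrightarrow> (\<lambda>z. x z + c * y z) \<in> L"
  by (auto simp: subsp_def)

lemma subsp_add: "subsp L \<Longrightarrow> x \<in> L \<Longrightarrow> y \<in> L \<Longrightarrow> (\<lambda>z. x z + y z) \<in> L"
  using subsp_comb[of L x y 1] by simp

lemma subsp_diff: "subsp L \<Longrightarrow> x \<in> L \<Longrightarrow> y \<in> L \<Longrightarrow> (\<lambda>z. x z - y z) \<in> L"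
  using subsp_comb[of L x y "-1"] by simp

lemma subsp_scale: "subsp L \<Longrightarrow> x \<in> L \<Longrightarrow> (\<lambda>z. c * x z) \<in> L"
  using subsp_comb[OF _ subsp_zero, of L x c] subsp_comb[of L "\<lambda>_. 0" x c] subsp_zero[of L] by simp

lemma subsp_sum:
  assumes "subsp L" "\<And>j. j \<in> J \<Longrightarrow> w j \<in> L" shows "(\<lambda>z. \<Sum>j\<in>J. c j * w j z) \<in> L"
  using assms(2)
proof (induction J rule: infinite_finite_induct)
  case (insert j J)
  have "(\<lambda>z. (\<Sum>j\<in>J. c j * w j z) + c j * w j z) \<in> L"
    using insert by (intro subsp_comb[OF assms(1)]) auto
  then show ?case using insert by (simp add: add.commute)
qed (use subsp_zero[OF assms(1)] in auto)

lemma subsp_sum1: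
  assumes "subsp L" "\<And>j. j \<in> J \<Longrightarrow> w j \<in> L" shows "(\<lambda>z. \<Sum>j\<in>J. w j z) \<in> L"
  using subsp_sum[of L J w "\<lambda>_. 1"] assms by simp

lemma linmap_comb: "linmap P \<Longrightarrow> P (\<lambda>z. x z + c * y z) = (\<lambda>z. P x z + c * P y z)"
  by (simp add: linmap_def)

lemma linmap_zero: "linmap P \<Longrightarrow> P (\<lambda>_. 0) = (\<lambda>_. 0)"
  using linmap_comb[of P "\<lambda>_. 0" "-1" "\<lambda>_. 0"] by simp

lemma linmap_diff: "linmap P \<Longrightarrow> P (\<lambda>z. x z - y z) = (\<lambda>z. P x z - P y z)"
  using linmap_comb[of P x "-1" y] by simp

lemma linmap_sum:
  assumes "linmap P" shows "P (\<lambda>z. \<Sum>j\<in>J. c j * w j z) = (\<lambda>z. \<Sum>j\<in>J. c j * P (w j) z)"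
proof (induction J rule: infinite_finite_induct)
  case (insert j J)
  have "P (\<lambda>z. (\<Sum>j\<in>J. c j * w j z) + c j * w j z) = (\<lambda>z. (\<Sum>j\<in>J. c j * P (w j) z) + c j * P (w j) z)"
    unfolding linmap_comb[OF assms] insert.IH ..
  then show ?case using insert by (simp add: add.commute)
qed (use linmap_zero[OF assms] in auto)

text \<open>The family \<open>b\<close> is a basis of \<open>A\<close> modulo \<open>B\<close>.\<close>

definition qbasis :: "'j set \<Rightarrow> ('j \<Rightarrow> 'z \<Rightarrow> 'k::field) \<Rightarrow> ('z \<Rightarrow> 'k) set \<Rightarrow> ('z \<Rightarrow> 'k) set \<Rightarrow> bool" where
  "qbasis J b A B \<longleftrightarrow> finite J \<and> (\<forall>j\<in>J. b j \<in> A) \<and>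
     (\<forall>x\<in>A. \<exists>c. (\<lambda>z. x z - (\<Sum>j\<in>J. c j * b j z)) \<in> B) \<and>
     (\<forall>c. (\<lambda>z. \<Sum>j\<in>J. c j * b j z) \<in> B \<longrightarrow> (\<forall>j\<in>J. c j = 0))"

lemma qbasisD:
  assumes "qbasis J b A B"
  shows "finite J" "j \<in> J \<Longrightarrow> b j \<in> A" "x \<in> A \<Longrightarrow> \<exists>c. (\<lambda>z. x z - (\<Sum>j\<in>J. c j * b j z)) \<in> B"
    "(\<lambda>z. \<Sum>j\<in>J. c j * b j z) \<in> B \<Longrightarrow> j \<in> J \<Longrightarrow> c j = 0"
  using assms unfolding qbasis_def by blast+

lemma qbasis_empty_iff:
  assumes "qbasis J b A B" "subsp B" "subsp A" "B \<subseteq> A"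
  shows "J = {} \<longleftrightarrow> A \<subseteq> B"
proof
  assume J: "J = {}"
  show "A \<subseteq> B"
  proof
    fix x assume "x \<in> A"
    then show "x \<in> B" using qbasisD(3)[OF assms(1), of x] J by simp
  qed
next
  assume AB: "A \<subseteq> B"
  show "J = {}"
  proof (rule ccontr)
    assume "J \<noteq> {}"
    then obtain j where j: "j \<in> J" by blast
    have "(\<lambda>z. \<Sum>i\<in>J. 1 * b i z) \<in> B" using AB qbasisD(2)[OF assms(1)] by (intro subsp_sum[OF assms(2)]) blast
    then have "(1::'c) = 0" using qbasisD(4)[OF assms(1), of "\<lambda>_. 1" j] j by blast
    then show False by simp
  qed
qed

text \<open>Both A/B and A'/B' are L modulo the same subspace, the common preimage of B and B'. A
  basis is lifted to L along P and pushed down along Q.\<close>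

lemma qbasis_transfer:
  assumes q: "qbasis J b A B" and P: "linmap P" and Q: "linmap Q" and L: "subsp L"
    and PA: "\<And>w. w \<in> L \<Longrightarrow> P w \<in> A" and Ponto: "\<And>a. a \<in> A \<Longrightarrow> \<exists>w\<in>L. P w = a"
    and QA: "\<And>w. w \<in> L \<Longrightarrow> Q w \<in> A'" and Qonto: "\<And>a. a \<in> A' \<Longrightarrow> \<exists>w\<in>L. Q w = a"
    and PQ: "\<And>w. w \<in> L \<Longrightarrow> P w \<in> B \<longleftrightarrow> Q w \<in> B'"
  shows "\<exists>b'. qbasis J b' A' B'"
proof -
  have "\<forall>j\<in>J. \<exists>w\<in>L. P w = b j" using Ponto qbasisD(2)[OF q] by blast
  then obtain w where w: "\<And>j. j \<in> J \<Longrightarrow> w j \<in> L \<and> P (w j) = b j" by metis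
  have sL: "(\<lambda>z. \<Sum>j\<in>J. c j * w j z) \<in> L" for c using w by (intro subsp_sum[OF L]) blast
  have Ps: "P (\<lambda>z. \<Sum>j\<in>J. c j * w j z) = (\<lambda>z. \<Sum>j\<in>J. c j * b j z)" for c
    unfolding linmap_sum[OF P] using w by (intro ext sum.cong) auto
  have "qbasis J (\<lambda>j. Q (w j)) A' B'"
    unfolding qbasis_def
  proof (intro conjI ballI allI impI)
    show "finite J" by (rule qbasisD(1)[OF q])
    show "Q (w j) \<in> A'" if "j \<in> J" for j using QA w that by blast
    fix x assume "x \<in> A'"
    then obtain y where y: "y \<in> L" "Q y = x" using Qonto by blast
    obtain c where c: "(\<lambda>z. P y z - (\<Sum>j\<in>J. c j * b j z)) \<in> B" using qbasisD(3)[OF q PA[OF y(1)]] by blast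
    let ?v = "\<lambda>z. y z - (\<Sum>j\<in>J. c j * w j z)"
    have v: "?v \<in> L" by (rule subsp_diff[OF L y(1) sL])
    have "P ?v = (\<lambda>z. P y z - (\<Sum>j\<in>J. c j * b j z))" unfolding linmap_diff[OF P] Ps ..
    then have "Q ?v \<in> B'" using PQ[OF v] c by simp
    moreover have "Q ?v = (\<lambda>z. x z - (\<Sum>j\<in>J. c j * Q (w j) z))" unfolding linmap_diff[OF Q] linmap_sum[OF Q] y(2) ..
    ultimately show "\<exists>c. (\<lambda>z. x z - (\<Sum>j\<in>J. c j * Q (w j) z)) \<in> B'" by (intro exI[of _ c]) simp
  next
    fix c j assume c: "(\<lambda>z. \<Sum>j\<in>J. c j * Q (w j) z) \<in> B'" and j: "j \<in> J"
    from c have "Q (\<lambda>z. \<Sum>j\<in>J. c j * w j z) \<in> B'" unfolding linmap_sum[OF Q] .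
    then have "(\<lambda>z. \<Sum>j\<in>J. c j * b j z) \<in> B" using PQ[OF sL, of c] unfolding Ps by blast
    then show "c j = 0" using j by (rule qbasisD(4)[OF q])
  qed
  then show ?thesis by (intro exI[of _ "\<lambda>j. Q (w j)"])
qed

lemma qbasis_reindex:
  assumes q: "qbasis J b A B" and h: "bij_betw h J' J"
  shows "qbasis J' (\<lambda>i. b (h i)) A B"
proof -
  have s: "(\<Sum>i\<in>J'. c (h i) * b (h i) z) = (\<Sum>j\<in>J. c j * b j z)" for c z
    by (rule sum.reindex_bij_betw[OF h, of "\<lambda>j. c j * b j z"])
  show ?thesis unfolding qbasis_def
  proof (intro conjI ballI allI impI)
    show "finite J'" using qbasisD(1)[OF q] bij_betw_finite[OF h] by simp
    show "b (h i) \<in> A" if "i \<in> J'" for i using qbasisD(2)[OF q] bij_betwE[OF h] that by blast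
    fix x assume "x \<in> A"
    then obtain c where "(\<lambda>z. x z - (\<Sum>j\<in>J. c j * b j z)) \<in> B" using qbasisD(3)[OF q] by blast
    then show "\<exists>c. (\<lambda>z. x z - (\<Sum>j\<in>J'. c j * b (h j) z)) \<in> B"
      unfolding s[symmetric] by (intro exI[of _ "\<lambda>i. c (h i)"])
  next
    fix c i assume c: "(\<lambda>z. \<Sum>j\<in>J'. c j * b (h j) z) \<in> B" and i: "i \<in> J'"
    define d where "d j = c (inv_into J' h j)" for j
    have d: "d (h i) = c i" if "i \<in> J'" for i
      using that h by (simp add: d_def bij_betw_def)
    have "(\<Sum>j\<in>J'. c j * b (h j) z) = (\<Sum>j\<in>J. d j * b j z)" for z
      unfolding s[symmetric] using d by (intro sum.cong) auto
    then have "(\<lambda>z. \<Sum>j\<in>J. d j * b j z) \<in> B" using c by simp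
    moreover have "h i \<in> J" using bij_betwE[OF h] i by blast
    ultimately have "d (h i) = 0" by (rule qbasisD(4)[OF q])
    then show "c i = 0" using d[OF i] by simp
  qed
qed

text \<open>Gaussian elimination: an unknown i with nonzero coefficient in equation k is removed
  from the other equations and then determined by equation k.\<close>

lemma underdetermined_system:
  fixes m :: "'i \<Rightarrow> 'j \<Rightarrow> 'k::field"
  assumes "finite J'" "finite J" "card J' < card J"
  shows "\<exists>x. (\<exists>j\<in>J. x j \<noteq> 0) \<and> (\<forall>k\<in>J'. (\<Sum>j\<in>J. x j * m j k) = 0)"
  using assms
proof (induction J' arbitrary: J m)
  case empty
  then obtain j where "j \<in> J" by fastforce
  then show ?case by (intro exI[of _ "\<lambda>_. 1"]) auto
next
  case (insert k J')
  show ?case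
  proof (cases "\<forall>j\<in>J. m j k = 0")
    case True
    obtain x where "\<exists>j\<in>J. x j \<noteq> 0" "\<forall>l\<in>J'. (\<Sum>j\<in>J. x j * m j l) = 0"
      using insert.IH[of J m] insert.prems insert.hyps by auto
    then show ?thesis using True by (intro exI[of _ x]) auto
  next
    case False
    then obtain i where i: "i \<in> J" "m i k \<noteq> 0" by blast
    let ?J = "J - {i}"
    define m' where "m' j l = m j l - m j k / m i k * m i l" for j l
    have "card J' < card ?J" using insert.prems insert.hyps i by simp
    then obtain x where x: "\<exists>j\<in>?J. x j \<noteq> 0" "\<And>l. l \<in> J' \<Longrightarrow> (\<Sum>j\<in>?J. x j * m' j l) = 0"
      using insert.IH[of ?J m'] insert.prems by auto
    define s where "s = - (\<Sum>j\<in>?J. x j * m j k) / m i k"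
    define y where "y = x(i := s)"
    have sum: "(\<Sum>j\<in>J. y j * m j l) = s * m i l + (\<Sum>j\<in>?J. x j * m j l)" for l
      using insert.prems(1) i(1) by (simp add: sum.remove y_def)
    have "(\<Sum>j\<in>J. y j * m j l) = 0" if "l \<in> insert k J'" for l
    proof (cases "l = k")
      case True
      then show ?thesis unfolding sum using i(2) by (simp add: s_def)
    next
      case False
      then have "0 = (\<Sum>j\<in>?J. x j * m' j l)" using x(2) that by simp
      also have "\<dots> = (\<Sum>j\<in>?J. x j * m j l - x j * m j k * (m i l / m i k))"
        by (intro sum.cong) (auto simp: m'_def right_diff_distrib)
      also have "\<dots> = (\<Sum>j\<in>?J. x j * m j l) + s * m i l"
      proof -
        have "(\<Sum>j\<in>?J. x j * m j k * (m i l / m i k)) = (\<Sum>j\<in>?J. x j * m j k) * (m i l / m i k)"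
          by (rule sum_distrib_right[symmetric])
        then show ?thesis by (simp add: sum_subtractf s_def)
      qed
      finally show ?thesis unfolding sum by (simp add: add.commute)
    qed
    moreover have "\<exists>j\<in>J. y j \<noteq> 0" using x(1) by (auto simp: y_def)
    ultimately show ?thesis by (intro exI[of _ y]) blast
  qed
qed

text \<open>Expressing each b j through b' modulo B gives \<open>card J'\<close> equations in
  \<open>card J\<close> unknowns; a nontrivial solution would be a relation among the b j modulo
  B.\<close>

lemma qbasis_card_le:
  assumes q: "qbasis J b A B" and q': "qbasis J' b' A B" and B: "subsp B"
  shows "card J \<le> card J'"
proof (rule ccontr)
  assume "\<not> card J \<le> card J'"
  have "\<forall>j\<in>J. \<exists>c. (\<lambda>z. b j z - (\<Sum>k\<in>J'. c k * b' k z)) \<in> B"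
    using qbasisD(3)[OF q'] qbasisD(2)[OF q] by blast
  then obtain m where m: "\<And>j. j \<in> J \<Longrightarrow> (\<lambda>z. b j z - (\<Sum>k\<in>J'. m j k * b' k z)) \<in> B" by metis
  obtain x where x: "\<exists>j\<in>J. x j \<noteq> 0" "\<forall>k\<in>J'. (\<Sum>j\<in>J. x j * m j k) = 0"
    using underdetermined_system[OF qbasisD(1)[OF q'] qbasisD(1)[OF q], of m] \<open>\<not> card J \<le> card J'\<close> by auto
  have "(\<lambda>z. \<Sum>j\<in>J. x j * (b j z - (\<Sum>k\<in>J'. m j k * b' k z))) \<in> B"
    by (rule subsp_sum[OF B m])
  moreover have "(\<Sum>j\<in>J. x j * (b j z - (\<Sum>k\<in>J'. m j k * b' k z))) = (\<Sum>j\<in>J. x j * b j z)" for z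
  proof -
    have "(\<Sum>j\<in>J. x j * (\<Sum>k\<in>J'. m j k * b' k z)) = (\<Sum>j\<in>J. \<Sum>k\<in>J'. x j * m j k * b' k z)"
      by (simp add: sum_distrib_left mult.assoc)
    also have "\<dots> = (\<Sum>k\<in>J'. (\<Sum>j\<in>J. x j * m j k) * b' k z)"
      by (subst sum.swap) (simp add: sum_distrib_right)
    also have "\<dots> = 0" using x(2) by simp
    finally show ?thesis by (simp add: right_diff_distrib sum_subtractf)
  qed
  ultimately have "(\<lambda>z. \<Sum>j\<in>J. x j * b j z) \<in> B" by simp
  then show False using qbasisD(4)[OF q] x(1) by blast
qed

lemma qbasis_card: "qbasis J b A B \<Longrightarrow> qbasis J' b' A B \<Longrightarrow> subsp B \<Longrightarrow> card J = card J'"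
  by (intro antisym) (rule qbasis_card_le; assumption)+

text \<open>Induction on a finite set carrying all supports. Passing to functions that vanish at x
  changes the quotient only if A, but not B, has a function nonzero at x; then one basis vector is
  added.\<close>

lemma qbasis_exists:
  fixes A B :: "('z \<Rightarrow> 'k::field) set"
  assumes "finite X" "subsp A" "subsp B" "B \<subseteq> A" "\<And>f z. f \<in> A \<Longrightarrow> f z \<noteq> 0 \<Longrightarrow> z \<in> X"
  shows "\<exists>(r::nat) b. qbasis {..<r} b A B"
  using assms
proof (induction X arbitrary: A B)
  case empty
  have "x = (\<lambda>_. 0)" if "x \<in> A" for x using empty(4)[OF that] by auto
  then have "qbasis {..<0::nat} (\<lambda>_ _. 0) A B" using subsp_zero[OF empty(2)] by (auto simp: qbasis_def)
  then show ?case by blast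
next
  case (insert x X)
  let ?A = "{f \<in> A. f x = 0}" and ?B = "{f \<in> B. f x = 0}"
  have "subsp ?A" "subsp ?B" using insert.prems(1,2) by (auto simp: subsp_def)
  moreover have "?B \<subseteq> ?A" using insert.prems(3) by blast
  moreover have "z \<in> X" if "f \<in> ?A" "f z \<noteq> 0" for f z using insert.prems(4)[of f z] that by auto
  ultimately obtain r :: nat and b where q: "qbasis {..<r} b ?A ?B" using insert.IH[of ?A ?B] by blast
  have bx: "b j x = 0" if "j < r" for j using qbasisD(2)[OF q, of j] that by auto
  have sx: "(\<Sum>j<r. c j * b j x) = 0" for c using bx by simp
  have indep: "(\<lambda>z. \<Sum>j<r. c j * b j z) \<in> B \<Longrightarrow> j < r \<Longrightarrow> c j = 0" for c j
    using qbasisD(4)[OF q, of c j] sx by simp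
  show ?case
  proof (cases "\<exists>b0\<in>B. b0 x \<noteq> 0")
    case True
    then obtain b0 where b0: "b0 \<in> B" "b0 x \<noteq> 0" by blast
    have "qbasis {..<r} b A B" unfolding qbasis_def
    proof (intro conjI ballI allI impI)
      show "b j \<in> A" if "j \<in> {..<r}" for j using qbasisD(2)[OF q that] by blast
      fix y assume y: "y \<in> A"
      define t where "t = y x / b0 x"
      have "(\<lambda>z. y z + (- t) * b0 z) \<in> ?A"
        using subsp_comb[OF insert.prems(1) y, of b0 "- t"] b0 insert.prems(3) by (auto simp: t_def)
      then obtain c where c: "(\<lambda>z. (y z + (- t) * b0 z) - (\<Sum>j<r. c j * b j z)) \<in> ?B" using qbasisD(3)[OF q] by blast
      then have "(\<lambda>z. ((y z + (- t) * b0 z) - (\<Sum>j<r. c j * b j z)) + t * b0 z) \<in> B"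
        by (intro subsp_comb[OF insert.prems(2)] b0) blast
      moreover have "((y z + (- t) * b0 z) - (\<Sum>j<r. c j * b j z)) + t * b0 z = y z - (\<Sum>j<r. c j * b j z)" for z by simp
      ultimately have "(\<lambda>z. y z - (\<Sum>j<r. c j * b j z)) \<in> B" by (simp only:)
      then show "\<exists>c. (\<lambda>z. y z - (\<Sum>j<r. c j * b j z)) \<in> B" by (intro exI[of _ c])
    qed (use indep in auto)
    then show ?thesis by blast
  next
    case False
    then have BBx: "f x = 0" if "f \<in> B" for f using that by blast
    then have BB: "?B = B" by blast
    show ?thesis
    proof (cases "\<exists>a0\<in>A. a0 x \<noteq> 0")
      case True
      then obtain a0 where a0: "a0 \<in> A" "a0 x \<noteq> 0" by blast
      define b' where "b' = b(r := a0)"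
      have sum: "(\<Sum>j<Suc r. c j * b' j z) = (\<Sum>j<r. c j * b j z) + c r * a0 z" for c z by (simp add: b'_def)
      have "qbasis {..<Suc r} b' A B" unfolding qbasis_def
      proof (intro conjI ballI allI impI)
        show "b' j \<in> A" if "j \<in> {..<Suc r}" for j using qbasisD(2)[OF q, of j] a0 that by (auto simp: b'_def)
        fix y assume y: "y \<in> A"
        define t where "t = y x / a0 x"
        have "(\<lambda>z. y z + (- t) * a0 z) \<in> ?A"
          using subsp_comb[OF insert.prems(1) y a0(1), of "- t"] a0 by (auto simp: t_def)
        then obtain c where c: "(\<lambda>z. (y z + (- t) * a0 z) - (\<Sum>j<r. c j * b j z)) \<in> ?B" using qbasisD(3)[OF q] by blast
        have "(y z + (- t) * a0 z) - (\<Sum>j<r. c j * b j z) = y z - (\<Sum>j<Suc r. (c(r := t)) j * b' j z)" for z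
          unfolding sum by simp
        then have "(\<lambda>z. y z - (\<Sum>j<Suc r. (c(r := t)) j * b' j z)) \<in> B" using c by (simp only: mem_Collect_eq)
        then show "\<exists>c. (\<lambda>z. y z - (\<Sum>j<Suc r. c j * b' j z)) \<in> B" by (intro exI[of _ "c(r := t)"])
      next
        fix c j assume c: "(\<lambda>z. \<Sum>j<Suc r. c j * b' j z) \<in> B" and j: "j \<in> {..<Suc r}"
        have "(\<Sum>j<Suc r. c j * b' j x) = 0" using BBx[OF c] .
        then have cr: "c r = 0" unfolding sum sx using a0 by simp
        then have "(\<lambda>z. \<Sum>j<r. c j * b j z) \<in> B" using c unfolding sum by simp
        then show "c j = 0" using indep[of c j] cr j by (cases "j = r") auto
      qed simp
      then show ?thesis by blast
    next
      case False
      then have "?A = A" by blast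
      then show ?thesis using q BB by auto
    qed
  qed
qed

section \<open>Koszul homology of syzygies\<close>

definition mdvd :: "monomial \<Rightarrow> monomial \<Rightarrow> bool" where
  "mdvd a u \<longleftrightarrow> (\<forall>v. lk a v \<le> lk u v)"

lemma mdvd_refl [simp]: "mdvd a a" and mdvd_trans: "mdvd a b \<Longrightarrow> mdvd b c \<Longrightarrow> mdvd a c" and mdvd_zero [simp]: "mdvd 0 u"
  by (auto simp: mdvd_def intro: order_trans)

lemma mdvd_minus: "mdvd (u - w) u" by (simp add: mdvd_def lookup_minus)

lemma mdvd_keys: "mdvd a u \<Longrightarrow> keys a \<subseteq> keys u"
  unfolding mdvd_def by (metis in_keys_iff le_zero_eq subsetI)

lemma mdvd_minus_sqfree: "finite S' \<Longrightarrow> S \<subseteq> S' \<Longrightarrow> mdvd (u - sqfree S') (u - sqfree S)"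
  using finite_subset[of S S'] by (auto simp: mdvd_def lookup_minus lookup_sqfree)

text \<open>The degree \<open>u\<close> part of the sum of the \<open>R(-m)\<close> for \<open>m\<close> in \<open>a\<close>, where \<open>w p\<close> is the coefficient of
  \<open>x\<^sup>u\<^sup>-\<^sup>a\<^sup>p\<close>. Multiplication by a monomial becomes an inclusion, so multigraded submodules are monotone
  families of subspaces, and homogeneous maps are scalar matrices.\<close>

definition frees :: "monomial list \<Rightarrow> monomial \<Rightarrow> (nat \<Rightarrow> 'k::field) set" where
  "frees a u = {w. \<forall>p. w p \<noteq> 0 \<longrightarrow> p < length a \<and> mdvd (a ! p) u}"

definition matapp :: "nat \<Rightarrow> (nat \<Rightarrow> nat \<Rightarrow> 'k::field) \<Rightarrow> (nat \<Rightarrow> 'k) \<Rightarrow> nat \<Rightarrow> 'k" where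
  "matapp s C w = (\<lambda>p. \<Sum>q<s. C p q * w q)"

definition matappk :: "nat \<Rightarrow> (nat \<Rightarrow> nat \<Rightarrow> 'k::field) \<Rightarrow> (nat set \<times> nat \<Rightarrow> 'k) \<Rightarrow> nat set \<times> nat \<Rightarrow> 'k" where
  "matappk s C f = (\<lambda>(S, p). \<Sum>q<s. C p q * f (S, q))"

definition kbd :: "nat \<Rightarrow> (nat set \<times> nat \<Rightarrow> 'k::field) \<Rightarrow> nat set \<times> nat \<Rightarrow> 'k" where
  "kbd n f = (\<lambda>(T, p). bd n (\<lambda>S. f (S, p)) T)"

text \<open>Degree u of the j-th Koszul module of Z: with e_S in degree x_S, its coefficient lies in
  Z in degree u - S. The pair (S, p) stands for e_S times the p-th generator of the ambient free
  module.\<close>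

definition kchains :: "(monomial \<Rightarrow> (nat \<Rightarrow> 'k::field) set) \<Rightarrow> monomial \<Rightarrow> nat \<Rightarrow> (nat set \<times> nat \<Rightarrow> 'k) set" where
  "kchains Z u j = {f. (\<forall>S p. f (S, p) \<noteq> 0 \<longrightarrow> S \<subseteq> keys u \<and> card S = j) \<and>
     (\<forall>S. S \<subseteq> keys u \<longrightarrow> (\<lambda>p. f (S, p)) \<in> Z (u - sqfree S))}"

definition gfam :: "nat \<Rightarrow> (monomial \<Rightarrow> (nat \<Rightarrow> 'k::field) set) \<Rightarrow> bool" where
  "gfam n Z \<longleftrightarrow> (\<forall>u\<in>monomials n. subsp (Z u)) \<and>
     (\<forall>u\<in>monomials n. \<forall>v\<in>monomials n. mdvd u v \<longrightarrow> Z u \<subseteq> Z v)"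

definition kcycles :: "nat \<Rightarrow> (monomial \<Rightarrow> (nat \<Rightarrow> 'k::field) set) \<Rightarrow> monomial \<Rightarrow> nat \<Rightarrow> (nat set \<times> nat \<Rightarrow> 'k) set" where
  "kcycles n Z u j = {f \<in> kchains Z u j. kbd n f = (\<lambda>_. 0)}"

definition kbounds :: "nat \<Rightarrow> (monomial \<Rightarrow> (nat \<Rightarrow> 'k::field) set) \<Rightarrow> monomial \<Rightarrow> nat \<Rightarrow> (nat set \<times> nat \<Rightarrow> 'k) set" where
  "kbounds n Z u j = kbd n ` kchains Z u (Suc j)"

lemma linmap_matapp: "linmap (matapp s C)"
  by (auto simp: linmap_def matapp_def algebra_simps sum.distrib sum_distrib_left)

lemma linmap_matappk: "linmap (matappk s C)"
  by (auto simp: linmap_def matappk_def algebra_simps sum.distrib sum_distrib_left)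

lemma linmap_kbd: "linmap (kbd n)"
  by (auto simp: linmap_def kbd_def koszul_add koszul_scale)

lemma matappk_kbd: "matappk s C (kbd n f) = kbd n (matappk s C f)"
  by (auto simp: matappk_def kbd_def koszul_sum koszul_scale)

lemma matappk_matapp: "(\<lambda>p. matappk s C f (S, p)) = matapp s C (\<lambda>q. f (S, q))"
  by (simp add: matappk_def matapp_def)

lemma kchains_supp: "f \<in> kchains Z u j \<Longrightarrow> f (S, p) \<noteq> 0 \<Longrightarrow> S \<subseteq> keys u \<and> card S = j"
  and kchains_mem: "f \<in> kchains Z u j \<Longrightarrow> S \<subseteq> keys u \<Longrightarrow> (\<lambda>p. f (S, p)) \<in> Z (u - sqfree S)"
  by (auto simp: kchains_def)

lemma kchains_finite: "f \<in> kchains Z u j \<Longrightarrow> f (S, p) \<noteq> 0 \<Longrightarrow> finite S"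
  using kchains_supp[of f Z u j S p] finite_subset[of S "keys u"] by simp

lemma subsp_image:
  assumes "linmap P" "subsp L" shows "subsp (P ` L)"
  unfolding subsp_def
proof (intro conjI ballI allI)
  show "(\<lambda>_. 0) \<in> P ` L"
    using linmap_zero[OF assms(1)] subsp_zero[OF assms(2)] by (intro image_eqI[of _ P "\<lambda>_. 0"]) simp_all
  fix x y c assume "x \<in> P ` L" "y \<in> P ` L"
  then obtain x' y' where *: "x = P x'" "y = P y'" "x' \<in> L" "y' \<in> L" by auto
  show "(\<lambda>z. x z + c * y z) \<in> P ` L"
    using subsp_comb[OF assms(2) *(3,4), of c]
    by (intro image_eqI[of _ P "\<lambda>z. x' z + c * y' z"]) (simp_all add: linmap_comb[OF assms(1)] *)
qed

lemma subsp_kernel: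
  assumes "linmap P" "subsp L" shows "subsp {w \<in> L. P w = (\<lambda>_. 0)}"
  unfolding subsp_def
proof (intro conjI ballI allI)
  show "(\<lambda>_. 0) \<in> {w \<in> L. P w = (\<lambda>_. 0)}"
    using linmap_zero[OF assms(1)] subsp_zero[OF assms(2)] by simp
  fix x y c assume "x \<in> {w \<in> L. P w = (\<lambda>_. 0)}" "y \<in> {w \<in> L. P w = (\<lambda>_. 0)}"
  then have *: "x \<in> L" "y \<in> L" "P x = (\<lambda>_. 0)" "P y = (\<lambda>_. 0)" by auto
  have "P (\<lambda>z. x z + c * y z) = (\<lambda>_. 0)" unfolding linmap_comb[OF assms(1)] * by simp
  then show "(\<lambda>z. x z + c * y z) \<in> {w \<in> L. P w = (\<lambda>_. 0)}"
    using subsp_comb[OF assms(2) *(1,2), of c] by simp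
qed

lemma linmap_compose: "linmap P \<Longrightarrow> linmap Q \<Longrightarrow> linmap (\<lambda>w. P (Q w))"
  by (simp add: linmap_def)

lemma koszul_nonzero:
  assumes "koszul n x f T \<noteq> 0" shows "\<exists>v\<in>{1..n} - T. f (insert v T) \<noteq> 0"
proof (rule ccontr)
  assume "\<not> ?thesis"
  then have "koszul n x f T = 0" unfolding koszul_def by (intro sum.neutral) simp
  then show False using assms by simp
qed

lemma kchains_subsp:
  assumes "gfam n Z" "u \<in> monomials n" shows "subsp (kchains Z u j)"
proof -
  have s: "subsp (Z (u - sqfree S))" for S using assms monomials_minus by (auto simp: gfam_def)
  have "(\<lambda>z. x z + c * y z) \<in> kchains Z u j" if x: "x \<in> kchains Z u j" and y: "y \<in> kchains Z u j" for x y c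
  proof -
    have "S \<subseteq> keys u \<and> card S = j" if "x (S, p) + c * y (S, p) \<noteq> 0" for S p
    proof -
      have "x (S, p) \<noteq> 0 \<or> y (S, p) \<noteq> 0" using that by auto
      then show ?thesis using kchains_supp[OF x] kchains_supp[OF y] by blast
    qed
    moreover have "(\<lambda>p. x (S, p) + c * y (S, p)) \<in> Z (u - sqfree S)" if "S \<subseteq> keys u" for S
      by (rule subsp_comb[OF s kchains_mem[OF x that] kchains_mem[OF y that]])
    ultimately show ?thesis unfolding kchains_def by blast
  qed
  moreover have "(\<lambda>_. 0) \<in> kchains Z u j" unfolding kchains_def using subsp_zero[OF s] by simp
  ultimately show ?thesis unfolding subsp_def by simp
qed

text \<open>Dropping v from a set multiplies by x_v, which moves a coefficient from degree u - S - v
  to u - S. In this encoding that is the inclusion given by monotonicity of Z.\<close>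

lemma kbd_kchains:
  assumes Z: "gfam n Z" and u: "u \<in> monomials n" and f: "f \<in> kchains Z u (Suc j)"
  shows "kbd n f \<in> kchains Z u j"
  unfolding kchains_def
proof (intro CollectI conjI allI impI)
  fix S p assume "kbd n f (S, p) \<noteq> 0"
  then have "bd n (\<lambda>S. f (S, p)) S \<noteq> 0" by (simp add: kbd_def)
  from koszul_nonzero[OF this] obtain v where v: "v \<in> {1..n} - S" "f (insert v S, p) \<noteq> 0" by (elim bexE)
  have *: "insert v S \<subseteq> keys u" "card (insert v S) = Suc j" "finite S"
    using kchains_supp[OF f v(2)] kchains_finite[OF f v(2)] by auto
  then show "S \<subseteq> keys u" "card S = j" using v by auto
next
  fix S assume S: "S \<subseteq> keys u"
  have fS: "finite S" using S by (rule finite_subset) simp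
  have um: "u - sqfree T \<in> monomials n" for T by (rule monomials_minus[OF u])
  have sZ: "subsp (Z (u - sqfree S))" using Z um by (auto simp: gfam_def)
  have "(\<lambda>p. f (insert v S, p)) \<in> Z (u - sqfree S)" if "v \<in> {1..n} - S" for v
  proof (cases "insert v S \<subseteq> keys u")
    case True
    have "Z (u - sqfree (insert v S)) \<subseteq> Z (u - sqfree S)"
      using Z um mdvd_minus_sqfree[of "insert v S" S u] fS unfolding gfam_def by blast
    then show ?thesis using kchains_mem[OF f True] by blast
  next
    case False
    then have "(\<lambda>p. f (insert v S, p)) = (\<lambda>_. 0)" using kchains_supp[OF f] by blast
    then show ?thesis using subsp_zero[OF sZ] by simp
  qed
  then have "(\<lambda>p. \<Sum>v\<in>{1..n} - S. (sg v S * 1) * f (insert v S, p)) \<in> Z (u - sqfree S)"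
    by (rule subsp_sum[OF sZ])
  then show "(\<lambda>p. kbd n f (S, p)) \<in> Z (u - sqfree S)" by (simp add: kbd_def koszul_def)
qed

lemma kbd_kbd:
  assumes "f \<in> kchains Z u j" shows "kbd n (kbd n f) = (\<lambda>_. 0)"
proof
  fix x :: "nat set \<times> nat"
  obtain T p where x: "x = (T, p)" by (cases x)
  show "kbd n (kbd n f) x = 0"
  proof (cases "finite T")
    case True
    then show ?thesis using koszul_koszul[OF True, of n "\<lambda>_. 1" "\<lambda>S. f (S, p)"] by (simp add: x kbd_def)
  next
    case False
    have "f (insert v (insert w T), p) = 0" for v w using kchains_finite[OF assms, of "insert v (insert w T)" p] False by auto
    then show ?thesis by (simp add: x kbd_def koszul_def)
  qed
qed

lemma kcycles_subsp: "gfam n Z \<Longrightarrow> u \<in> monomials n \<Longrightarrow> subsp (kcycles n Z u j)"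
  unfolding kcycles_def by (rule subsp_kernel[OF linmap_kbd kchains_subsp])

lemma kbounds_subsp: "gfam n Z \<Longrightarrow> u \<in> monomials n \<Longrightarrow> subsp (kbounds n Z u j)"
  unfolding kbounds_def by (rule subsp_image[OF linmap_kbd kchains_subsp])

lemma kbounds_kcycles: "gfam n Z \<Longrightarrow> u \<in> monomials n \<Longrightarrow> kbounds n Z u j \<subseteq> kcycles n Z u j"
  by (auto simp: kbounds_def kcycles_def kbd_kchains kbd_kbd)

lemma frees_gfam: "gfam n (frees a :: _ \<Rightarrow> (nat \<Rightarrow> 'k::field) set)"
  unfolding gfam_def
proof (intro conjI ballI impI)
  fix u show "subsp (frees a u :: (nat \<Rightarrow> 'k) set)" unfolding subsp_def
  proof (intro conjI ballI allI)
    fix x y :: "nat \<Rightarrow> 'k" and c assume "x \<in> frees a u" "y \<in> frees a u"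
    then have "p < length a \<and> mdvd (a ! p) u" if "x p \<noteq> 0 \<or> y p \<noteq> 0" for p using that by (auto simp: frees_def)
    moreover have "x p \<noteq> 0 \<or> y p \<noteq> 0" if "x p + c * y p \<noteq> 0" for p using that by auto
    ultimately show "(\<lambda>z. x z + c * y z) \<in> frees a u" unfolding frees_def by blast
  qed (simp add: frees_def)
next
  fix u v assume "mdvd u v"
  then show "(frees a u :: (nat \<Rightarrow> 'k) set) \<subseteq> frees a v" by (auto simp: frees_def intro: mdvd_trans)
qed

lemma frees_subsp: "u \<in> monomials n \<Longrightarrow> subsp (frees a u)"
  using frees_gfam unfolding gfam_def by blast

text \<open>The Koszul complex splits over the generators. If a_p properly divides u, some variable
  divides the quotient u - a_p, and multiplying by its e_x contracts that summand. A generator of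
  degree u itself contributes only at the empty set, and there the last hypothesis applies.\<close>

lemma frees_exact:
  assumes u: "u \<in> monomials n" and f: "f \<in> kchains (frees a) u j" and cyc: "kbd n f = (\<lambda>_. 0)"
    and z: "\<And>p. p < length a \<Longrightarrow> a ! p = u \<Longrightarrow> f ({}, p) = 0"
  shows "\<exists>g\<in>kchains (frees a) u (Suc j). kbd n g = f"
proof -
  define syz_fam where "syz_fam p \<longleftrightarrow> p < length a \<and> mdvd (a ! p) u \<and> keys (u - a ! p) \<noteq> {}" for p
  define x where "x p = (SOME v. v \<in> keys (u - a ! p))" for p
  have x: "x p \<in> keys (u - a ! p)" if "syz_fam p" for p
    unfolding x_def using that by (metis syz_fam_def all_not_in_conv someI_ex)
  have xn: "x p \<in> {1..n}" if "syz_fam p" for p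
    using x[OF that] keys_minus_subsp[of u "a ! p"] u by (auto simp: monomials_def)
  define g where "g = (\<lambda>(S, p). if syz_fam p then wedge (x p) (\<lambda>S. f (S, p)) S else 0)"
  have fm: "p < length a \<and> mdvd (a ! p) (u - sqfree S)" if "f (S, p) \<noteq> 0" for S p
    using kchains_mem[OF f, of S] kchains_supp[OF f that] that by (auto simp: frees_def)
  have g0: "x p \<in> S \<and> f (S - {x p}, p) \<noteq> 0 \<and> syz_fam p" if "g (S, p) \<noteq> 0" for S p
    using that by (auto simp: g_def wedge_def split: if_splits)
  have gs: "S \<subseteq> keys u \<and> card S = Suc j \<and> p < length a \<and> mdvd (a ! p) (u - sqfree S)" if nz: "g (S, p) \<noteq> 0" for S p
  proof -
    note * = g0[OF nz]
    let ?T = "S - {x p}"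
    have T: "?T \<subseteq> keys u" "card ?T = j" "finite ?T" using kchains_supp[OF f, of ?T p] kchains_finite[OF f, of ?T p] * by auto
    have xk: "x p \<in> keys (u - a ! p)" using x * by blast
    then have xu: "x p \<in> keys u" using keys_minus_subsp by blast
    have fS: "finite S" using T(3) by simp
    have S: "S \<subseteq> keys u" using T(1) xu by auto
    have c: "card S = Suc j" using card.remove[OF fS, of "x p"] * T(2) by (simp only:)
    have d: "mdvd (a ! p) (u - sqfree ?T)" and pl: "p < length a" using fm[of ?T p] * by auto
    have "lk (a ! p) v \<le> lk (u - sqfree S) v" for v
    proof (cases "v = x p")
      case True
      then show ?thesis using xk * fS by (simp add: in_keys_iff lookup_minus lookup_sqfree)
    next
      case False
      then have "lk (u - sqfree S) v = lk (u - sqfree ?T) v" using fS by (simp add: lookup_minus lookup_sqfree)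
      then show ?thesis using d by (simp add: mdvd_def)
    qed
    then show ?thesis using S c pl by (simp add: mdvd_def)
  qed
  have gK: "g \<in> kchains (frees a) u (Suc j)" unfolding kchains_def frees_def using gs by blast
  have "kbd n g (T, p) = f (T, p)" for T p
  proof (cases "finite T")
    case False
    have "g (insert v T, p) = 0" for v using kchains_finite[OF gK, of "insert v T" p] False by auto
    moreover have "f (T, p) = 0" using kchains_finite[OF f] False by blast
    ultimately show ?thesis by (simp add: kbd_def koszul_def)
  next
    case True
    show ?thesis
    proof (cases "syz_fam p")
      case gp: True
      have b0: "bd n (\<lambda>S. f (S, p)) S = 0" for S using fun_cong[OF cyc, of "(S, p)"] by (simp add: kbd_def)
      have "kbd n g (T, p) = bd n (wedge (x p) (\<lambda>S. f (S, p))) T" using gp by (simp add: kbd_def g_def)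
      also have "\<dots> = f (T, p)"
      proof -
        have "wedge (x p) (bd n (\<lambda>S. f (S, p))) T = 0" unfolding wedge_def b0 by simp
        then show ?thesis using koszul_wedge[OF True xn[OF gp], of "\<lambda>_. 1" "\<lambda>S. f (S, p)"] by simp
      qed
      finally show ?thesis .
    next
      case False
      have "f (T, p) = 0"
      proof (rule ccontr)
        assume nz: "f (T, p) \<noteq> 0"
        note fp = fm[OF nz]
        have d: "mdvd (a ! p) u" using fp mdvd_trans mdvd_minus by blast
        then have k: "keys (u - a ! p) = {}" using False fp by (simp add: syz_fam_def)
        have eq: "a ! p = u"
        proof (rule poly_mapping_eqI)
          fix v have "lk (u - a ! p) v = 0" using k by (metis empty_iff in_keys_iff)
          then show "lk (a ! p) v = lk u v" using d by (simp add: mdvd_def lookup_minus antisym)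
        qed
        have "T = {}"
        proof (rule ccontr)
          assume "T \<noteq> {}"
          then obtain v where v: "v \<in> T" by blast
          then have "v \<in> keys u" using kchains_supp[OF f nz] by blast
          moreover have "lk u v \<le> lk (u - sqfree T) v" using fp eq by (simp add: mdvd_def)
          ultimately show False using v \<open>finite T\<close> by (simp add: lookup_minus lookup_sqfree in_keys_iff)
        qed
        then show False using z[of p] fp eq nz by simp
      qed
      then show ?thesis using False by (simp add: kbd_def g_def)
    qed
  qed
  then have "kbd n g = f" by auto
  then show ?thesis using gK by blast
qed

text \<open>The scalar \<open>C p q\<close> stands for a multiple of the monomial b_q / a_p. Strict
  divisibility makes every nonzero entry nonconstant, which is minimality.\<close>

definition minimal_mat :: "monomial list \<Rightarrow> monomial list \<Rightarrow> (nat \<Rightarrow> nat \<Rightarrow> 'k::field) \<Rightarrow> bool" where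
  "minimal_mat a b C \<longleftrightarrow> (\<forall>p q. C p q \<noteq> 0 \<longrightarrow> p < length a \<and> q < length b \<and> mdvd (a ! p) (b ! q) \<and> a ! p \<noteq> b ! q)"

definition imgs :: "monomial list \<Rightarrow> (nat \<Rightarrow> nat \<Rightarrow> 'k::field) \<Rightarrow> monomial \<Rightarrow> (nat \<Rightarrow> 'k) set" where
  "imgs b C u = matapp (length b) C ` frees b u"

definition kers :: "monomial list \<Rightarrow> (nat \<Rightarrow> nat \<Rightarrow> 'k::field) \<Rightarrow> monomial \<Rightarrow> (nat \<Rightarrow> 'k) set" where
  "kers b C u = {w \<in> frees b u. matapp (length b) C w = (\<lambda>_. 0)}"

lemma imgs_gfam: "gfam n (imgs b C)"
  unfolding gfam_def
proof (intro conjI ballI impI)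
  fix u assume u: "u \<in> monomials n"
  show "subsp (imgs b C u)" unfolding imgs_def by (rule subsp_image[OF linmap_matapp frees_subsp[OF u]])
next
  fix u v assume "u \<in> monomials n" "v \<in> monomials n" "mdvd u v"
  then have "frees b u \<subseteq> frees b v" using frees_gfam[of n b] unfolding gfam_def by blast
  then show "imgs b C u \<subseteq> imgs b C v" unfolding imgs_def by blast
qed

lemma kers_gfam: "gfam n (kers b C)"
  unfolding gfam_def
proof (intro conjI ballI impI)
  fix u assume u: "u \<in> monomials n"
  show "subsp (kers b C u)" unfolding kers_def by (rule subsp_kernel[OF linmap_matapp frees_subsp[OF u]])
next
  fix u v assume "u \<in> monomials n" "v \<in> monomials n" "mdvd u v"
  then have "frees b u \<subseteq> frees b v" using frees_gfam[of n b] unfolding gfam_def by blast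
  then show "kers b C u \<subseteq> kers b C v" unfolding kers_def by blast
qed

lemma matappk_kchains_im: "w \<in> kchains (frees b) u j \<Longrightarrow> matappk (length b) C w \<in> kchains (imgs b C) u j"
  unfolding kchains_def[of "imgs b C"]
proof (intro CollectI conjI allI impI)
  assume w: "w \<in> kchains (frees b) u j"
  fix S p
  {
    assume "matappk (length b) C w (S, p) \<noteq> 0"
    moreover have "matappk (length b) C w (S, p) = 0" if "\<And>q. w (S, q) = 0" using that by (simp add: matappk_def)
    ultimately obtain q where "w (S, q) \<noteq> 0" by metis
    then show "S \<subseteq> keys u" "card S = j" using kchains_supp[OF w] by auto
  }
  assume "S \<subseteq> keys u"
  then show "(\<lambda>p. matappk (length b) C w (S, p)) \<in> imgs b C (u - sqfree S)"
    unfolding matappk_matapp imgs_def using kchains_mem[OF w] by blast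
qed

text \<open>Preimages are chosen separately for each \<open>S\<close>. Zero is lifted to zero, so
  that the support condition survives.\<close>

lemma matappk_lift:
  assumes u: "u \<in> monomials n" and f: "f \<in> kchains (imgs b C) u j"
  shows "\<exists>g\<in>kchains (frees b) u j. matappk (length b) C g = f"
proof -
  have "\<exists>w. (S \<subseteq> keys u \<longrightarrow> w \<in> frees b (u - sqfree S)) \<and> matapp (length b) C w = (\<lambda>p. f (S, p)) \<and>
      ((\<forall>p. f (S, p) = 0) \<longrightarrow> w = (\<lambda>_. 0))" for S
  proof (cases "\<forall>p. f (S, p) = 0")
    case True
    then show ?thesis using subsp_zero[OF frees_subsp[OF monomials_minus[OF u]]]
      by (intro exI[of _ "\<lambda>_. 0"]) (auto simp: linmap_zero[OF linmap_matapp])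
  next
    case False
    then have "S \<subseteq> keys u" using kchains_supp[OF f] by blast
    then show ?thesis using kchains_mem[OF f, of S] False by (auto simp: imgs_def)
  qed
  then obtain w where w: "\<And>S. S \<subseteq> keys u \<Longrightarrow> w S \<in> frees b (u - sqfree S)" "\<And>S. matapp (length b) C (w S) = (\<lambda>p. f (S, p))"
    "\<And>S. \<forall>p. f (S, p) = 0 \<Longrightarrow> w S = (\<lambda>_. 0)" by metis
  define g where "g = (\<lambda>(S, q). w S q)"
  have "g \<in> kchains (frees b) u j" unfolding kchains_def
  proof (intro CollectI conjI allI impI)
    fix S q assume "g (S, q) \<noteq> 0"
    then have "w S \<noteq> (\<lambda>_. 0)" by (auto simp: g_def)
    then obtain p where "f (S, p) \<noteq> 0" using w(3) by blast
    then show "S \<subseteq> keys u" "card S = j" using kchains_supp[OF f] by auto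
  qed (use w(1) in \<open>simp add: g_def\<close>)
  moreover have "matappk (length b) C g (S, p) = f (S, p)" for S p
    using fun_cong[OF w(2)[of S], of p] by (simp add: matappk_def matapp_def g_def)
  ultimately show ?thesis by (intro bexI[of _ g]) auto
qed

text \<open>The coefficient of e_v lives in degree u - v, which a generator of degree u does not
  divide. So boundaries have no component along generators of degree u.\<close>

lemma kbd_top_zero:
  assumes u: "u \<in> monomials n" and g: "g \<in> kchains (frees b) u (Suc j)" and q: "b ! q = u"
  shows "kbd n g ({}, q) = 0"
proof -
  have "g ({v}, q) = 0" for v
  proof (rule ccontr)
    assume nz: "g ({v}, q) \<noteq> 0"
    have v: "v \<in> keys u" using kchains_supp[OF g nz] by simp
    then have "mdvd (b ! q) (u - sqfree {v})" using kchains_mem[OF g, of "{v}"] nz by (auto simp: frees_def)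
    then have "lk u v \<le> lk (u - sqfree {v}) v" using q by (simp add: mdvd_def)
    then show False using v by (simp add: lookup_minus lookup_sqfree in_keys_iff)
  qed
  then show ?thesis by (simp add: kbd_def koszul_def)
qed

lemma ker_mem_kchains:
  assumes u: "u \<in> monomials n" and w: "w \<in> kchains (frees b) u j" "matappk (length b) C w = (\<lambda>_. 0)"
  shows "w \<in> kchains (kers b C) u j"
  unfolding kchains_def kers_def
proof (intro CollectI conjI allI impI)
  fix S p assume "w (S, p) \<noteq> 0" then show "S \<subseteq> keys u" "card S = j" using kchains_supp[OF w(1)] by auto
next
  fix S assume S: "S \<subseteq> keys u"
  then show "(\<lambda>p. w (S, p)) \<in> frees b (u - sqfree S)" by (rule kchains_mem[OF w(1)])
  show "matapp (length b) C (\<lambda>p. w (S, p)) = (\<lambda>_. 0)" unfolding matappk_matapp[symmetric] w(2) ..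
qed

lemma kchains_ker:
  assumes "w \<in> kchains (kers b C) u j" shows "w \<in> kchains (frees b) u j" "matappk (length b) C w = (\<lambda>_. 0)"
proof -
  show "w \<in> kchains (frees b) u j" using assms by (auto simp: kchains_def kers_def)
  show "matappk (length b) C w = (\<lambda>_. 0)"
  proof
    fix x :: "nat set \<times> nat"
    obtain S p where x: "x = (S, p)" by (cases x)
    show "matappk (length b) C w x = 0"
    proof (cases "S \<subseteq> keys u")
      case True
      then have "matapp (length b) C (\<lambda>q. w (S, q)) = (\<lambda>_. 0)" using kchains_mem[OF assms] by (auto simp: kers_def)
      then show ?thesis using fun_cong[of _ _ p] by (simp add: x matappk_def matapp_def fun_eq_iff)
    next
      case False
      then have "w (S, q) = 0" for q using kchains_supp[OF assms] by blast
      then show ?thesis by (simp add: x matappk_def)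
    qed
  qed
qed

text \<open>Dimension shifting along an exact sequence of multigraded modules whose middle term is free and
  whose first term, the kernel, lies in the maximal ideal times the middle term.\<close>

lemma Koszul_shift:
  assumes u: "u \<in> monomials n" and q: "qbasis J \<beta> (kcycles n (kers b C) u j) (kbounds n (kers b C) u j)"
    and min: "\<And>w p. w \<in> kers b C u \<Longrightarrow> p < length b \<Longrightarrow> b ! p = u \<Longrightarrow> w p = 0"
  shows "\<exists>\<beta>'. qbasis J \<beta>' (kcycles n (imgs b C) u (Suc j)) (kbounds n (imgs b C) u (Suc j))"
proof -
  let ?matapp = "matappk (length b) C"
  \<comment> \<open>Chains of the free module whose boundary lies in the kernel. Taking boundaries
    maps them onto cycles of the kernel, applying the matrix maps them onto cycles of the image one
    degree up; this correspondence is the connecting map.\<close>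
  define L where "L = {w \<in> kchains (frees b) u (Suc j). ?matapp (kbd n w) = (\<lambda>_. 0)}"
  note sK = kchains_subsp[OF frees_gfam u, of b]
  have kK: "kbd n w \<in> kchains (frees b) u i" if "w \<in> kchains (frees b) u (Suc i)" for w i by (rule kbd_kchains[OF frees_gfam u that])
  have emp: "f ({}, p) = 0" if "f \<in> kchains (frees b) u (Suc i)" for f p i using kchains_supp[OF that, of "{}" p] by fastforce
  show ?thesis
  proof (rule qbasis_transfer[OF q linmap_kbd[of n] linmap_matappk[of "length b" C]])
    show "subsp L" unfolding L_def by (rule subsp_kernel[OF linmap_compose[OF linmap_matappk linmap_kbd] sK])
    show "kbd n w \<in> kcycles n (kers b C) u j" if "w \<in> L" for w
      using that kbd_kbd[of w "frees b" u "Suc j" n] ker_mem_kchains[OF u kK] by (auto simp: L_def kcycles_def)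
    show "\<exists>w\<in>L. kbd n w = f" if f: "f \<in> kcycles n (kers b C) u j" for f
    proof -
      have f': "f \<in> kchains (kers b C) u j" "kbd n f = (\<lambda>_. 0)" using f by (auto simp: kcycles_def)
      have "f ({}, p) = 0" if "p < length b" "b ! p = u" for p
        using min[of "\<lambda>p. f ({}, p)" p] kchains_mem[OF f'(1), of "{}"] that by (simp add: sqfree_def)
      then obtain g where "g \<in> kchains (frees b) u (Suc j)" "kbd n g = f"
        using frees_exact[OF u kchains_ker(1)[OF f'(1)] f'(2)] by blast
      then show ?thesis using kchains_ker(2)[OF f'(1)] by (auto simp: L_def)
    qed
    show "?matapp w \<in> kcycles n (imgs b C) u (Suc j)" if "w \<in> L" for w
      using that matappk_kchains_im by (auto simp: L_def kcycles_def matappk_kbd)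
    show "\<exists>w\<in>L. ?matapp w = f" if f: "f \<in> kcycles n (imgs b C) u (Suc j)" for f
    proof -
      have f': "f \<in> kchains (imgs b C) u (Suc j)" "kbd n f = (\<lambda>_. 0)" using f by (auto simp: kcycles_def)
      obtain g where g: "g \<in> kchains (frees b) u (Suc j)" "?matapp g = f" using matappk_lift[OF u f'(1)] by blast
      then show ?thesis using f'(2) by (auto simp: L_def matappk_kbd)
    qed
    show "kbd n w \<in> kbounds n (kers b C) u j \<longleftrightarrow> ?matapp w \<in> kbounds n (imgs b C) u (Suc j)" if w: "w \<in> L" for w
    proof
      have wK: "w \<in> kchains (frees b) u (Suc j)" using w by (simp add: L_def)
      {
        assume "kbd n w \<in> kbounds n (kers b C) u j"
        then obtain z where z: "z \<in> kchains (kers b C) u (Suc j)" "kbd n w = kbd n z" by (auto simp: kbounds_def)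
        let ?d = "\<lambda>x. w x - z x"
        have "?d \<in> kchains (frees b) u (Suc j)" by (rule subsp_diff[OF sK wK kchains_ker(1)[OF z(1)]])
        moreover have "kbd n ?d = (\<lambda>_. 0)" unfolding linmap_diff[OF linmap_kbd] z(2) by simp
        ultimately obtain g where g: "g \<in> kchains (frees b) u (Suc (Suc j))" "kbd n g = ?d"
          using frees_exact[OF u, of ?d b "Suc j"] emp by blast
        have "?matapp w = ?matapp ?d" unfolding linmap_diff[OF linmap_matappk] kchains_ker(2)[OF z(1)] by simp
        also have "\<dots> = kbd n (?matapp g)" using g(2) matappk_kbd by metis
        finally show "?matapp w \<in> kbounds n (imgs b C) u (Suc j)" using matappk_kchains_im[OF g(1)] by (simp add: kbounds_def)
      }
      assume "?matapp w \<in> kbounds n (imgs b C) u (Suc j)"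
      then obtain f' where f': "f' \<in> kchains (imgs b C) u (Suc (Suc j))" "?matapp w = kbd n f'" by (auto simp: kbounds_def)
      obtain g where g: "g \<in> kchains (frees b) u (Suc (Suc j))" "?matapp g = f'" using matappk_lift[OF u f'(1)] by blast
      let ?d = "\<lambda>x. w x - kbd n g x"
      have "?d \<in> kchains (frees b) u (Suc j)" by (rule subsp_diff[OF sK wK kK[OF g(1)]])
      moreover have "?matapp ?d = (\<lambda>_. 0)" unfolding linmap_diff[OF linmap_matappk] f'(2) matappk_kbd g(2) by simp
      ultimately have d: "?d \<in> kchains (kers b C) u (Suc j)" by (rule ker_mem_kchains[OF u])
      have "kbd n ?d = kbd n w" unfolding linmap_diff[OF linmap_kbd] kbd_kbd[OF g(1)] by simp
      then show "kbd n w \<in> kbounds n (kers b C) u j" unfolding kbounds_def by (rule image_eqI[OF sym d])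
    qed
  qed
qed

text \<open>H_0 of a module counts its minimal generators. The image is the free module modulo the
  kernel, and in degree u the kernel has no coefficient at generators of degree u, so these remain a
  basis.\<close>

lemma Koszul_start:
  assumes u: "u \<in> monomials n"
    and min: "\<And>w p. w \<in> kers b C u \<Longrightarrow> p < length b \<Longrightarrow> b ! p = u \<Longrightarrow> w p = 0"
  shows "\<exists>\<beta>. qbasis {p. p < length b \<and> b ! p = u} \<beta> (kcycles n (imgs b C) u 0) (kbounds n (imgs b C) u 0)"
proof -
  let ?matapp = "matappk (length b) C" and ?J = "{p. p < length b \<and> b ! p = u}"
  let ?A = "kchains (frees b) u 0 :: (nat set \<times> nat \<Rightarrow> 'a) set"
  let ?B = "{f \<in> ?A. \<forall>p\<in>?J. f ({}, p) = 0}"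
  define \<delta> where "\<delta> p = (\<lambda>x. if x = ({} :: nat set, p) then 1 else 0 :: 'a)" for p :: nat
  note sK = kchains_subsp[OF frees_gfam u, of b]
  have mon0: "sqfree {} = 0" by (simp add: sqfree_def)
  have dA: "\<delta> p \<in> ?A" if "p \<in> ?J" for p
    using that by (auto simp: kchains_def frees_def \<delta>_def mon0)
  have at: "(\<Sum>j\<in>?J. c j * \<delta> j ({}, p)) = c p" if "p \<in> ?J" for c p
    using that by (simp add: \<delta>_def if_distrib[of "(*) _"] sum.delta cong: if_cong)
  have q: "qbasis ?J \<delta> ?A ?B" unfolding qbasis_def
  proof (intro conjI ballI allI impI)
    fix x assume x: "x \<in> ?A"
    let ?c = "\<lambda>p. x ({}, p)"
    have "(\<lambda>z. x z - (\<Sum>j\<in>?J. ?c j * \<delta> j z)) \<in> ?A" by (intro subsp_diff[OF sK x] subsp_sum[OF sK] dA)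
    then have "(\<lambda>z. x z - (\<Sum>j\<in>?J. ?c j * \<delta> j z)) \<in> ?B" using at[of _ ?c] by auto
    then show "\<exists>c. (\<lambda>z. x z - (\<Sum>j\<in>?J. c j * \<delta> j z)) \<in> ?B" by (intro exI[of _ ?c])
  next
    fix c j assume c: "(\<lambda>z. \<Sum>j\<in>?J. c j * \<delta> j z) \<in> ?B" and j: "j \<in> ?J"
    then have "(\<Sum>i\<in>?J. c i * \<delta> i ({}, j)) = 0" by blast
    then show "c j = 0" using at[OF j] by simp
  qed (use dA in auto)
  have kd0: "kbd n f = (\<lambda>_. 0)" if "f \<in> kchains Z u 0" for f :: "nat set \<times> nat \<Rightarrow> 'a" and Z
  proof
    fix x :: "nat set \<times> nat"
    obtain S p where x: "x = (S, p)" by (cases x)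
    have "f (insert v S, p) = 0" for v
    proof (rule ccontr)
      assume nz: "f (insert v S, p) \<noteq> 0"
      then show False using kchains_supp[OF that nz] kchains_finite[OF that nz] by simp
    qed
    then show "kbd n f x = 0" by (simp add: x kbd_def koszul_def)
  qed
  have lid: "linmap (\<lambda>x. x)" by (simp add: linmap_def)
  show ?thesis
  proof (rule qbasis_transfer[OF q lid linmap_matappk[of "length b" C] sK])
    show "?matapp w \<in> kcycles n (imgs b C) u 0" if "w \<in> ?A" for w
      using matappk_kchains_im[OF that, of C] kd0[of "?matapp w" "imgs b C"] by (simp add: kcycles_def)
    show "\<exists>w\<in>?A. ?matapp w = f" if "f \<in> kcycles n (imgs b C) u 0" for f
      using matappk_lift[OF u, of f b C 0] that by (auto simp: kcycles_def)
    show "w \<in> ?B \<longleftrightarrow> ?matapp w \<in> kbounds n (imgs b C) u 0" if w: "w \<in> ?A" for w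
    proof
      assume "w \<in> ?B"
      then obtain g where g: "g \<in> kchains (frees b) u (Suc 0)" "kbd n g = w"
        using frees_exact[OF u w kd0[OF w]] by blast
      then have "?matapp w = kbd n (?matapp g)" using matappk_kbd by metis
      then show "?matapp w \<in> kbounds n (imgs b C) u 0" using matappk_kchains_im[OF g(1)] by (simp add: kbounds_def)
    next
      assume "?matapp w \<in> kbounds n (imgs b C) u 0"
      then obtain f' where f': "f' \<in> kchains (imgs b C) u (Suc 0)" "?matapp w = kbd n f'" by (auto simp: kbounds_def)
      obtain g where g: "g \<in> kchains (frees b) u (Suc 0)" "?matapp g = f'" using matappk_lift[OF u f'(1)] by blast
      let ?d = "\<lambda>x. w x - kbd n g x"
      have "?d \<in> ?A" by (rule subsp_diff[OF sK w kbd_kchains[OF frees_gfam u g(1)]])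
      moreover have "?matapp ?d = (\<lambda>_. 0)" unfolding linmap_diff[OF linmap_matappk] f'(2) matappk_kbd g(2) by simp
      ultimately have "?d \<in> kchains (kers b C) u 0" by (rule ker_mem_kchains[OF u])
      then have "(\<lambda>p. ?d ({}, p)) \<in> kers b C u" using kchains_mem[of ?d "kers b C" u 0 "{}"] by (simp add: mon0)
      then have "?d ({}, p) = 0" if "p \<in> ?J" for p using min[of "\<lambda>p. ?d ({}, p)" p] that by simp
      then have "w ({}, p) = 0" if "p \<in> ?J" for p using kbd_top_zero[OF u g(1), of p] that by simp
      then show "w \<in> ?B" using w by simp
    qed
  qed auto
qed

text \<open>The ideal itself, as a submodule of the free module with the single generator \<open>0\<close>.\<close>

definition ideal_fam :: "nat set set \<Rightarrow> monomial \<Rightarrow> (nat \<Rightarrow> 'k::field) set" where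
  "ideal_fam \<Delta> u = {w. (\<forall>p. p \<noteq> 0 \<longrightarrow> w p = 0) \<and> (keys u \<in> \<Delta> \<longrightarrow> w 0 = 0)}"

lemma ideal_fam_gfam: assumes "cplx n \<Delta>" shows "gfam n (ideal_fam \<Delta> :: _ \<Rightarrow> (nat \<Rightarrow> 'k::field) set)"
  unfolding gfam_def
proof (intro conjI ballI impI)
  fix u show "subsp (ideal_fam \<Delta> u :: (nat \<Rightarrow> 'k) set)"
    unfolding subsp_def ideal_fam_def by auto
next
  fix u v assume "mdvd u v"
  then have "keys v \<in> \<Delta> \<Longrightarrow> keys u \<in> \<Delta>" using cplxD[OF assms] mdvd_keys by blast
  then show "(ideal_fam \<Delta> u :: (nat \<Rightarrow> 'k) set) \<subseteq> ideal_fam \<Delta> v" by (auto simp: ideal_fam_def)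
qed

lemma cone_fill:
  assumes "finite S" "a \<in> {1..n}" "\<And>T. bd n h T = 0" shows "bd n (wedge a h) S = h S"
proof -
  have "wedge a (bd n h) S = 0" unfolding wedge_def assms(3) by simp
  then show ?thesis using koszul_wedge[OF assms(1,2), of "\<lambda>_. 1" h] by simp
qed

text \<open>The Koszul complex of R is exact in positive degrees, so H_i(I) and H_(i+1)(R/I) vanish
  together. In degree u the filling in R is a cone over any variable a dividing u; u = 1 is treated
  apart.\<close>

lemma kcycles_ideal_fam_exact:
  assumes c: "cplx n \<Delta>" and e: "{} \<in> \<Delta>" and u: "u \<in> monomials n"
  shows "kcycles n (ideal_fam \<Delta>) u i \<subseteq> kbounds n (ideal_fam \<Delta> :: _ \<Rightarrow> (nat \<Rightarrow> 'k::field) set) u i \<longleftrightarrow> exact_at n TYPE('k) (kfaces \<Delta> u) (Suc i)"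
proof
  have uk: "keys u \<subseteq> {1..n}" using u by (simp add: monomials_def)
  have up: "bd n (\<lambda>S. if S \<in> kfaces \<Delta> u then k S else 0) T = bd n k T"
    if "T \<in> kfaces \<Delta> u" "\<And>S. k S \<noteq> 0 \<Longrightarrow> S \<subseteq> keys u" for k :: "nat set \<Rightarrow> 'k" and T
    unfolding koszul_def
  proof (intro sum.cong refl)
    fix v
    have "(if insert v T \<in> kfaces \<Delta> u then k (insert v T) else 0) = k (insert v T)"
      using kfaces_up[OF c that(1), of "insert v T"] that(2)[of "insert v T"] by auto
    then show "sg v T * 1 * (if insert v T \<in> kfaces \<Delta> u then k (insert v T) else 0) = sg v T * 1 * k (insert v T)" by simp
  qed
  {
    assume CB: "kcycles n (ideal_fam \<Delta>) u i \<subseteq> kbounds n (ideal_fam \<Delta> :: _ \<Rightarrow> (nat \<Rightarrow> 'k) set) u i"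
    show "exact_at n TYPE('k) (kfaces \<Delta> u) (Suc i)" unfolding exact_at_def
    proof (intro allI impI)
      fix f :: "nat set \<Rightarrow> 'k" assume f: "supp_on (kfaces \<Delta> u) (Suc i) f" "\<forall>T\<in>kfaces \<Delta> u. bd n f T = 0"
      have fk: "S \<subseteq> keys u \<and> card S = Suc i" if "f S \<noteq> 0" for S using f(1) that by (auto simp: supp_on_def kfaces_def)
      have sP: "supp_on (Pow {1..n}) (Suc i) f" using fk uk by (auto simp: supp_on_def)
      define F where "F = (\<lambda>(S, p). if p = (0::nat) then bd n f S else 0)"
      have FK: "F \<in> kchains (ideal_fam \<Delta>) u i" unfolding kchains_def
      proof (intro CollectI conjI allI impI)
        fix S p assume "F (S, p) \<noteq> 0"
        then have nz: "bd n f S \<noteq> 0" by (auto simp: F_def split: if_splits)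
        from koszul_nonzero[OF this] obtain v where "v \<in> {1..n} - S" "f (insert v S) \<noteq> 0" by (elim bexE)
        then show "S \<subseteq> keys u" using fk[of "insert v S"] by blast
        show "card S = i" using nz supp_koszul[OF sP] by (auto simp: supp_on_def)
      next
        fix S assume "S \<subseteq> keys u"
        then show "(\<lambda>p. F (S, p)) \<in> ideal_fam \<Delta> (u - sqfree S)" using f(2) by (auto simp: ideal_fam_def F_def kfaces_def)
      qed
      moreover have "kbd n F = (\<lambda>_. 0)"
      proof
        fix x :: "nat set \<times> nat"
        obtain T p where x: "x = (T, p)" by (cases x)
        have "bd n (bd n f) T = 0"
        proof (cases "finite T")
          case True then show ?thesis by (rule koszul_koszul)
        next
          case False
          then have "bd n f (insert v T) = 0" for v using koszul_infinite[OF sP] by simp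
          then show ?thesis by (simp add: koszul_def[of n _ "bd n f"])
        qed
        then show "kbd n F x = 0" by (cases "p = 0") (simp_all add: x kbd_def F_def)
      qed
      ultimately have "F \<in> kbounds n (ideal_fam \<Delta>) u i" using CB by (auto simp: kcycles_def)
      then obtain G where G: "G \<in> kchains (ideal_fam \<Delta>) u (Suc i)" "F = kbd n G" by (auto simp: kbounds_def)
      show "\<exists>g. supp_on (kfaces \<Delta> u) (Suc (Suc i)) g \<and> (\<forall>S\<in>kfaces \<Delta> u. card S = Suc i \<longrightarrow> bd n g S = f S)"
      proof (cases "keys u = {}")
        case True
        then have "f S = 0" for S using fk[of S] by fastforce
        then show ?thesis by (intro exI[of _ "\<lambda>_. 0"]) (simp add: supp_on_def)
      next
        case False
        then obtain a where a: "a \<in> keys u" by blast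
        \<comment> \<open>The lift f and the chain G in the ideal have the same boundary F. Their
          difference is a cycle of R, filled by a cone; on faces of R/I the chain G is zero, so this
          fills f.\<close>
        define h where "h S = f S - G (S, 0)" for S
        have hk: "S \<subseteq> keys u \<and> card S = Suc i" if "h S \<noteq> 0" for S
          using that fk[of S] kchains_supp[OF G(1), of S 0] by (cases "f S = 0") (simp_all add: h_def)
        have bh: "bd n h T = 0" for T
          using fun_cong[OF G(2), of "(T, 0)"] by (simp add: h_def[abs_def] koszul_diff kbd_def F_def)
        define k where "k = wedge a h"
        have kk: "S \<subseteq> keys u \<and> card S = Suc (Suc i)" if "k S \<noteq> 0" for S
        proof -
          have *: "a \<in> S" "h (S - {a}) \<noteq> 0" using that by (auto simp: k_def wedge_def split: if_splits)
          then have **: "S - {a} \<subseteq> keys u" "card (S - {a}) = Suc i" using hk by auto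
          then have S: "S \<subseteq> keys u" using a by auto
          then have "finite S" by (rule finite_subset) simp
          from card.remove[OF this *(1)] **(2) have "card S = Suc (Suc i)" by (simp only:)
          then show ?thesis using S by simp
        qed
        have bk: "bd n k S = h S" if "finite S" for S
          unfolding k_def using a uk by (intro cone_fill that bh) blast
        let ?g = "\<lambda>S. if S \<in> kfaces \<Delta> u then k S else 0"
        have "supp_on (kfaces \<Delta> u) (Suc (Suc i)) ?g" using kk by (auto simp: supp_on_def)
        moreover have "bd n ?g S = f S" if S: "S \<in> kfaces \<Delta> u" for S
        proof -
          have Sk: "S \<subseteq> keys u" "keys (u - sqfree S) \<in> \<Delta>" using S by (auto simp: kfaces_def)
          have "finite S" using Sk(1) by (rule finite_subset) simp
          moreover have "G (S, 0) = 0" using kchains_mem[OF G(1) Sk(1)] Sk(2) by (auto simp: ideal_fam_def)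
          ultimately show ?thesis using up[OF S, of k] kk bk by (simp add: h_def)
        qed
        ultimately show ?thesis by (intro exI[of _ ?g]) simp
      qed
    qed
  }
  assume E: "exact_at n TYPE('k) (kfaces \<Delta> u) (Suc i)"
  show "kcycles n (ideal_fam \<Delta>) u i \<subseteq> kbounds n (ideal_fam \<Delta> :: _ \<Rightarrow> (nat \<Rightarrow> 'k) set) u i"
  proof
    fix F :: "nat set \<times> nat \<Rightarrow> 'k" assume "F \<in> kcycles n (ideal_fam \<Delta>) u i"
    then have F: "F \<in> kchains (ideal_fam \<Delta>) u i" "kbd n F = (\<lambda>_. 0)" by (auto simp: kcycles_def)
    have F0: "F (S, p) = 0" if "p \<noteq> 0 \<or> S \<in> kfaces \<Delta> u" for S p
    proof (rule ccontr)
      assume nz: "F (S, p) \<noteq> 0"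
      then have "(\<lambda>p. F (S, p)) \<in> ideal_fam \<Delta> (u - sqfree S)" using kchains_mem[OF F(1)] kchains_supp[OF F(1) nz] by blast
      then show False using nz that by (cases "p = 0") (auto simp: ideal_fam_def kfaces_def)
    qed
    show "F \<in> kbounds n (ideal_fam \<Delta>) u i"
    proof (cases "keys u = {}")
      case True
      \<comment> \<open>With u = 1 there is no variable to form a cone, but the ideal contains no
        constants because the empty set is a face.\<close>
      have "F (S, p) = 0" for S p
      proof (rule ccontr)
        assume nz: "F (S, p) \<noteq> 0"
        then have "S = {}" using kchains_supp[OF F(1) nz] True by simp
        then have "S \<in> kfaces \<Delta> u" using True e by (simp add: kfaces_def sqfree_def)
        then show False using F0 nz by blast
      qed
      then have "F = (\<lambda>_. 0)" by auto
      then show ?thesis using subsp_zero[OF kbounds_subsp[OF ideal_fam_gfam[OF c] u]] by simp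
    next
      case False
      then obtain a where a: "a \<in> keys u" by blast
      let ?f = "\<lambda>S. F (S, 0)"
      have bf: "bd n ?f T = 0" for T using fun_cong[OF F(2), of "(T, 0)"] by (simp add: kbd_def)
      define k where "k = wedge a ?f"
      have kk: "S \<subseteq> keys u \<and> card S = Suc i" if "k S \<noteq> 0" for S
      proof -
        have *: "a \<in> S" "?f (S - {a}) \<noteq> 0" using that by (auto simp: k_def wedge_def split: if_splits)
        then have **: "S - {a} \<subseteq> keys u" "card (S - {a}) = i" using kchains_supp[OF F(1)] by auto
        then have S: "S \<subseteq> keys u" using a by auto
        then have "finite S" by (rule finite_subset) simp
        from card.remove[OF this *(1)] **(2) have "card S = Suc i" by (simp only:)
        then show ?thesis using S by simp
      qed
      have bk: "bd n k S = ?f S" if "finite S" for S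
        unfolding k_def using a uk by (intro cone_fill[of S a n ?f] that bf) blast
      let ?k = "\<lambda>S. if S \<in> kfaces \<Delta> u then k S else 0"
      have "supp_on (kfaces \<Delta> u) (Suc i) ?k" using kk by (auto simp: supp_on_def)
      moreover have "bd n ?k T = 0" if T: "T \<in> kfaces \<Delta> u" for T
      proof -
        have "finite T" using T finite_subset[of T "keys u"] by (auto simp: kfaces_def)
        then show ?thesis using up[OF T, of k] kk bk F0[of 0 T] T by simp
      qed
      ultimately obtain g where g: "supp_on (kfaces \<Delta> u) (Suc (Suc i)) g" "\<And>S. S \<in> kfaces \<Delta> u \<Longrightarrow> card S = Suc i \<Longrightarrow> bd n g S = ?k S"
        using E unfolding exact_at_def by blast
      have gk: "S \<subseteq> keys u \<and> card S = Suc (Suc i)" if "g S \<noteq> 0" for S using g(1) that by (auto simp: supp_on_def kfaces_def)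
      have gP: "supp_on (Pow {1..n}) (Suc (Suc i)) g" using gk uk by (auto simp: supp_on_def)
      \<comment> \<open>The cone k fills F in R, yet may leave the ideal. Modulo the ideal it is a
        cycle, and g bounds it there, so k - dg takes values in the ideal and still has boundary
        F.\<close>
      define G where "G = (\<lambda>(S, p). if p = (0::nat) then k S - bd n g S else 0)"
      have Gk: "S \<subseteq> keys u \<and> card S = Suc i" if "k S - bd n g S \<noteq> 0" for S
      proof (cases "k S = 0")
        case False then show ?thesis by (rule kk)
      next
        case True
        then have nz: "bd n g S \<noteq> 0" using that by simp
        from koszul_nonzero[OF this] obtain v where "v \<in> {1..n} - S" "g (insert v S) \<noteq> 0" by (elim bexE)
        then have "S \<subseteq> keys u" using gk[of "insert v S"] by blast
        moreover have "card S = Suc i" using nz supp_koszul[OF gP] by (auto simp: supp_on_def)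
        ultimately show ?thesis by simp
      qed
      have "G \<in> kchains (ideal_fam \<Delta>) u (Suc i)" unfolding kchains_def
      proof (intro CollectI conjI allI impI)
        fix S p assume "G (S, p) \<noteq> 0"
        then have "k S - bd n g S \<noteq> 0" by (auto simp: G_def split: if_splits)
        then show "S \<subseteq> keys u" "card S = Suc i" using Gk by auto
      next
        fix S assume S: "S \<subseteq> keys u"
        have "k S - bd n g S = 0" if "keys (u - sqfree S) \<in> \<Delta>"
        proof (rule ccontr)
          assume nz: "k S - bd n g S \<noteq> 0"
          have "S \<in> kfaces \<Delta> u" using S that by (simp add: kfaces_def)
          then show False using g(2)[of S] Gk[OF nz] nz by simp
        qed
        then show "(\<lambda>p. G (S, p)) \<in> ideal_fam \<Delta> (u - sqfree S)" by (auto simp: ideal_fam_def G_def)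
      qed
      moreover have "kbd n G (T, p) = F (T, p)" for T p
      proof (cases "p = 0")
        case True
        show ?thesis
        proof (cases "finite T")
          case fT: True
          have "bd n (bd n g) T = 0" by (rule koszul_koszul[OF fT])
          then show ?thesis using True bk[OF fT] by (simp add: kbd_def G_def koszul_diff)
        next
          case False
          then have "k (insert v T) = 0" "bd n g (insert v T) = 0" for v
            using kk[of "insert v T"] koszul_infinite[OF gP, of "insert v T"] finite_subset[of "insert v T" "keys u"] by auto
          then show ?thesis using True False kchains_finite[OF F(1), of T 0] by (auto simp: kbd_def G_def koszul_def)
        qed
      next
        case False
        then show ?thesis using F0[of p T] by (simp add: kbd_def G_def)
      qed
      ultimately show ?thesis unfolding kbounds_def by (intro image_eqI[of _ _ G]) auto
    qed
  qed
qed

section \<open>Existence of minimal resolutions\<close>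

lemma mdvd_antisym: "mdvd a b \<Longrightarrow> mdvd b a \<Longrightarrow> a = b"
  by (intro poly_mapping_eqI) (auto simp: mdvd_def intro: antisym)

lemma kchains_cong:
  assumes "u \<in> monomials n" "\<And>u. u \<in> monomials n \<Longrightarrow> Z u = Z' u"
  shows "kchains Z u j = kchains Z' u j"
  unfolding kchains_def using assms(2)[OF monomials_minus[OF assms(1)]] by simp

text \<open>A minimal multigraded resolution, with all its maps written as scalar matrices.\<close>

definition scalar_res :: "nat \<Rightarrow> nat set set \<Rightarrow> (nat \<Rightarrow> monomial list) \<Rightarrow> (nat \<Rightarrow> nat \<Rightarrow> nat \<Rightarrow> 'k::field) \<Rightarrow> bool" where
  "scalar_res n \<Delta> a C \<longleftrightarrow> a 0 = [0] \<and> (\<forall>i. set (a i) \<subseteq> monomials n) \<and> (\<forall>i. minimal_mat (a i) (a (Suc i)) (C i)) \<and>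
     (\<forall>u\<in>monomials n. imgs (a (Suc 0)) (C 0) u = ideal_fam \<Delta> u) \<and>
     (\<forall>i. \<forall>u\<in>monomials n. imgs (a (Suc (Suc i))) (C (Suc i)) u = kers (a (Suc i)) (C i) u)"

text \<open>A nonzero contribution would need a generator of c whose degree is strictly divisible by
  b_p = u and at the same time divides u.\<close>

lemma imgs_minimal:
  assumes "minimal_mat b c D" "w \<in> imgs c D u" "b ! p = u" shows "w p = 0"
proof -
  obtain x where x: "x \<in> frees c u" "w = matapp (length c) D x" using assms(2) by (auto simp: imgs_def)
  have "D p q * x q = 0" for q
  proof (rule ccontr)
    assume "D p q * x q \<noteq> 0"
    then have "D p q \<noteq> 0" "x q \<noteq> 0" by auto
    then have "mdvd (b ! p) (c ! q)" "b ! p \<noteq> c ! q" "mdvd (c ! q) u" using assms(1) x(1) by (auto simp: minimal_mat_def frees_def)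
    then show False using assms(3) mdvd_antisym by blast
  qed
  then show ?thesis unfolding x(2) matapp_def by (rule sum.neutral[rule_format])
qed

text \<open>The generators in degree u form a basis of H_0 of the i-th syzygy module by
  \<open>Koszul_start\<close>; each \<open>Koszul_shift\<close> moves one module back and one
  homological degree up, ending at H_i of the ideal.\<close>

lemma scalar_res_qbasis:
  assumes S: "scalar_res n \<Delta> a (C :: nat \<Rightarrow> nat \<Rightarrow> nat \<Rightarrow> 'k::field)" and u: "u \<in> monomials n"
  shows "\<exists>\<beta>. qbasis {p. p < length (a (Suc i)) \<and> a (Suc i) ! p = u} \<beta> (kcycles n (ideal_fam \<Delta>) u i) (kbounds n (ideal_fam \<Delta> :: _ \<Rightarrow> (nat \<Rightarrow> 'k) set) u i)"
proof -
  let ?J = "{p. p < length (a (Suc i)) \<and> a (Suc i) ! p = u}"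
  let ?Z = "\<lambda>l. imgs (a (Suc l)) (C l)"
  have ker: "imgs (a (Suc (Suc l))) (C (Suc l)) v = kers (a (Suc l)) (C l) v" if "v \<in> monomials n" for l v
    using S that by (auto simp: scalar_res_def)
  have min: "w p = 0" if "w \<in> kers (a (Suc l)) (C l) u" "a (Suc l) ! p = u" for w p l
  proof -
    have "minimal_mat (a (Suc l)) (a (Suc (Suc l))) (C (Suc l))" using S by (simp add: scalar_res_def)
    then show ?thesis using that ker[OF u] by (intro imgs_minimal[of "a (Suc l)" "a (Suc (Suc l))" "C (Suc l)" w u p]) auto
  qed
  have "\<exists>\<beta>. qbasis ?J \<beta> (kcycles n (?Z (i - k)) u k) (kbounds n (?Z (i - k)) u k)" if "k \<le> i" for k
    using that
  proof (induction k)
    case 0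
    have "\<exists>\<beta>. qbasis ?J \<beta> (kcycles n (?Z i) u 0) (kbounds n (?Z i) u 0)"
      by (rule Koszul_start[OF u]) (rule min)
    then show ?case by simp
  next
    case (Suc k)
    then obtain \<beta> where q: "qbasis ?J \<beta> (kcycles n (?Z (i - k)) u k) (kbounds n (?Z (i - k)) u k)" by auto
    obtain l where l: "i - k = Suc l" "i - Suc k = l" using Suc.prems by (metis Suc_diff_Suc Suc_le_lessD)
    have "kchains (?Z (Suc l)) u j = kchains (kers (a (Suc l)) (C l)) u j" for j
      by (rule kchains_cong[OF u ker])
    then have "qbasis ?J \<beta> (kcycles n (kers (a (Suc l)) (C l)) u k) (kbounds n (kers (a (Suc l)) (C l)) u k)"
      using q l by (simp add: kcycles_def kbounds_def)
    then show ?case unfolding l(2) by (rule Koszul_shift[OF u]) (rule min)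
  qed
  from this[of i] obtain \<beta> where q: "qbasis ?J \<beta> (kcycles n (?Z 0) u i) (kbounds n (?Z 0) u i)" by auto
  have "kchains (?Z 0) u j = kchains (ideal_fam \<Delta> :: _ \<Rightarrow> (nat \<Rightarrow> 'k) set) u j" for j
    by (rule kchains_cong[OF u]) (use S in \<open>auto simp: scalar_res_def\<close>)
  then have "qbasis ?J \<beta> (kcycles n (ideal_fam \<Delta>) u i) (kbounds n (ideal_fam \<Delta>) u i)" using q by (simp add: kcycles_def kbounds_def)
  then show ?thesis by blast
qed

text \<open>The invariant of the construction: generators of squarefree degree, a submodule
  determined by its squarefree degrees, and containment in the maximal ideal times the free module.
  It leaves only the subsets of \<open>{1..n}\<close> as degrees to search for generators, so each
  step is finite.\<close>

definition syz_fam :: "nat \<Rightarrow> monomial list \<Rightarrow> (monomial \<Rightarrow> (nat \<Rightarrow> 'k::field) set) \<Rightarrow> bool" where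
  "syz_fam n a Z \<longleftrightarrow> set a \<subseteq> sqfree ` Pow {1..n} \<and> gfam n Z \<and> (\<forall>u\<in>monomials n. Z u \<subseteq> frees a u \<and> Z u = Z (sqfree (keys u)) \<and>
     (\<forall>w\<in>Z u. \<forall>p<length a. a ! p = u \<longrightarrow> w p = 0))"

lemma qbasis_cong:
  assumes "qbasis J b A B" "\<And>j. j \<in> J \<Longrightarrow> b j = b' j" shows "qbasis J b' A B"
proof -
  have "(\<Sum>j\<in>J. c j * b' j z) = (\<Sum>j\<in>J. c j * b j z)" for c z using assms(2) by (intro sum.cong) auto
  then show ?thesis using assms unfolding qbasis_def by simp
qed

lemma sqfree_subset_mdvd:
  assumes "finite W" shows "mdvd (sqfree W) u \<longleftrightarrow> W \<subseteq> keys u"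
proof
  assume "mdvd (sqfree W) u" then show "W \<subseteq> keys u" using mdvd_keys[of "sqfree W" u] keys_sqfree[OF assms] by simp
next
  assume W: "W \<subseteq> keys u"
  have "1 \<le> lk u v" if "v \<in> W" for v
  proof -
    have "v \<in> keys u" using W that by blast
    then show ?thesis by (simp add: in_keys_iff)
  qed
  then show "mdvd (sqfree W) u" using assms by (simp add: mdvd_def lookup_sqfree)
qed

lemma matapp_restrict: "matapp m C w = (\<lambda>p. \<Sum>q\<in>{q. q < m \<and> w q \<noteq> 0}. w q * C p q)"
proof
  fix p
  have "(\<Sum>q\<in>{q. q < m \<and> w q \<noteq> 0}. w q * C p q) = (\<Sum>q<m. w q * C p q)"
    by (rule sum.mono_neutral_left) auto
  then show "matapp m C w p = (\<Sum>q\<in>{q. q < m \<and> w q \<noteq> 0}. w q * C p q)" by (simp add: matapp_def mult.commute)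
qed

text \<open>One step of the minimal resolution: choose a basis of \<open>Z\<^sub>W\<close> modulo the part generated in lower
  squarefree degrees.\<close>

lemma resolution_step:
  fixes Z :: "monomial \<Rightarrow> (nat \<Rightarrow> 'k::field) set"
  assumes g: "syz_fam n a Z"
  shows "\<exists>b C. minimal_mat a b C \<and> (\<forall>u\<in>monomials n. imgs b C u = Z u) \<and> syz_fam n b (kers b C)"
proof -
  note gd = g[unfolded syz_fam_def]
  have Zf: "gfam n Z" and ZF: "\<And>u. u \<in> monomials n \<Longrightarrow> Z u \<subseteq> frees a u"
    and Zk: "\<And>u. u \<in> monomials n \<Longrightarrow> Z u = Z (sqfree (keys u))"
    and Zm: "\<And>u w p. u \<in> monomials n \<Longrightarrow> w \<in> Z u \<Longrightarrow> p < length a \<Longrightarrow> a ! p = u \<Longrightarrow> w p = 0"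
    using gd by blast+
  have fW: "finite W" if "W \<subseteq> {1..n}" for W using that finite_subset by auto
  have mW: "sqfree W \<in> monomials n" if "W \<subseteq> {1..n}" for W using sqfree_monomials[OF that] .
  have sZ: "subsp (Z u)" if "u \<in> monomials n" for u using Zf that by (simp add: gfam_def)
  have Zmono: "Z (sqfree V) \<subseteq> Z (sqfree W)" if "V \<subseteq> W" "W \<subseteq> {1..n}" for V W
  proof -
    have V: "V \<subseteq> {1..n}" using that by blast
    have "mdvd (sqfree V) (sqfree W)" using sqfree_subset_mdvd[OF fW[OF V], of "sqfree W"] that keys_sqfree[OF fW[OF that(2)]] by simp
    then show ?thesis using Zf mW[OF V] mW[OF that(2)] unfolding gfam_def by blast
  qed
  \<comment> \<open>The degree W part of the maximal ideal times Z; its complement is what new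
    generators must supply.\<close>
  define Low where "Low W = {w. \<exists>y. (\<forall>v\<in>W. y v \<in> Z (sqfree (W - {v}))) \<and> w = (\<lambda>p. \<Sum>v\<in>W. y v p)}" for W
  have subW: "W - {v} \<subseteq> {1..n}" if "W \<subseteq> {1..n}" for W and v :: nat using that by blast
  have Lsub: "subsp (Low W)" if W: "W \<subseteq> {1..n}" for W
    unfolding subsp_def
  proof (intro conjI ballI allI)
    show "(\<lambda>_. 0) \<in> Low W" unfolding Low_def using subsp_zero[OF sZ[OF mW[OF subW[OF W]]]]
      by (intro CollectI exI[of _ "\<lambda>_ _. 0"]) simp
    fix x y c assume "x \<in> Low W" "y \<in> Low W"
    then obtain x' y' where x': "\<forall>v\<in>W. x' v \<in> Z (sqfree (W - {v}))" "x = (\<lambda>p. \<Sum>v\<in>W. x' v p)"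
      and y': "\<forall>v\<in>W. y' v \<in> Z (sqfree (W - {v}))" "y = (\<lambda>p. \<Sum>v\<in>W. y' v p)" unfolding Low_def by blast
    have "\<forall>v\<in>W. (\<lambda>p. x' v p + c * y' v p) \<in> Z (sqfree (W - {v}))"
      using x'(1) y'(1) subsp_comb[OF sZ[OF mW[OF subW[OF W]]]] by blast
    moreover have "(\<lambda>z. x z + c * y z) = (\<lambda>p. \<Sum>v\<in>W. x' v p + c * y' v p)"
      unfolding x'(2) y'(2) by (simp add: sum.distrib sum_distrib_left)
    ultimately show "(\<lambda>z. x z + c * y z) \<in> Low W" unfolding Low_def
      by (intro CollectI exI[of _ "\<lambda>v p. x' v p + c * y' v p"] conjI)
  qed
  have LowZ: "Low W \<subseteq> Z (sqfree W)" if W: "W \<subseteq> {1..n}" for W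
  proof
    fix w assume "w \<in> Low W"
    then obtain y where y: "\<forall>v\<in>W. y v \<in> Z (sqfree (W - {v}))" "w = (\<lambda>p. \<Sum>v\<in>W. y v p)" unfolding Low_def by blast
    have "y v \<in> Z (sqfree W)" if "v \<in> W" for v using y(1) that Zmono[of "W - {v}" W] W by blast
    then show "w \<in> Z (sqfree W)" unfolding y(2) by (rule subsp_sum1[OF sZ[OF mW[OF W]]])
  qed
  have LowI: "x \<in> Low W" if W: "W \<subseteq> {1..n}" and v: "v \<in> W" and x: "x \<in> Z (sqfree (W - {v}))" for x v W
  proof -
    let ?y = "\<lambda>v'. if v' = v then x else (\<lambda>_. 0)"
    have "\<forall>v'\<in>W. ?y v' \<in> Z (sqfree (W - {v'}))" using x subsp_zero[OF sZ[OF mW[OF subW[OF W]]]] by simp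
    moreover have "x = (\<lambda>p. \<Sum>v'\<in>W. ?y v' p)"
    proof
      fix p
      have "(\<Sum>v'\<in>W. ?y v' p) = (\<Sum>v'\<in>W. if v' = v then x p else 0)" by (intro sum.cong) auto
      then show "x p = (\<Sum>v'\<in>W. ?y v' p)" using v fW[OF W] by (simp add: sum.delta)
    qed
    ultimately show ?thesis unfolding Low_def by (intro CollectI exI[of _ ?y] conjI)
  qed
  have "\<exists>(r::nat) \<beta>. qbasis {..<r} \<beta> (Z (sqfree W)) (Low W)" if W: "W \<in> Pow {1..n}" for W
  proof (rule qbasis_exists[of "{..<length a}"])
    show "z \<in> {..<length a}" if "f \<in> Z (sqfree W)" "f z \<noteq> 0" for f z
      using ZF[OF mW] W that by (auto simp: frees_def)
  qed (use W sZ mW Lsub LowZ in auto)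
  then obtain r :: "nat set \<Rightarrow> nat" and \<beta> where q: "\<And>W. W \<in> Pow {1..n} \<Longrightarrow> qbasis {..<r W} (\<beta> W) (Z (sqfree W)) (Low W)" by metis
  \<comment> \<open>One generator for each subset W and each basis vector of Z in degree W modulo
    \<open>Low W\<close>.\<close>
  define P where "P = (SIGMA W:Pow {1..n}. {..<r W})"
  have "finite P" unfolding P_def by (intro finite_SigmaI) auto
  then obtain ps where ps: "set ps = P" "distinct ps" using finite_distinct_list by blast
  define m where "m = length ps"
  define bb where "bb k = \<beta> (fst (ps ! k)) (snd (ps ! k))" for k
  define b where "b = map (\<lambda>x. sqfree (fst x)) ps"
  define C where "C p k = (if k < m then bb k p else 0)" for p k
  define JW where "JW W = {k. k < m \<and> fst (ps ! k) = W}" for W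
  have lb: "length b = m" and bk: "k < m \<Longrightarrow> b ! k = sqfree (fst (ps ! k))" for k by (simp_all add: b_def m_def)
  have psP: "fst (ps ! k) \<subseteq> {1..n} \<and> snd (ps ! k) < r (fst (ps ! k))" if "k < m" for k
  proof -
    have "ps ! k \<in> P" using that ps(1) by (metis m_def nth_mem)
    then show ?thesis by (auto simp: P_def)
  qed
  have bbZ: "bb k \<in> Z (b ! k)" if "k < m" for k
    using qbasisD(2)[OF q, of "fst (ps ! k)" "snd (ps ! k)"] psP[OF that] bk[OF that] by (simp add: bb_def)
  have bm: "b ! k \<in> monomials n" if "k < m" for k using bk[OF that] mW psP[OF that] by simp
  have qJ: "qbasis (JW W) bb (Z (sqfree W)) (Low W)" if W: "W \<subseteq> {1..n}" for W
  proof -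
    have "bij_betw (\<lambda>k. snd (ps ! k)) (JW W) {..<r W}"
      unfolding bij_betw_def
    proof
      show "inj_on (\<lambda>k. snd (ps ! k)) (JW W)"
      proof (rule inj_onI)
        fix k l assume kl: "k \<in> JW W" "l \<in> JW W" "snd (ps ! k) = snd (ps ! l)"
        then have "ps ! k = ps ! l" by (simp add: JW_def prod_eq_iff)
        then show "k = l" using kl ps(2) by (simp add: JW_def m_def nth_eq_iff_index_eq)
      qed
      show "(\<lambda>k. snd (ps ! k)) ` JW W = {..<r W}"
      proof
        show "(\<lambda>k. snd (ps ! k)) ` JW W \<subseteq> {..<r W}" using psP by (auto simp: JW_def)
        show "{..<r W} \<subseteq> (\<lambda>k. snd (ps ! k)) ` JW W"
        proof
          fix j assume "j \<in> {..<r W}"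
          then have "(W, j) \<in> set ps" using W ps(1) by (auto simp: P_def)
          then obtain k where "k < m" "ps ! k = (W, j)" by (auto simp: in_set_conv_nth m_def)
          then show "j \<in> (\<lambda>k. snd (ps ! k)) ` JW W" by (intro image_eqI[of _ _ k]) (simp_all add: JW_def)
        qed
      qed
    qed
    then have "qbasis (JW W) (\<lambda>k. \<beta> W (snd (ps ! k))) (Z (sqfree W)) (Low W)"
      using W by (intro qbasis_reindex[OF q]) simp
    then show ?thesis by (rule qbasis_cong) (simp add: JW_def bb_def)
  qed
  have comp: "minimal_mat a b C" unfolding minimal_mat_def
  proof (intro allI impI)
    fix p k assume nz: "C p k \<noteq> 0"
    then have k: "k < m" and nz: "bb k p \<noteq> 0" by (auto simp: C_def split: if_splits)
    have "bb k \<in> frees a (b ! k)" using ZF[OF bm[OF k]] bbZ[OF k] by blast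
    then have *: "p < length a" "mdvd (a ! p) (b ! k)" using nz by (auto simp: frees_def)
    moreover have "a ! p \<noteq> b ! k" using Zm[OF bm[OF k] bbZ[OF k] *(1)] nz by blast
    ultimately show "p < length a \<and> k < length b \<and> mdvd (a ! p) (b ! k) \<and> a ! p \<noteq> b ! k" using k lb by simp
  qed
  have imZ: "imgs b C u \<subseteq> Z u" if u: "u \<in> monomials n" for u
  proof
    fix x assume "x \<in> imgs b C u"
    then obtain w where w: "w \<in> frees b u" "x = matapp m C w" by (auto simp: imgs_def lb)
    have "(\<lambda>p. C p k) \<in> Z u" if "k \<in> {k. k < m \<and> w k \<noteq> 0}" for k
    proof -
      have k: "k < m" "mdvd (b ! k) u" using that w(1) by (auto simp: frees_def)
      then have "Z (b ! k) \<subseteq> Z u" using Zf bm[OF k(1)] u unfolding gfam_def by blast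
      then show ?thesis using bbZ[OF k(1)] k(1) by (auto simp: C_def)
    qed
    then show "x \<in> Z u" unfolding w(2) matapp_restrict by (rule subsp_sum[OF sZ[OF u]])
  qed
  have imsub: "subsp (imgs b C u)" if "u \<in> monomials n" for u using imgs_gfam that unfolding gfam_def by blast
  \<comment> \<open>Induction on the size of W: modulo chosen generators an element lies in
    \<open>Low W\<close>, hence comes from smaller subsets.\<close>
  have Zim: "Z (sqfree W) \<subseteq> imgs b C (sqfree W)" if "W \<subseteq> {1..n}" for W
    using that
  proof (induction "card W" arbitrary: W rule: less_induct)
    case less
    note W = less.prems
    show ?case
    proof
      fix z assume "z \<in> Z (sqfree W)"
      then obtain c where "(\<lambda>p. z p - (\<Sum>k\<in>JW W. c k * bb k p)) \<in> Low W" using qbasisD(3)[OF qJ[OF W]] by blast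
      then obtain y where y: "\<forall>v\<in>W. y v \<in> Z (sqfree (W - {v}))"
        "(\<lambda>p. z p - (\<Sum>k\<in>JW W. c k * bb k p)) = (\<lambda>p. \<Sum>v\<in>W. y v p)" unfolding Low_def by blast
      have "y v \<in> imgs b C (sqfree W)" if v: "v \<in> W" for v
      proof -
        have "card (W - {v}) < card W" by (rule card_Diff1_less[OF fW[OF W] v])
        then have "y v \<in> imgs b C (sqfree (W - {v}))" using less.hyps[OF _ subW[OF W]] y(1) v by blast
        moreover have "mdvd (sqfree (W - {v})) (sqfree W)"
          using sqfree_subset_mdvd[OF fW[OF subW[OF W]], of v "sqfree W"] keys_sqfree[OF fW[OF W]] by auto
        ultimately show ?thesis using imgs_gfam[of n b C] mW[OF W] mW[OF subW[OF W]] unfolding gfam_def by blast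
      qed
      then have 1: "(\<lambda>p. \<Sum>v\<in>W. y v p) \<in> imgs b C (sqfree W)" by (rule subsp_sum1[OF imsub[OF mW[OF W]]])
      have "bb k \<in> imgs b C (sqfree W)" if k: "k \<in> JW W" for k
      proof -
        have km: "k < m" "b ! k = sqfree W" using k bk by (auto simp: JW_def)
        let ?w = "\<lambda>l. if l = k then 1 else 0 :: 'k"
        have "?w \<in> frees b (sqfree W)" using km lb by (simp add: frees_def)
        moreover have "matapp m C ?w = bb k"
          using km(1) by (simp add: matapp_def C_def fun_eq_iff if_distrib[of "(*) _"] sum.delta cong: if_cong)
        ultimately show ?thesis unfolding imgs_def lb by (intro image_eqI[of _ _ ?w]) simp_all
      qed
      then have "(\<lambda>p. \<Sum>k\<in>JW W. c k * bb k p) \<in> imgs b C (sqfree W)" by (rule subsp_sum[OF imsub[OF mW[OF W]]])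
      from subsp_add[OF imsub[OF mW[OF W]] this 1]
      have "(\<lambda>p. (\<Sum>k\<in>JW W. c k * bb k p) + (\<Sum>v\<in>W. y v p)) \<in> imgs b C (sqfree W)" .
      moreover have "(\<lambda>p. (\<Sum>k\<in>JW W. c k * bb k p) + (\<Sum>v\<in>W. y v p)) = z"
        using y(2) by (simp add: fun_eq_iff) (metis add_diff_eq add_diff_cancel_left')
      ultimately show "z \<in> imgs b C (sqfree W)" by simp
    qed
  qed
  have im: "imgs b C u = Z u" if u: "u \<in> monomials n" for u
  proof
    show "imgs b C u \<subseteq> Z u" by (rule imZ[OF u])
    have k: "keys u \<subseteq> {1..n}" using u by (simp add: monomials_def)
    have "mdvd (sqfree (keys u)) u" by (simp add: sqfree_subset_mdvd)
    then have "imgs b C (sqfree (keys u)) \<subseteq> imgs b C u" using imgs_gfam[of n b C] mW[OF k] u unfolding gfam_def by blast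
    then show "Z u \<subseteq> imgs b C u" using Zk[OF u] Zim[OF k] by blast
  qed
  have "syz_fam n b (kers b C)" unfolding syz_fam_def
  proof (intro conjI ballI allI impI)
    show "set b \<subseteq> sqfree ` Pow {1..n}" using ps(1) by (auto simp: b_def P_def)
    show "gfam n (kers b C)" by (rule kers_gfam)
    fix u assume u: "u \<in> monomials n"
    show "kers b C u \<subseteq> frees b u" by (auto simp: kers_def)
    have "frees b u = (frees b (sqfree (keys u)) :: (nat \<Rightarrow> 'k) set)"
    proof -
      have "mdvd (b ! k) u \<longleftrightarrow> mdvd (b ! k) (sqfree (keys u))" if "k < m" for k
        using bk[OF that] psP[OF that] sqfree_subset_mdvd[OF fW, of "fst (ps ! k)"] keys_sqfree[of "keys u"] by simp
      then show ?thesis by (auto simp: frees_def lb)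
    qed
    then show "kers b C u = kers b C (sqfree (keys u))" by (simp add: kers_def)
    fix w k assume w: "w \<in> kers b C u" and k: "k < length b" "b ! k = u"
    let ?W = "fst (ps ! k)"
    have km: "k < m" using k lb by simp
    have W: "?W \<subseteq> {1..n}" and uW: "u = sqfree ?W" using psP[OF km] bk[OF km] k(2) by auto
    have wF: "w \<in> frees b u" and w0: "matapp m C w = (\<lambda>_. 0)" using w by (auto simp: kers_def lb)
    \<comment> \<open>A generator of another degree dividing x_W has its degree in a proper subset,
      so its value lies in \<open>Low W\<close>. A relation in degree W then reduces modulo
      \<open>Low W\<close> to the basis vectors at W, whose coefficients vanish.\<close>
    have in_Low: "(\<lambda>p. C p l) \<in> Low ?W" if l: "l \<in> {l. l < m \<and> w l \<noteq> 0} - JW ?W" for l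
    proof -
      have lm: "l < m" "fst (ps ! l) \<noteq> ?W" "mdvd (b ! l) u" using l wF by (auto simp: JW_def frees_def)
      have V: "fst (ps ! l) \<subseteq> {1..n}" using psP[OF lm(1)] by simp
      have "fst (ps ! l) \<subseteq> ?W" using lm(3) bk[OF lm(1)] sqfree_subset_mdvd[OF fW[OF V], of u] keys_sqfree[OF fW[OF W]] uW by simp
      then obtain v where v: "v \<in> ?W" "fst (ps ! l) \<subseteq> ?W - {v}" using lm(2) by blast
      have "bb l \<in> Z (sqfree (?W - {v}))" using bbZ[OF lm(1)] bk[OF lm(1)] Zmono[OF v(2) subW[OF W]] by auto
      then have "bb l \<in> Low ?W" by (rule LowI[OF W v(1)])
      then show ?thesis using lm(1) by (simp add: C_def)
    qed
    have A: "(\<lambda>p. \<Sum>l\<in>{l. l < m \<and> w l \<noteq> 0} - JW ?W. w l * C p l) \<in> Low ?W"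
      by (rule subsp_sum[OF Lsub[OF W] in_Low])
    have sum: "(\<Sum>l\<in>JW ?W. w l * bb l p) = - (\<Sum>l\<in>{l. l < m \<and> w l \<noteq> 0} - JW ?W. w l * C p l)" for p
    proof -
      have "0 = (\<Sum>l<m. w l * C p l)" using fun_cong[OF w0, of p] by (simp add: matapp_def mult.commute)
      also have "{..<m} = JW ?W \<union> ({..<m} - JW ?W)" by (auto simp: JW_def)
      also have "(\<Sum>l\<in>\<dots>. w l * C p l) = (\<Sum>l\<in>JW ?W. w l * C p l) + (\<Sum>l\<in>{..<m} - JW ?W. w l * C p l)"
        by (rule sum.union_disjoint) (auto simp: JW_def)
      also have "(\<Sum>l\<in>JW ?W. w l * C p l) = (\<Sum>l\<in>JW ?W. w l * bb l p)"
        by (intro sum.cong) (auto simp: JW_def C_def)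
      also have "(\<Sum>l\<in>{..<m} - JW ?W. w l * C p l) = (\<Sum>l\<in>{l. l < m \<and> w l \<noteq> 0} - JW ?W. w l * C p l)"
        by (rule sum.mono_neutral_right) auto
      finally show ?thesis by (simp add: eq_neg_iff_add_eq_0)
    qed
    have "(\<lambda>p. \<Sum>l\<in>JW ?W. w l * bb l p) \<in> Low ?W"
      unfolding sum using subsp_scale[OF Lsub[OF W] A, of "-1"] by simp
    then show "w k = 0" using qbasisD(4)[OF qJ[OF W], of w k] km by (simp add: JW_def)
  qed
  then show ?thesis using comp im by blast
qed

lemma syz_fam_ideal_fam:
  assumes c: "cplx n \<Delta>" and e: "{} \<in> \<Delta>"
  shows "syz_fam n [0] (ideal_fam \<Delta> :: _ \<Rightarrow> (nat \<Rightarrow> 'k::field) set)"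
  unfolding syz_fam_def
proof (intro conjI ballI allI impI)
  have "sqfree {} = 0" by (simp add: sqfree_def)
  then show "set [0] \<subseteq> sqfree ` Pow {1..n}" by (auto intro: image_eqI[of _ _ "{}"])
  show "gfam n (ideal_fam \<Delta> :: _ \<Rightarrow> (nat \<Rightarrow> 'k) set)" by (rule ideal_fam_gfam[OF c])
  fix u
  have "p = 0" if "w \<in> ideal_fam \<Delta> u" "w p \<noteq> 0" for w :: "nat \<Rightarrow> 'k" and p using that by (auto simp: ideal_fam_def)
  then show "(ideal_fam \<Delta> u :: (nat \<Rightarrow> 'k) set) \<subseteq> frees [0] u" unfolding frees_def by fastforce
  show "(ideal_fam \<Delta> u :: (nat \<Rightarrow> 'k) set) = ideal_fam \<Delta> (sqfree (keys u))" by (simp add: ideal_fam_def keys_sqfree)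
  fix w :: "nat \<Rightarrow> 'k" and p assume "w \<in> ideal_fam \<Delta> u" "p < length [0 :: monomial]" "[0] ! p = u"
  then show "w p = 0" using e by (auto simp: ideal_fam_def)
qed

text \<open>Dependent choice on pairs of generator list and syzygy family; the clause for i = 0 pins
  the start to the ideal inside R.\<close>

lemma scalar_res_exists:
  assumes c: "cplx n \<Delta>" and e: "{} \<in> \<Delta>"
  shows "\<exists>a (C :: nat \<Rightarrow> nat \<Rightarrow> nat \<Rightarrow> 'k::field). scalar_res n \<Delta> a C"
proof -
  let ?P = "\<lambda>(i::nat) x. syz_fam n (fst x) (snd x) \<and> (i = 0 \<longrightarrow> x = ([0], ideal_fam \<Delta> :: _ \<Rightarrow> (nat \<Rightarrow> 'k) set))"
  let ?Q = "\<lambda>(i::nat) x y. \<exists>C. minimal_mat (fst x) (fst y) C \<and> (\<forall>u\<in>monomials n. imgs (fst y) C u = snd x u) \<and> snd y = kers (fst y) C"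
  have "\<exists>f. \<forall>i. ?P i (f i) \<and> ?Q i (f i) (f (Suc i))"
  proof (rule dependent_nat_choice)
    show "\<exists>x. ?P 0 x" using syz_fam_ideal_fam[OF c e] by (intro exI[of _ "([0], ideal_fam \<Delta>)"]) simp
    fix x i assume "?P i x"
    then obtain b C where bC: "minimal_mat (fst x) b C" "\<forall>u\<in>monomials n. imgs b C u = snd x u" "syz_fam n b (kers b C)"
      using resolution_step by blast
    then show "\<exists>y. ?P (Suc i) y \<and> ?Q i x y" by (intro exI[of _ "(b, kers b C)"]) auto
  qed
  then obtain f where f0: "\<forall>i. ?P i (f i) \<and> ?Q i (f i) (f (Suc i))" by (rule exE)
  have f: "\<And>i. ?P i (f i)" "\<And>i. ?Q i (f i) (f (Suc i))"
    by (rule f0[rule_format, THEN conjunct1], rule f0[rule_format, THEN conjunct2])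
  from f(2) obtain C where C: "\<And>i. minimal_mat (fst (f i)) (fst (f (Suc i))) (C i)"
    "\<And>i u. u \<in> monomials n \<Longrightarrow> imgs (fst (f (Suc i))) (C i) u = snd (f i) u" "\<And>i. snd (f (Suc i)) = kers (fst (f (Suc i))) (C i)"
    by metis
  have f0: "f 0 = ([0], ideal_fam \<Delta>)" using f(1)[of 0] by simp
  have "set (fst (f i)) \<subseteq> monomials n" for i
  proof -
    have "set (fst (f i)) \<subseteq> sqfree ` Pow {1..n}" using f(1)[of i] by (simp add: syz_fam_def)
    also have "\<dots> \<subseteq> monomials n" using sqfree_monomials by blast
    finally show ?thesis .
  qed
  then have "scalar_res n \<Delta> (\<lambda>i. fst (f i)) C"
    unfolding scalar_res_def using C f0 by simp
  then show ?thesis by blast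
qed

section \<open>Scalar matrices and polynomial matrices\<close>

definition free_mod :: "nat \<Rightarrow> monomial list \<Rightarrow> 'k::field mpoly vec set" where
  "free_mod n a = {v \<in> carrier_vec (length a). \<forall>j<length a. v $ j \<in> polys n}"

lemma free_module_free_mod: "free_module n (length a) = free_mod n a"
  by (simp add: free_module_def free_mod_def)

text \<open>Coordinates of the degree u part in the basis x^(u-a_p) e_p. The guard is needed since
  subtraction of exponents truncates.\<close>

definition comps :: "monomial list \<Rightarrow> monomial \<Rightarrow> 'k::field mpoly vec \<Rightarrow> nat \<Rightarrow> 'k" where
  "comps a u v = (\<lambda>p. if p < length a \<and> mdvd (a ! p) u then lk (v $ p) (u - a ! p) else 0)"

definition homog_mat :: "monomial list \<Rightarrow> monomial list \<Rightarrow> (nat \<Rightarrow> nat \<Rightarrow> 'k::field) \<Rightarrow> 'k mpoly mat" where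
  "homog_mat a b C = mat (length a) (length b) (\<lambda>(p, q). single (b ! q - a ! p) (C p q))"

lemma comps_frees: "comps a u v \<in> frees a u"
  by (simp add: frees_def comps_def)

lemma mdvd_plus: "mdvd a u \<Longrightarrow> u - a + a = u"
  by (intro poly_mapping_eqI) (simp add: mdvd_def lookup_add lookup_minus)

lemma mdvd_plusI: "mdvd a (m + a)"
  by (simp add: mdvd_def lookup_add)

lemma homog_mat_carrier: "homog_mat a b C \<in> carrier_mat (length a) (length b)"
  by (simp add: homog_mat_def)

lemma homog_mat_index:
  assumes "v \<in> carrier_vec (length b)" "p < length a"
  shows "(homog_mat a b C *\<^sub>v v) $ p = (\<Sum>q<length b. single (b ! q - a ! p) (C p q) * v $ q)"
  using assms by (simp add: homog_mat_def scalar_prod_def lessThan_atLeast0)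

text \<open>A homogeneous matrix acts on each multidegree by its scalars: the monomial b_q / a_p
  carries the basis element of degree u over q to the one over p.\<close>

lemma comps_mult:
  assumes C: "minimal_mat a b C" and v: "v \<in> carrier_vec (length b)"
  shows "comps a u (homog_mat a b C *\<^sub>v v) = matapp (length b) C (comps b u v)"
proof
  fix p
  show "comps a u (homog_mat a b C *\<^sub>v v) p = matapp (length b) C (comps b u v) p"
  proof (cases "p < length a \<and> mdvd (a ! p) u")
    case False
    have "C p q * comps b u v q = 0" for q
    proof (rule ccontr)
      assume "C p q * comps b u v q \<noteq> 0"
      then have "C p q \<noteq> 0" "comps b u v q \<noteq> 0" by auto
      then have "p < length a" "mdvd (a ! p) (b ! q)" "mdvd (b ! q) u" using C by (auto simp: minimal_mat_def comps_def split: if_splits)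
      then show False using False mdvd_trans by blast
    qed
    then have "matapp (length b) C (comps b u v) p = 0" unfolding matapp_def by (rule sum.neutral[rule_format])
    moreover have "comps a u (homog_mat a b C *\<^sub>v v) p = 0" unfolding comps_def using False by (simp only: if_False)
    ultimately show ?thesis by simp
  next
    case True
    then have "comps a u (homog_mat a b C *\<^sub>v v) p = (\<Sum>q<length b. lk (single (b ! q - a ! p) (C p q) * v $ q) (u - a ! p))"
      by (simp add: comps_def homog_mat_index[OF v] lookup_sum)
    also have "\<dots> = (\<Sum>q<length b. C p q * comps b u v q)"
    proof (intro sum.cong refl)
      fix q assume q: "q \<in> {..<length b}"
      show "lk (single (b ! q - a ! p) (C p q) * v $ q) (u - a ! p) = C p q * comps b u v q"
      proof (cases "C p q = 0")
        case False
        then have ab: "mdvd (a ! p) (b ! q)" using C by (simp add: minimal_mat_def)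
        show ?thesis
        proof (cases "mdvd (b ! q) u")
          case bu: True
          have "u - a ! p = (b ! q - a ! p) + (u - b ! q)"
            using ab bu by (intro poly_mapping_eqI) (simp add: mdvd_def lookup_add lookup_minus)
          then show ?thesis using bu q by (simp add: lookup_single_times_plus comps_def)
        next
          case bu: False
          have "u - a ! p \<noteq> (b ! q - a ! p) + m'" for m'
          proof
            assume "u - a ! p = (b ! q - a ! p) + m'"
            then have "u - a ! p + a ! p = m' + (b ! q - a ! p + a ! p)" by (simp add: ac_simps)
            then have "u = m' + b ! q" using mdvd_plus True ab by simp
            then show False using bu mdvd_plusI by simp
          qed
          then show ?thesis using bu by (simp add: lookup_single_times_none comps_def)
        qed
      qed simp
    qed
    finally show ?thesis by (simp add: matapp_def)
  qed
qed

lemma free_mod_assemble: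
  assumes U: "finite U" "U \<subseteq> monomials n" and w: "\<And>u. u \<in> U \<Longrightarrow> w u \<in> frees a u"
  shows "\<exists>v\<in>free_mod n a. \<forall>u. comps a u v = (if u \<in> U then w u else (\<lambda>_. 0))"
proof -
  define v where "v = vec (length a) (\<lambda>p. \<Sum>u\<in>U. single (u - a ! p) (w u p))"
  have "v \<in> free_mod n a" using U(2) by (auto simp: free_mod_def v_def intro!: polys_sum polys_single monomials_minus)
  moreover have "comps a u v p = (if u \<in> U then w u p else 0)" for u p
  proof (cases "p < length a \<and> mdvd (a ! p) u")
    case False
    then have "w u p = 0" if "u \<in> U" using w[OF that] by (auto simp: frees_def)
    moreover have "comps a u v p = 0" unfolding comps_def using False by (simp only: if_False)
    ultimately show ?thesis by simp
  next
    case True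
    then have "comps a u v p = (\<Sum>u'\<in>U. lk (single (u' - a ! p) (w u' p)) (u - a ! p))"
      by (simp add: comps_def v_def lookup_sum)
    also have "\<dots> = (\<Sum>u'\<in>U. if u = u' then w u' p else 0)"
    proof (intro sum.cong refl)
      fix u' assume u': "u' \<in> U"
      show "lk (single (u' - a ! p) (w u' p)) (u - a ! p) = (if u = u' then w u' p else 0)"
      proof (cases "w u' p = 0")
        case False
        then have "mdvd (a ! p) u'" using w[OF u'] by (auto simp: frees_def)
        then have "u' - a ! p = u - a ! p \<longleftrightarrow> u = u'" using True mdvd_plus by metis
        then show ?thesis by (auto simp: lookup_single when_def)
      qed simp
    qed
    also have "\<dots> = (if u \<in> U then w u p else 0)" using U(1) by (simp add: sum.delta')
    finally show ?thesis .
  qed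
  ultimately show ?thesis by (intro bexI[of _ v]) (auto simp: fun_eq_iff)
qed

lemma comps_inj:
  assumes a: "set a \<subseteq> monomials n" and v: "v \<in> free_mod n a" "v' \<in> free_mod n a"
    and eq: "\<And>u. u \<in> monomials n \<Longrightarrow> comps a u v = comps a u v'"
  shows "v = v'"
proof (rule eq_vecI)
  show "dim_vec v = dim_vec v'" using v by (auto simp: free_mod_def)
  fix p assume "p < dim_vec v'"
  then have p: "p < length a" using v by (auto simp: free_mod_def)
  show "v $ p = v' $ p"
  proof (rule poly_mapping_eqI)
    fix m
    show "lk (v $ p) m = lk (v' $ p) m"
    proof (cases "m \<in> monomials n")
      case True
      have "m + a ! p \<in> monomials n" using True a p by (intro monomials_add) auto
      from fun_cong[OF eq[OF this], of p] show ?thesis using p mdvd_plusI by (simp add: comps_def)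
    next
      case False
      have "v $ p \<in> polys n" "v' $ p \<in> polys n" using v p by (auto simp: free_mod_def)
      then have "m \<notin> keys (v $ p)" "m \<notin> keys (v' $ p)" using False by (auto simp: polys_def)
      then show ?thesis by (simp add: in_keys_iff)
    qed
  qed
qed

lemma comps_finite: "finite {u. comps a u v \<noteq> (\<lambda>_. 0)}"
proof (rule finite_subset)
  show "{u. comps a u v \<noteq> (\<lambda>_. 0)} \<subseteq> (\<Union>p<length a. (\<lambda>m. m + a ! p) ` keys (v $ p))"
  proof
    fix u assume "u \<in> {u. comps a u v \<noteq> (\<lambda>_. 0)}"
    then obtain p where "comps a u v p \<noteq> 0" by (auto simp: fun_eq_iff)
    then have p: "p < length a" "mdvd (a ! p) u" "lk (v $ p) (u - a ! p) \<noteq> 0" by (auto simp: comps_def split: if_splits)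
    then show "u \<in> (\<Union>p<length a. (\<lambda>m. m + a ! p) ` keys (v $ p))"
      using mdvd_plus[OF p(2)] by (auto simp: in_keys_iff intro!: bexI[of _ p] image_eqI[of _ _ "u - a ! p"])
  qed
qed auto

lemma homog_mat_free_mod:
  assumes b: "set b \<subseteq> monomials n" and v: "v \<in> free_mod n b"
  shows "homog_mat a b C *\<^sub>v v \<in> free_mod n a"
proof -
  have vc: "v \<in> carrier_vec (length b)" using v by (simp add: free_mod_def)
  have "(homog_mat a b C *\<^sub>v v) $ p \<in> polys n" if p: "p < length a" for p
    unfolding homog_mat_index[OF vc p]
  proof (intro polys_sum polys_mult polys_single monomials_minus)
    fix q assume "q \<in> {..<length b}"
    then show "b ! q \<in> monomials n" "v $ q \<in> polys n" using b v by (auto simp: free_mod_def)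
  qed
  then show ?thesis using homog_mat_carrier[of a b C] vc unfolding free_mod_def by auto
qed

text \<open>Preimages are chosen degree by degree. Only finitely many degrees of a vector are
  nonzero, so they assemble to a vector of polynomials.\<close>

lemma homog_mat_image_iff:
  assumes C: "minimal_mat a b C" and ab: "set a \<subseteq> monomials n" "set b \<subseteq> monomials n" and v: "v \<in> free_mod n a"
  shows "v \<in> (\<lambda>x. homog_mat a b C *\<^sub>v x) ` free_mod n b \<longleftrightarrow> (\<forall>u\<in>monomials n. comps a u v \<in> imgs b C u)"
proof
  assume "v \<in> (\<lambda>x. homog_mat a b C *\<^sub>v x) ` free_mod n b"
  then obtain x where x: "v = homog_mat a b C *\<^sub>v x" "x \<in> free_mod n b" by blast
  then have "x \<in> carrier_vec (length b)" by (simp add: free_mod_def)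
  then show "\<forall>u\<in>monomials n. comps a u v \<in> imgs b C u"
    unfolding x(1) imgs_def using comps_mult[OF C] by (auto intro!: imageI comps_frees)
next
  assume im: "\<forall>u\<in>monomials n. comps a u v \<in> imgs b C u"
  define U where "U = {u \<in> monomials n. comps a u v \<noteq> (\<lambda>_. 0)}"
  have "finite U" unfolding U_def by (rule finite_subset[OF _ comps_finite[of a v]]) auto
  have "\<forall>u\<in>U. \<exists>w. w \<in> frees b u \<and> matapp (length b) C w = comps a u v"
  proof
    fix u assume "u \<in> U"
    then have "comps a u v \<in> imgs b C u" using im by (simp add: U_def)
    then show "\<exists>w. w \<in> frees b u \<and> matapp (length b) C w = comps a u v" by (auto simp: imgs_def)
  qed
  then obtain w where w: "\<And>u. u \<in> U \<Longrightarrow> w u \<in> frees b u \<and> matapp (length b) C (w u) = comps a u v" by metis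
  obtain x where x: "x \<in> free_mod n b" "\<forall>u. comps b u x = (if u \<in> U then w u else (\<lambda>_. 0))"
    using free_mod_assemble[of U n w b] \<open>finite U\<close> w U_def by auto
  have "homog_mat a b C *\<^sub>v x = v"
  proof (rule comps_inj[OF ab(1) homog_mat_free_mod[OF ab(2) x(1)] v])
    fix u assume u: "u \<in> monomials n"
    have "x \<in> carrier_vec (length b)" using x(1) by (simp add: free_mod_def)
    then have "comps a u (homog_mat a b C *\<^sub>v x) = matapp (length b) C (comps b u x)" by (rule comps_mult[OF C])
    also have "\<dots> = comps a u v"
    proof (cases "u \<in> U")
      case False
      then have "comps a u v = (\<lambda>_. 0)" using u by (simp add: U_def)
      then show ?thesis using False x(2) linmap_zero[OF linmap_matapp] by simp
    qed (use x(2) w in simp)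
    finally show "comps a u (homog_mat a b C *\<^sub>v x) = comps a u v" .
  qed
  then show "v \<in> (\<lambda>x. homog_mat a b C *\<^sub>v x) ` free_mod n b" using x(1) by blast
qed

lemma homog_mat_ker_iff:
  assumes C: "minimal_mat a b C" and ab: "set a \<subseteq> monomials n" "set b \<subseteq> monomials n" and v: "v \<in> free_mod n b"
  shows "homog_mat a b C *\<^sub>v v = 0\<^sub>v (length a) \<longleftrightarrow> (\<forall>u\<in>monomials n. comps b u v \<in> kers b C u)"
proof -
  have vc: "v \<in> carrier_vec (length b)" using v by (simp add: free_mod_def)
  have z: "0\<^sub>v (length a) \<in> free_mod n a" by (simp add: free_mod_def)
  have cz: "comps a u (0\<^sub>v (length a)) = (\<lambda>_. 0)" for u by (auto simp: comps_def)
  have "homog_mat a b C *\<^sub>v v = 0\<^sub>v (length a) \<longleftrightarrow> (\<forall>u\<in>monomials n. comps a u (homog_mat a b C *\<^sub>v v) = comps a u (0\<^sub>v (length a)))"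
    using comps_inj[OF ab(1) homog_mat_free_mod[OF ab(2) v] z] by auto
  then show ?thesis unfolding cz comps_mult[OF C vc] kers_def using comps_frees by auto
qed

text \<open>Vectors concentrated in one degree test equality of the families; they satisfy the
  conditions in other degrees because 0 belongs to every space.\<close>

lemma free_mod_sets_eq:
  fixes K K' :: "monomial \<Rightarrow> (nat \<Rightarrow> 'k::field) set"
  assumes K: "\<And>u. u \<in> monomials n \<Longrightarrow> K u \<subseteq> frees b u \<and> (\<lambda>_. 0) \<in> K u"
    and K': "\<And>u. u \<in> monomials n \<Longrightarrow> K' u \<subseteq> frees b u \<and> (\<lambda>_. 0) \<in> K' u"
  shows "{v \<in> free_mod n b. \<forall>u\<in>monomials n. comps b u v \<in> K u} = {v \<in> free_mod n b. \<forall>u\<in>monomials n. comps b u v \<in> K' u}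
    \<longleftrightarrow> (\<forall>u\<in>monomials n. K u = K' u)"
proof
  have aux: "K u \<subseteq> K' u" if K: "\<And>u. u \<in> monomials n \<Longrightarrow> K u \<subseteq> frees b u \<and> (\<lambda>_. 0) \<in> K u"
    and s: "{v \<in> free_mod n b. \<forall>u\<in>monomials n. comps b u v \<in> K u} \<subseteq> {v \<in> free_mod n b. \<forall>u\<in>monomials n. comps b u v \<in> K' u}"
    and u: "u \<in> monomials n" for u and K K' :: "monomial \<Rightarrow> (nat \<Rightarrow> 'k) set"
  proof
    fix w assume w: "w \<in> K u"
    have wF: "w \<in> frees b u" using K[OF u] w by blast
    obtain v where v: "v \<in> free_mod n b" "\<forall>u'. comps b u' v = (if u' \<in> {u} then w else (\<lambda>_. 0))"
      using free_mod_assemble[of "{u}" n "\<lambda>_. w" b] u wF by auto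
    have "comps b u' v \<in> K u'" if "u' \<in> monomials n" for u' using v(2) K[OF that] w by (cases "u' = u") auto
    then have "v \<in> {v \<in> free_mod n b. \<forall>u\<in>monomials n. comps b u v \<in> K' u}" using s v(1) by blast
    then have "comps b u v \<in> K' u" using u by blast
    then show "w \<in> K' u" using v(2) by simp
  qed
  assume eq: "{v \<in> free_mod n b. \<forall>u\<in>monomials n. comps b u v \<in> K u} = {v \<in> free_mod n b. \<forall>u\<in>monomials n. comps b u v \<in> K' u}"
  show "\<forall>u\<in>monomials n. K u = K' u"
  proof
    fix u assume u: "u \<in> monomials n"
    show "K u = K' u" using aux[of K K', OF K equalityD1[OF eq] u] aux[of K' K, OF K' equalityD2[OF eq] u] by (rule subset_antisym)
  qed
qed auto

lemma zero_imgs: "(\<lambda>_. 0) \<in> imgs b C u" and zero_kers: "(\<lambda>_. 0) \<in> kers b C u"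
  unfolding imgs_def kers_def using linmap_zero[OF linmap_matapp, of "length b" C]
  by (auto simp: frees_def intro!: image_eqI[of _ _ "\<lambda>_. 0"])

lemma kers_subsp_frees: "kers b C u \<subseteq> frees b u"
  by (auto simp: kers_def)

lemma imgs_subsp_frees:
  assumes "minimal_mat a b C" shows "imgs b C u \<subseteq> frees a u"
proof
  fix w assume "w \<in> imgs b C u"
  then obtain x where x: "x \<in> frees b u" "w = matapp (length b) C x" by (auto simp: imgs_def)
  show "w \<in> frees a u" unfolding frees_def
  proof (intro CollectI allI impI)
    fix p assume "w p \<noteq> 0"
    then obtain q where "C p q * x q \<noteq> 0" unfolding x(2) matapp_def by (metis (no_types, lifting) sum.neutral)
    then have "C p q \<noteq> 0" "x q \<noteq> 0" by auto
    then have "p < length a" "mdvd (a ! p) (b ! q)" "mdvd (b ! q) u" using assms x(1) by (auto simp: minimal_mat_def frees_def)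
    then show "p < length a \<and> mdvd (a ! p) u" using mdvd_trans by blast
  qed
qed

lemma homog_mat_exact_iff:
  assumes C: "minimal_mat a b C" "minimal_mat b c C'" and abc: "set a \<subseteq> monomials n" "set b \<subseteq> monomials n" "set c \<subseteq> monomials n"
  shows "{v \<in> free_mod n b. homog_mat a b C *\<^sub>v v = 0\<^sub>v (length a)} = (\<lambda>v. homog_mat b c C' *\<^sub>v v) ` free_mod n c
    \<longleftrightarrow> (\<forall>u\<in>monomials n. imgs c C' u = kers b C u)"
proof -
  have "{v \<in> free_mod n b. homog_mat a b C *\<^sub>v v = 0\<^sub>v (length a)} = {v \<in> free_mod n b. \<forall>u\<in>monomials n. comps b u v \<in> kers b C u}"
    using homog_mat_ker_iff[OF C(1) abc(1,2)] by blast
  moreover have "(\<lambda>v. homog_mat b c C' *\<^sub>v v) ` free_mod n c = {v \<in> free_mod n b. \<forall>u\<in>monomials n. comps b u v \<in> imgs c C' u}"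
    using homog_mat_image_iff[OF C(2) abc(2,3)] homog_mat_free_mod[OF abc(3)] by blast
  moreover have "{v \<in> free_mod n b. \<forall>u\<in>monomials n. comps b u v \<in> kers b C u} = {v \<in> free_mod n b. \<forall>u\<in>monomials n. comps b u v \<in> imgs c C' u}
    \<longleftrightarrow> (\<forall>u\<in>monomials n. kers b C u = imgs c C' u)"
    by (rule free_mod_sets_eq) (simp_all add: zero_imgs zero_kers imgs_subsp_frees[OF C(2)] kers_subsp_frees)
  ultimately show ?thesis by auto
qed

lemma augmentation_lookup:
  assumes e: "e \<in> free_mod n a" "\<And>p. p < length a \<Longrightarrow> keys (e $ p) \<subseteq> {a ! p}" and v: "v \<in> free_mod n a"
  shows "lk (e \<bullet> v) u = (\<Sum>p<length a. lk (e $ p) (a ! p) * comps a u v p)"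
proof -
  have "lk (e \<bullet> v) u = (\<Sum>p<length a. lk (e $ p * v $ p) u)"
  proof -
    have "dim_vec v = length a" using v carrier_vecD[of v "length a"] by (simp add: free_mod_def)
    then show ?thesis by (simp add: scalar_prod_def lookup_sum lessThan_atLeast0)
  qed
  also have "\<dots> = (\<Sum>p<length a. lk (e $ p) (a ! p) * comps a u v p)"
  proof (intro sum.cong refl)
    fix p assume "p \<in> {..<length a}"
    then have p: "p < length a" by simp
    have ep: "e $ p = single (a ! p) (lk (e $ p) (a ! p))"
    proof (rule poly_mapping_eqI)
      fix m show "lk (e $ p) m = lk (single (a ! p) (lk (e $ p) (a ! p))) m"
        using e(2)[OF p] by (cases "m = a ! p") (auto simp: lookup_single in_keys_iff)
    qed
    show "lk (e $ p * v $ p) u = lk (e $ p) (a ! p) * comps a u v p"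
    proof (cases "mdvd (a ! p) u")
      case True
      have "u = a ! p + (u - a ! p)" using mdvd_plus[OF True] by (simp add: add.commute)
      then have "lk (single (a ! p) (lk (e $ p) (a ! p)) * v $ p) u = lk (e $ p) (a ! p) * lk (v $ p) (u - a ! p)"
        by (metis lookup_single_times_plus)
      then show ?thesis using ep p True by (simp add: comps_def)
    next
      case False
      have "u \<noteq> a ! p + m'" for m' using False mdvd_plusI[of "a ! p" m'] by (auto simp: add.commute)
      then have "lk (single (a ! p) (lk (e $ p) (a ! p)) * v $ p) u = 0" by (rule lookup_single_times_none)
      then show ?thesis using ep False by (simp add: comps_def)
    qed
  qed
  finally show ?thesis .
qed

section \<open>Betti numbers\<close>

text \<open>Minimality is imposed on the matrices \<open>D i\<close>; that F_0 is a single generator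
  of degree 0 has to be derived, from surjectivity of the augmentation and minimality of
  \<open>D 0\<close>.\<close>

lemma resolution_scalar_res:
  fixes e :: "'k::field mpoly vec"
  assumes c: "cplx n \<Delta>" and emp: "{} \<in> \<Delta>" and res: "minimal_free_resolution n (nonfaces n \<Delta>) a e D"
  shows "\<exists>C :: nat \<Rightarrow> nat \<Rightarrow> nat \<Rightarrow> 'k. scalar_res n \<Delta> a C"
proof -
  interpret Q: quot n "nonfaces n \<Delta> :: 'k mpoly set" by unfold_locales (rule nonfaces_pideal[OF c])
  note r0 = res[unfolded minimal_free_resolution_def Let_def free_module_free_mod irrelevant_ideal_eq]
  note r1 = conjunct2[OF r0] note r2 = conjunct2[OF r1] note r3 = conjunct2[OF r2]
  note r4 = conjunct2[OF r3] note r5 = conjunct2[OF r4] note r6 = conjunct2[OF r5]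
  have a: "set (a i) \<subseteq> monomials n" for i using conjunct1[OF r0] by (rule spec)
  have e: "e \<in> free_mod n (a 0)" "\<And>p. p < length (a 0) \<Longrightarrow> keys (e $ p) \<subseteq> {a 0 ! p}"
    using conjunct1[OF r1] conjunct1[OF r2] by simp_all
  have Dc: "D i \<in> carrier_mat (length (a i)) (length (a (Suc i)))" for i
    using spec[OF conjunct1[OF r3], of i] by (rule conjunct1)
  have Dk: "m + a i ! p = a (Suc i) ! q"
    if "p < length (a i)" "q < length (a (Suc i))" "m \<in> keys (D i $$ (p, q))" for i p q m
    using spec[OF conjunct1[OF r3], of i] that by simp
  note surj = conjunct1[OF r4] note ex0 = conjunct1[OF r5]
  have ex: "{v \<in> free_mod n (a (Suc i)). D i *\<^sub>v v = 0\<^sub>v (length (a i))} = (\<lambda>v. D (Suc i) *\<^sub>v v) ` free_mod n (a (Suc (Suc i)))" for i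
    using conjunct1[OF r6] by (rule spec)
  have Dm: "elements_mat (D i) \<subseteq> maxid n" for i using conjunct2[OF r6] by (rule spec)
  define C where "C i p q = (if p < length (a i) \<and> q < length (a (Suc i)) then lk (D i $$ (p, q)) (a (Suc i) ! q - a i ! p) else 0)" for i p q
  have CD: "D i = homog_mat (a i) (a (Suc i)) (C i)" for i
  proof (rule eq_matI)
    fix p q assume "p < dim_row (homog_mat (a i) (a (Suc i)) (C i))" "q < dim_col (homog_mat (a i) (a (Suc i)) (C i))"
    then have pq: "p < length (a i)" "q < length (a (Suc i))" by (simp_all add: homog_mat_def)
    have "D i $$ (p, q) = single (a (Suc i) ! q - a i ! p) (C i p q)"
    proof (rule poly_mapping_eqI)
      fix m
      show "lk (D i $$ (p, q)) m = lk (single (a (Suc i) ! q - a i ! p) (C i p q)) m"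
      proof (cases "m = a (Suc i) ! q - a i ! p")
        case False
        have "m \<notin> keys (D i $$ (p, q))"
        proof
          assume "m \<in> keys (D i $$ (p, q))"
          from Dk[OF pq this] have "a (Suc i) ! q - a i ! p = m" by (metis add_diff_cancel_right')
          then show False using False by simp
        qed
        then show ?thesis using False by (simp add: in_keys_iff lookup_single)
      qed (use pq in \<open>simp add: C_def\<close>)
    qed
    then show "D i $$ (p, q) = homog_mat (a i) (a (Suc i)) (C i) $$ (p, q)" using pq by (simp add: homog_mat_def)
  qed (use Dc[of i] in \<open>auto simp: homog_mat_def\<close>)
  have comp: "minimal_mat (a i) (a (Suc i)) (C i)" for i
    unfolding minimal_mat_def
  proof (intro allI impI)
    fix p q assume nz: "C i p q \<noteq> 0"
    then have pq: "p < length (a i)" "q < length (a (Suc i))" by (auto simp: C_def split: if_splits)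
    let ?m = "a (Suc i) ! q - a i ! p"
    have k: "lk (D i $$ (p, q)) ?m \<noteq> 0" using nz pq by (simp add: C_def)
    then have m: "?m + a i ! p = a (Suc i) ! q" using Dk[OF pq, of ?m] by (simp add: in_keys_iff)
    have "D i $$ (p, q) \<in> elements_mat (D i)" by (rule elements_matI[OF Dc pq refl])
    then have z: "lk (D i $$ (p, q)) 0 = 0" using Dm lookup_maxid_zero by blast
    have "a i ! p \<noteq> a (Suc i) ! q" using k z by auto
    moreover have "mdvd (a i ! p) (a (Suc i) ! q)" using mdvd_plusI[of "a i ! p" ?m] m by simp
    ultimately show "p < length (a i) \<and> q < length (a (Suc i)) \<and> mdvd (a i ! p) (a (Suc i) ! q) \<and> a i ! p \<noteq> a (Suc i) ! q"
      using pq by simp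
  qed
  have exact: "\<forall>u\<in>monomials n. imgs (a (Suc (Suc i))) (C (Suc i)) u = kers (a (Suc i)) (C i) u" for i
    using ex[of i] unfolding CD homog_mat_exact_iff[OF comp comp a a a] .
  define \<epsilon> where "\<epsilon> p = lk (e $ p) (a 0 ! p)" for p
  have aug: "lk (e \<bullet> v) u = (\<Sum>p<length (a 0). \<epsilon> p * comps (a 0) u v p)" if "v \<in> free_mod n (a 0)" for v u
    unfolding \<epsilon>_def by (rule augmentation_lookup[OF e that])
  have evR: "e \<bullet> v \<in> polys n" if "v \<in> free_mod n (a 0)" for v
    unfolding scalar_prod_def using e(1) that by (auto simp: free_mod_def intro!: polys_sum polys_mult)
  \<comment> \<open>The kernel of the augmentation F_0 -> R/I in degree u, where R/I is K or 0
    according to whether the support of u is a face.\<close>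
  define KE where "KE u = {w \<in> frees (a 0) u. keys u \<in> \<Delta> \<longrightarrow> (\<Sum>p<length (a 0). \<epsilon> p * w p) = 0}" for u
  have "{v \<in> free_mod n (a 0). nonfaces n \<Delta> +>\<^bsub>poly_ring n\<^esub> (e \<bullet> v) = \<zero>\<^bsub>poly_ring n Quot nonfaces n \<Delta>\<^esub>}
    = {v \<in> free_mod n (a 0). \<forall>u\<in>monomials n. comps (a 0) u v \<in> KE u}"
  proof -
    have "nonfaces n \<Delta> +>\<^bsub>poly_ring n\<^esub> (e \<bullet> v) = \<zero>\<^bsub>poly_ring n Quot nonfaces n \<Delta>\<^esub> \<longleftrightarrow> (\<forall>u\<in>monomials n. comps (a 0) u v \<in> KE u)"
      if v: "v \<in> free_mod n (a 0)" for v
    proof -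
      have "nonfaces n \<Delta> +>\<^bsub>poly_ring n\<^esub> (e \<bullet> v) = \<zero>\<^bsub>poly_ring n Quot nonfaces n \<Delta>\<^esub> \<longleftrightarrow> e \<bullet> v \<in> nonfaces n \<Delta>"
        using Q.rclass_eq[OF evR[OF v] polys_zero] Q.rclass_zero by (simp add: Q.rclass_def)
      also have "\<dots> \<longleftrightarrow> (\<forall>u. keys u \<in> \<Delta> \<longrightarrow> lk (e \<bullet> v) u = 0)" using evR[OF v] by (simp add: nonfaces_iff)
      also have "\<dots> \<longleftrightarrow> (\<forall>u\<in>monomials n. keys u \<in> \<Delta> \<longrightarrow> lk (e \<bullet> v) u = 0)"
        using cplx_subsp[OF c] by (auto simp: monomials_def)
      also have "\<dots> \<longleftrightarrow> (\<forall>u\<in>monomials n. comps (a 0) u v \<in> KE u)" unfolding KE_def aug[OF v] using comps_frees by auto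
      finally show ?thesis .
    qed
    then show ?thesis by auto
  qed
  moreover have "(\<lambda>v. D 0 *\<^sub>v v) ` free_mod n (a 1) = {v \<in> free_mod n (a 0). \<forall>u\<in>monomials n. comps (a 0) u v \<in> imgs (a 1) (C 0) u}"
    using homog_mat_image_iff[OF comp[of 0] a a] homog_mat_free_mod[OF a[of "Suc 0"], of _ "a 0" "C 0"] unfolding CD by auto
  moreover have "{v \<in> free_mod n (a 0). \<forall>u\<in>monomials n. comps (a 0) u v \<in> KE u} = {v \<in> free_mod n (a 0). \<forall>u\<in>monomials n. comps (a 0) u v \<in> imgs (a 1) (C 0) u}
    \<longleftrightarrow> (\<forall>u\<in>monomials n. KE u = imgs (a 1) (C 0) u)"
  proof (rule free_mod_sets_eq)
    show "KE u \<subseteq> frees (a 0) u \<and> (\<lambda>_. 0) \<in> KE u" for u by (auto simp: KE_def frees_def)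
    show "imgs (a 1) (C 0) u \<subseteq> frees (a 0) u \<and> (\<lambda>_. 0) \<in> imgs (a 1) (C 0) u" for u
      using imgs_subsp_frees[OF comp[of 0]] zero_imgs by simp
  qed
  ultimately have KE: "\<And>u. u \<in> monomials n \<Longrightarrow> KE u = imgs (a (Suc 0)) (C 0) u" using ex0 by simp
  \<comment> \<open>Hitting the class of 1 requires, in degree 0, a generator of degree 0 with
    nonzero image.\<close>
  have "nonfaces n \<Delta> +>\<^bsub>poly_ring n\<^esub> 1 \<in> carrier (poly_ring n Quot (nonfaces n \<Delta> :: 'k mpoly set))"
    using Q.carrier_Quot polys_one by (auto simp: Q.rclass_def)
  then obtain v where v: "v \<in> free_mod n (a 0)" "nonfaces n \<Delta> +>\<^bsub>poly_ring n\<^esub> 1 = nonfaces n \<Delta> +>\<^bsub>poly_ring n\<^esub> (e \<bullet> v)"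
    unfolding surj[symmetric] by blast
  then have "1 - e \<bullet> v \<in> nonfaces n \<Delta>" using Q.rclass_eq[OF polys_one evR[OF v(1)]] by (simp add: Q.rclass_def)
  then have "\<forall>m. keys m \<in> \<Delta> \<longrightarrow> lk (1 - e \<bullet> v) m = 0" unfolding nonfaces_iff by (rule conjunct2)
  from this[rule_format, of 0] have "lk (e \<bullet> v) 0 = 1" using emp by (simp add: lookup_minus)
  then have "(\<Sum>p<length (a 0). \<epsilon> p * comps (a 0) 0 v p) \<noteq> 0" unfolding aug[OF v(1)] by simp
  then obtain p0 where "\<epsilon> p0 * comps (a 0) 0 v p0 \<noteq> 0" by (metis (no_types, lifting) sum.neutral)
  then have p0: "\<epsilon> p0 \<noteq> 0" "p0 < length (a 0)" "mdvd (a 0 ! p0) 0" by (auto simp: comps_def split: if_splits)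
  then have ap0: "a 0 ! p0 = 0" using mdvd_antisym mdvd_zero by blast
  \<comment> \<open>Another generator q could be cancelled against p0 in degree a_q. This relation
    has coefficient 1 at q in the very degree of q, which the image of the minimal matrix
    \<open>D 0\<close> forbids.\<close>
  have only: "q = p0" if q: "q < length (a 0)" for q
  proof (rule ccontr)
    assume qp: "q \<noteq> p0"
    let ?u = "a 0 ! q"
    let ?w = "\<lambda>x. if x = q then 1 else if x = p0 then - \<epsilon> q / \<epsilon> p0 else 0"
    have u: "?u \<in> monomials n" using a[of 0] q by auto
    have "(\<Sum>p<length (a 0). \<epsilon> p * ?w p) = (\<Sum>p\<in>{q, p0}. \<epsilon> p * ?w p)"
      by (rule sum.mono_neutral_right) (use q p0 in auto)
    also have "\<dots> = 0" using qp p0(1) by simp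
    finally have "?w \<in> KE ?u" using q p0 ap0 by (auto simp: KE_def frees_def)
    then have "?w \<in> imgs (a (Suc 0)) (C 0) ?u" using KE[OF u] by simp
    then have "?w q = 0" by (rule imgs_minimal[OF comp[of 0]]) simp
    then show False by simp
  qed
  have "0 < length (a 0)" using p0(2) by linarith
  then have p00: "p0 = 0" using only[of 0] by simp
  have "length (a 0) = 1"
  proof -
    have "\<not> 1 < length (a 0)" using only[of 1] p00 by auto
    then show ?thesis using p0(2) by linarith
  qed
  then have a0: "a 0 = [0]" using ap0 p00 by (cases "a 0") auto
  have e0: "\<epsilon> 0 \<noteq> 0" using p0(1) p00 by simp
  have "KE u = ideal_fam \<Delta> u" for u
  proof -
    have "w \<in> frees [0] u \<longleftrightarrow> (\<forall>p. p \<noteq> 0 \<longrightarrow> w p = 0)" for w :: "nat \<Rightarrow> 'k"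
    proof
      assume w: "w \<in> frees [0] u"
      show "\<forall>p. p \<noteq> 0 \<longrightarrow> w p = 0"
      proof (intro allI impI)
        fix p :: nat assume "p \<noteq> 0"
        then show "w p = 0" using w[unfolded frees_def] by auto
      qed
    next
      assume w: "\<forall>p. p \<noteq> 0 \<longrightarrow> w p = 0"
      show "w \<in> frees [0] u" unfolding frees_def
      proof (intro CollectI allI impI)
        fix p assume "w p \<noteq> 0"
        then have "p = 0" using w by blast
        then show "p < length [0 :: monomial] \<and> mdvd ([0] ! p) u" by simp
      qed
    qed
    then show ?thesis using e0 unfolding KE_def ideal_fam_def a0 by simp
  qed
  then have "scalar_res n \<Delta> a C" unfolding scalar_res_def using a0 a comp exact KE by simp
  then show ?thesis by blast
qed

lemma scalar_res_resolution:
  fixes C :: "nat \<Rightarrow> nat \<Rightarrow> nat \<Rightarrow> 'k::field"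
  assumes c: "cplx n \<Delta>" and emp: "{} \<in> \<Delta>" and S: "scalar_res n \<Delta> a C"
  shows "\<exists>(e :: 'k mpoly vec) D. minimal_free_resolution n (nonfaces n \<Delta>) a e D"
proof -
  interpret Q: quot n "nonfaces n \<Delta> :: 'k mpoly set" by unfold_locales (rule nonfaces_pideal[OF c])
  note r0 = S[unfolded scalar_res_def]
  note r1 = conjunct2[OF r0] note r2 = conjunct2[OF r1] note r3 = conjunct2[OF r2]
  note a0 = conjunct1[OF r0]
  have a: "set (a i) \<subseteq> monomials n" for i using conjunct1[OF r1] by (rule spec)
  have comp: "minimal_mat (a i) (a (Suc i)) (C i)" for i using conjunct1[OF r2] by (rule spec)
  have im0: "imgs (a (Suc 0)) (C 0) u = ideal_fam \<Delta> u" if "u \<in> monomials n" for u using conjunct1[OF r3] that by (rule bspec)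
  have ex: "\<forall>u\<in>monomials n. imgs (a (Suc (Suc i))) (C (Suc i)) u = kers (a (Suc i)) (C i) u" for i
    using conjunct2[OF r3] by (rule spec)
  define e :: "'k mpoly vec" where "e = vec 1 (\<lambda>_. 1)"
  define D where "D i = homog_mat (a i) (a (Suc i)) (C i)" for i
  have e: "e \<in> free_mod n (a 0)" by (simp add: free_mod_def e_def a0)
  have ev: "e \<bullet> v = v $ 0" if "v \<in> free_mod n (a 0)" for v
    using that by (auto simp: e_def free_mod_def a0 scalar_prod_def)
  have v0: "v $ 0 \<in> polys n" if "v \<in> free_mod n (a 0)" for v using that by (auto simp: free_mod_def a0)
  have entry: "D i $$ (p, q) = single (a (Suc i) ! q - a i ! p) (C i p q)" if "p < length (a i)" "q < length (a (Suc i))" for i p q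
    using that by (simp add: D_def homog_mat_def)
  have entry_maxid: "x \<in> maxid n" if x: "x \<in> elements_mat (D i)" for i x
  proof -
    obtain p q where pq: "p < length (a i)" "q < length (a (Suc i))" "x = D i $$ (p, q)"
      using x by (auto simp: elements_mat_def D_def homog_mat_def)
    show ?thesis
    proof (cases "C i p q = 0")
      case True
      then show ?thesis using pq entry[OF pq(1,2)] pideal_zero[OF maxid_pideal] by simp
    next
      case False
      then have d: "mdvd (a i ! p) (a (Suc i) ! q)" "a i ! p \<noteq> a (Suc i) ! q" using comp[of i] by (auto simp: minimal_mat_def)
      have "a (Suc i) ! q - a i ! p \<noteq> 0"
      proof
        assume "a (Suc i) ! q - a i ! p = 0"
        then show False using mdvd_plus[OF d(1)] d(2) by simp
      qed
      moreover have "a (Suc i) ! q - a i ! p \<in> monomials n" using a[of "Suc i"] pq by (intro monomials_minus) auto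
      ultimately show ?thesis using pq entry[OF pq(1,2)] single_maxid by simp
    qed
  qed
  have "minimal_free_resolution n (nonfaces n \<Delta>) a e D"
    unfolding minimal_free_resolution_def Let_def free_module_free_mod irrelevant_ideal_eq
  proof (intro conjI allI impI ballI)
    show "set (a i) \<subseteq> monomials n" for i by (rule a)
    show "e \<in> free_mod n (a 0)" by (rule e)
    show "keys (e $ p) \<subseteq> {a 0 ! p}" if "p < length (a 0)" for p using that by (simp add: e_def a0)
    show "D i \<in> carrier_mat (length (a i)) (length (a (Suc i)))" for i by (simp add: D_def homog_mat_def)
    show "elements_mat (D i) \<subseteq> carrier (poly_ring n)" for i
    proof
      fix x assume "x \<in> elements_mat (D i)"
      then show "x \<in> carrier (poly_ring n)" using pideal_subsp[OF maxid_pideal entry_maxid] by simp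
    qed
    show "elements_mat (D i) \<subseteq> maxid n" for i using entry_maxid by blast
    show "m + a i ! p = a (Suc i) ! q" if "p < length (a i)" "q < length (a (Suc i))" "m \<in> keys (D i $$ (p, q))" for i p q m
    proof -
      have nz: "C i p q \<noteq> 0" "m = a (Suc i) ! q - a i ! p" using that(3) unfolding entry[OF that(1,2)] by (auto split: if_splits)
      then have "mdvd (a i ! p) (a (Suc i) ! q)" using comp[of i] by (auto simp: minimal_mat_def)
      then show ?thesis using mdvd_plus nz(2) by simp
    qed
    show "(\<lambda>v. nonfaces n \<Delta> +>\<^bsub>poly_ring n\<^esub> (e \<bullet> v)) ` free_mod n (a 0) = carrier (poly_ring n Quot nonfaces n \<Delta>)"
    proof
      show "(\<lambda>v. nonfaces n \<Delta> +>\<^bsub>poly_ring n\<^esub> (e \<bullet> v)) ` free_mod n (a 0) \<subseteq> carrier (poly_ring n Quot nonfaces n \<Delta>)"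
        using ev v0 by (auto simp: Q.carrier_Quot Q.rclass_def)
      show "carrier (poly_ring n Quot nonfaces n \<Delta>) \<subseteq> (\<lambda>v. nonfaces n \<Delta> +>\<^bsub>poly_ring n\<^esub> (e \<bullet> v)) ` free_mod n (a 0)"
      proof
        fix X :: "'k mpoly set" assume "X \<in> carrier (poly_ring n Quot nonfaces n \<Delta>)"
        then obtain x where x: "x \<in> polys n" "X = nonfaces n \<Delta> +>\<^bsub>poly_ring n\<^esub> x" by (auto simp: Q.carrier_Quot Q.rclass_def)
        have "vec 1 (\<lambda>_. x) \<in> free_mod n (a 0)" using x by (simp add: free_mod_def a0)
        moreover from ev[OF this] have "e \<bullet> vec 1 (\<lambda>_. x) = x" by simp
        ultimately show "X \<in> (\<lambda>v. nonfaces n \<Delta> +>\<^bsub>poly_ring n\<^esub> (e \<bullet> v)) ` free_mod n (a 0)"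
          using x(2) by (intro image_eqI[of _ _ "vec 1 (\<lambda>_. x)"]) simp_all
      qed
    qed
    show "{v \<in> free_mod n (a 0). nonfaces n \<Delta> +>\<^bsub>poly_ring n\<^esub> (e \<bullet> v) = \<zero>\<^bsub>poly_ring n Quot nonfaces n \<Delta>\<^esub>} = (\<lambda>v. D 0 *\<^sub>v v) ` free_mod n (a 1)"
    proof -
      have "nonfaces n \<Delta> +>\<^bsub>poly_ring n\<^esub> (e \<bullet> v) = \<zero>\<^bsub>poly_ring n Quot nonfaces n \<Delta>\<^esub> \<longleftrightarrow> v \<in> (\<lambda>v. D 0 *\<^sub>v v) ` free_mod n (a 1)"
        if v: "v \<in> free_mod n (a 0)" for v
      proof -
        have "nonfaces n \<Delta> +>\<^bsub>poly_ring n\<^esub> (e \<bullet> v) = \<zero>\<^bsub>poly_ring n Quot nonfaces n \<Delta>\<^esub> \<longleftrightarrow> v $ 0 \<in> nonfaces n \<Delta>"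
          using Q.rclass_eq[OF v0[OF v] polys_zero] Q.rclass_zero ev[OF v] by (simp add: Q.rclass_def)
        also have "\<dots> \<longleftrightarrow> (\<forall>u\<in>monomials n. keys u \<in> \<Delta> \<longrightarrow> lk (v $ 0) u = 0)"
          using v0[OF v] cplx_subsp[OF c] by (auto simp: nonfaces_iff monomials_def)
        also have "\<dots> \<longleftrightarrow> (\<forall>u\<in>monomials n. comps (a 0) u v \<in> ideal_fam \<Delta> u)" by (simp add: comps_def ideal_fam_def a0)
        also have "\<dots> \<longleftrightarrow> v \<in> (\<lambda>v. D 0 *\<^sub>v v) ` free_mod n (a 1)"
          using homog_mat_image_iff[OF comp[of 0] a a v] im0 by (simp add: D_def)
        finally show ?thesis .
      qed
      moreover have "(\<lambda>v. D 0 *\<^sub>v v) ` free_mod n (a 1) \<subseteq> free_mod n (a 0)" using homog_mat_free_mod[OF a[of 1]] by (auto simp: D_def)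
      ultimately show ?thesis by blast
    qed
    show "{v \<in> free_mod n (a (Suc i)). D i *\<^sub>v v = 0\<^sub>v (length (a i))} = (\<lambda>v. D (Suc i) *\<^sub>v v) ` free_mod n (a (Suc (Suc i)))" for i
      unfolding D_def homog_mat_exact_iff[OF comp comp a a a] by (rule ex)
  qed
  then show ?thesis by blast
qed

section \<open>Betti numbers as Koszul homology\<close>

lemma count_list_card: "count_list xs x = card {p. p < length xs \<and> xs ! p = x}"
  by (simp add: count_list_eq_length_filter length_filter_conv_card) (metis (full_types))

text \<open>Any two minimal resolutions yield bases of the same space of cycles modulo boundaries of
  the ideal, hence equal counts; so the definite description denotes.\<close>

lemma betti_eq:
  fixes C :: "nat \<Rightarrow> nat \<Rightarrow> nat \<Rightarrow> 'k::field"
  assumes c: "cplx n \<Delta>" and emp: "{} \<in> \<Delta>" and S: "scalar_res n \<Delta> a C" and u: "u \<in> monomials n"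
  shows "betti n (nonfaces n \<Delta> :: 'k mpoly set) i u = count_list (a i) u"
  unfolding betti_def
proof (rule the_equality)
  obtain e :: "'k mpoly vec" and D where "minimal_free_resolution n (nonfaces n \<Delta>) a e D" using scalar_res_resolution[OF c emp S] by blast
  then show "\<exists>a' (e :: 'k mpoly vec) D. minimal_free_resolution n (nonfaces n \<Delta>) a' e D \<and> count_list (a i) u = count_list (a' i) u" by blast
next
  fix b assume "\<exists>a' (e :: 'k mpoly vec) D. minimal_free_resolution n (nonfaces n \<Delta>) a' e D \<and> b = count_list (a' i) u"
  then obtain a' and e :: "'k mpoly vec" and D where m: "minimal_free_resolution n (nonfaces n \<Delta>) a' e D" and b: "b = count_list (a' i) u" by blast
  obtain C' :: "nat \<Rightarrow> nat \<Rightarrow> nat \<Rightarrow> 'k" where S': "scalar_res n \<Delta> a' C'" using resolution_scalar_res[OF c emp m] by blast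
  show "b = count_list (a i) u"
  proof (cases i)
    case 0
    then show ?thesis using S S' b by (simp add: scalar_res_def)
  next
    case (Suc j)
    obtain \<beta> where q: "qbasis {p. p < length (a (Suc j)) \<and> a (Suc j) ! p = u} \<beta> (kcycles n (ideal_fam \<Delta>) u j) (kbounds n (ideal_fam \<Delta> :: _ \<Rightarrow> (nat \<Rightarrow> 'k) set) u j)"
      using scalar_res_qbasis[OF S u] by blast
    obtain \<beta>' where q': "qbasis {p. p < length (a' (Suc j)) \<and> a' (Suc j) ! p = u} \<beta>' (kcycles n (ideal_fam \<Delta>) u j) (kbounds n (ideal_fam \<Delta> :: _ \<Rightarrow> (nat \<Rightarrow> 'k) set) u j)"
      using scalar_res_qbasis[OF S' u] by blast
    show ?thesis using qbasis_card[OF q q' kbounds_subsp[OF ideal_fam_gfam[OF c] u]] b Suc by (simp add: count_list_card)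
  qed
qed

text \<open>H_0 of the Koszul complex of R/I is the residue field, placed in degree 1. In any other
  degree a variable v dividing u fills the single coefficient.\<close>

lemma exact_kfaces_zero:
  assumes c: "cplx n \<Delta>" and emp: "{} \<in> \<Delta>" and u: "u \<in> monomials n"
  shows "exact_at n TYPE('k::field) (kfaces \<Delta> u) 0 \<longleftrightarrow> u \<noteq> 0"
proof
  assume E: "exact_at n TYPE('k) (kfaces \<Delta> u) 0"
  show "u \<noteq> 0"
  proof
    assume u0: "u = 0"
    have kfaces: "kfaces \<Delta> u = {{}}" using emp by (auto simp: kfaces_def u0 sqfree_def)
    let ?f = "\<lambda>S. if S = {} then 1 else 0 :: 'k"
    have "supp_on (kfaces \<Delta> u) 0 ?f" by (auto simp: supp_on_def kfaces)
    moreover have "\<forall>T\<in>kfaces \<Delta> u. bd n ?f T = 0" by (simp add: koszul_def)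
    ultimately obtain g where g: "supp_on (kfaces \<Delta> u) (Suc 0) g" "\<forall>S\<in>kfaces \<Delta> u. card S = 0 \<longrightarrow> bd n g S = ?f S"
      using E unfolding exact_at_def by blast
    have "g S = 0" for S
    proof (rule ccontr)
      assume "g S \<noteq> 0"
      then show False using g(1) kfaces by (auto simp: supp_on_def)
    qed
    then have "bd n g {} = 0" by (simp add: koszul_def)
    then show False using g(2) kfaces by simp
  qed
next
  assume "u \<noteq> 0"
  then obtain v where v: "v \<in> keys u" by (metis all_not_in_conv keys_eq_empty)
  have vn: "v \<in> {1..n}" using v u by (auto simp: monomials_def)
  show "exact_at n TYPE('k) (kfaces \<Delta> u) 0" unfolding exact_at_def
  proof (intro allI impI)
    fix f :: "nat set \<Rightarrow> 'k" assume f: "supp_on (kfaces \<Delta> u) 0 f"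
    have fin: "finite S" if "S \<in> kfaces \<Delta> u" for S using that finite_subset[of S "keys u"] by (auto simp: kfaces_def)
    let ?g = "\<lambda>S. if S = {v} then f {} else 0"
    have "supp_on (kfaces \<Delta> u) (Suc 0) ?g"
      unfolding supp_on_def
    proof (intro allI impI)
      fix S assume *: "?g S \<noteq> 0"
      then have S: "S = {v}" "f {} \<noteq> 0" by (auto split: if_splits)
      then have "{} \<in> kfaces \<Delta> u" using f by (auto simp: supp_on_def)
      then have "{v} \<in> kfaces \<Delta> u" by (rule kfaces_up[OF c]) (use v in auto)
      then show "S \<in> kfaces \<Delta> u \<and> card S = Suc 0" using S by simp
    qed
    moreover have "bd n ?g S = f S" if "S \<in> kfaces \<Delta> u" "card S = 0" for S
    proof -
      have S: "S = {}" using that fin by simp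
      have "bd n ?g {} = (\<Sum>w\<in>{1..n}. if w = v then f {} else 0)"
        unfolding koszul_def by (intro sum.cong) (auto simp: sg_def)
      then show ?thesis using vn S by (simp add: sum.delta)
    qed
    ultimately show "\<exists>g. supp_on (kfaces \<Delta> u) (Suc 0) g \<and> (\<forall>S\<in>kfaces \<Delta> u. card S = 0 \<longrightarrow> bd n g S = f S)"
      by (intro exI[of _ ?g]) simp
  qed
qed

text \<open>For i = 0 both sides say that u = 1. For larger i the generators of F_i are counted by
  H_(i-1) of the ideal, which vanishes exactly when H_i of R/I does.\<close>

lemma betti_nonzero_iff:
  assumes c: "cplx n \<Delta>" and emp: "{} \<in> \<Delta>" and u: "u \<in> monomials n"
  shows "betti n (nonfaces n \<Delta> :: 'k::field mpoly set) i u \<noteq> 0 \<longleftrightarrow> \<not> exact_at n TYPE('k) (kfaces \<Delta> u) i"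
proof -
  obtain a and C :: "nat \<Rightarrow> nat \<Rightarrow> nat \<Rightarrow> 'k" where S: "scalar_res n \<Delta> a C" using scalar_res_exists[OF c emp, where ?'k = 'k] by blast
  note b = betti_eq[OF c emp S u, of i]
  show ?thesis
  proof (cases i)
    case 0
    then show ?thesis using b S exact_kfaces_zero[OF c emp u, where ?'k = 'k] by (simp add: scalar_res_def)
  next
    case (Suc j)
    obtain \<beta> where q: "qbasis {p. p < length (a (Suc j)) \<and> a (Suc j) ! p = u} \<beta> (kcycles n (ideal_fam \<Delta>) u j) (kbounds n (ideal_fam \<Delta> :: _ \<Rightarrow> (nat \<Rightarrow> 'k) set) u j)"
      using scalar_res_qbasis[OF S u] by blast
    have "{p. p < length (a (Suc j)) \<and> a (Suc j) ! p = u} = {} \<longleftrightarrow> exact_at n TYPE('k) (kfaces \<Delta> u) (Suc j)"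
      using qbasis_empty_iff[OF q kbounds_subsp[OF ideal_fam_gfam[OF c] u] kcycles_subsp[OF ideal_fam_gfam[OF c] u] kbounds_kcycles[OF ideal_fam_gfam[OF c] u]]
        kcycles_ideal_fam_exact[OF c emp u] by simp
    then show ?thesis using b Suc by (simp add: count_list_card)
  qed
qed

lemma nonfaces_maxid:
  assumes emp: "{} \<in> \<Delta>" shows "(nonfaces n \<Delta> :: 'k::field mpoly set) \<subseteq> maxid n"
proof
  fix p :: "'k mpoly" assume p: "p \<in> nonfaces n \<Delta>"
  have "single m (lk p m) \<in> maxid n" if m: "m \<in> keys p" for m
  proof (rule single_maxid)
    show "m \<in> monomials n" using p m by (auto simp: nonfaces_def polys_def)
    show "m \<noteq> 0" using p m emp by (auto simp: nonfaces_def)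
  qed
  then have "(\<Sum>m\<in>keys p. single m (lk p m)) \<in> maxid n" by (rule pideal_sum[OF maxid_pideal])
  then show "p \<in> maxid n" using poly_as_sum[of p] by simp
qed

lemma mdeg_sqfree: "finite W \<Longrightarrow> mdeg (sqfree W) = card W"
  by (simp add: mdeg_def keys_sqfree lookup_sqfree)

theorem theorem1p3:
  fixes n :: nat and \<Delta> :: "nat set set"
  assumes "simplicial_complex \<Delta>"
    and "vertices \<Delta> = {1..n}"
    and "spherical TYPE('k::field) \<Delta>"
    and "\<not> acyclic_complex TYPE('k) \<Delta>"
  shows "regularity n (stanley_reisner_ideal n \<Delta> :: 'k mpoly set) =
         int (depth (poly_ring n) (irrelevant_ideal n)
               (quotient_module (poly_ring n) (stanley_reisner_ideal n \<Delta> :: 'k mpoly set)))"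
proof -
  have c: "cplx n \<Delta>" unfolding cplx_def
  proof (intro conjI ballI allI impI subsetI PowI)
    fix \<sigma> v assume "\<sigma> \<in> \<Delta>" "v \<in> \<sigma>"
    then have "{v} \<in> \<Delta>" using assms(1) by (simp add: simplicial_complex_def)
    then show "v \<in> {1..n}" unfolding assms(2)[symmetric] by (simp add: vertices_def)
  qed (use assms(1) in \<open>auto simp: simplicial_complex_def\<close>)
  obtain i where i: "homology_dim TYPE('k) \<Delta> i \<noteq> 0" using assms(4) by (auto simp: acyclic_complex_def)
  then have "i \<ge> -1" using homology_low[of i \<Delta>, where ?'k = 'k] by (meson not_less)
  \<comment> \<open>The common value of both invariants is i + 1, the number of vertices of a face
    in the degree carrying the homology.\<close>
  then obtain d where id: "i = int d - 1" by (metis add.commute add_diff_cancel_left' add_neg_numeral_special(8) diff_add_cancel diff_ge_0_iff_ge diff_minus_eq_add zero_le_imp_eq_int)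
  have d: "\<not> exact_at n TYPE('k) \<Delta> d" using homology_facts(1)[OF c id, where ?'k = 'k] i by blast
  then obtain f :: "nat set \<Rightarrow> 'k" where f: "supp_on \<Delta> d f" "\<not> (\<exists>g. supp_on \<Delta> (Suc d) g \<and> (\<forall>S\<in>\<Delta>. card S = d \<longrightarrow> bd n g S = f S))"
    unfolding exact_at_def by blast
  have "\<exists>S. f S \<noteq> 0"
  proof (rule ccontr)
    assume "\<not> (\<exists>S. f S \<noteq> 0)"
    then show False using f(2) by (auto simp: supp_on_def dest!: spec[of _ "\<lambda>_. 0"])
  qed
  then obtain S where "f S \<noteq> 0" by blast
  then have S: "S \<in> \<Delta>" "card S = d" using f(1) by (auto simp: supp_on_def)
  have emp: "{} \<in> \<Delta>" using cplxD[OF c S(1)] by simp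
  have dn: "d \<le> n" using card_mono[OF _ cplx_subsp[OF c S(1)]] S(2) by simp
  have ind: "j \<le> d \<and> d \<le> j + (n - card W)" if "W \<subseteq> {1..n}" "\<not> exact_at n TYPE('k) (restr \<Delta> W) j" for W j
    using spherical_induced_degrees[OF assms(3) c d that(2)] that(1) finite_subset[OF that(1)]
    by (simp add: assms(2) card_Diff_subset)
  have cardW: "card W \<le> n" if "W \<subseteq> {1..n}" for W using card_mono[OF _ that] by simp
  let ?V = "{1..n}"
  \<comment> \<open>The full vertex set attains both extremes: it gives the top Koszul degree n - d
    and the regularity entry n - (n - d) = d.\<close>
  have top: "\<not> exact_at n TYPE('k) (kfaces \<Delta> (sqfree ?V)) (n - d)"
    using exact_kfaces_sqfree[of ?V n "n - d" d \<Delta>, where ?'k = 'k] dn d restr_all[OF c, of ?V] assms(2) by simp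
  let ?I = "nonfaces n \<Delta> :: 'k mpoly set"
  interpret Q: quot n ?I by unfold_locales (rule nonfaces_pideal[OF c])
  have q1: "\<not> kexact n ?I (n - d)" using exact_kfaces_of_kexact[OF c _ sqfree_monomials] top by blast
  \<comment> \<open>Koszul degree i at W corresponds to j = |W| - i, so the lower bound d \<le> j +
    (n - |W|) reads i \<le> n - d.\<close>
  have q2: "kexact n ?I i" if i: "n - d < i" for i
  proof (rule kexact_of_exact_kfaces[OF c], rule ccontr)
    fix u assume "u \<in> monomials n" "\<not> exact_at n TYPE('k) (kfaces \<Delta> u) i"
    then obtain W where W: "W \<subseteq> {1..n}" "i \<le> card W" "\<not> exact_at n TYPE('k) (restr \<Delta> W) (card W - i)"
      by (rule not_exact_kfaces)
    then show False using ind[OF W(1,3)] cardW[OF W(1)] i dn by linarith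
  qed
  have "depth (poly_ring n) (irrelevant_ideal n) (quotient_module (poly_ring n) ?I) = d"
    using Q.depth_eq[OF nonfaces_maxid[OF emp] q1 q2] dn by (simp add: Q.M_def)
  moreover have "regularity n ?I = int d"
    unfolding regularity_def
  proof (rule Max_eqI)
    let ?X = "{int (mdeg m) - int i | i m. m \<in> monomials n \<and> betti n ?I i m \<noteq> 0}"
    \<comment> \<open>Here |W| - i is the degree j of nonzero homology, so the upper bound j \<le> d
      applies; with the lower bound 0 it also gives the finiteness that \<open>Max\<close>
      requires.\<close>
    have X: "0 \<le> x \<and> x \<le> int d" if "x \<in> ?X" for x
    proof -
      from that obtain i m where m: "x = int (mdeg m) - int i" "m \<in> monomials n" "betti n ?I i m \<noteq> 0" by blast
      then have "\<not> exact_at n TYPE('k) (kfaces \<Delta> m) i" using betti_nonzero_iff[OF c emp m(2), where ?'k = 'k] by blast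
      with m(2) obtain W where W: "W \<subseteq> {1..n}" "m = sqfree W" "i \<le> card W" "\<not> exact_at n TYPE('k) (restr \<Delta> W) (card W - i)"
        by (rule not_exact_kfaces)
      have "finite W" using W(1) finite_subset by auto
      then have "x = int (card W - i)" using m(1) W(2,3) by (simp add: mdeg_sqfree of_nat_diff)
      then show ?thesis using ind[OF W(1,4)] by simp
    qed
    have "?X \<subseteq> {0..int d}"
    proof
      fix x assume "x \<in> ?X"
      from X[OF this] show "x \<in> {0..int d}" by simp
    qed
    then show "finite ?X" by (rule finite_subset) simp
    show "y \<le> int d" if "y \<in> ?X" for y using X[OF that] by simp
    have "betti n ?I (n - d) (sqfree ?V) \<noteq> 0" using betti_nonzero_iff[OF c emp sqfree_monomials[of ?V n], where ?'k = 'k] top by simp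
    moreover have "int d = int (mdeg (sqfree ?V)) - int (n - d)" using dn by (simp add: mdeg_sqfree of_nat_diff)
    ultimately show "int d \<in> ?X" using sqfree_monomials[of ?V n] by blast
  qed
  ultimately show ?thesis unfolding stanley_reisner_eq[OF c] by simp
qed

end
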